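(* Let $((X_t),\mathbb{P}_\mu)$ be a reversible ergodic Markov process with continuous sample paths in a complete separable metric space $(\mathcal{X},d)$, whose Dirichlet form $(\mathcal{E},\mathbb{D}(\mathcal{E}))$ is given by a carré-du-champ $\Gamma$: $\mathcal{E}(h,h)=\int_{\mathcal{X}}\Gamma(h,h)\,d\mu$ for $h\in\mathbb{D}(\mathcal{E})$. Assume that $\int_{\mathcal{X}}d^2(x,x_0)\,d\mu(x)<+\infty$ and that there are constants $\sigma,C>0$ such that for every bounded $g\in C_{\mathrm{Lip}}(\mathcal{X},d)$ with $\mu(g)=0$: $g\in\mathbb{D}(\mathcal{E})$, $$\sqrt{\Gamma(g,g)}\le\sigma\|g\|_{\mathrm{Lip}},\quad\mu\text{-a.s.},$$ and there is some $h\in\mathbb{D}_2(\mathcal{L})$ such that $-\mathcal{L}h=g$ ($\mu$-a.e.) together with a continuous $\mu$-version $\tilde h$ of $h$ satisfying $\|\tilde h\|_{\mathrm{Lip}}\le C\|g\|_{\mathrm{Lip}}$. Then for every $g\in C_{\mathrm{Lip}}(\mathcal{X},d)$ with $\mu(g)=0$, every convex function $\phi$ on $\mathbb{R}$ and every $t>0$, $$\mathbb{E}_\mu\,\phi\Big(\int_0^tg(X_s)\,ds\Big)\le\mathbb{E}\,\phi\big(B_{2\sigma^2C^2\|g\|_{\mathrm{Lip}}^2t}\big),$$ where $B$ is a standard Brownian motion. In particular $$\mathbb{E}_\mu\exp\Big(\lambda\int_0^tg(X_s)\,ds\Big)\le e^{\lambda^2(\sigma C)^2\|g\|_{\mathrm{Lip}}^2t},\qquad\forall\lambda\in\mathbb{R},\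 t>0,$$ and $\mu$ satisfies $W_1I(\sigma C)$ on $(\mathcal{X},d)$: $W_1(\nu,\mu)^2\le4(\sigma C)^2I(\nu|\mu)$ for all $\nu\in M_1(\mathcal{X})$.
   Context: $C_{\mathrm{Lip}}(\mathcal{X},d)$ is the space of $d$-Lipschitz real functions, $\|\cdot\|_{\mathrm{Lip}}$ the Lipschitz seminorm, $W_1$ the $L^1$-Wasserstein distance for $d$, $M_1(\mathcal{X})$ the set of Borel probability measures, $\mu(g)=\int g\,d\mu$, $x_0\in\mathcal{X}$ a fixed point. The process has invariant probability measure $\mu$ and transition semigroup $(P_t)$, symmetric and strongly continuous on $L^2(\mu)$, with generator $\mathcal{L}$ of $L^2(\mu)$-domain $\mathbb{D}_2(\mathcal{L})$; ergodic means: if $f$ is bounded measurable with $P_tf=f$ $\mu$-a.e. for all $t\ge 0$, then $f$ is $\mu$-a.e. constant. $(\mathcal{E},\mathbb{D}(\mathcal{E}))$ is the closure of $\mathcal{E}(g,g)=\langle-\mathcal{L}g,g\rangle_\mu$, $g\in\mathbb{D}_2(\mathcal{L})$. The carré-du-champ $\Gamma:\mathbb{D}(\mathcal{E})\times\mathbb{D}(\mathcal{E})\to L^1(\mu)$ is a symmetric, bilinear, nonnegative definite form; by path continuity it is a differentiation: $\Gamma(F(h_1,\dots,h_n),g)=\sum_i\partial_iF(h_1,\dots,h_n)\Gamma(h_i,g)$ for $h_i,g\in\mathbb{D}(\mathcal{E})$, $F\in C_b^1(\mathbb{R}^n)$. $I(\nu|\mu)=\mathcal{E}(\sqrt f,\sqrt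 f)$ if $\nu=f\mu$ with $\sqrt f\in\mathbb{D}(\mathcal{E})$, and $+\infty$ otherwise. $\mathbb{E}_\mu$ is expectation for the process started from $\mu$. *)

theory Defs
  imports "HOL-Probability.Probability"
begin

section \<open>Lipschitz functions and the Wasserstein distance\<close>

definition C_Lip :: "('a::metric_space \<Rightarrow> real) set" where
  "C_Lip = {g. \<exists>L. L-lipschitz_on UNIV g}"

text \<open>The supremum ranges over all pairs: the diagonal contributes \<open>0 / 0 = 0\<close>, so that the
  index set is nonempty even on a one-point space. The value is meaningful on \<^const>\<open>C_Lip\<close> only.\<close>

definition lip_seminorm :: "('a::metric_space \<Rightarrow> real) \<Rightarrow> real" where
  "lip_seminorm g = (SUP (x, y). \<bar>g x - g y\<bar> / dist x y)"

definition couplings ::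
  "'a::polish_space measure \<Rightarrow> 'a measure \<Rightarrow> ('a \<times> 'a) measure set" where
  "couplings \<nu> \<mu> =
    {\<pi>. sets \<pi> = sets (borel \<Otimes>\<^sub>M borel) \<and> distr \<pi> borel fst = \<nu> \<and> distr \<pi> borel snd = \<mu>}"

definition W1 :: "'a::polish_space measure \<Rightarrow> 'a measure \<Rightarrow> ennreal" where
  "W1 \<nu> \<mu> = (INF \<pi>\<in>couplings \<nu> \<mu>. \<integral>\<^sup>+ (x, y). ennreal (dist x y) \<partial>\<pi>)"


section \<open>Square integrable functions\<close>

text \<open>Elements of \<open>L\<^sup>2(\<mu>)\<close> are represented by measurable functions; all notions below are
  invariant under \<open>\<mu>\<close>-a.e. equality.\<close>

definition L2fun :: "'a measure \<Rightarrow> ('a \<Rightarrow> real) set" where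
  "L2fun \<mu> = {f \<in> borel_measurable \<mu>. integrable \<mu> (\<lambda>x. (f x)\<^sup>2)}"

definition L2_tendsto ::
  "'a measure \<Rightarrow> ('i \<Rightarrow> 'a \<Rightarrow> real) \<Rightarrow> ('a \<Rightarrow> real) \<Rightarrow> 'i filter \<Rightarrow> bool" where
  "L2_tendsto \<mu> F f net \<longleftrightarrow> ((\<lambda>i. \<integral>\<^sup>+ x. ennreal ((F i x - f x)\<^sup>2) \<partial>\<mu>) \<longlongrightarrow> 0) net"


section \<open>Transition semigroup, generator and Dirichlet form\<close>

text \<open>A family of transition kernels is indexed by \<^typ>\<open>real\<close>; only times \<open>t \<ge> 0\<close> matter.\<close>

definition transition_kernels :: "(real \<Rightarrow> 'a::polish_space \<Rightarrow> 'a measure) \<Rightarrow> bool" where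
  "transition_kernels P \<longleftrightarrow>
    (\<forall>t\<ge>0. P t \<in> borel \<rightarrow>\<^sub>M prob_algebra borel) \<and>
    (\<forall>x. P 0 x = return borel x) \<and>
    (\<forall>s\<ge>0. \<forall>t\<ge>0. \<forall>x. P (s + t) x = P s x \<bind> P t)"

definition semigroup_op ::
  "(real \<Rightarrow> 'a \<Rightarrow> 'a measure) \<Rightarrow> real \<Rightarrow> ('a \<Rightarrow> real) \<Rightarrow> 'a \<Rightarrow> real" where
  "semigroup_op P t f x = (\<integral>y. f y \<partial>P t x)"

definition invariant_measure ::
  "(real \<Rightarrow> 'a::polish_space \<Rightarrow> 'a measure) \<Rightarrow> 'a measure \<Rightarrow> bool" where
  "invariant_measure P \<mu> \<longleftrightarrow> (\<forall>t\<ge>0. \<mu> \<bind> P t = \<mu>)"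

definition symmetric_semigroup ::
  "(real \<Rightarrow> 'a \<Rightarrow> 'a measure) \<Rightarrow> 'a measure \<Rightarrow> bool" where
  "symmetric_semigroup P \<mu> \<longleftrightarrow>
    (\<forall>t\<ge>0. \<forall>f\<in>L2fun \<mu>. \<forall>g\<in>L2fun \<mu>.
      (\<integral>x. semigroup_op P t f x * g x \<partial>\<mu>) = (\<integral>x. f x * semigroup_op P t g x \<partial>\<mu>))"

definition strongly_continuous_semigroup ::
  "(real \<Rightarrow> 'a \<Rightarrow> 'a measure) \<Rightarrow> 'a measure \<Rightarrow> bool" where
  "strongly_continuous_semigroup P \<mu> \<longleftrightarrow>
    (\<forall>f\<in>L2fun \<mu>. L2_tendsto \<mu> (\<lambda>t. semigroup_op P t f) f (at_right 0))"

definition ergodic_semigroup ::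
  "(real \<Rightarrow> 'a::polish_space \<Rightarrow> 'a measure) \<Rightarrow> 'a measure \<Rightarrow> bool" where
  "ergodic_semigroup P \<mu> \<longleftrightarrow>
    (\<forall>f\<in>borel_measurable borel. bounded (range f) \<longrightarrow>
      (\<forall>t\<ge>0. AE x in \<mu>. semigroup_op P t f x = f x) \<longrightarrow> (\<exists>c. AE x in \<mu>. f x = c))"

definition generator_graph ::
  "(real \<Rightarrow> 'a \<Rightarrow> 'a measure) \<Rightarrow> 'a measure \<Rightarrow> ('a \<Rightarrow> real) \<Rightarrow> ('a \<Rightarrow> real) \<Rightarrow> bool" where
  "generator_graph P \<mu> f k \<longleftrightarrow> f \<in> L2fun \<mu> \<and> k \<in> L2fun \<mu> \<and>
    L2_tendsto \<mu> (\<lambda>t x. (semigroup_op P t f x - f x) / t) k (at_right 0)"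

definition D2 :: "(real \<Rightarrow> 'a \<Rightarrow> 'a measure) \<Rightarrow> 'a measure \<Rightarrow> ('a \<Rightarrow> real) set" where
  "D2 P \<mu> = {f. \<exists>k. generator_graph P \<mu> f k}"

text \<open>The limit is unique up to \<open>\<mu>\<close>-null sets, so the choice is immaterial.\<close>

definition generator ::
  "(real \<Rightarrow> 'a \<Rightarrow> 'a measure) \<Rightarrow> 'a measure \<Rightarrow> ('a \<Rightarrow> real) \<Rightarrow> 'a \<Rightarrow> real" where
  "generator P \<mu> f = (SOME k. generator_graph P \<mu> f k)"

definition pre_form ::
  "(real \<Rightarrow> 'a \<Rightarrow> 'a measure) \<Rightarrow> 'a measure \<Rightarrow> ('a \<Rightarrow> real) \<Rightarrow> real" where
  "pre_form P \<mu> f = (\<integral>x. - generator P \<mu> f x * f x \<partial>\<mu>)"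

text \<open>The closure of the form \<^const>\<open>pre_form\<close> on \<^const>\<open>D2\<close>: \<open>f\<close> belongs to its domain iff it is
  the \<open>L\<^sup>2\<close>-limit of a sequence in \<^const>\<open>D2\<close> that is Cauchy for the form, and the value at \<open>f\<close>
  is the limit of the values (independent of the sequence, since the form is closable).
  Only the quadratic form \<open>f \<mapsto> \<E>(f, f)\<close> is needed.\<close>

definition approximates ::
  "(real \<Rightarrow> 'a \<Rightarrow> 'a measure) \<Rightarrow> 'a measure \<Rightarrow> (nat \<Rightarrow> 'a \<Rightarrow> real) \<Rightarrow> ('a \<Rightarrow> real) \<Rightarrow> bool" where
  "approximates P \<mu> u f \<longleftrightarrow> (\<forall>n. u n \<in> D2 P \<mu>) \<and> L2_tendsto \<mu> u f sequentially \<and>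
    (\<forall>e>0. \<exists>N. \<forall>m\<ge>N. \<forall>n\<ge>N. pre_form P \<mu> (\<lambda>x. u m x - u n x) < e)"

definition D_form :: "(real \<Rightarrow> 'a \<Rightarrow> 'a measure) \<Rightarrow> 'a measure \<Rightarrow> ('a \<Rightarrow> real) set" where
  "D_form P \<mu> = {f \<in> L2fun \<mu>. \<exists>u. approximates P \<mu> u f}"

definition dirichlet_form ::
  "(real \<Rightarrow> 'a \<Rightarrow> 'a measure) \<Rightarrow> 'a measure \<Rightarrow> ('a \<Rightarrow> real) \<Rightarrow> real" where
  "dirichlet_form P \<mu> f =
    (THE e. \<exists>u. approximates P \<mu> u f \<and> (\<lambda>n. pre_form P \<mu> (u n)) \<longlonglongrightarrow> e)"

text \<open>The Fisher--Donsker--Varadhan information \<open>I(\<nu>|\<mu>)\<close>.\<close>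

definition DV_information ::
  "(real \<Rightarrow> 'a \<Rightarrow> 'a measure) \<Rightarrow> 'a measure \<Rightarrow> 'a measure \<Rightarrow> ennreal" where
  "DV_information P \<nu> \<mu> =
    (let f = (\<lambda>x. enn2real (RN_deriv \<mu> \<nu> x)) in
     if absolutely_continuous \<mu> \<nu> \<and> (\<lambda>x. sqrt (f x)) \<in> D_form P \<mu>
     then ennreal (dirichlet_form P \<mu> (\<lambda>x. sqrt (f x))) else \<infinity>)"


section \<open>Carr\'e du champ\<close>

text \<open>\<open>C1b n F D\<close>: \<open>F\<close> is in \<open>C\<^sub>b\<^sup>1(\<real>\<^sup>n)\<close> (bounded, with bounded continuous first partial
  derivatives) and \<open>D i\<close> is its \<open>i\<close>-th partial derivative. Functions on \<open>\<real>\<^sup>n\<close> are encoded as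
  functions on \<^typ>\<open>nat \<Rightarrow> real\<close> (with the product topology) that depend on the coordinates
  \<open>i < n\<close> only.\<close>

definition C1b ::
  "nat \<Rightarrow> ((nat \<Rightarrow> real) \<Rightarrow> real) \<Rightarrow> (nat \<Rightarrow> (nat \<Rightarrow> real) \<Rightarrow> real) \<Rightarrow> bool" where
  "C1b n F D \<longleftrightarrow>
    (\<forall>x y. (\<forall>i<n. x i = y i) \<longrightarrow> F x = F y) \<and> bounded (range F) \<and>
    (\<forall>i<n. (\<forall>x. ((\<lambda>s. F (x(i := s))) has_real_derivative D i x) (at (x i))) \<and>
      continuous_on UNIV (D i) \<and> bounded (range (D i)))"

definition carre_du_champ ::
  "(real \<Rightarrow> 'a \<Rightarrow> 'a measure) \<Rightarrow> 'a measure \<Rightarrow>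
    (('a \<Rightarrow> real) \<Rightarrow> ('a \<Rightarrow> real) \<Rightarrow> 'a \<Rightarrow> real) \<Rightarrow> bool" where
  "carre_du_champ P \<mu> \<Gamma> \<longleftrightarrow>
    \<comment> \<open>\<open>\<Gamma>\<close> maps into \<open>L\<^sup>1(\<mu>)\<close> and is well defined on \<open>\<mu>\<close>-a.e. classes\<close>
    (\<forall>f\<in>D_form P \<mu>. \<forall>g\<in>D_form P \<mu>. integrable \<mu> (\<Gamma> f g)) \<and>
    (\<forall>f\<in>D_form P \<mu>. \<forall>f'\<in>D_form P \<mu>. \<forall>g\<in>D_form P \<mu>.
      (AE x in \<mu>. f x = f' x) \<longrightarrow> (AE x in \<mu>. \<Gamma> f g x = \<Gamma> f' g x)) \<and>
    \<comment> \<open>symmetric, bilinear, nonnegative definite\<close>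
    (\<forall>f\<in>D_form P \<mu>. \<forall>g\<in>D_form P \<mu>. AE x in \<mu>. \<Gamma> f g x = \<Gamma> g f x) \<and>
    (\<forall>f\<in>D_form P \<mu>. \<forall>f'\<in>D_form P \<mu>. \<forall>g\<in>D_form P \<mu>. \<forall>a b. AE x in \<mu>.
      \<Gamma> (\<lambda>y. a * f y + b * f' y) g x = a * \<Gamma> f g x + b * \<Gamma> f' g x) \<and>
    (\<forall>f\<in>D_form P \<mu>. AE x in \<mu>. 0 \<le> \<Gamma> f f x) \<and>
    \<comment> \<open>differentiation\<close>
    (\<forall>n F D h. \<forall>g\<in>D_form P \<mu>. C1b n F D \<longrightarrow> (\<forall>i<n. h i \<in> D_form P \<mu>) \<longrightarrow>
      (\<lambda>y. F (\<lambda>i. h i y)) \<in> D_form P \<mu> \<and>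
      (AE x in \<mu>. \<Gamma> (\<lambda>y. F (\<lambda>i. h i y)) g x = (\<Sum>i<n. D i (\<lambda>j. h j x) * \<Gamma> (h i) g x))) \<and>
    \<comment> \<open>the Dirichlet form is given by \<open>\<Gamma>\<close>\<close>
    (\<forall>h\<in>D_form P \<mu>. dirichlet_form P \<mu> h = (\<integral>x. \<Gamma> h h x \<partial>\<mu>))"


section \<open>Processes\<close>

definition natural_filtration ::
  "'w measure \<Rightarrow> (real \<Rightarrow> 'w \<Rightarrow> 'a::polish_space) \<Rightarrow> real \<Rightarrow> 'w measure" where
  "natural_filtration M X s =
    sigma (space M) {X u -` A \<inter> space M | u A. 0 \<le> u \<and> u \<le> s \<and> A \<in> sets borel}"

text \<open>\<open>X\<close> is a Markov process on the probability space \<open>M\<close> (the measure \<open>\<P>\<^sub>\<mu>\<close>) with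
  transition kernels \<open>P\<close> and initial law \<open>\<mu>\<close>.\<close>

definition markov_process ::
  "'w measure \<Rightarrow> (real \<Rightarrow> 'w \<Rightarrow> 'a::polish_space) \<Rightarrow> (real \<Rightarrow> 'a \<Rightarrow> 'a measure) \<Rightarrow> 'a measure \<Rightarrow>
    bool" where
  "markov_process M X P \<mu> \<longleftrightarrow>
    prob_space M \<and> transition_kernels P \<and>
    (\<forall>t\<ge>0. X t \<in> M \<rightarrow>\<^sub>M borel) \<and> distr M borel (X 0) = \<mu> \<and>
    (\<forall>s\<ge>0. \<forall>t\<ge>0. \<forall>A\<in>sets borel. AE \<omega> in M.
      real_cond_exp M (natural_filtration M X s) (\<lambda>\<omega>. indicator A (X (s + t) \<omega>)) \<omega> =
        measure (P t (X s \<omega>)) A)"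

definition continuous_paths ::
  "'w measure \<Rightarrow> (real \<Rightarrow> 'w \<Rightarrow> 'a::topological_space) \<Rightarrow> bool" where
  "continuous_paths M X \<longleftrightarrow> (\<forall>\<omega>\<in>space M. continuous_on {0..} (\<lambda>t. X t \<omega>))"

definition standard_brownian_motion :: "'b measure \<Rightarrow> (real \<Rightarrow> 'b \<Rightarrow> real) \<Rightarrow> bool" where
  "standard_brownian_motion N B \<longleftrightarrow>
    prob_space N \<and> (\<forall>t\<ge>0. B t \<in> borel_measurable N) \<and>
    (AE \<omega> in N. B 0 \<omega> = 0) \<and>
    (\<forall>s t. 0 \<le> s \<and> s < t \<longrightarrow>
      distributed N lborel (\<lambda>\<omega>. B t \<omega> - B s \<omega>) (normal_density 0 (sqrt (t - s)))) \<and>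
    (\<forall>n \<tau>. incseq \<tau> \<and> 0 \<le> \<tau> 0 \<longrightarrow>
      prob_space.indep_vars N (\<lambda>_. borel) (\<lambda>i \<omega>. B (\<tau> (Suc i)) \<omega> - B (\<tau> i) \<omega>) {..<n::nat}) \<and>
    continuous_paths N B"

text \<open>Expectation with values in the extended reals, meaningful when the positive or the negative
  part is integrable. The latter holds for convex functions of integrable random variables,
  which are bounded below by affine functions.\<close>

definition ext_expectation :: "'w measure \<Rightarrow> ('w \<Rightarrow> real) \<Rightarrow> ereal" where
  "ext_expectation M Y =
    enn2ereal (\<integral>\<^sup>+ \<omega>. ennreal (Y \<omega>) \<partial>M) - enn2ereal (\<integral>\<^sup>+ \<omega>. ennreal (- Y \<omega>) \<partial>M)"

end

theory Submission
  imports Defs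
begin

text \<open>The additive functional of a bounded Lipschitz \<open>g\<close> is split as in Lyons--Zheng: with
  \<open>-\<L> h = g\<close>, twice the trapezoidal sum of \<open>g\<close> along the chain \<open>X\<^bsub>id\<^esub>\<close> is a forward plus a backward sum of
  the increments \<open>h y - h x + d g x\<close>, which have equal laws by reversibility. Stochastic calculus is
  avoided: the forward sum is compared with a Gaussian by Lindeberg's replacement method as \<open>d \<rightarrow> 0\<close>.
  The conditional variances are at most \<open>2 K d + o(d)\<close>, where \<open>\<Gamma>(h, h) \<le> K = (\<sigma> C \<parallel>g\<parallel>)\<^sup>2\<close>, and the Lindeberg
  condition follows from the chain rule for \<open>\<Gamma>\<close>, so that both rest on the Dirichlet form only. The
  transport inequality follows from \<open>\<nu>(g) = \<E>(f, h) = 2 \<integral> \<surd>f \<Gamma>(\<surd>f, h) d\<mu>\<close> for \<open>\<nu> = f \<mu>\<close> and Kantorovich--Rubinstein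
  duality, which is reduced to finitely many points.\<close>

section \<open>Kantorovich--Rubinstein duality\<close>

text \<open>The solution \<open>h\<close> of the Poisson equation may be unbounded and is known in
  the L2 domain of the generator, so there is no pointwise bound on the conditional variance of a
  step. In the replacement argument this variance is multiplied by a second derivative at the random
  past sum; a bound in the mean is therefore too weak, and the positive part of its excess over
  \<open>2 K d\<close> has to be o(d) in L1. This is obtained weakly: a second order formula for the
  square of \<open>h\<close> is integrated against test functions in the form domain, and Lipschitz
  cutoffs of compact sets together with inner regularity turn it into a bound on the positive part.
  The factor 2 is a normalisation: the mean squared increment of \<open>h\<close> over time
  \<open>d\<close> is close to \<open>2 d\<close> times the integral of \<Gamma>(h, h). The
  dependence between the two sums costs nothing: the trapezoidal sum is the mean of two variables
  with the same law, and a convex function of a mean is at most the mean of its values. Convexity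
  also makes upper bounds on variances sufficient.\<close>

lemma compact_UNIV_PiE:
  fixes A :: "'i \<Rightarrow> 'b::topological_space set"
  assumes "\<And>i. compact (A i)"
  shows "compact (Pi\<^sub>E UNIV A)"
proof -
  have "compactin (product_topology (\<lambda>_. euclidean) UNIV) (Pi\<^sub>E UNIV A)"
    unfolding compactin_PiE using assms by auto
  then show ?thesis by (simp add: euclidean_product_topology)
qed

text \<open>One-sided first order condition: for small \<open>t\<close> the linear term decides the
  sign. The witness \<open>t\<close> is at most - G / (H + 1), which makes 2 G + t H
  negative.\<close>

lemma derivative_sign_from_min:
  fixes G H e :: real
  assumes "0 < e" "\<And>t. 0 < t \<Longrightarrow> t \<le> e \<Longrightarrow> 0 \<le> 2 * t * G + t\<^sup>2 * H" "0 \<le> H"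
  shows "0 \<le> G"
proof (rule ccontr)
  assume "\<not> 0 \<le> G"
  then have G: "G < 0" by simp
  define t where "t = min e (- G / (H + 1))"
  have t: "0 < t" "t \<le> e" using assms G by (auto simp: t_def divide_neg_pos)
  have "t \<le> - G / (H + 1)" by (simp add: t_def)
  then have "t * (H + 1) \<le> - G" using assms(3) pos_le_divide_eq[of "H + 1" t "- G"] by simp
  then have "t * H < - 2 * G" using t G by (simp add: algebra_simps)
  then have "t * (2 * G + t * H) < 0" using t by (intro mult_pos_neg) auto
  then show False using assms(2)[OF t] by (simp add: algebra_simps power2_eq_square)
qed

text \<open>Farkas' lemma for the transport polytope: minimise the squared violation of the constraints;
  the first order conditions at a minimiser turn the residuals into a dual feasible pair.\<close>

lemma transport_alternative:
  fixes p q :: "'a \<Rightarrow> real" and c :: "'a \<Rightarrow> 'a \<Rightarrow> real"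
  assumes S: "finite S"
    and p: "\<And>a. a \<in> S \<Longrightarrow> 0 \<le> p a" "sum p S = 1"
    and q: "\<And>a. a \<in> S \<Longrightarrow> 0 \<le> q a" "sum q S = 1"
    and D: "0 \<le> D"
    and dual: "\<And>\<alpha> \<beta>. (\<And>a b. a \<in> S \<Longrightarrow> b \<in> S \<Longrightarrow> \<alpha> a + \<beta> b \<le> c a b) \<Longrightarrow>
      (\<Sum>a\<in>S. \<alpha> a * p a) + (\<Sum>b\<in>S. \<beta> b * q b) \<le> D"
  shows "\<exists>w. (\<forall>a\<in>S. \<forall>b\<in>S. 0 \<le> w a b) \<and> (\<forall>a\<in>S. (\<Sum>b\<in>S. w a b) = p a) \<and>
    (\<forall>b\<in>S. (\<Sum>a\<in>S. w a b) = q b) \<and> (\<Sum>a\<in>S. \<Sum>b\<in>S. c a b * w a b) \<le> D"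
proof -
  define row where "row w a = (\<Sum>b\<in>S. w (a, b))" for w :: "'a \<times> 'a \<Rightarrow> real" and a
  define col where "col w b = (\<Sum>a\<in>S. w (a, b))" for w :: "'a \<times> 'a \<Rightarrow> real" and b
  define cost where "cost w = (\<Sum>a\<in>S. \<Sum>b\<in>S. c a b * w (a, b))" for w :: "'a \<times> 'a \<Rightarrow> real"
  \<comment> \<open>Squared violations of the marginals and of the cost bound; \<open>max 0\<close>
    occurs because the cost is constrained from above only.\<close>
  define V where "V w = (\<Sum>a\<in>S. (row w a - p a)\<^sup>2) + (\<Sum>b\<in>S. (col w b - q b)\<^sup>2)
      + (max 0 (cost w - D))\<^sup>2" for w
  \<comment> \<open>Plans are functions on all pairs that vanish off \<open>S \<times> S\<close>, so
    that Tychonoff's theorem gives compactness. The bound 4 is so large that it is inactive at a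
    minimiser, see \<open>w4\<close>.\<close>
  define K where "K = Pi\<^sub>E UNIV (\<lambda>i. if i \<in> S \<times> S then {0..4::real} else {0})"
  have coordc: "continuous_on K (\<lambda>w. w i)" for i
    by (rule continuous_on_subset[OF continuous_on_product_coordinates]) auto
  have "compact K" unfolding K_def by (rule compact_UNIV_PiE) auto
  moreover have z: "(\<lambda>_. 0) \<in> K" by (auto simp: K_def)
  moreover have "continuous_on K V"
    unfolding V_def row_def col_def cost_def
    by (intro continuous_intros coordc)
  ultimately obtain w where w: "w \<in> K" and wmin: "\<And>v. v \<in> K \<Longrightarrow> V w \<le> V v"
    using continuous_attains_inf[of K V] by blast
  have w0: "0 \<le> w (a, b)" if "a \<in> S" "b \<in> S" for a b
  proof -
    have "w (a, b) \<in> (if (a, b) \<in> S \<times> S then {0..4::real} else {0})"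
      using w unfolding K_def by (rule PiE_mem) simp
    then show ?thesis using that by simp
  qed
  have p1: "p a \<le> 1" if "a \<in> S" for a
    using member_le_sum[OF that, of p] p S by auto
  have sq: "(\<Sum>a\<in>S. (r a)\<^sup>2) \<le> 1" if "\<And>a. a \<in> S \<Longrightarrow> 0 \<le> r a" "sum r S = 1" for r :: "'a \<Rightarrow> real"
  proof -
    have "(\<Sum>a\<in>S. (r a)\<^sup>2) \<le> (\<Sum>a\<in>S. r a)"
    proof (rule sum_mono)
      fix a assume a: "a \<in> S"
      then have "r a \<le> 1" using member_le_sum[OF a, of r] that S by auto
      then show "(r a)\<^sup>2 \<le> r a" using that(1)[OF a] by (simp add: power2_eq_square mult_left_le)
    qed
    then show ?thesis using that by simp
  qed
  \<comment> \<open>The zero plan bounds the minimum by 2, whereas an entry of at least 4 makes a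
    row sum exceed its target, which is at most 1, by 3 and so costs 9.\<close>
  have "V (\<lambda>_. 0) \<le> 2"
    using sq[OF p] sq[OF q] D by (simp add: V_def row_def col_def cost_def)
  then have V2: "V w \<le> 2" using wmin[OF z] by simp
  have w4: "w (a, b) < 4" if ab: "a \<in> S" "b \<in> S" for a b
  proof (rule ccontr)
    assume "\<not> w (a, b) < 4"
    moreover have "w (a, b) \<le> row w a"
      unfolding row_def using ab w0 S by (intro member_le_sum[of b S "\<lambda>b. w (a, b)"]) auto
    ultimately have "3 \<le> row w a - p a" using p1[OF ab(1)] by linarith
    then have "9 \<le> (row w a - p a)\<^sup>2"
      using power_mono[of 3 "row w a - p a" 2] by simp
    also have "\<dots> \<le> (\<Sum>a\<in>S. (row w a - p a)\<^sup>2)"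
      using ab S by (intro member_le_sum[of a S "\<lambda>a. (row w a - p a)\<^sup>2"]) auto
    also have "\<dots> \<le> V w" unfolding V_def by (simp add: sum_nonneg)
    finally show False using V2 by simp
  qed
  define s where "s = max 0 (cost w - D)"
  \<comment> \<open>Half the directional derivative of \<open>V\<close> at \<open>w\<close> when
    mass is added at \<open>(a, b)\<close>; \<open>H\<close> is the matching second order
    coefficient.\<close>
  define G where "G a b = (row w a - p a) + (col w b - q b) + s * c a b" for a b
  define H where "H a b = 2 + (c a b)\<^sup>2" for a b
  have pert: "0 \<le> 2 * t * G a b + t\<^sup>2 * H a b"
    if ab: "a \<in> S" "b \<in> S" and t: "0 \<le> w (a, b) + t" "w (a, b) + t \<le> 4" for a b t
  proof -
    define v where "v = w((a, b) := w (a, b) + t)"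
    have v: "v i = w i + (if i = (a, b) then t else 0)" for i by (simp add: v_def)
    have vK: "v \<in> K"
    proof -
      have "v i \<in> (if i \<in> S \<times> S then {0..4::real} else {0})" for i
        using PiE_mem[OF w[unfolded K_def], of i] ab t by (cases "i = (a, b)") (simp_all add: v_def)
      then show ?thesis by (auto simp: K_def)
    qed
    have row_v: "row v a' = row w a' + (if a' = a then t else 0)" for a'
    proof -
      have "row v a' = row w a' + (\<Sum>b'\<in>S. if b' = b then (if a' = a then t else 0) else 0)"
        unfolding row_def v by (subst sum.distrib[symmetric], rule sum.cong) auto
      also have "(\<Sum>b'\<in>S. if b' = b then (if a' = a then t else 0) else 0) = (if a' = a then t else 0)"
        using S ab by (subst sum.delta) auto
      finally show ?thesis .
    qed
    have col_v: "col v b' = col w b' + (if b' = b then t else 0)" for b'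
    proof -
      have "col v b' = col w b' + (\<Sum>a'\<in>S. if a' = a then (if b' = b then t else 0) else 0)"
        unfolding col_def v by (subst sum.distrib[symmetric], rule sum.cong) auto
      also have "(\<Sum>a'\<in>S. if a' = a then (if b' = b then t else 0) else 0) = (if b' = b then t else 0)"
        using S ab by (subst sum.delta) auto
      finally show ?thesis .
    qed
    have cost_v: "cost v = cost w + t * c a b"
    proof -
      have "cost v = cost w + (\<Sum>a'\<in>S. \<Sum>b'\<in>S. if b' = b then (if a' = a then t * c a' b' else 0) else 0)"
        unfolding cost_def v
        by (subst sum.distrib[symmetric], intro sum.cong refl, subst sum.distrib[symmetric],
            intro sum.cong refl) (auto simp: algebra_simps)
      also have "(\<Sum>a'\<in>S. \<Sum>b'\<in>S. if b' = b then (if a' = a then t * c a' b' else 0) else 0)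
          = (\<Sum>a'\<in>S. if a' = a then t * c a' b else 0)"
        using S ab by (intro sum.cong refl) (subst sum.delta, auto)
      also have "\<dots> = t * c a b"
        using S ab by (subst sum.delta) auto
      finally show ?thesis .
    qed
    have sqs: "(\<Sum>a'\<in>S. (x a' + (if a' = k then t else 0))\<^sup>2) = (\<Sum>a'\<in>S. (x a')\<^sup>2) + (2 * t * x k + t\<^sup>2)"
      if "k \<in> S" for x :: "'a \<Rightarrow> real" and k
    proof -
      have "(\<Sum>a'\<in>S. (x a' + (if a' = k then t else 0))\<^sup>2)
        = (\<Sum>a'\<in>S. (x a')\<^sup>2) + (\<Sum>a'\<in>S. if a' = k then 2 * t * x a' + t\<^sup>2 else 0)"
        by (subst sum.distrib[symmetric], rule sum.cong) (auto simp: power2_eq_square algebra_simps)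
      also have "(\<Sum>a'\<in>S. if a' = k then 2 * t * x a' + t\<^sup>2 else 0) = 2 * t * x k + t\<^sup>2"
        using S that by (subst sum.delta) auto
      finally show ?thesis .
    qed
    \<comment> \<open>The kink of \<open>max 0\<close> is replaced by a smooth majorant that agrees
      with it at \<open>t = 0\<close>, which suffices at a minimum.\<close>
    have mx: "(max 0 (cost v - D))\<^sup>2 \<le> (s + t * c a b)\<^sup>2"
    proof (rule abs_le_square_iff[THEN iffD1])
      show "\<bar>max 0 (cost v - D)\<bar> \<le> \<bar>s + t * c a b\<bar>"
        unfolding cost_v s_def by (auto simp: max_def abs_if)
    qed
    have "V v = (\<Sum>a'\<in>S. ((row w a' - p a') + (if a' = a then t else 0))\<^sup>2)
        + (\<Sum>b'\<in>S. ((col w b' - q b') + (if b' = b then t else 0))\<^sup>2) + (max 0 (cost v - D))\<^sup>2"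
      unfolding V_def row_v col_v
      by (intro arg_cong2[where f="(+)"] sum.cong refl) (simp_all add: algebra_simps)
    also have "\<dots> \<le> (\<Sum>a\<in>S. (row w a - p a)\<^sup>2) + (2 * t * (row w a - p a) + t\<^sup>2)
        + ((\<Sum>b\<in>S. (col w b - q b)\<^sup>2) + (2 * t * (col w b - q b) + t\<^sup>2)) + (s + t * c a b)\<^sup>2"
      using mx sqs[OF ab(1), of "\<lambda>a. row w a - p a"] sqs[OF ab(2), of "\<lambda>b. col w b - q b"] by simp
    also have "\<dots> = V w + (2 * t * G a b + t\<^sup>2 * H a b)"
      unfolding V_def G_def H_def s_def[symmetric] by (simp add: power2_eq_square algebra_simps)
    finally show ?thesis using wmin[OF vK] by simp
  qed
  have G0: "0 \<le> G a b" if ab: "a \<in> S" "b \<in> S" for a b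
  proof (rule derivative_sign_from_min[of "4 - w (a, b)" _ "H a b"])
    show "0 < 4 - w (a, b)" using w4[OF ab] by simp
    show "0 \<le> H a b" by (simp add: H_def)
    fix t assume "0 < t" "t \<le> 4 - w (a, b)"
    then show "0 \<le> 2 * t * G a b + t\<^sup>2 * H a b" using w0[OF ab] by (intro pert ab) auto
  qed
  \<comment> \<open>Complementary slackness: where the plan has mass, mass may also be removed, so
    the derivative vanishes.\<close>
  have G1: "w (a, b) * G a b = 0" if ab: "a \<in> S" "b \<in> S" for a b
  proof (cases "w (a, b) = 0")
    case False
    then have pos: "0 < w (a, b)" using w0[OF ab] by simp
    have "0 \<le> - G a b"
    proof (rule derivative_sign_from_min[of "w (a, b)" _ "H a b"])
      show "0 < w (a, b)" by fact
      show "0 \<le> H a b" by (simp add: H_def)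
      fix t assume t: "0 < t" "t \<le> w (a, b)"
      show "0 \<le> 2 * t * (- G a b) + t\<^sup>2 * H a b"
        using pert[OF ab, of "- t"] t w4[OF ab] by simp
    qed
    then show ?thesis using G0[OF ab] by simp
  qed simp
  define \<alpha> where "\<alpha> a = p a - row w a" for a
  define \<beta> where "\<beta> b = q b - col w b" for b
  have ab: "\<alpha> a + \<beta> b \<le> s * c a b" if "a \<in> S" "b \<in> S" for a b
    using G0[OF that] by (simp add: G_def \<alpha>_def \<beta>_def)
  have s0: "0 \<le> s" by (simp add: s_def)
  \<comment> \<open>For \<open>s = 0\<close> the residuals satisfy \<alpha> a + \<beta> b \<le> 0
    and are summed against the product of \<open>p\<close> and \<open>q\<close>; for
    \<open>s > 0\<close> division by \<open>s\<close> makes them admissible in the dual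
    bound.\<close>
  have d: "(\<Sum>a\<in>S. \<alpha> a * p a) + (\<Sum>b\<in>S. \<beta> b * q b) \<le> s * D"
  proof (cases "s = 0")
    case True
    have "(\<Sum>a\<in>S. \<alpha> a * p a) + (\<Sum>b\<in>S. \<beta> b * q b)
        = (\<Sum>a\<in>S. \<alpha> a * p a) * sum q S + (\<Sum>b\<in>S. \<beta> b * q b) * sum p S"
      using p q by simp
    also have "\<dots> = (\<Sum>a\<in>S. \<Sum>b\<in>S. (\<alpha> a * p a) * q b) + (\<Sum>b\<in>S. \<Sum>a\<in>S. (\<beta> b * q b) * p a)"
      by (simp only: sum_product)
    also have "(\<Sum>b\<in>S. \<Sum>a\<in>S. (\<beta> b * q b) * p a) = (\<Sum>a\<in>S. \<Sum>b\<in>S. (\<beta> b * q b) * p a)"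
      by (rule sum.swap)
    also have "(\<Sum>a\<in>S. \<Sum>b\<in>S. (\<alpha> a * p a) * q b) + \<dots> = (\<Sum>a\<in>S. \<Sum>b\<in>S. (\<alpha> a + \<beta> b) * (p a * q b))"
      by (simp add: sum.distrib[symmetric] algebra_simps)
    also have "\<dots> \<le> 0"
      using ab True p q by (intro sum_nonpos mult_nonpos_nonneg) auto
    finally show ?thesis using True by simp
  next
    case False
    with s0 have s: "0 < s" by simp
    have "(\<Sum>a\<in>S. \<alpha> a / s * p a) + (\<Sum>b\<in>S. \<beta> b / s * q b) \<le> D"
      by (rule dual) (use ab s in \<open>simp add: add_divide_distrib[symmetric] divide_le_eq mult.commute\<close>)
    then have "((\<Sum>a\<in>S. \<alpha> a * p a) + (\<Sum>b\<in>S. \<beta> b * q b)) / s \<le> D"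
      by (simp add: add_divide_distrib sum_divide_distrib)
    then show ?thesis using s by (simp add: divide_le_eq mult.commute)
  qed
  have "0 = (\<Sum>a\<in>S. \<Sum>b\<in>S. w (a, b) * G a b)"
    by (intro sum.neutral[symmetric] ballI sum.neutral) (rule G1)
  also have "\<dots> = (\<Sum>a\<in>S. \<Sum>b\<in>S. s * (c a b * w (a, b)) - \<alpha> a * w (a, b) - \<beta> b * w (a, b))"
    by (intro sum.cong refl) (simp add: G_def \<alpha>_def \<beta>_def algebra_simps)
  also have "\<dots> = s * cost w - (\<Sum>a\<in>S. \<alpha> a * row w a) - (\<Sum>a\<in>S. \<Sum>b\<in>S. \<beta> b * w (a, b))"
    by (simp add: sum_subtractf cost_def row_def sum_distrib_left)
  also have "(\<Sum>a\<in>S. \<Sum>b\<in>S. \<beta> b * w (a, b)) = (\<Sum>b\<in>S. \<beta> b * col w b)"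
    by (subst sum.swap) (simp add: col_def sum_distrib_left)
  finally have e: "s * cost w = (\<Sum>a\<in>S. \<alpha> a * row w a) + (\<Sum>b\<in>S. \<beta> b * col w b)" by simp
  \<comment> \<open>Since \<open>p\<close> is \<alpha> plus the row sums and \<open>q\<close> is
    \<beta> plus the column sums, \<open>d\<close> and \<open>e\<close> together say that the
    squares of all residuals and of \<open>s\<close> add up to at most 0.\<close>
  have "(\<Sum>a\<in>S. \<alpha> a * p a) = (\<Sum>a\<in>S. (\<alpha> a)\<^sup>2) + (\<Sum>a\<in>S. \<alpha> a * row w a)"
    by (simp add: sum.distrib[symmetric] \<alpha>_def power2_eq_square algebra_simps)
  moreover have "(\<Sum>b\<in>S. \<beta> b * q b) = (\<Sum>b\<in>S. (\<beta> b)\<^sup>2) + (\<Sum>b\<in>S. \<beta> b * col w b)"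
    by (simp add: sum.distrib[symmetric] \<beta>_def power2_eq_square algebra_simps)
  moreover have "s * cost w - s * D = s\<^sup>2"
    by (auto simp: s_def max_def power2_eq_square algebra_simps)
  moreover have "0 \<le> (\<Sum>a\<in>S. (\<alpha> a)\<^sup>2)" "0 \<le> (\<Sum>a\<in>S. (\<beta> a)\<^sup>2)" "0 \<le> s\<^sup>2"
    by (simp_all add: sum_nonneg)
  ultimately have "(\<Sum>a\<in>S. (\<alpha> a)\<^sup>2) = 0" "(\<Sum>a\<in>S. (\<beta> a)\<^sup>2) = 0" "s\<^sup>2 = 0"
    using d e by linarith+
  then have "\<forall>a\<in>S. \<alpha> a = 0" "\<forall>a\<in>S. \<beta> a = 0" "s = 0"
    using S by (auto simp: sum_nonneg_eq_0_iff)
  then show ?thesis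
    using w0 by (intro exI[of _ "\<lambda>a b. w (a, b)"])
      (auto simp: \<alpha>_def \<beta>_def row_def col_def s_def cost_def max_def split: if_splits)
qed

lemma finite_range_level_sets:
  fixes T :: "'a \<Rightarrow> 'b"
  assumes "prob_space M" "finite (range T)" "\<And>a. {x. T x = a} \<in> sets M" "space M = UNIV"
  shows nn_integral_finite_range: "(\<And>a. 0 \<le> \<phi> a) \<Longrightarrow>
      (\<integral>\<^sup>+ x. ennreal (\<phi> (T x)) \<partial>M) = ennreal (\<Sum>a\<in>range T. \<phi> a * measure M {x. T x = a})"
    and integral_finite_range:
      "(\<integral>x. (\<phi> (T x) :: real) \<partial>M) = (\<Sum>a\<in>range T. \<phi> a * measure M {x. T x = a})"
    and integrable_finite_range: "integrable M (\<lambda>x. (\<phi> (T x) :: real))"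
proof -
  interpret prob_space M by fact
  have e: "\<phi> (T x) = (\<Sum>a\<in>range T. \<phi> a * indicator {x. T x = a} x)" for x and \<phi> :: "'b \<Rightarrow> real"
    using assms(2) by (subst sum.remove[of _ "T x"]) (auto intro!: sum.neutral simp: indicator_def)
  show i: "integrable M (\<lambda>x. (\<phi> (T x) :: real))"
    unfolding e using assms(3)
    by (intro Bochner_Integration.integrable_sum integrable_mult_right integrable_real_indicator)
      (auto simp: emeasure_eq_measure)
  show r: "(\<integral>x. (\<phi> (T x) :: real) \<partial>M) = (\<Sum>a\<in>range T. \<phi> a * measure M {x. T x = a})"
    unfolding e using assms(3)
    by (subst Bochner_Integration.integral_sum) (auto simp: emeasure_eq_measure intro!: integrable_mult_right integrable_real_indicator)
  show "(\<integral>\<^sup>+ x. ennreal (\<phi> (T x)) \<partial>M) = ennreal (\<Sum>a\<in>range T. \<phi> a * measure M {x. T x = a})"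
    if "\<And>a. 0 \<le> \<phi> a"
    using nn_integral_eq_integral[OF i] that r by simp
qed

lemma clip_dist: "\<bar>max (- R) (min R a) - max (- R) (min R b)\<bar> \<le> \<bar>a - b\<bar>" for a b R :: real
  by (auto simp: max_def min_def)

lemma lipschitz_on_realI:
  fixes g :: "'a::metric_space \<Rightarrow> real"
  assumes "0 \<le> L" "\<And>x y. g x - g y \<le> L * dist x y"
  shows "L-lipschitz_on UNIV g"
proof (rule lipschitz_onI)
  fix x y
  show "dist (g x) (g y) \<le> L * dist x y"
    using assms(2)[of x y] assms(2)[of y x] by (simp add: dist_real_def abs_le_iff dist_commute)
qed fact

text \<open>Both laws are pushed to a finite set by a simple map \<open>T\<close> of small mean
  displacement. The finite problem yields a plan between the images, and this lifts to a coupling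
  whose density depends on \<open>T x\<close> and \<open>T y\<close> only.\<close>

lemma kantorovich_rubinstein_bound:
  fixes \<mu> \<nu> :: "'a::polish_space measure"
  assumes \<mu>: "\<mu> \<in> space (prob_algebra borel)" and \<nu>: "\<nu> \<in> space (prob_algebra borel)"
    and fin: "integrable \<mu> (\<lambda>x. dist x x0)"
    and D: "0 \<le> D"
    and dual: "\<And>g. 1-lipschitz_on UNIV g \<Longrightarrow> bounded (range g) \<Longrightarrow>
      (\<integral>x. g x \<partial>\<nu>) - (\<integral>x. g x \<partial>\<mu>) \<le> D"
  shows "W1 \<nu> \<mu> \<le> ennreal D"
proof -
  interpret \<mu>: prob_space \<mu> using \<mu> by (simp add: space_prob_algebra)
  interpret \<nu>: prob_space \<nu> using \<nu> by (simp add: space_prob_algebra)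
  interpret \<nu>\<mu>: pair_prob_space \<nu> \<mu> ..
  have [measurable_cong, simp]: "sets \<mu> = sets borel" "sets \<nu> = sets borel"
    using \<mu> \<nu> by (auto simp: space_prob_algebra)
  have [simp]: "space \<mu> = UNIV" "space \<nu> = UNIV"
    using sets_eq_imp_space_eq[of \<mu> borel] sets_eq_imp_space_eq[of \<nu> borel] by auto
  have lip_meas: "g \<in> borel_measurable borel" if "1-lipschitz_on UNIV g" for g :: "'a \<Rightarrow> real"
    using lipschitz_on_continuous_on[OF that] by (rule borel_measurable_continuous_onI)
  \<comment> \<open>The truncated distances are bounded and 1-Lipschitz, so the dual bound carries
    the first moment of \<mu> over to \<nu>.\<close>
  have finN: "integrable \<nu> (\<lambda>x. dist x x0)"
  proof (rule integrableI_nonneg)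
    define g where "g n x = min (real n) (dist x x0)" for n x
    have "(\<integral>\<^sup>+x. ennreal (dist x x0) \<partial>\<nu>) = (\<integral>\<^sup>+x. (SUP n. ennreal (g n x)) \<partial>\<nu>)"
    proof (rule nn_integral_cong, rule antisym)
      fix x
      obtain n where "dist x x0 \<le> real n" using real_arch_simple by blast
      then have "dist x x0 = g n x" by (simp add: g_def)
      then show "ennreal (dist x x0) \<le> (SUP n. ennreal (g n x))"
        by (auto intro: SUP_upper2)
      show "(SUP n. ennreal (g n x)) \<le> ennreal (dist x x0)"
        by (rule SUP_least) (simp add: g_def ennreal_leI)
    qed
    also have "\<dots> = (SUP n. \<integral>\<^sup>+x. ennreal (g n x) \<partial>\<nu>)"
    proof (rule nn_integral_monotone_convergence_SUP)
      show "incseq (\<lambda>i x. ennreal (g i x))"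
        by (auto simp: incseq_def le_fun_def g_def intro!: ennreal_leI)
    qed (auto simp: g_def)
    also have "\<dots> \<le> ennreal (D + (\<integral>x. dist x x0 \<partial>\<mu>))"
    proof (rule SUP_least)
      fix n
      have l: "1-lipschitz_on UNIV (g n)"
      proof (rule lipschitz_on_realI)
        fix x y
        show "g n x - g n y \<le> 1 * dist x y"
          using dist_triangle[of x x0 y] zero_le_dist[of x y] by (auto simp: g_def min_def simp del: zero_le_dist)
      qed simp
      have b: "bounded (range (g n))"
        by (rule boundedI[of _ "real n"]) (auto simp: g_def)
      have i: "integrable \<mu> (g n)"
        using lip_meas[OF l]
        by (intro \<mu>.integrable_const_bound[of _ "real n"]) (auto simp: g_def)
      have i': "integrable \<nu> (g n)"
        using lip_meas[OF l]
        by (intro \<nu>.integrable_const_bound[of _ "real n"]) (auto simp: g_def)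
      have "(\<integral>x. g n x \<partial>\<mu>) \<le> (\<integral>x. dist x x0 \<partial>\<mu>)"
        by (rule integral_mono[OF i fin]) (simp add: g_def)
      with dual[OF l b] have "(\<integral>x. g n x \<partial>\<nu>) \<le> D + (\<integral>x. dist x x0 \<partial>\<mu>)" by simp
      moreover have "(\<integral>\<^sup>+x. ennreal (g n x) \<partial>\<nu>) = ennreal (\<integral>x. g n x \<partial>\<nu>)"
        by (rule nn_integral_eq_integral[OF i']) (simp add: g_def)
      ultimately show "(\<integral>\<^sup>+x. ennreal (g n x) \<partial>\<nu>) \<le> ennreal (D + (\<integral>x. dist x x0 \<partial>\<mu>))"
        by (simp add: ennreal_leI)
    qed
    finally show "(\<integral>\<^sup>+x. ennreal (dist x x0) \<partial>\<nu>) < \<infinity>"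
      by (simp add: le_less_trans)
  qed auto
  \<comment> \<open>The error \<open>4 * e\<close> consists of one displacement by \<open>T\<close>
    on each side, and of \<open>2 * e\<close> lost when integrals over the finite images are
    compared with those over the original laws.\<close>
  have main: "W1 \<nu> \<mu> \<le> ennreal (D + 4 * e)" if e: "e > 0" for e
  proof -
    have "(\<lambda>x. x) \<in> borel_measurable borel" by simp
    from borel_measurable_implies_sequence_metric[OF this, of x0]
    obtain F where F: "\<And>i. simple_function borel (F i)" "\<And>x. (\<lambda>i. F i x) \<longlonglongrightarrow> x"
      "\<And>i x. dist (F i x) x0 \<le> 2 * dist x x0"
      by (metis UNIV_I space_borel)
    have Fm[measurable]: "F i \<in> borel_measurable borel" for i
      by (rule borel_measurable_simple_function[OF F(1)])
    have conv: "(\<lambda>i. \<integral>x. dist x (F i x) \<partial>\<rho>) \<longlonglongrightarrow> 0" and Fint: "integrable \<rho> (\<lambda>x. dist x (F i x))"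
      if [measurable_cong]: "sets \<rho> = sets borel" and i: "integrable \<rho> (\<lambda>x. dist x x0)" for \<rho> i
    proof -
      have bd: "dist x (F i x) \<le> 3 * dist x x0" for x i
        using F(3)[of i x] dist_triangle[of x "F i x" x0] by (simp add: dist_commute)
      have "(\<lambda>i. \<integral>x. dist x (F i x) \<partial>\<rho>) \<longlonglongrightarrow> (\<integral>x. 0 \<partial>\<rho>)"
      proof (rule integral_dominated_convergence[where w = "\<lambda>x. 3 * dist x x0"])
        show "AE x in \<rho>. (\<lambda>i. dist x (F i x)) \<longlonglongrightarrow> 0"
          using tendsto_dist[OF tendsto_const F(2)] by (intro AE_I2) (metis dist_self)
      qed (use bd i in auto)
      then show "(\<lambda>i. \<integral>x. dist x (F i x) \<partial>\<rho>) \<longlonglongrightarrow> 0" by simp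
      show "integrable \<rho> (\<lambda>x. dist x (F i x))"
        by (rule Bochner_Integration.integrable_bound[of _ "\<lambda>x. 3 * dist x x0"]) (use bd i in auto)
    qed
    have "eventually (\<lambda>i. (\<integral>x. dist x (F i x) \<partial>\<mu>) < e \<and> (\<integral>x. dist x (F i x) \<partial>\<nu>) < e) sequentially"
      using order_tendstoD(2)[OF conv[OF _ fin] e] order_tendstoD(2)[OF conv[OF _ finN] e]
      by (auto intro: eventually_conj)
    then obtain i where i: "(\<integral>x. dist x (F i x) \<partial>\<mu>) < e" "(\<integral>x. dist x (F i x) \<partial>\<nu>) < e"
      by (auto simp: eventually_sequentially)
    define T where "T = F i"
    define S where "S = range T"
    have [measurable]: "T \<in> borel_measurable borel" by (simp add: T_def)
    have finS: "finite (range T)" using F(1)[of i] by (simp add: simple_function_def T_def)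
    have lev[measurable]: "{x. T x = a} \<in> sets borel" for a
    proof -
      have "T -` {a} \<inter> space borel \<in> sets borel" by measurable
      then show ?thesis by (simp add: vimage_def)
    qed
    have eT: "(\<integral>x. dist x (T x) \<partial>\<mu>) < e" "(\<integral>x. dist x (T x) \<partial>\<nu>) < e"
      and iT: "integrable \<mu> (\<lambda>x. dist x (T x))" "integrable \<nu> (\<lambda>x. dist x (T x))"
      using i Fint[OF _ fin] Fint[OF _ finN] by (auto simp: T_def)
    define p where "p a = measure \<nu> {x. T x = a}" for a
    define q where "q a = measure \<mu> {x. T x = a}" for a
    note frN = nn_integral_finite_range[OF \<nu>.prob_space_axioms finS, folded p_def S_def]
      integral_finite_range[OF \<nu>.prob_space_axioms finS, folded p_def S_def]
      integrable_finite_range[OF \<nu>.prob_space_axioms finS]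
    note frM = nn_integral_finite_range[OF \<mu>.prob_space_axioms finS, folded q_def S_def]
      integral_finite_range[OF \<mu>.prob_space_axioms finS, folded q_def S_def]
      integrable_finite_range[OF \<mu>.prob_space_axioms finS]
    have pq: "sum p S = 1" "sum q S = 1"
      using frN(2)[of "\<lambda>_. 1"] frM(2)[of "\<lambda>_. 1"] \<mu>.prob_space \<nu>.prob_space by auto
    have "\<exists>w. (\<forall>a\<in>S. \<forall>b\<in>S. 0 \<le> w a b) \<and> (\<forall>a\<in>S. (\<Sum>b\<in>S. w a b) = p a) \<and>
      (\<forall>b\<in>S. (\<Sum>a\<in>S. w a b) = q b) \<and> (\<Sum>a\<in>S. \<Sum>b\<in>S. dist a b * w a b) \<le> D + 2 * e"
    proof (rule transport_alternative)
      show "finite S" using finS by (simp add: S_def)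
      fix \<alpha> \<beta> :: "'a \<Rightarrow> real" assume ab: "\<And>a b. a \<in> S \<Longrightarrow> b \<in> S \<Longrightarrow> \<alpha> a + \<beta> b \<le> dist a b"
      \<comment> \<open>The c-transform of \<alpha>: it is 1-Lipschitz on the whole space, with
        \<alpha> \<le> - g0 and \<beta> \<le> g0 on \<open>S\<close>. Clipping at \<open>R\<close>
        makes it bounded and leaves its values on \<open>S\<close> unchanged.\<close>
      define g0 where "g0 x = Min ((\<lambda>a. dist x a - \<alpha> a) ` S)" for x
      define R where "R = Max ((\<lambda>a. \<bar>g0 a\<bar>) ` S)"
      define g where "g x = max (- R) (min R (g0 x))" for x
      have Sne: "S \<noteq> {}" "finite S" using finS by (auto simp: S_def)
      have g0le: "g0 x \<le> dist x a - \<alpha> a" if "a \<in> S" for x a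
        unfolding g0_def using Sne that by (intro Min_le) auto
      have g0lip: "g0 x - g0 y \<le> dist x y" for x y
      proof -
        have "g0 x - dist x y \<le> dist y a - \<alpha> a" if "a \<in> S" for a
          using g0le[OF that, of x] dist_triangle[of x a y] by simp
        then have "g0 x - dist x y \<le> g0 y"
          unfolding g0_def[of y] using Sne by (intro Min.boundedI) auto
        then show ?thesis by simp
      qed
      have l: "1-lipschitz_on UNIV (\<lambda>x. - g x)"
      proof (rule lipschitz_on_realI)
        fix x y
        have "\<bar>g y - g x\<bar> \<le> \<bar>g0 y - g0 x\<bar>" unfolding g_def by (rule clip_dist)
        also have "\<dots> \<le> dist x y" using g0lip[of x y] g0lip[of y x] by (simp add: dist_commute)
        finally show "- g x - - g y \<le> 1 * dist x y" by simp
      qed simp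
      have gm[measurable]: "g \<in> borel_measurable borel"
        using lip_meas[OF l] by simp
      have R0: "0 \<le> R"
      proof -
        obtain a where a: "a \<in> S" using Sne by auto
        have "\<bar>g0 a\<bar> \<le> R" unfolding R_def using Sne a by (intro Max_ge) auto
        then show ?thesis by simp
      qed
      have gR: "\<bar>g x\<bar> \<le> R" for x using R0 by (auto simp: g_def)
      have b: "bounded (range (\<lambda>x. - g x))"
        by (rule boundedI[of _ R]) (use gR in auto)
      have gS: "g a = g0 a" if "a \<in> S" for a
      proof -
        have "\<bar>g0 a\<bar> \<le> R" unfolding R_def using Sne that by (intro Max_ge) auto
        then show ?thesis by (auto simp: g_def)
      qed
      have \<beta>: "\<beta> b \<le> g b" if "b \<in> S" for b
        unfolding gS[OF that] g0_def using Sne ab[OF _ that]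
        by (intro Min.boundedI) (auto simp: dist_commute algebra_simps)
      have \<alpha>: "\<alpha> a \<le> - g a" if "a \<in> S" for a
        unfolding gS[OF that] using g0le[OF that, of a] by simp
      have iN: "integrable \<nu> g" and iM: "integrable \<mu> g"
        by (auto intro!: \<nu>.integrable_const_bound[of _ R] \<mu>.integrable_const_bound[of _ R] simp: gR)
      have gT: "\<bar>g (T x) - g x\<bar> \<le> dist x (T x)" for x
        using lipschitz_onD[OF l, of x "T x"] by (simp add: dist_real_def)
      have "(\<integral>x. g (T x) - g x \<partial>\<mu>) \<le> (\<integral>x. dist x (T x) \<partial>\<mu>)"
        using gT iM iT frM(3)[of g] by (intro integral_mono) (auto simp: abs_le_iff)
      then have "(\<integral>x. g (T x) \<partial>\<mu>) - (\<integral>x. g x \<partial>\<mu>) \<le> (\<integral>x. dist x (T x) \<partial>\<mu>)"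
        using iM frM(3)[of g] by simp
      moreover have "(\<integral>x. g x - g (T x) \<partial>\<nu>) \<le> (\<integral>x. dist x (T x) \<partial>\<nu>)"
        using gT iN iT frN(3)[of g] by (intro integral_mono) (auto simp: abs_le_iff)
      then have "(\<integral>x. g x \<partial>\<nu>) - (\<integral>x. g (T x) \<partial>\<nu>) \<le> (\<integral>x. dist x (T x) \<partial>\<nu>)"
        using iN frN(3)[of g] by simp
      moreover have "(\<Sum>a\<in>S. \<alpha> a * p a) \<le> - (\<integral>x. g (T x) \<partial>\<nu>)"
      proof -
        have "(\<Sum>a\<in>S. \<alpha> a * p a) \<le> (\<Sum>a\<in>S. (- g a) * p a)"
          using \<alpha> by (intro sum_mono mult_right_mono) (auto simp: p_def)
        then show ?thesis using frN(2)[of g] by (simp add: sum_negf)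
      qed
      moreover have "(\<Sum>b\<in>S. \<beta> b * q b) \<le> (\<integral>x. g (T x) \<partial>\<mu>)"
      proof -
        have "(\<Sum>b\<in>S. \<beta> b * q b) \<le> (\<Sum>b\<in>S. g b * q b)"
          using \<beta> by (intro sum_mono mult_right_mono) (auto simp: q_def)
        then show ?thesis using frM(2)[of g] by simp
      qed
      moreover have "(\<integral>x. g x \<partial>\<mu>) - (\<integral>x. g x \<partial>\<nu>) \<le> D"
        using dual[OF l b] by simp
      ultimately show "(\<Sum>a\<in>S. \<alpha> a * p a) + (\<Sum>b\<in>S. \<beta> b * q b) \<le> D + 2 * e"
        using eT by linarith
    qed (use pq D e in \<open>auto simp: p_def q_def\<close>)
    then obtain w where w: "\<And>a b. a \<in> S \<Longrightarrow> b \<in> S \<Longrightarrow> 0 \<le> w a b"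
      "\<And>a. a \<in> S \<Longrightarrow> (\<Sum>b\<in>S. w a b) = p a" "\<And>b. b \<in> S \<Longrightarrow> (\<Sum>a\<in>S. w a b) = q b"
      "(\<Sum>a\<in>S. \<Sum>b\<in>S. dist a b * w a b) \<le> D + 2 * e" by blast
    have TS: "T x \<in> S" for x by (simp add: S_def)
    have fS: "finite S" using finS by (simp add: S_def)
    have wp: "w a b = 0" if "p a = 0" "a \<in> S" "b \<in> S" for a b
      using w(2)[OF that(2)] that w(1)[OF that(2)] fS by (simp add: sum_nonneg_eq_0_iff)
    have wq: "w a b = 0" if "q b = 0" "a \<in> S" "b \<in> S" for a b
      using w(3)[OF that(3)] that w(1)[OF _ that(3)] fS by (simp add: sum_nonneg_eq_0_iff)
    \<comment> \<open>Density of the lifted plan with respect to the product of \<nu> and \<mu>.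
      Quotients by zero are 0, in accordance with \<open>wp\<close> and \<open>wq\<close>: the plan
      has no mass in null rows and columns.\<close>
    define k where "k a b = (if a \<in> S \<and> b \<in> S then w a b / (p a * q b) else 0)" for a b
    have k0: "0 \<le> k a b" for a b using w(1) by (auto simp: k_def p_def q_def)
    have kq: "k a b * q b = w a b / p a" if "a \<in> S" "b \<in> S" for a b
      using that wq[OF _ that] by (cases "q b = 0") (auto simp: k_def)
    have kp: "k a b * p a = w a b / q b" if "a \<in> S" "b \<in> S" for a b
      using that wp[OF _ that] by (cases "p a = 0") (auto simp: k_def)
    have mk[measurable]: "(\<lambda>z. h (T (fst z)) (T (snd z))) \<in> borel_measurable (borel \<Otimes>\<^sub>M borel)"
      for h :: "'a \<Rightarrow> 'a \<Rightarrow> real"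
    proof -
      have "(\<lambda>z. h (T (fst z)) (T (snd z))) = (\<lambda>z. \<Sum>a\<in>S. \<Sum>b\<in>S. h a b *
          (indicator {x. T x = a} (fst z) * indicator {x. T x = b} (snd z)))" (is "_ = (\<lambda>z. ?r z)")
      proof
        fix z
        have "?r z = (\<Sum>a\<in>S. \<Sum>b\<in>S. if b = T (snd z) then (if a = T (fst z) then h a b else 0) else 0)"
          by (intro sum.cong refl) (auto simp: indicator_def)
        also have "\<dots> = h (T (fst z)) (T (snd z))"
          using TS fS by simp
        finally show "h (T (fst z)) (T (snd z)) = ?r z" by simp
      qed
      then show ?thesis by simp
    qed
    have AEp: "AE x in \<nu>. p (T x) \<noteq> 0"
    proof -
      have "AE x in \<nu>. \<forall>a\<in>S. p a = 0 \<longrightarrow> T x \<noteq> a"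
      proof (rule AE_finite_allI[OF fS])
        fix a
        have "AE x in \<nu>. T x \<noteq> a" if "p a = 0"
          using that by (intro AE_I[of _ _ "{x. T x = a}"]) (auto simp: p_def \<nu>.emeasure_eq_measure)
        then show "AE x in \<nu>. p a = 0 \<longrightarrow> T x \<noteq> a" by (cases "p a = 0") auto
      qed
      then show ?thesis using TS by auto
    qed
    have AEq: "AE x in \<mu>. q (T x) \<noteq> 0"
    proof -
      have "AE x in \<mu>. \<forall>a\<in>S. q a = 0 \<longrightarrow> T x \<noteq> a"
      proof (rule AE_finite_allI[OF fS])
        fix a
        have "AE x in \<mu>. T x \<noteq> a" if "q a = 0"
          using that by (intro AE_I[of _ _ "{x. T x = a}"]) (auto simp: q_def \<mu>.emeasure_eq_measure)
        then show "AE x in \<mu>. q a = 0 \<longrightarrow> T x \<noteq> a" by (cases "q a = 0") auto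
      qed
      then show ?thesis using TS by auto
    qed
    define \<pi> where "\<pi> = density (\<nu> \<Otimes>\<^sub>M \<mu>) (\<lambda>z. ennreal (k (T (fst z)) (T (snd z))))"
    have nnpi: "(\<integral>\<^sup>+z. f z \<partial>\<pi>) = (\<integral>\<^sup>+x. \<integral>\<^sup>+y. ennreal (k (T x) (T y)) * f (x, y) \<partial>\<mu> \<partial>\<nu>)"
      "(\<integral>\<^sup>+z. f z \<partial>\<pi>) = (\<integral>\<^sup>+y. \<integral>\<^sup>+x. ennreal (k (T x) (T y)) * f (x, y) \<partial>\<nu> \<partial>\<mu>)"
      if [measurable]: "f \<in> borel_measurable (borel \<Otimes>\<^sub>M borel)" for f
    proof -
      have e: "(\<integral>\<^sup>+z. f z \<partial>\<pi>) = (\<integral>\<^sup>+z. ennreal (k (T (fst z)) (T (snd z))) * f z \<partial>(\<nu> \<Otimes>\<^sub>M \<mu>))"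
        unfolding \<pi>_def by (subst nn_integral_density) auto
      have m: "(\<lambda>z. ennreal (k (T (fst z)) (T (snd z))) * f z) \<in> borel_measurable (\<nu> \<Otimes>\<^sub>M \<mu>)"
        by measurable
      show "(\<integral>\<^sup>+z. f z \<partial>\<pi>) = (\<integral>\<^sup>+x. \<integral>\<^sup>+y. ennreal (k (T x) (T y)) * f (x, y) \<partial>\<mu> \<partial>\<nu>)"
        unfolding e using \<mu>.nn_integral_fst[OF m] by simp
      show "(\<integral>\<^sup>+z. f z \<partial>\<pi>) = (\<integral>\<^sup>+y. \<integral>\<^sup>+x. ennreal (k (T x) (T y)) * f (x, y) \<partial>\<nu> \<partial>\<mu>)"
        unfolding e using \<nu>\<mu>.nn_integral_snd[of "\<lambda>z. ennreal (k (T (fst z)) (T (snd z))) * f z"] m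
        by (simp add: case_prod_beta)
    qed
    have setspi: "sets \<pi> = sets (borel \<Otimes>\<^sub>M borel)"
      unfolding \<pi>_def by (simp cong: sets_pair_measure_cong)
    have [measurable_cong]: "sets \<pi> = sets (borel \<Otimes>\<^sub>M borel)" by (fact setspi)
    have m1: "distr \<pi> borel fst = \<nu>"
    proof (rule measure_eqI)
      fix A assume "A \<in> sets (distr \<pi> borel fst)"
      then have [measurable]: "A \<in> sets borel" by simp
      have "emeasure (distr \<pi> borel fst) A = (\<integral>\<^sup>+x. indicator A x \<partial>distr \<pi> borel fst)"
        by simp
      also have "\<dots> = (\<integral>\<^sup>+z. indicator A (fst z) \<partial>\<pi>)"
        by (rule nn_integral_distr) auto
      also have "\<dots> = (\<integral>\<^sup>+x. \<integral>\<^sup>+y. ennreal (k (T x) (T y)) * indicator A x \<partial>\<mu> \<partial>\<nu>)"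
        by (subst nnpi(1)) auto
      also have "\<dots> = (\<integral>\<^sup>+x. indicator A x \<partial>\<nu>)"
      proof (rule nn_integral_cong_AE, use AEp in eventually_elim)
        fix x assume x: "p (T x) \<noteq> 0"
        have "(\<integral>\<^sup>+y. ennreal (k (T x) (T y)) \<partial>\<mu>) = ennreal (\<Sum>b\<in>S. k (T x) b * q b)"
          by (rule frM(1)) (auto simp: k0)
        also have "(\<Sum>b\<in>S. k (T x) b * q b) = (\<Sum>b\<in>S. w (T x) b) / p (T x)"
          using kq TS by (simp add: sum_divide_distrib)
        finally have "(\<integral>\<^sup>+y. ennreal (k (T x) (T y)) \<partial>\<mu>) = 1"
          using x w(2)[OF TS] by simp
        moreover have "(\<lambda>y. ennreal (k (T x) (T y))) \<in> borel_measurable \<mu>"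
          using frM(3)[of "k (T x)"] by auto
        ultimately show "(\<integral>\<^sup>+y. ennreal (k (T x) (T y)) * indicator A x \<partial>\<mu>) = indicator A x"
          by (subst nn_integral_multc) auto
      qed
      finally show "emeasure (distr \<pi> borel fst) A = emeasure \<nu> A" by simp
    qed auto
    have m2: "distr \<pi> borel snd = \<mu>"
    proof (rule measure_eqI)
      fix A assume "A \<in> sets (distr \<pi> borel snd)"
      then have [measurable]: "A \<in> sets borel" by simp
      have "emeasure (distr \<pi> borel snd) A = (\<integral>\<^sup>+x. indicator A x \<partial>distr \<pi> borel snd)"
        by simp
      also have "\<dots> = (\<integral>\<^sup>+z. indicator A (snd z) \<partial>\<pi>)"
        by (rule nn_integral_distr) auto
      also have "\<dots> = (\<integral>\<^sup>+y. \<integral>\<^sup>+x. ennreal (k (T x) (T y)) * indicator A y \<partial>\<nu> \<partial>\<mu>)"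
        by (subst nnpi(2)) auto
      also have "\<dots> = (\<integral>\<^sup>+y. indicator A y \<partial>\<mu>)"
      proof (rule nn_integral_cong_AE, use AEq in eventually_elim)
        fix y assume y: "q (T y) \<noteq> 0"
        have "(\<integral>\<^sup>+x. ennreal (k (T x) (T y)) \<partial>\<nu>) = ennreal (\<Sum>a\<in>S. k a (T y) * p a)"
          by (rule frN(1)) (auto simp: k0)
        also have "(\<Sum>a\<in>S. k a (T y) * p a) = (\<Sum>a\<in>S. w a (T y)) / q (T y)"
          using kp TS by (simp add: sum_divide_distrib)
        finally have "(\<integral>\<^sup>+x. ennreal (k (T x) (T y)) \<partial>\<nu>) = 1"
          using y w(3)[OF TS] by simp
        moreover have "(\<lambda>x. ennreal (k (T x) (T y))) \<in> borel_measurable \<nu>"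
          using frN(3)[of "\<lambda>a. k a (T y)"] by auto
        ultimately show "(\<integral>\<^sup>+x. ennreal (k (T x) (T y)) * indicator A y \<partial>\<nu>) = indicator A y"
          by (subst nn_integral_multc) auto
      qed
      finally show "emeasure (distr \<pi> borel snd) A = emeasure \<mu> A" by simp
    qed auto
    have pic: "\<pi> \<in> couplings \<nu> \<mu>" using setspi m1 m2 by (simp add: couplings_def)
    have c1: "(\<integral>\<^sup>+z. ennreal (dist (fst z) (T (fst z))) \<partial>\<pi>) \<le> ennreal e"
    proof -
      have "(\<integral>\<^sup>+z. ennreal (dist (fst z) (T (fst z))) \<partial>\<pi>) = (\<integral>\<^sup>+x. ennreal (dist x (T x)) \<partial>distr \<pi> borel fst)"
        by (subst nn_integral_distr) auto
      also have "\<dots> \<le> ennreal e"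
        unfolding m1 using eT iT by (subst nn_integral_eq_integral) (auto intro!: ennreal_leI)
      finally show ?thesis .
    qed
    have c2: "(\<integral>\<^sup>+z. ennreal (dist (snd z) (T (snd z))) \<partial>\<pi>) \<le> ennreal e"
    proof -
      have "(\<integral>\<^sup>+z. ennreal (dist (snd z) (T (snd z))) \<partial>\<pi>) = (\<integral>\<^sup>+x. ennreal (dist x (T x)) \<partial>distr \<pi> borel snd)"
        by (subst nn_integral_distr) auto
      also have "\<dots> \<le> ennreal e"
        unfolding m2 using eT iT by (subst nn_integral_eq_integral) (auto intro!: ennreal_leI)
      finally show ?thesis .
    qed
    have c3: "(\<integral>\<^sup>+z. ennreal (dist (T (fst z)) (T (snd z))) \<partial>\<pi>) \<le> ennreal (D + 2 * e)"
    proof -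
      have "(\<integral>\<^sup>+z. ennreal (dist (T (fst z)) (T (snd z))) \<partial>\<pi>)
        = (\<integral>\<^sup>+x. \<integral>\<^sup>+y. ennreal (k (T x) (T y) * dist (T x) (T y)) \<partial>\<mu> \<partial>\<nu>)"
        by (subst nnpi(1)) (auto simp: ennreal_mult' k0)
      also have "\<dots> = (\<integral>\<^sup>+x. ennreal ((\<lambda>a. \<Sum>b\<in>S. k a b * dist a b * q b) (T x)) \<partial>\<nu>)"
        using frM(1)[where \<phi> = "\<lambda>b. k (T x) b * dist (T x) b" for x]
        by (intro nn_integral_cong) (auto simp: k0)
      also have "\<dots> = ennreal (\<Sum>a\<in>S. (\<Sum>b\<in>S. k a b * dist a b * q b) * p a)"
        by (rule frN(1)) (auto intro!: sum_nonneg simp: k0 q_def)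
      also have "(\<Sum>a\<in>S. (\<Sum>b\<in>S. k a b * dist a b * q b) * p a) = (\<Sum>a\<in>S. \<Sum>b\<in>S. dist a b * w a b)"
        unfolding sum_distrib_right
      proof (intro sum.cong refl)
        fix a b assume ab: "a \<in> S" "b \<in> S"
        have "k a b * dist a b * q b * p a = dist a b * ((k a b * q b) * p a)" by simp
        also have "(k a b * q b) * p a = w a b"
          using kq[OF ab] wp[OF _ ab] by (cases "p a = 0") auto
        finally show "k a b * dist a b * q b * p a = dist a b * w a b" .
      qed
      finally show ?thesis using w(4) by (simp add: ennreal_leI)
    qed
    have "(\<integral>\<^sup>+ (x, y). ennreal (dist x y) \<partial>\<pi>) \<le>
      (\<integral>\<^sup>+ z. ennreal (dist (fst z) (T (fst z))) + (ennreal (dist (T (fst z)) (T (snd z)))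
        + ennreal (dist (snd z) (T (snd z)))) \<partial>\<pi>)"
    proof (rule nn_integral_mono)
      fix z :: "'a \<times> 'a"
      have "dist (fst z) (snd z) \<le> dist (fst z) (T (fst z)) + (dist (T (fst z)) (T (snd z)) + dist (snd z) (T (snd z)))"
        using dist_triangle[of "fst z" "snd z" "T (fst z)"] dist_triangle[of "T (fst z)" "snd z" "T (snd z)"]
        by (simp add: dist_commute)
      then show "(case z of (x, y) \<Rightarrow> ennreal (dist x y)) \<le> ennreal (dist (fst z) (T (fst z))) +
        (ennreal (dist (T (fst z)) (T (snd z))) + ennreal (dist (snd z) (T (snd z))))"
        by (simp add: case_prod_beta ennreal_leI flip: ennreal_plus)
    qed
    also have "\<dots> = (\<integral>\<^sup>+ z. ennreal (dist (fst z) (T (fst z))) \<partial>\<pi>) +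
       ((\<integral>\<^sup>+ z. ennreal (dist (T (fst z)) (T (snd z))) \<partial>\<pi>) + (\<integral>\<^sup>+ z. ennreal (dist (snd z) (T (snd z))) \<partial>\<pi>))"
      by (simp add: nn_integral_add)
    also have "\<dots> \<le> ennreal e + (ennreal (D + 2 * e) + ennreal e)"
      by (intro add_mono c1 c2 c3)
    also have "\<dots> = ennreal (D + 4 * e)"
      using e D by (simp flip: ennreal_plus)
    finally show ?thesis
      unfolding W1_def using pic by (rule INF_lower2[rotated])
  qed
  show ?thesis
  proof (rule ennreal_le_epsilon)
    fix e :: real assume "0 < e"
    then show "W1 \<nu> \<mu> \<le> ennreal D + ennreal e"
      using main[of "e / 4"] D by (simp flip: ennreal_plus)
  qed
qed

section \<open>Square integrable functions and kernels\<close>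

lemma discriminant_nonpos:
  fixes a b c :: real
  assumes "\<And>t. 0 \<le> a + 2 * t * b + t\<^sup>2 * c" "0 \<le> c"
  shows "b\<^sup>2 \<le> a * c"
proof (cases "c = 0")
  case True
  have "b = 0"
  proof (rule ccontr)
    assume "b \<noteq> 0"
    \<comment> \<open>At this \<open>t\<close> the expression equals -1.\<close>
    then show False using assms(1)[of "- (a + 1) / (2 * b)"] True by (simp add: field_simps)
  qed
  then show ?thesis using True by simp
next
  case False
  then have c: "0 < c" using assms(2) by simp
  have "0 \<le> a - b\<^sup>2 / c"
    using assms(1)[of "- b / c"] c by (simp add: field_simps power2_eq_square)
  then show ?thesis using c by (simp add: field_simps)
qed

section \<open>Inner product and squared norm of square integrable functions\<close>

definition ip :: "'a measure \<Rightarrow> ('a \<Rightarrow> real) \<Rightarrow> ('a \<Rightarrow> real) \<Rightarrow> real" where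
  "ip M f g = (\<integral>x. f x * g x \<partial>M)"

definition sqn :: "'a measure \<Rightarrow> ('a \<Rightarrow> real) \<Rightarrow> real" where
  "sqn M f = (\<integral>x. (f x)\<^sup>2 \<partial>M)"

lemma L2D: "f \<in> L2fun M \<Longrightarrow> f \<in> borel_measurable M" "f \<in> L2fun M \<Longrightarrow> integrable M (\<lambda>x. (f x)\<^sup>2)"
  by (auto simp: L2fun_def)

lemma L2_mult: assumes "f \<in> L2fun M" "g \<in> L2fun M" shows "integrable M (\<lambda>x. f x * g x)"
proof (rule Bochner_Integration.integrable_bound)
  show "integrable M (\<lambda>x. (f x)\<^sup>2 + (g x)\<^sup>2)" using assms by (auto simp: L2fun_def)
  show "(\<lambda>x. f x * g x) \<in> borel_measurable M" using assms by (auto simp: L2fun_def)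
  have "\<bar>a * b\<bar> \<le> a\<^sup>2 + b\<^sup>2" for a b :: real
  proof -
    have "0 \<le> (\<bar>a\<bar> - \<bar>b\<bar>)\<^sup>2" by simp
    then have "2 * \<bar>a * b\<bar> \<le> a\<^sup>2 + b\<^sup>2" by (simp add: power2_diff abs_mult)
    moreover have "0 \<le> \<bar>a * b\<bar>" by simp
    ultimately show ?thesis by linarith
  qed
  then show "AE x in M. norm (f x * g x) \<le> norm ((f x)\<^sup>2 + (g x)\<^sup>2)" by simp
qed

lemma L2_add: assumes "f \<in> L2fun M" "g \<in> L2fun M" shows "(\<lambda>x. f x + g x) \<in> L2fun M"
  using assms L2_mult[OF assms] by (auto simp: L2fun_def power2_sum mult.assoc)

lemma L2_scale: assumes "f \<in> L2fun M" shows "(\<lambda>x. c * f x) \<in> L2fun M"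
  using assms by (auto simp: L2fun_def power_mult_distrib)

lemma L2_diff: assumes "f \<in> L2fun M" "g \<in> L2fun M" shows "(\<lambda>x. f x - g x) \<in> L2fun M"
  using L2_add[OF assms(1) L2_scale[OF assms(2), of "-1"]] by simp

lemma L2_div: assumes "f \<in> L2fun M" shows "(\<lambda>x. f x / c) \<in> L2fun M"
  using L2_scale[OF assms, of "1 / c"] by simp

lemma L2_bounded:
  assumes "finite_measure M" "f \<in> borel_measurable M" "\<And>x. \<bar>f x\<bar> \<le> B"
  shows "f \<in> L2fun M"
  unfolding L2fun_def
proof (intro CollectI conjI)
  show "integrable M (\<lambda>x. (f x)\<^sup>2)"
    using assms(2,3) power_mono[OF assms(3) abs_ge_zero, of _ 2]
    by (intro finite_measure.integrable_const_bound[OF assms(1), of _ "B\<^sup>2"]) auto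
qed fact

lemma L2_const: "finite_measure M \<Longrightarrow> (\<lambda>x. c) \<in> L2fun M"
  by (rule L2_bounded[of _ _ "\<bar>c\<bar>"]) auto

lemma L2_bdd_mult:
  assumes "f \<in> L2fun M" "g \<in> borel_measurable M" "\<And>x. \<bar>g x\<bar> \<le> B"
  shows "(\<lambda>x. g x * f x) \<in> L2fun M"
  unfolding L2fun_def
proof (intro CollectI conjI)
  show m: "(\<lambda>x. g x * f x) \<in> borel_measurable M" using assms by (auto simp: L2fun_def)
  show "integrable M (\<lambda>x. (g x * f x)\<^sup>2)"
  proof (rule Bochner_Integration.integrable_bound)
    show "integrable M (\<lambda>x. B\<^sup>2 * (f x)\<^sup>2)" using L2D(2)[OF assms(1)] by simp
    have "(g x)\<^sup>2 \<le> B\<^sup>2" for x using power_mono[OF assms(3)[of x] abs_ge_zero, of 2] by simp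
    then show "AE x in M. norm ((g x * f x)\<^sup>2) \<le> norm (B\<^sup>2 * (f x)\<^sup>2)"
      by (simp add: power_mult_distrib mult_right_mono)
  qed (use m in simp)
qed

lemma L2_integrable: "finite_measure M \<Longrightarrow> f \<in> L2fun M \<Longrightarrow> integrable M f"
  using L2_mult[OF _ L2_const[of M 1], of f] by simp

lemma L2_AE: assumes "f \<in> L2fun M" "g \<in> borel_measurable M" "AE x in M. f x = g x" shows "g \<in> L2fun M"
proof -
  have "integrable M (\<lambda>x. (g x)\<^sup>2) = integrable M (\<lambda>x. (f x)\<^sup>2)"
    by (rule integrable_cong_AE) (use assms in \<open>auto simp: L2fun_def\<close>)
  then show ?thesis using assms by (simp add: L2fun_def)
qed

lemma sqn_ip: "sqn M f = ip M f f" by (simp add: sqn_def ip_def power2_eq_square)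
lemma sqn_nonneg: "0 \<le> sqn M f" by (simp add: sqn_def)
lemma ip_commute: "ip M f g = ip M g f" by (simp add: ip_def mult.commute)

lemma ip_lin:
  assumes "f \<in> L2fun M" "g \<in> L2fun M" "h \<in> L2fun M"
  shows "ip M (\<lambda>x. f x + g x) h = ip M f h + ip M g h"
    "ip M h (\<lambda>x. f x + g x) = ip M h f + ip M h g"
    "ip M (\<lambda>x. f x - g x) h = ip M f h - ip M g h"
    "ip M h (\<lambda>x. f x - g x) = ip M h f - ip M h g"
  using L2_mult[OF assms(1,3)] L2_mult[OF assms(2,3)] L2_mult[OF assms(3,1)] L2_mult[OF assms(3,2)]
  by (simp_all add: ip_def algebra_simps)

lemma ip_scale:
  "ip M (\<lambda>x. c * f x) h = c * ip M f h" "ip M h (\<lambda>x. c * f x) = c * ip M h f"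
  "ip M (\<lambda>x. f x / c) h = ip M f h / c" "ip M h (\<lambda>x. f x / c) = ip M h f / c"
  "ip M (\<lambda>x. - f x) h = - ip M f h" "ip M h (\<lambda>x. - f x) = - ip M h f"
  by (simp_all add: ip_def mult.assoc mult.left_commute[of _ c])

lemma ip_cong_AE:
  assumes "f \<in> borel_measurable M" "f' \<in> borel_measurable M" "g \<in> borel_measurable M" "g' \<in> borel_measurable M"
    "AE x in M. f x = f' x" "AE x in M. g x = g' x"
  shows "ip M f g = ip M f' g'"
  unfolding ip_def by (rule integral_cong_AE) (use assms in auto)

lemma sqn_add:
  assumes "f \<in> L2fun M" "g \<in> L2fun M"
  shows "sqn M (\<lambda>x. f x + c * g x) = sqn M f + 2 * c * ip M f g + c\<^sup>2 * sqn M g"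
  unfolding sqn_ip
  using ip_lin[OF assms(1) L2_scale[OF assms(2), of c] L2_add[OF assms(1) L2_scale[OF assms(2), of c]]]
    ip_lin[OF assms(1) L2_scale[OF assms(2), of c] assms(1)]
    ip_lin[OF assms(1) L2_scale[OF assms(2), of c] assms(2)]
  by (simp add: ip_scale ip_commute[of M g f] power2_eq_square algebra_simps)

lemma ip_cauchy:
  assumes "f \<in> L2fun M" "g \<in> L2fun M"
  shows "(ip M f g)\<^sup>2 \<le> sqn M f * sqn M g"
  using discriminant_nonpos[of "sqn M f" "ip M f g" "sqn M g"] sqn_add[OF assms]
  by (metis sqn_nonneg)

lemma ip_cauchy_sqrt:
  assumes "f \<in> L2fun M" "g \<in> L2fun M"
  shows "\<bar>ip M f g\<bar> \<le> sqrt (sqn M f) * sqrt (sqn M g)"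
  using real_sqrt_le_mono[OF ip_cauchy[OF assms]] by (simp add: real_sqrt_mult)

lemma L1_le_sqn:
  assumes "prob_space M" "f \<in> L2fun M"
  shows "(\<integral>x. \<bar>f x\<bar> \<partial>M) \<le> sqrt (sqn M f)"
proof -
  interpret prob_space M by fact
  have m: "f \<in> borel_measurable M" using assms by (simp add: L2fun_def)
  have "(\<lambda>x. \<bar>f x\<bar>) \<in> L2fun M" using assms by (auto simp: L2fun_def)
  from ip_cauchy_sqrt[OF this L2_const[OF finite_measure_axioms, of 1]]
  show ?thesis by (simp add: ip_def sqn_def prob_space)
qed

lemma L2_abs: "f \<in> L2fun M \<Longrightarrow> (\<lambda>x. \<bar>f x\<bar>) \<in> L2fun M"
  by (auto simp: L2fun_def)

lemma abs_ip_le: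
  assumes "f \<in> L2fun M" "g \<in> L2fun M"
  shows "(\<integral>x. \<bar>f x * g x\<bar> \<partial>M) \<le> sqrt (sqn M f) * sqrt (sqn M g)"
  using ip_cauchy_sqrt[OF L2_abs[OF assms(1)] L2_abs[OF assms(2)]]
  by (simp add: ip_def sqn_def abs_mult)

lemma sqn_triangle:
  assumes "f \<in> L2fun M" "g \<in> L2fun M"
  shows "sqrt (sqn M (\<lambda>x. f x + g x)) \<le> sqrt (sqn M f) + sqrt (sqn M g)"
proof (rule real_le_lsqrt)
  have "sqn M (\<lambda>x. f x + g x) = sqn M f + 2 * ip M f g + sqn M g"
    using sqn_add[OF assms, of 1] by simp
  also have "\<dots> \<le> sqn M f + 2 * (sqrt (sqn M f) * sqrt (sqn M g)) + sqn M g"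
    using ip_cauchy_sqrt[OF assms] by simp
  also have "\<dots> = (sqrt (sqn M f) + sqrt (sqn M g))\<^sup>2"
    by (simp add: power2_sum sqn_nonneg)
  finally show "sqn M (\<lambda>x. f x + g x) \<le> (sqrt (sqn M f) + sqrt (sqn M g))\<^sup>2" .
qed (simp_all add: sqn_nonneg)

lemma nn_integral_sqn:
  assumes "f \<in> L2fun M"
  shows "(\<integral>\<^sup>+x. ennreal ((f x)\<^sup>2) \<partial>M) = ennreal (sqn M f)"
  unfolding sqn_def by (rule nn_integral_eq_integral) (use assms in \<open>auto simp: L2fun_def\<close>)

lemma L2_tendsto_iff:
  assumes "eventually (\<lambda>i. F i \<in> L2fun M) net" "f \<in> L2fun M"
  shows "L2_tendsto M F f net \<longleftrightarrow> ((\<lambda>i. sqn M (\<lambda>x. F i x - f x)) \<longlongrightarrow> 0) net"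
proof -
  have "L2_tendsto M F f net \<longleftrightarrow> ((\<lambda>i. ennreal (sqn M (\<lambda>x. F i x - f x))) \<longlongrightarrow> ennreal 0) net"
    unfolding L2_tendsto_def ennreal_0
    by (rule tendsto_cong, use assms(1) in eventually_elim) (simp add: nn_integral_sqn L2_diff assms(2))
  also have "\<dots> \<longleftrightarrow> ((\<lambda>i. sqn M (\<lambda>x. F i x - f x)) \<longlongrightarrow> 0) net"
    by (rule tendsto_ennreal_iff) (auto simp: sqn_nonneg)
  finally show ?thesis .
qed

lemma tendsto_ip:
  assumes F: "eventually (\<lambda>i. F i \<in> L2fun M) net" "f \<in> L2fun M"
    and G: "eventually (\<lambda>i. G i \<in> L2fun M) net" "g \<in> L2fun M"
    and FL: "L2_tendsto M F f net" and GL: "L2_tendsto M G g net"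
  shows "((\<lambda>i. ip M (F i) (G i)) \<longlongrightarrow> ip M f g) net"
proof -
  define d where "d i = sqrt (sqn M (\<lambda>x. F i x - f x))" for i
  define e where "e i = sqrt (sqn M (\<lambda>x. G i x - g x))" for i
  have d0: "(d \<longlongrightarrow> 0) net"
    using tendsto_real_sqrt[OF FL[unfolded L2_tendsto_iff[OF F]]] by (simp add: d_def[abs_def])
  have e0: "(e \<longlongrightarrow> 0) net"
    using tendsto_real_sqrt[OF GL[unfolded L2_tendsto_iff[OF G]]] by (simp add: e_def[abs_def])
  have "((\<lambda>i. ip M (F i) (G i) - ip M f g) \<longlongrightarrow> 0) net"
  proof (rule Lim_null_comparison)
    show "((\<lambda>i. d i * e i + d i * sqrt (sqn M g) + sqrt (sqn M f) * e i) \<longlongrightarrow> 0) net"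
      by (rule tendsto_eq_intros d0 e0 refl)+ simp
    show "eventually (\<lambda>i. norm (ip M (F i) (G i) - ip M f g)
        \<le> d i * e i + d i * sqrt (sqn M g) + sqrt (sqn M f) * e i) net"
      using F(1) G(1)
    proof eventually_elim
      case (elim i)
      note Li = L2_diff[OF elim(1) F(2)] L2_diff[OF elim(2) G(2)]
      have "ip M (F i) (G i) - ip M f g = ip M (\<lambda>x. F i x - f x) (\<lambda>x. G i x - g x)
          + ip M (\<lambda>x. F i x - f x) g + ip M f (\<lambda>x. G i x - g x)"
        using ip_lin(3)[OF elim(1) F(2) Li(2)] ip_lin(3)[OF elim(1) F(2) G(2)]
          ip_lin(4)[OF elim(2) G(2) F(2)] ip_lin(4)[OF elim(2) G(2) elim(1)] by simp
      then show ?case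
        using ip_cauchy_sqrt[OF Li] ip_cauchy_sqrt[OF Li(1) G(2)] ip_cauchy_sqrt[OF F(2) Li(2)]
        unfolding d_def e_def by (simp add: abs_le_iff)
    qed
  qed
  then show ?thesis by (rule LIM_zero_cancel)
qed

lemma L2_tendsto_const: "L2_tendsto M (\<lambda>_. f) f net"
  by (simp add: L2_tendsto_def)

lemma L2_tendsto_lin:
  assumes F: "eventually (\<lambda>i. F i \<in> L2fun M) net" "f \<in> L2fun M"
    and G: "eventually (\<lambda>i. G i \<in> L2fun M) net" "g \<in> L2fun M"
    and FL: "L2_tendsto M F f net" and GL: "L2_tendsto M G g net"
  shows "L2_tendsto M (\<lambda>i x. a * F i x + b * G i x) (\<lambda>x. a * f x + b * g x) net"
proof -
  have ev: "eventually (\<lambda>i. (\<lambda>x. a * F i x + b * G i x) \<in> L2fun M) net"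
    using F(1) G(1) by eventually_elim (intro L2_add L2_scale)
  have l: "(\<lambda>x. a * f x + b * g x) \<in> L2fun M" using F G by (intro L2_add L2_scale)
  show ?thesis
    unfolding L2_tendsto_iff[OF ev l]
  proof (rule Lim_null_comparison)
    show "((\<lambda>i. 2 * a\<^sup>2 * sqn M (\<lambda>x. F i x - f x) + 2 * b\<^sup>2 * sqn M (\<lambda>x. G i x - g x)) \<longlongrightarrow> 0) net"
      using FL GL unfolding L2_tendsto_iff[OF F] L2_tendsto_iff[OF G]
      by (auto intro!: tendsto_eq_intros)
    show "eventually (\<lambda>i. norm (sqn M (\<lambda>x. a * F i x + b * G i x - (a * f x + b * g x)))
      \<le> 2 * a\<^sup>2 * sqn M (\<lambda>x. F i x - f x) + 2 * b\<^sup>2 * sqn M (\<lambda>x. G i x - g x)) net"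
      using F(1) G(1)
    proof eventually_elim
      case (elim i)
      note i1 = L2D(2)[OF L2_diff[OF elim(1) F(2)]] and i2 = L2D(2)[OF L2_diff[OF elim(2) G(2)]]
      have l1: "(\<lambda>x. a * F i x + b * G i x - (a * f x + b * g x)) \<in> L2fun M"
        using elim F G by (intro L2_add L2_scale L2_diff)
      have "sqn M (\<lambda>x. a * F i x + b * G i x - (a * f x + b * g x))
        \<le> (\<integral>x. 2 * a\<^sup>2 * (F i x - f x)\<^sup>2 + 2 * b\<^sup>2 * (G i x - g x)\<^sup>2 \<partial>M)"
        unfolding sqn_def
      proof (rule integral_mono)
        fix x
        have "0 \<le> (a * (F i x - f x) - b * (G i x - g x))\<^sup>2" by simp
        then show "(a * F i x + b * G i x - (a * f x + b * g x))\<^sup>2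
          \<le> 2 * a\<^sup>2 * (F i x - f x)\<^sup>2 + 2 * b\<^sup>2 * (G i x - g x)\<^sup>2"
          by (simp add: power2_eq_square algebra_simps)
      qed (use i1 i2 L2D(2)[OF l1] in auto)
      also have "\<dots> = 2 * a\<^sup>2 * sqn M (\<lambda>x. F i x - f x) + 2 * b\<^sup>2 * sqn M (\<lambda>x. G i x - g x)"
        using i1 i2 by (simp add: sqn_def)
      finally show ?case by (simp add: sqn_nonneg)
    qed
  qed
qed

lemma L2_tendsto_unique:
  assumes F: "eventually (\<lambda>i. F i \<in> L2fun M) net" and f: "f \<in> L2fun M" "f' \<in> L2fun M"
    and FL: "L2_tendsto M F f net" and FL': "L2_tendsto M F f' net" and net: "net \<noteq> bot"
  shows "AE x in M. f x = f' x"
proof -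
  have "L2_tendsto M (\<lambda>i x. 1 * F i x + (-1) * F i x) (\<lambda>x. 1 * f x + (-1) * f' x) net"
    by (rule L2_tendsto_lin[OF F f(1) F f(2) FL FL'])
  moreover have l: "(\<lambda>x. f x - f' x) \<in> L2fun M" by (rule L2_diff[OF f])
  moreover have z: "(\<lambda>x. 0) \<in> L2fun M" by (simp add: L2fun_def)
  ultimately have "((\<lambda>i. sqn M (\<lambda>x. 0 - (f x - f' x))) \<longlongrightarrow> 0) net"
    by (subst L2_tendsto_iff[symmetric]) auto
  then have "sqn M (\<lambda>x. f x - f' x) = 0"
    using net by (simp add: tendsto_const_iff sqn_def power2_commute)
  then have "AE x in M. (f x - f' x)\<^sup>2 = 0"
    unfolding sqn_def using integral_nonneg_eq_0_iff_AE[OF L2D(2)[OF l]] by simp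
  then show ?thesis by simp
qed

section \<open>Joint law of a point and of a draw from a kernel at that point\<close>

definition semidirect :: "'x measure \<Rightarrow> 'y measure \<Rightarrow> ('x \<Rightarrow> 'y measure) \<Rightarrow> ('x \<times> 'y) measure" where
  "semidirect A N \<kappa> = A \<bind> (\<lambda>x. distr (\<kappa> x) (A \<Otimes>\<^sub>M N) (Pair x))"

context
  fixes A :: "'x measure" and N :: "'y measure" and \<kappa>
  assumes A: "prob_space A" and k: "\<kappa> \<in> A \<rightarrow>\<^sub>M prob_algebra N"
begin

lemma semidirect_kernel: "(\<lambda>x. distr (\<kappa> x) (A \<Otimes>\<^sub>M N) (Pair x)) \<in> A \<rightarrow>\<^sub>M prob_algebra (A \<Otimes>\<^sub>M N)"
  using k by measurable

lemma sets_semidirect: "sets (semidirect A N \<kappa>) = sets (A \<Otimes>\<^sub>M N)"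
  unfolding semidirect_def
  by (rule sets_bind'[of A A]) (use A semidirect_kernel in \<open>auto simp: space_prob_algebra\<close>)

lemma prob_space_semidirect: "prob_space (semidirect A N \<kappa>)"
  unfolding semidirect_def
  by (rule prob_space_bind'[of A A]) (use A semidirect_kernel in \<open>auto simp: space_prob_algebra\<close>)

lemma kernel_sets: "x \<in> space A \<Longrightarrow> sets (\<kappa> x) = sets N" "x \<in> space A \<Longrightarrow> prob_space (\<kappa> x)"
  using measurable_space[OF k] by (auto simp: space_prob_algebra)

lemma nn_integral_semidirect:
  assumes f[measurable]: "f \<in> borel_measurable (A \<Otimes>\<^sub>M N)"
  shows "(\<integral>\<^sup>+z. f z \<partial>semidirect A N \<kappa>) = (\<integral>\<^sup>+x. \<integral>\<^sup>+y. f (x, y) \<partial>\<kappa> x \<partial>A)"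
  unfolding semidirect_def
  by (subst nn_integral_bind[OF f measurable_prob_algebraD[OF semidirect_kernel]])
    (auto intro!: nn_integral_cong nn_integral_distr simp: kernel_sets cong: measurable_cong_sets)

lemma distr_snd_semidirect: "distr (semidirect A N \<kappa>) N snd = A \<bind> \<kappa>"
proof (rule measure_eqI)
  show "sets (distr (semidirect A N \<kappa>) N snd) = sets (A \<bind> \<kappa>)"
    using sets_bind'[of A A \<kappa> N] A k by (simp add: space_prob_algebra)
  fix B assume "B \<in> sets (distr (semidirect A N \<kappa>) N snd)"
  then have B[measurable]: "B \<in> sets N" by simp
  have [measurable]: "snd \<in> semidirect A N \<kappa> \<rightarrow>\<^sub>M N"
    by (simp cong: measurable_cong_sets add: sets_semidirect)
  have "emeasure (distr (semidirect A N \<kappa>) N snd) B = (\<integral>\<^sup>+y. indicator B y \<partial>distr (semidirect A N \<kappa>) N snd)"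
    by simp
  also have "\<dots> = (\<integral>\<^sup>+z. indicator B (snd z) \<partial>semidirect A N \<kappa>)"
    by (rule nn_integral_distr) auto
  also have "\<dots> = (\<integral>\<^sup>+x. \<integral>\<^sup>+y. indicator B y \<partial>\<kappa> x \<partial>A)"
    by (subst nn_integral_semidirect) auto
  also have "\<dots> = (\<integral>\<^sup>+x. emeasure (\<kappa> x) B \<partial>A)"
    by (intro nn_integral_cong) (simp add: kernel_sets)
  also have "\<dots> = emeasure (A \<bind> \<kappa>) B"
    using A k B by (subst emeasure_bind_prob_algebra[of A A]) (auto simp: space_prob_algebra)
  finally show "emeasure (distr (semidirect A N \<kappa>) N snd) B = emeasure (A \<bind> \<kappa>) B" .
qed

lemma distr_fst_semidirect: "distr (semidirect A N \<kappa>) A fst = A"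
proof (rule measure_eqI)
  fix B assume "B \<in> sets (distr (semidirect A N \<kappa>) A fst)"
  then have B[measurable]: "B \<in> sets A" by simp
  have [measurable]: "fst \<in> semidirect A N \<kappa> \<rightarrow>\<^sub>M A"
    by (simp cong: measurable_cong_sets add: sets_semidirect)
  have "emeasure (distr (semidirect A N \<kappa>) A fst) B = (\<integral>\<^sup>+y. indicator B y \<partial>distr (semidirect A N \<kappa>) A fst)"
    by simp
  also have "\<dots> = (\<integral>\<^sup>+z. indicator B (fst z) \<partial>semidirect A N \<kappa>)"
    by (rule nn_integral_distr) auto
  also have "\<dots> = (\<integral>\<^sup>+x. \<integral>\<^sup>+y. indicator B x \<partial>\<kappa> x \<partial>A)"
    by (subst nn_integral_semidirect) auto
  also have "\<dots> = (\<integral>\<^sup>+x. indicator B x \<partial>A)"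
    by (intro nn_integral_cong) (simp add: prob_space.emeasure_space_1[OF kernel_sets(2)])
  finally show "emeasure (distr (semidirect A N \<kappa>) A fst) B = emeasure A B" by simp
qed simp

text \<open>Fubini's theorem for a kernel, from \<open>nn_integral_semidirect\<close> applied to the
  positive and the negative part. Sections are integrable only almost everywhere; there the inner
  integral is the difference of the two parts.\<close>

lemma integrable_semidirect:
  fixes f :: "'x \<times> 'y \<Rightarrow> real"
  assumes f: "integrable (semidirect A N \<kappa>) f"
  shows AE_integrable_semidirect: "AE x in A. integrable (\<kappa> x) (\<lambda>y. f (x, y))" (is ?ae)
    and integrable_integral_semidirect: "integrable A (\<lambda>x. \<integral>y. f (x, y) \<partial>\<kappa> x)" (is ?i)
    and integral_semidirect: "(\<integral>z. f z \<partial>semidirect A N \<kappa>) = (\<integral>x. \<integral>y. f (x, y) \<partial>\<kappa> x \<partial>A)" (is ?e)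
proof -
  have fm[measurable]: "f \<in> borel_measurable (A \<Otimes>\<^sub>M N)"
    using borel_measurable_integrable[OF f] by (simp cong: measurable_cong_sets add: sets_semidirect)
  have km: "\<kappa> \<in> A \<rightarrow>\<^sub>M subprob_algebra N" using k by (rule measurable_prob_algebraD)
  have sec[measurable]: "(\<lambda>y. f (x, y)) \<in> borel_measurable (\<kappa> x)" if "x \<in> space A" for x
    using that by (simp cong: measurable_cong_sets add: kernel_sets)
  have nm: "(\<lambda>x. \<integral>\<^sup>+y. ennreal (g (x, y)) \<partial>\<kappa> x) \<in> borel_measurable A"
    if [measurable]: "g \<in> borel_measurable (A \<Otimes>\<^sub>M N)" for g :: "'x \<times> 'y \<Rightarrow> real"
    by (rule nn_integral_measurable_subprob_algebra2[OF _ km]) simp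
  have fin: "(\<integral>\<^sup>+x. \<integral>\<^sup>+y. ennreal \<bar>f (x, y)\<bar> \<partial>\<kappa> x \<partial>A) < \<infinity>"
    using f nn_integral_semidirect[of "\<lambda>z. ennreal \<bar>f z\<bar>"]
    by (simp add: integrable_iff_bounded)
  have "AE x in A. (\<integral>\<^sup>+y. ennreal \<bar>f (x, y)\<bar> \<partial>\<kappa> x) \<noteq> \<infinity>"
    by (rule nn_integral_PInf_AE[OF nm[of "\<lambda>z. \<bar>f z\<bar>"]]) (use fin in auto)
  then show ae: ?ae
    by (rule AE_mp[OF _ AE_I2]) (auto simp: integrable_iff_bounded less_top)
  define p n where "p x = (\<integral>\<^sup>+y. ennreal (f (x, y)) \<partial>\<kappa> x)" and "n x = (\<integral>\<^sup>+y. ennreal (- f (x, y)) \<partial>\<kappa> x)" for x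
  have pm[measurable]: "p \<in> borel_measurable A" "n \<in> borel_measurable A"
    unfolding p_def n_def using nm[of f] nm[of "\<lambda>z. - f z"] by auto
  have le: "p x \<le> (\<integral>\<^sup>+y. ennreal \<bar>f (x, y)\<bar> \<partial>\<kappa> x)" "n x \<le> (\<integral>\<^sup>+y. ennreal \<bar>f (x, y)\<bar> \<partial>\<kappa> x)" for x
    unfolding p_def n_def by (auto intro!: nn_integral_mono ennreal_leI)
  have pf: "(\<integral>\<^sup>+x. p x \<partial>A) < \<infinity>" "(\<integral>\<^sup>+x. n x \<partial>A) < \<infinity>"
    using nn_integral_mono[of A p, OF le(1)] nn_integral_mono[of A n, OF le(2)] fin
    by (auto intro: le_less_trans)
  have AEp: "AE x in A. p x \<noteq> \<infinity>" "AE x in A. n x \<noteq> \<infinity>"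
    using nn_integral_PInf_AE[OF pm(1)] nn_integral_PInf_AE[OF pm(2)] pf by (simp_all add: less_top)
  have pi: "integrable A (\<lambda>x. enn2real (p x))" "(\<integral>x. enn2real (p x) \<partial>A) = enn2real (\<integral>\<^sup>+x. p x \<partial>A)"
  proof -
    have e: "(\<integral>\<^sup>+x. ennreal (enn2real (p x)) \<partial>A) = (\<integral>\<^sup>+x. p x \<partial>A)"
      by (rule nn_integral_cong_AE) (rule AE_mp[OF AEp(1) AE_I2], simp add: less_top)
    show "integrable A (\<lambda>x. enn2real (p x))"
      by (rule integrableI_nonneg) (use e pf in auto)
    show "(\<integral>x. enn2real (p x) \<partial>A) = enn2real (\<integral>\<^sup>+x. p x \<partial>A)"
      by (subst integral_eq_nn_integral) (auto simp: e)
  qed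
  have ni: "integrable A (\<lambda>x. enn2real (n x))" "(\<integral>x. enn2real (n x) \<partial>A) = enn2real (\<integral>\<^sup>+x. n x \<partial>A)"
  proof -
    have e: "(\<integral>\<^sup>+x. ennreal (enn2real (n x)) \<partial>A) = (\<integral>\<^sup>+x. n x \<partial>A)"
      by (rule nn_integral_cong_AE) (rule AE_mp[OF AEp(2) AE_I2], simp add: less_top)
    show "integrable A (\<lambda>x. enn2real (n x))"
      by (rule integrableI_nonneg) (use e pf in auto)
    show "(\<integral>x. enn2real (n x) \<partial>A) = enn2real (\<integral>\<^sup>+x. n x \<partial>A)"
      by (subst integral_eq_nn_integral) (auto simp: e)
  qed
  have eq: "AE x in A. (\<integral>y. f (x, y) \<partial>\<kappa> x) = enn2real (p x) - enn2real (n x)"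
    using ae by eventually_elim (simp add: real_lebesgue_integral_def p_def n_def)
  \<comment> \<open>Measurability has to cover the exceptional points as well; it comes from the
    measurability of the Bochner integral as a function of the measure.\<close>
  have m: "(\<lambda>x. \<integral>y. f (x, y) \<partial>\<kappa> x) \<in> borel_measurable A"
  proof -
    have "(\<lambda>x. integral\<^sup>L (distr (\<kappa> x) (A \<Otimes>\<^sub>M N) (Pair x)) f) \<in> borel_measurable A"
      by (rule measurable_compose[OF measurable_prob_algebraD[OF semidirect_kernel] integral_measurable_subprob_algebra[OF fm]])
    then show ?thesis
      by (rule measurable_cong[THEN iffD1, rotated])
        (subst integral_distr, auto cong: measurable_cong_sets simp: kernel_sets)
  qed
  show ?i
    using pi ni eq m by (subst integrable_cong_AE[OF m _ eq]) auto
  have "(\<integral>x. \<integral>y. f (x, y) \<partial>\<kappa> x \<partial>A) = (\<integral>x. enn2real (p x) - enn2real (n x) \<partial>A)"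
    by (rule integral_cong_AE[OF m _ eq]) auto
  also have "\<dots> = enn2real (\<integral>\<^sup>+x. p x \<partial>A) - enn2real (\<integral>\<^sup>+x. n x \<partial>A)"
    using pi ni by simp
  also have "\<dots> = (\<integral>z. f z \<partial>semidirect A N \<kappa>)"
    unfolding real_lebesgue_integral_def[OF f] p_def n_def
    by (subst (1 2) nn_integral_semidirect) auto
  finally show ?e by simp
qed

end

section \<open>Symmetric Markov semigroups\<close>

locale symmetric_markov_semigroup =
  fixes \<mu> :: "'a::polish_space measure" and P :: "real \<Rightarrow> 'a \<Rightarrow> 'a measure"
  assumes mu: "\<mu> \<in> space (prob_algebra borel)"
    and kern: "transition_kernels P"
    and inv: "invariant_measure P \<mu>"
    and sym: "symmetric_semigroup P \<mu>"
    and sc: "strongly_continuous_semigroup P \<mu>"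
begin

abbreviation S :: "real \<Rightarrow> ('a \<Rightarrow> real) \<Rightarrow> 'a \<Rightarrow> real" where "S \<equiv> semigroup_op P"

text \<open>The law of the positions at times 0 and \<open>t\<close> in stationarity. Both marginals
  are \<mu>, so that second moments of increments become inner products with the semigroup.\<close>

definition J :: "real \<Rightarrow> ('a \<times> 'a) measure" where "J t = semidirect \<mu> borel (P t)"

lemma sets_mu[measurable_cong, simp]: "sets \<mu> = sets borel"
  and prob_mu: "prob_space \<mu>"
  using mu by (auto simp: space_prob_algebra)

lemma space_mu[simp]: "space \<mu> = UNIV"
  using sets_eq_imp_space_eq[OF sets_mu] by simp

sublocale prob_space \<mu> by (rule prob_mu)

lemma meas_mu: "borel_measurable \<mu> = borel_measurable borel"
  by (rule measurable_cong_sets) auto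

lemma L2_meas: "f \<in> L2fun \<mu> \<Longrightarrow> f \<in> borel_measurable borel"
  by (simp add: L2fun_def meas_mu)

lemma P_kernel: "0 \<le> t \<Longrightarrow> P t \<in> borel \<rightarrow>\<^sub>M prob_algebra borel"
  using kern by (simp add: transition_kernels_def)

lemma P_kernel_mu: "0 \<le> t \<Longrightarrow> P t \<in> \<mu> \<rightarrow>\<^sub>M prob_algebra borel"
  using P_kernel by (simp cong: measurable_cong_sets)

lemma P_prob: "0 \<le> t \<Longrightarrow> prob_space (P t x)" and P_sets: "0 \<le> t \<Longrightarrow> sets (P t x) = sets borel"
  using measurable_space[OF P_kernel, of t x] by (auto simp: space_prob_algebra)

lemma P_meas: "0 \<le> t \<Longrightarrow> borel_measurable (P t x) = borel_measurable borel"
  by (rule measurable_cong_sets) (auto simp: P_sets)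

lemma S_meas: "0 \<le> t \<Longrightarrow> f \<in> borel_measurable borel \<Longrightarrow> S t f \<in> borel_measurable borel"
  unfolding semigroup_op_def
  by (rule measurable_compose[OF measurable_prob_algebraD[OF P_kernel] integral_measurable_subprob_algebra])

lemma prob_J: "0 \<le> t \<Longrightarrow> prob_space (J t)"
  unfolding J_def by (rule prob_space_semidirect[OF prob_mu P_kernel_mu])

lemma sets_J: "0 \<le> t \<Longrightarrow> sets (J t) = sets (borel \<Otimes>\<^sub>M borel)"
  unfolding J_def by (subst sets_semidirect[OF prob_mu P_kernel_mu]) (auto cong: sets_pair_measure_cong)

lemma J_meas: "0 \<le> t \<Longrightarrow> measurable (J t) N = measurable (borel \<Otimes>\<^sub>M borel) N"
  by (rule measurable_cong_sets) (auto simp: sets_J)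

lemma J_snd: "0 \<le> t \<Longrightarrow> distr (J t) borel snd = \<mu>"
  unfolding J_def by (subst distr_snd_semidirect[OF prob_mu P_kernel_mu])
    (use inv in \<open>auto simp: invariant_measure_def\<close>)

lemma J_fst: assumes "0 \<le> t" shows "distr (J t) borel fst = \<mu>"
proof -
  have "distr (J t) borel fst = distr (J t) \<mu> fst" by (rule distr_cong) auto
  then show ?thesis unfolding J_def using distr_fst_semidirect[OF prob_mu P_kernel_mu[OF assms]] by simp
qed

lemma J_snd_int:
  assumes "0 \<le> t" "f \<in> borel_measurable borel"
  shows "integrable (J t) (\<lambda>z. f (snd z) :: real) \<longleftrightarrow> integrable \<mu> f"
    "(\<integral>z. (f (snd z) :: real) \<partial>J t) = (\<integral>x. f x \<partial>\<mu>)"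
  using integrable_distr_eq[of snd "J t" borel f] integral_distr[of snd "J t" borel f] assms
  by (simp_all add: J_snd J_meas)

lemma J_fst_int:
  assumes "0 \<le> t" "f \<in> borel_measurable borel"
  shows "integrable (J t) (\<lambda>z. f (fst z) :: real) \<longleftrightarrow> integrable \<mu> f"
    "(\<integral>z. (f (fst z) :: real) \<partial>J t) = (\<integral>x. f x \<partial>\<mu>)"
  using integrable_distr_eq[of fst "J t" borel f] integral_distr[of fst "J t" borel f] assms
  by (simp_all add: J_fst J_meas)

lemma J_integral:
  fixes f :: "'a \<times> 'a \<Rightarrow> real"
  assumes "0 \<le> t" "integrable (J t) f"
  shows "AE x in \<mu>. integrable (P t x) (\<lambda>y. f (x, y))"
    "integrable \<mu> (\<lambda>x. \<integral>y. f (x, y) \<partial>P t x)"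
    "(\<integral>z. f z \<partial>J t) = (\<integral>x. \<integral>y. f (x, y) \<partial>P t x \<partial>\<mu>)"
  using integrable_semidirect[OF prob_mu P_kernel_mu[OF assms(1)]] assms(2) unfolding J_def by auto

lemma S_integrable:
  assumes "0 \<le> t" "integrable \<mu> f"
  shows "AE x in \<mu>. integrable (P t x) f" "integrable \<mu> (S t f)" "(\<integral>x. S t f x \<partial>\<mu>) = (\<integral>x. f x \<partial>\<mu>)"
proof -
  have m: "f \<in> borel_measurable borel" using assms(2) by (simp add: meas_mu[symmetric])
  have i: "integrable (J t) (\<lambda>z. f (snd z))" using assms m by (simp add: J_snd_int)
  from J_integral[OF assms(1) i] J_snd_int(2)[OF assms(1) m]
  show "AE x in \<mu>. integrable (P t x) f" "integrable \<mu> (S t f)" "(\<integral>x. S t f x \<partial>\<mu>) = (\<integral>x. f x \<partial>\<mu>)"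
    by (auto simp: semigroup_op_def[abs_def])
qed

lemma L2_int: "f \<in> L2fun \<mu> \<Longrightarrow> integrable \<mu> f"
  by (rule L2_integrable[OF finite_measure_axioms])

lemma L2_J:
  assumes "0 \<le> t" "f \<in> L2fun \<mu>"
  shows "(\<lambda>z. f (snd z)) \<in> L2fun (J t)" "(\<lambda>z. f (fst z)) \<in> L2fun (J t)"
    "sqn (J t) (\<lambda>z. f (snd z)) = sqn \<mu> f" "sqn (J t) (\<lambda>z. f (fst z)) = sqn \<mu> f"
proof -
  have m[measurable]: "f \<in> borel_measurable borel" using assms(2) by (rule L2_meas)
  have m2: "(\<lambda>x. (f x)\<^sup>2) \<in> borel_measurable borel" by simp
  show "(\<lambda>z. f (snd z)) \<in> L2fun (J t)" "(\<lambda>z. f (fst z)) \<in> L2fun (J t)"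
    "sqn (J t) (\<lambda>z. f (snd z)) = sqn \<mu> f" "sqn (J t) (\<lambda>z. f (fst z)) = sqn \<mu> f"
    using assms J_snd_int[OF assms(1) m2] J_fst_int[OF assms(1) m2]
    by (auto simp: L2fun_def sqn_def J_meas)
qed

lemma S_abs_le: "\<bar>S t f x\<bar> \<le> S t (\<lambda>x. \<bar>f x\<bar>) x"
  unfolding semigroup_op_def by (rule integral_abs_bound)

text \<open>Jensen's inequality, read off from a nonnegative conditional variance.\<close>

lemma S_square_le: 
  assumes "0 \<le> t" "f \<in> L2fun \<mu>"
  shows "AE x in \<mu>. (S t f x)\<^sup>2 \<le> S t (\<lambda>x. (f x)\<^sup>2) x"
  using S_integrable(1)[OF assms(1) L2_int[OF assms(2)]] S_integrable(1)[OF assms(1) L2D(2)[OF assms(2)]]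
proof eventually_elim
  case (elim x)
  interpret Px: prob_space "P t x" by (rule P_prob[OF assms(1)])
  define c where "c = S t f x"
  have "0 \<le> (\<integral>y. (f y - c)\<^sup>2 \<partial>P t x)" by simp
  also have "(\<integral>y. (f y - c)\<^sup>2 \<partial>P t x) = (\<integral>y. (f y)\<^sup>2 - 2 * c * f y + c\<^sup>2 \<partial>P t x)"
    by (simp add: power2_diff algebra_simps)
  also have "\<dots> = (\<integral>y. (f y)\<^sup>2 \<partial>P t x) - 2 * c * (\<integral>y. f y \<partial>P t x) + c\<^sup>2"
    using elim by (simp add: Px.prob_space)
  finally show ?case by (simp add: c_def semigroup_op_def power2_eq_square)
qed

lemma S_L2: assumes "0 \<le> t" "f \<in> L2fun \<mu>"
  shows "S t f \<in> L2fun \<mu>" "sqn \<mu> (S t f) \<le> sqn \<mu> f"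
proof -
  have m: "S t f \<in> borel_measurable \<mu>" using S_meas[OF assms(1) L2_meas[OF assms(2)]] by (simp add: meas_mu)
  have i: "integrable \<mu> (S t (\<lambda>x. (f x)\<^sup>2))" using S_integrable(2)[OF assms(1) L2D(2)[OF assms(2)]] .
  have i2: "integrable \<mu> (\<lambda>x. (S t f x)\<^sup>2)"
    by (rule Bochner_Integration.integrable_bound[OF i])
      (use S_square_le[OF assms] m in \<open>auto elim!: eventually_mono\<close>)
  then show "S t f \<in> L2fun \<mu>" using m by (simp add: L2fun_def)
  have "sqn \<mu> (S t f) \<le> (\<integral>x. S t (\<lambda>x. (f x)\<^sup>2) x \<partial>\<mu>)"
    unfolding sqn_def by (rule integral_mono_AE[OF i2 i S_square_le[OF assms]])
  also have "\<dots> = sqn \<mu> f" unfolding sqn_def by (rule S_integrable(3)[OF assms(1) L2D(2)[OF assms(2)]])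
  finally show "sqn \<mu> (S t f) \<le> sqn \<mu> f" .
qed

lemma ip_J:
  assumes "0 \<le> t" "f \<in> L2fun \<mu>" "k \<in> L2fun \<mu>"
  shows "ip (J t) (\<lambda>z. f (fst z)) (\<lambda>z. k (snd z)) = ip \<mu> f (S t k)"
  using J_integral(3)[OF assms(1) L2_mult[OF L2_J(2)[OF assms(1,2)] L2_J(1)[OF assms(1,3)]]]
  by (simp add: ip_def semigroup_op_def)

lemma S_sym:
  assumes "0 \<le> t" "f \<in> L2fun \<mu>" "k \<in> L2fun \<mu>"
  shows "ip \<mu> f (S t k) = ip \<mu> (S t f) k"
  using sym assms by (simp add: symmetric_semigroup_def ip_def)

lemma S_lin:
  assumes "0 \<le> t" "integrable \<mu> f" "integrable \<mu> g"
  shows "AE x in \<mu>. S t (\<lambda>x. a * f x + b * g x) x = a * S t f x + b * S t g x"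
  using S_integrable(1)[OF assms(1,2)] S_integrable(1)[OF assms(1,3)]
  by eventually_elim (simp add: semigroup_op_def)

lemma S_diff:
  assumes "0 \<le> t" "integrable \<mu> f" "integrable \<mu> g"
  shows "AE x in \<mu>. S t (\<lambda>x. f x - g x) x = S t f x - S t g x"
  using S_lin[OF assms, of 1 "-1"] by simp

text \<open>By invariance, \<open>P t x\<close> charges a given \<mu>-null set for \<mu>-almost no
  \<open>x\<close>; thus the semigroup acts on classes.\<close>

lemma S_AE:
  assumes "0 \<le> t" "f \<in> borel_measurable borel" "g \<in> borel_measurable borel" "AE x in \<mu>. f x = g x"
  shows "AE x in \<mu>. S t f x = S t g x"
proof -
  have e: "\<mu> \<bind> P t = \<mu>" using inv assms(1) by (simp add: invariant_measure_def)
  have "AE x in \<mu> \<bind> P t. f x = g x" by (subst e) (rule assms(4))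
  then have "AE x in \<mu>. AE y in P t x. f y = g y"
    by (subst (asm) AE_bind[where B = borel])
      (use assms in \<open>auto intro!: measurable_prob_algebraD P_kernel_mu\<close>)
  then show ?thesis
    by eventually_elim
      (use assms in \<open>auto simp: semigroup_op_def P_meas intro!: integral_cong_AE\<close>)
qed

text \<open>The kernels compose at every point, but Fubini's theorem asks for integrability of
  \<open>f\<close> under \<open>P (s + t) x\<close>, which invariance gives for almost every
  \<open>x\<close>.\<close>

lemma S_semigroup:
  assumes "0 \<le> s" "0 \<le> t" "integrable \<mu> f"
  shows "AE x in \<mu>. S (s + t) f x = S s (S t f) x"
proof -
  have st: "0 \<le> s + t" using assms by simp
  show ?thesis using S_integrable(1)[OF st assms(3)]
  proof eventually_elim
    case (elim x)
    have m: "f \<in> borel_measurable borel" using assms(3) by (simp add: meas_mu[symmetric])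
    have e: "P (s + t) x = P s x \<bind> P t" using kern assms by (simp add: transition_kernels_def)
    have k: "P t \<in> P s x \<rightarrow>\<^sub>M prob_algebra borel"
      using P_kernel[OF assms(2)] by (simp add: P_sets assms cong: measurable_cong_sets)
    note sd = P_prob[OF assms(1), of x] k
    define Q where "Q = semidirect (P s x) borel (P t)"
    have snd: "snd \<in> Q \<rightarrow>\<^sub>M borel"
      unfolding Q_def by (simp add: sets_semidirect[OF sd] cong: measurable_cong_sets)
    have dq: "distr Q borel snd = P (s + t) x" unfolding Q_def e by (rule distr_snd_semidirect[OF sd])
    have i: "integrable Q (\<lambda>z. f (snd z))"
      using elim integrable_distr_eq[OF snd m] by (simp add: dq)
    have "S (s + t) f x = (\<integral>z. f (snd z) \<partial>Q)"
      using integral_distr[OF snd m] by (simp add: dq semigroup_op_def)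
    also have "\<dots> = S s (S t f) x"
      using integral_semidirect[OF sd i[unfolded Q_def]] by (simp add: Q_def semigroup_op_def)
    finally show ?case .
  qed
qed

lemma S_0: "f \<in> borel_measurable borel \<Longrightarrow> S 0 f = f"
  using kern by (auto simp: transition_kernels_def semigroup_op_def integral_return)

lemma S_bounds:
  assumes "0 \<le> t" "f \<in> borel_measurable borel" "\<And>x. a \<le> f x" "\<And>x. f x \<le> b"
  shows "a \<le> S t f x" "S t f x \<le> b"
proof -
  interpret Px: prob_space "P t x" by (rule P_prob[OF assms(1)])
  have i: "integrable (P t x) f"
  proof (rule Px.integrable_const_bound)
    show "AE y in P t x. norm (f y) \<le> max \<bar>a\<bar> \<bar>b\<bar>"
    proof (rule AE_I2)
      fix y
      show "norm (f y) \<le> max \<bar>a\<bar> \<bar>b\<bar>"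
        using assms(3)[of y] assms(4)[of y] by (simp add: max_def abs_if split: if_splits)
    qed
  qed (use assms in \<open>simp add: P_meas\<close>)
  show "a \<le> S t f x" unfolding semigroup_op_def by (rule Px.integral_ge_const[OF i]) (use assms in auto)
  show "S t f x \<le> b" unfolding semigroup_op_def by (rule Px.integral_le_const[OF i]) (use assms in auto)
qed

lemma S_L1:
  assumes "0 \<le> t" "integrable \<mu> f"
  shows "(\<integral>x. \<bar>S t f x\<bar> \<partial>\<mu>) \<le> (\<integral>x. \<bar>f x\<bar> \<partial>\<mu>)"
proof -
  have i: "integrable \<mu> (\<lambda>x. \<bar>f x\<bar>)" using assms by simp
  have "(\<integral>x. \<bar>S t f x\<bar> \<partial>\<mu>) \<le> (\<integral>x. S t (\<lambda>x. \<bar>f x\<bar>) x \<partial>\<mu>)"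
    by (rule integral_mono) (use S_integrable(2)[OF assms] S_integrable(2)[OF assms(1) i] S_abs_le in auto)
  then show ?thesis using S_integrable(3)[OF assms(1) i] by simp
qed

lemma ip_S_split:
  assumes "0 \<le> s" "0 \<le> t" "f \<in> L2fun \<mu>" "g \<in> L2fun \<mu>"
  shows "ip \<mu> f (S (s + t) g) = ip \<mu> (S s f) (S t g)"
proof -
  have "ip \<mu> f (S (s + t) g) = ip \<mu> f (S s (S t g))"
    using assms by (intro ip_cong_AE S_semigroup L2_int) (auto intro!: L2D S_L2)
  then show ?thesis using S_sym[OF assms(1,3) S_L2(1)[OF assms(2,4)]] by simp
qed

text \<open>Midpoint convexity of \<open>t \<mapsto> \<langle>f, P\<^sub>t f\<rangle>\<close>: the second difference is a squared norm.\<close>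

lemma ip_S_convex:
  assumes "0 \<le> a" "0 \<le> s" "f \<in> L2fun \<mu>"
  shows "2 * ip \<mu> f (S (a + s) f) \<le> ip \<mu> f (S a f) + ip \<mu> f (S (a + 2 * s) f)"
proof -
  define u where "u = S (a / 2) f"
  define v where "v = S (a / 2 + s) f"
  have a: "0 \<le> a / 2" "0 \<le> a / 2 + s" using assms by auto
  have L: "u \<in> L2fun \<mu>" "v \<in> L2fun \<mu>" unfolding u_def v_def using S_L2(1)[OF _ assms(3)] a by auto
  have "0 \<le> sqn \<mu> (\<lambda>x. u x + (-1) * v x)" by (rule sqn_nonneg)
  also have "\<dots> = sqn \<mu> u - 2 * ip \<mu> u v + sqn \<mu> v"
    using sqn_add[OF L, of "-1"] by simp
  also have "sqn \<mu> u = ip \<mu> f (S a f)"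
    using ip_S_split[OF a(1) a(1) assms(3,3)] by (simp add: sqn_ip u_def)
  also have "sqn \<mu> v = ip \<mu> f (S (a + 2 * s) f)"
    using ip_S_split[OF a(2) a(2) assms(3,3)] by (simp add: sqn_ip v_def algebra_simps)
  also have "ip \<mu> u v = ip \<mu> f (S (a + s) f)"
    using ip_S_split[OF a(1) a(2) assms(3,3)] by (simp add: u_def v_def algebra_simps)
  finally show ?thesis by simp
qed

lemma ev_S_L2: "f \<in> L2fun \<mu> \<Longrightarrow> eventually (\<lambda>t. S t f \<in> L2fun \<mu>) (at_right 0)"
  using eventually_at_right_less[of "0::real"] by (auto elim!: eventually_mono intro: S_L2)

lemma S_cont: "f \<in> L2fun \<mu> \<Longrightarrow> L2_tendsto \<mu> (\<lambda>t. S t f) f (at_right 0)"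
  using sc by (simp add: strongly_continuous_semigroup_def)

lemma sqn_S_tendsto:
  "f \<in> L2fun \<mu> \<Longrightarrow> ((\<lambda>t. sqn \<mu> (\<lambda>x. S t f x - f x)) \<longlongrightarrow> 0) (at_right 0)"
  using S_cont L2_tendsto_iff[OF ev_S_L2] by blast

text \<open>Contraction reduces the modulus of continuity at any time \<open>s\<close> to the one at
  0.\<close>

lemma sqn_S_diff:
  assumes "0 \<le> s" "0 \<le> d" "f \<in> L2fun \<mu>"
  shows "sqn \<mu> (\<lambda>x. S (s + d) f x - S s f x) \<le> sqn \<mu> (\<lambda>x. S d f x - f x)"
proof -
  have L: "(\<lambda>x. S d f x - f x) \<in> L2fun \<mu>" using assms by (intro L2_diff S_L2)
  have "sqn \<mu> (\<lambda>x. S (s + d) f x - S s f x) = sqn \<mu> (S s (\<lambda>x. S d f x - f x))"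
    unfolding sqn_ip
  proof (intro ip_cong_AE)
    have "AE x in \<mu>. S (s + d) f x - S s f x = S s (\<lambda>x. S d f x - f x) x"
      using S_semigroup[OF assms(1,2) L2_int[OF assms(3)]]
        S_diff[OF assms(1) L2_int[OF S_L2(1)[OF assms(2,3)]] L2_int[OF assms(3)]]
      by eventually_elim simp
    then show "AE x in \<mu>. S (s + d) f x - S s f x = S s (\<lambda>x. S d f x - f x) x"
      "AE x in \<mu>. S (s + d) f x - S s f x = S s (\<lambda>x. S d f x - f x) x" by auto
  qed (use assms in \<open>auto intro!: L2D L2_diff S_L2 L\<close>)
  also have "\<dots> \<le> sqn \<mu> (\<lambda>x. S d f x - f x)" by (rule S_L2(2)[OF assms(1) L])
  finally show ?thesis .
qed

text \<open>The approximating forms \<open>\<langle>f, (k - P\<^sub>t k)/t\<rangle>\<close> increase to the Dirichlet form as \<open>t\<close> decreases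
  to \<open>0\<close>.\<close>

definition Et :: "real \<Rightarrow> ('a \<Rightarrow> real) \<Rightarrow> ('a \<Rightarrow> real) \<Rightarrow> real" where
  "Et t f k = (ip \<mu> f k - ip \<mu> f (S t k)) / t"

text \<open>The approximating form is half the mean squared increment per unit of time. Positivity,
  the triangle inequality and the moment bounds on increments of \<open>h\<close> all rest on
  this.\<close>

lemma Et_J:
  assumes "0 < t" "f \<in> L2fun \<mu>"
  shows "2 * t * Et t f f = sqn (J t) (\<lambda>z. f (snd z) - f (fst z))"
proof -
  have t: "0 \<le> t" using assms by simp
  note L = L2_J[OF t assms(2)]
  have "sqn (J t) (\<lambda>z. f (snd z) + (-1) * f (fst z)) = 2 * sqn \<mu> f - 2 * ip \<mu> f (S t f)"
    using sqn_add[OF L(1,2), of "-1"] L(3,4) ip_J[OF t assms(2,2)]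
    by (simp add: ip_commute[of "J t" "\<lambda>z. f (snd z)"])
  then show ?thesis using assms(1) by (simp add: Et_def sqn_ip)
qed

lemma Et_nonneg: assumes "0 < t" "f \<in> L2fun \<mu>" shows "0 \<le> Et t f f"
proof -
  have "0 \<le> (2 * t) * Et t f f" unfolding Et_J[OF assms] by (rule sqn_nonneg)
  then show ?thesis using assms(1) by (simp add: zero_le_mult_iff)
qed

lemma Et_sym: "0 \<le> t \<Longrightarrow> f \<in> L2fun \<mu> \<Longrightarrow> g \<in> L2fun \<mu> \<Longrightarrow> Et t f g = Et t g f"
  by (simp add: Et_def S_sym ip_commute[of \<mu> g])

lemma ip_S_lin:
  assumes "0 \<le> t" "f \<in> L2fun \<mu>" "g \<in> L2fun \<mu>" "u \<in> L2fun \<mu>"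
  shows "ip \<mu> u (S t (\<lambda>x. a * f x + b * g x)) = a * ip \<mu> u (S t f) + b * ip \<mu> u (S t g)"
proof -
  have "ip \<mu> u (S t (\<lambda>x. a * f x + b * g x)) = ip \<mu> u (\<lambda>x. a * S t f x + b * S t g x)"
    using assms by (intro ip_cong_AE S_lin L2_int) (auto intro!: L2D L2_add L2_scale S_L2)
  also have "\<dots> = a * ip \<mu> u (S t f) + b * ip \<mu> u (S t g)"
    using assms by (subst ip_lin(2)) (auto intro!: L2_scale S_L2 simp: ip_scale)
  finally show ?thesis .
qed

lemma Et_lin:
  assumes "0 \<le> t" "f \<in> L2fun \<mu>" "g \<in> L2fun \<mu>" "u \<in> L2fun \<mu>"
  shows "Et t u (\<lambda>x. a * f x + b * g x) = a * Et t u f + b * Et t u g"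
proof -
  have "ip \<mu> u (\<lambda>x. a * f x + b * g x) = a * ip \<mu> u f + b * ip \<mu> u g"
    using assms by (subst ip_lin(2)) (auto intro!: L2_scale simp: ip_scale)
  then show ?thesis
    unfolding Et_def ip_S_lin[OF assms] by (simp add: diff_divide_distrib add_divide_distrib algebra_simps)
qed

lemma Et_quad:
  assumes "0 \<le> t" "f \<in> L2fun \<mu>" "g \<in> L2fun \<mu>"
  shows "Et t (\<lambda>x. a * f x + b * g x) (\<lambda>x. a * f x + b * g x)
    = a\<^sup>2 * Et t f f + 2 * a * b * Et t f g + b\<^sup>2 * Et t g g"
proof -
  have L: "(\<lambda>x. a * f x + b * g x) \<in> L2fun \<mu>" using assms by (intro L2_add L2_scale)
  have "Et t (\<lambda>x. a * f x + b * g x) (\<lambda>x. a * f x + b * g x)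
      = a * Et t f (\<lambda>x. a * f x + b * g x) + b * Et t g (\<lambda>x. a * f x + b * g x)"
    using Et_lin[OF assms L] Et_sym[OF assms(1) L] assms by simp
  then show ?thesis
    using Et_lin[OF assms assms(2)] Et_lin[OF assms assms(3)] Et_sym[OF assms(1,3,2)]
    by (simp add: power2_eq_square algebra_simps)
qed

text \<open>\<open>sqrt (2 * t * Et t f f)\<close> is the norm of the increment of \<open>f\<close>
  in L2 of \<open>J t\<close>, so this is the reverse triangle inequality there.\<close>

lemma Et_triangle:
  assumes "0 < t" "f \<in> L2fun \<mu>" "g \<in> L2fun \<mu>"
  shows "\<bar>sqrt (Et t f f) - sqrt (Et t g g)\<bar> \<le> sqrt (Et t (\<lambda>x. f x - g x) (\<lambda>x. f x - g x))"
proof -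
  have t: "0 \<le> t" using assms by simp
  define d where "d = (\<lambda>z. f (snd z) - f (fst z))"
  define e where "e = (\<lambda>z. g (snd z) - g (fst z))"
  have L: "d \<in> L2fun (J t)" "e \<in> L2fun (J t)"
    unfolding d_def e_def using L2_J[OF t] assms by (auto intro!: L2_diff)
  have sq: "sqrt (Et t u u) = sqrt (sqn (J t) (\<lambda>z. u (snd z) - u (fst z))) / sqrt (2 * t)"
    if "u \<in> L2fun \<mu>" for u
    using Et_J[OF assms(1) that] assms(1) by (simp flip: real_sqrt_divide add: field_simps)
  have s: "sqn (J t) (\<lambda>z. (f (snd z) - g (snd z)) - (f (fst z) - g (fst z))) = sqn (J t) (\<lambda>z. d z - e z)"
    by (simp add: d_def e_def algebra_simps)
  have "sqrt (sqn (J t) d) \<le> sqrt (sqn (J t) (\<lambda>z. d z - e z)) + sqrt (sqn (J t) e)"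
    using sqn_triangle[OF L2_diff[OF L] L(2)] by simp
  moreover have "sqrt (sqn (J t) e) \<le> sqrt (sqn (J t) (\<lambda>z. e z - d z)) + sqrt (sqn (J t) d)"
    using sqn_triangle[OF L2_diff[OF L(2,1)] L(1)] by simp
  moreover have "sqrt (sqn (J t) (\<lambda>z. e z - d z)) = sqrt (sqn (J t) (\<lambda>z. d z - e z))"
    by (simp add: sqn_def power2_commute)
  ultimately have "\<bar>sqrt (sqn (J t) d) - sqrt (sqn (J t) e)\<bar> \<le> sqrt (sqn (J t) (\<lambda>z. d z - e z))"
    by linarith
  then show ?thesis
    unfolding sq[OF assms(2)] sq[OF assms(3)] sq[OF L2_diff[OF assms(2,3)]] s d_def[symmetric] e_def[symmetric]
    using assms(1) by (simp add: diff_divide_distrib[symmetric] divide_right_mono)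
qed

text \<open>Midpoint convexity at \<open>0\<close>, \<open>s\<close> and \<open>2 * s\<close>
  compares the times \<open>s\<close> and \<open>2 * s\<close>. Dyadic times are enough, since they
  are combined only with limits at 0 that are known to exist.\<close>

lemma Et_mono: "0 < t \<Longrightarrow> f \<in> L2fun \<mu> \<Longrightarrow> Et t f f \<le> Et (t / 2 ^ n) f f"
proof (induction n)
  case (Suc n)
  define s where "s = t / 2 ^ Suc n"
  have s: "0 < s" "t / 2 ^ n = 2 * s" using Suc.prems by (auto simp: s_def)
  have S0: "S 0 f = f" using Suc.prems by (intro S_0 L2_meas)
  have "2 * ip \<mu> f (S s f) \<le> ip \<mu> f f + ip \<mu> f (S (2 * s) f)"
    using ip_S_convex[of 0 s f] s Suc.prems by (simp add: S0)
  then have h1: "(ip \<mu> f f - ip \<mu> f (S (2 * s) f)) / (2 * s) \<le> (2 * (ip \<mu> f f - ip \<mu> f (S s f))) / (2 * s)"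
    using s by (intro divide_right_mono) auto
  have h2: "(2 * (ip \<mu> f f - ip \<mu> f (S s f))) / (2 * s) = (ip \<mu> f f - ip \<mu> f (S s f)) / s"
    by (rule mult_divide_mult_cancel_left) simp
  have "Et (2 * s) f f \<le> Et s f f" unfolding Et_def using h1 unfolding h2 .
  moreover have "Et t f f \<le> Et (t / 2 ^ n) f f" using Suc by blast
  ultimately show ?case unfolding s(2) s_def by (rule order_trans[rotated])
qed simp

section \<open>The graph of the generator\<close>

lemma ggD:
  assumes "generator_graph P \<mu> f k"
  shows "f \<in> L2fun \<mu>" "k \<in> L2fun \<mu>" "L2_tendsto \<mu> (\<lambda>t x. (S t f x - f x) / t) k (at_right 0)"
    "eventually (\<lambda>t. (\<lambda>x. (S t f x - f x) / t) \<in> L2fun \<mu>) (at_right 0)"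
proof -
  show f: "f \<in> L2fun \<mu>" and "k \<in> L2fun \<mu>" "L2_tendsto \<mu> (\<lambda>t x. (S t f x - f x) / t) k (at_right 0)"
    using assms by (auto simp: generator_graph_def)
  show "eventually (\<lambda>t. (\<lambda>x. (S t f x - f x) / t) \<in> L2fun \<mu>) (at_right 0)"
    using ev_S_L2[OF f] by eventually_elim (intro L2_div L2_diff f)
qed

lemma Et_gg:
  assumes "generator_graph P \<mu> f k" "u \<in> L2fun \<mu>"
  shows "((\<lambda>t. Et t u f) \<longlongrightarrow> - ip \<mu> u k) (at_right 0)"
proof -
  note g = ggD[OF assms(1)]
  have "((\<lambda>t. - ip \<mu> u (\<lambda>x. (S t f x - f x) / t)) \<longlongrightarrow> - ip \<mu> u k) (at_right 0)"
    by (intro tendsto_minus tendsto_ip assms g L2_tendsto_const always_eventually allI)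
  moreover have "eventually (\<lambda>t. - ip \<mu> u (\<lambda>x. (S t f x - f x) / t) = Et t u f) (at_right 0)"
    using ev_S_L2[OF g(1)]
    by eventually_elim (simp add: Et_def ip_scale ip_lin[OF _ g(1) assms(2)] minus_divide_left)
  ultimately show ?thesis by (rule Lim_transform_eventually)
qed

lemma gg_unique:
  assumes "generator_graph P \<mu> f k" "generator_graph P \<mu> f k'"
  shows "AE x in \<mu>. k x = k' x"
  using ggD[OF assms(1)] ggD[OF assms(2)] by (intro L2_tendsto_unique) auto

lemma gg_lin:
  assumes "generator_graph P \<mu> f k" "generator_graph P \<mu> f' k'"
  shows "generator_graph P \<mu> (\<lambda>x. a * f x + b * f' x) (\<lambda>x. a * k x + b * k' x)"
proof -
  note g = ggD[OF assms(1)] ggD[OF assms(2)]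
  have "L2_tendsto \<mu> (\<lambda>t x. a * ((S t f x - f x) / t) + b * ((S t f' x - f' x) / t)) (\<lambda>x. a * k x + b * k' x) (at_right 0)"
    by (intro L2_tendsto_lin g)
  moreover have "eventually (\<lambda>t. (\<integral>\<^sup>+x. ennreal ((a * ((S t f x - f x) / t) + b * ((S t f' x - f' x) / t) - (a * k x + b * k' x))\<^sup>2) \<partial>\<mu>)
     = (\<integral>\<^sup>+x. ennreal (((S t (\<lambda>x. a * f x + b * f' x) x - (a * f x + b * f' x)) / t - (a * k x + b * k' x))\<^sup>2) \<partial>\<mu>)) (at_right 0)"
    using eventually_at_right_less[of "0::real"]
  proof eventually_elim
    case (elim t)
    then have t: "0 \<le> t" by simp
    show ?case
      by (rule nn_integral_cong_AE, use S_lin[OF t L2_int[OF g(1)] L2_int[OF g(5)], of a b] in eventually_elim)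
        (simp add: diff_divide_distrib add_divide_distrib algebra_simps)
  qed
  ultimately have "L2_tendsto \<mu> (\<lambda>t x. (S t (\<lambda>x. a * f x + b * f' x) x - (a * f x + b * f' x)) / t)
     (\<lambda>x. a * k x + b * k' x) (at_right 0)"
    unfolding L2_tendsto_def by (rule Lim_transform_eventually)
  then show ?thesis using g by (auto simp: generator_graph_def intro!: L2_add L2_scale)
qed

text \<open>The continuous version of a solution of the Poisson equation and its right-hand side are
  known up to null sets; this lets them replace the representatives chosen by
  \<open>generator\<close>.\<close>

lemma gg_AE:
  assumes "generator_graph P \<mu> f k" "f' \<in> borel_measurable borel" "k' \<in> borel_measurable borel"
    "AE x in \<mu>. f x = f' x" "AE x in \<mu>. k x = k' x"
  shows "generator_graph P \<mu> f' k'"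
proof -
  note g = ggD[OF assms(1)]
  have "eventually (\<lambda>t. (\<integral>\<^sup>+x. ennreal (((S t f x - f x) / t - k x)\<^sup>2) \<partial>\<mu>)
    = (\<integral>\<^sup>+x. ennreal (((S t f' x - f' x) / t - k' x)\<^sup>2) \<partial>\<mu>)) (at_right 0)"
    using eventually_at_right_less[of "0::real"]
  proof eventually_elim
    case (elim t)
    then have t: "0 \<le> t" by simp
    show ?case
      by (rule nn_integral_cong_AE, use S_AE[OF t L2_meas[OF g(1)] assms(2,4)] assms(4,5) in eventually_elim) simp
  qed
  then have "L2_tendsto \<mu> (\<lambda>t x. (S t f' x - f' x) / t) k' (at_right 0)"
    using g(3) unfolding L2_tendsto_def by (rule Lim_transform_eventually[rotated])
  then show ?thesis
    using L2_AE[OF g(1) _ assms(4)] L2_AE[OF g(2) _ assms(5)] assms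
    by (auto simp: generator_graph_def meas_mu)
qed

text \<open>The semigroup commutes with its difference quotients and, as a contraction, preserves
  their convergence.\<close>

lemma gg_S:
  assumes "generator_graph P \<mu> f k" "0 \<le> r"
  shows "generator_graph P \<mu> (S r f) (S r k)"
proof -
  note g = ggD[OF assms(1)]
  have lim: "((\<lambda>t. sqn \<mu> (\<lambda>x. (S t f x - f x) / t - k x)) \<longlongrightarrow> 0) (at_right 0)"
    using g L2_tendsto_iff[OF g(4,2)] by simp
  have SL: "S r f \<in> L2fun \<mu>" "S r k \<in> L2fun \<mu>" using S_L2(1)[OF assms(2)] g by auto
  have ev: "eventually (\<lambda>t. (\<lambda>x. (S t (S r f) x - S r f x) / t) \<in> L2fun \<mu>) (at_right 0)"
    using ev_S_L2[OF SL(1)] by eventually_elim (intro L2_div L2_diff SL)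
  have "((\<lambda>t. sqn \<mu> (\<lambda>x. (S t (S r f) x - S r f x) / t - S r k x)) \<longlongrightarrow> 0) (at_right 0)"
  proof (rule tendsto_sandwich[OF _ _ tendsto_const lim])
    show "eventually (\<lambda>t. sqn \<mu> (\<lambda>x. (S t (S r f) x - S r f x) / t - S r k x)
      \<le> sqn \<mu> (\<lambda>x. (S t f x - f x) / t - k x)) (at_right 0)"
      using eventually_at_right_less[of "0::real"]
    proof eventually_elim
      case (elim t)
      then have t: "0 \<le> t" by simp
      have L: "(\<lambda>x. (S t f x - f x) / t - k x) \<in> L2fun \<mu>"
        using g t by (intro L2_diff L2_div S_L2)
      have "sqn \<mu> (\<lambda>x. (S t (S r f) x - S r f x) / t - S r k x) = sqn \<mu> (S r (\<lambda>x. (S t f x - f x) / t - k x))"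
      proof -
        have i: "integrable \<mu> f" "integrable \<mu> (S t f)" "integrable \<mu> k" "integrable \<mu> (\<lambda>x. S t f x - f x)"
          using g t by (auto intro!: L2_int S_L2 L2_diff)
        have "AE x in \<mu>. (S t (S r f) x - S r f x) / t - S r k x = S r (\<lambda>x. (S t f x - f x) / t - k x) x"
          using S_semigroup[OF assms(2) t i(1)] S_semigroup[OF t assms(2) i(1)]
            S_diff[OF assms(2) i(2,1)] S_lin[OF assms(2) i(4,3), of "1 / t" "-1"]
          by eventually_elim (simp add: add.commute)
        then show ?thesis unfolding sqn_ip
          using SL t L assms(2) by (intro ip_cong_AE) (auto intro!: L2D L2_diff L2_div S_L2)
      qed
      also have "\<dots> \<le> sqn \<mu> (\<lambda>x. (S t f x - f x) / t - k x)" by (rule S_L2(2)[OF assms(2) L])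
      finally show ?case .
    qed
  qed (simp add: sqn_nonneg)
  then show ?thesis
    using SL L2_tendsto_iff[OF ev SL(2)] by (simp add: generator_graph_def)
qed

lemma gg_const: "generator_graph P \<mu> (\<lambda>x. c) (\<lambda>x. 0)"
proof -
  have "S t (\<lambda>x. c) x = c" if "0 < t" for t x
    using S_bounds[of t "\<lambda>x. c" c c x] that by simp
  then have "eventually (\<lambda>t. (\<integral>\<^sup>+x. ennreal (((S t (\<lambda>x. c) x - c) / t - 0)\<^sup>2) \<partial>\<mu>) = 0) (at_right 0)"
    using eventually_at_right_less[of "0::real"] by (auto elim!: eventually_mono)
  then have "L2_tendsto \<mu> (\<lambda>t x. (S t (\<lambda>x. c) x - c) / t) (\<lambda>x. 0) (at_right 0)"
    unfolding L2_tendsto_def by (rule tendsto_eventually)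
  then show ?thesis by (simp add: generator_graph_def L2_const[OF finite_measure_axioms])
qed

end

section \<open>The Dirichlet form\<close>

context symmetric_markov_semigroup
begin

lemma gg_generator: "f \<in> D2 P \<mu> \<Longrightarrow> generator_graph P \<mu> f (generator P \<mu> f)"
  using someI_ex[of "generator_graph P \<mu> f"] by (simp add: D2_def generator_def)

lemma gg_D2: "generator_graph P \<mu> f k \<Longrightarrow> f \<in> D2 P \<mu>"
  unfolding D2_def by auto

lemma D2_L2: "f \<in> D2 P \<mu> \<Longrightarrow> f \<in> L2fun \<mu>"
  using gg_generator ggD(1) by blast

lemma pre_form_gg:
  assumes "generator_graph P \<mu> f k"
  shows "pre_form P \<mu> f = - ip \<mu> f k"
proof -
  have g: "generator_graph P \<mu> f (generator P \<mu> f)" using assms by (intro gg_generator gg_D2)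
  have "pre_form P \<mu> f = - ip \<mu> f (generator P \<mu> f)"
    by (simp add: pre_form_def ip_def mult.commute)
  also have "ip \<mu> f (generator P \<mu> f) = ip \<mu> f k"
    using ggD[OF g] ggD[OF assms] gg_unique[OF g assms] by (intro ip_cong_AE) (auto intro: L2D)
  finally show ?thesis .
qed

lemma Et_pre_form: "f \<in> D2 P \<mu> \<Longrightarrow> ((\<lambda>t. Et t f f) \<longlongrightarrow> pre_form P \<mu> f) (at_right 0)"
  using Et_gg[OF gg_generator D2_L2] pre_form_gg[OF gg_generator] by simp

lemma halving_at_right:
  assumes "0 < t" shows "filterlim (\<lambda>n. t / 2 ^ n) (at_right (0::real)) sequentially"
proof -
  have "(\<lambda>n. t * (1 / 2) ^ n) \<longlonglongrightarrow> t * 0"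
    by (intro tendsto_mult tendsto_const LIMSEQ_power_zero) simp
  then have "(\<lambda>n. t / 2 ^ n) \<longlonglongrightarrow> 0" by (simp add: power_one_over)
  then show ?thesis
    using assms by (auto simp: filterlim_at)
qed

lemma Et_le_limit:
  assumes "0 < t" "f \<in> L2fun \<mu>" "((\<lambda>t. Et t f f) \<longlongrightarrow> e) (at_right 0)"
  shows "Et t f f \<le> e"
  by (rule LIMSEQ_le_const[OF filterlim_compose[OF assms(3) halving_at_right[OF assms(1)]]])
    (use Et_mono[OF assms(1,2)] in auto)

lemma Et_le_pre_form: "0 < t \<Longrightarrow> f \<in> D2 P \<mu> \<Longrightarrow> Et t f f \<le> pre_form P \<mu> f"
  by (rule Et_le_limit[OF _ D2_L2 Et_pre_form])

lemma D2_lin: "f \<in> D2 P \<mu> \<Longrightarrow> g \<in> D2 P \<mu> \<Longrightarrow> (\<lambda>x. a * f x + b * g x) \<in> D2 P \<mu>"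
  using gg_lin unfolding D2_def by blast

lemma D2_diff: "f \<in> D2 P \<mu> \<Longrightarrow> g \<in> D2 P \<mu> \<Longrightarrow> (\<lambda>x. f x - g x) \<in> D2 P \<mu>"
  using D2_lin[of f g 1 "-1"] by simp

lemma pre_form_nonneg: "f \<in> D2 P \<mu> \<Longrightarrow> 0 \<le> pre_form P \<mu> f"
  using Et_le_pre_form[of 1 f] Et_nonneg[of 1 f] D2_L2 by fastforce

lemma approximatesD:
  assumes "approximates P \<mu> u f"
  shows "\<And>n. u n \<in> D2 P \<mu>" "\<And>n. u n \<in> L2fun \<mu>" "L2_tendsto \<mu> u f sequentially"
    "\<And>e. e > 0 \<Longrightarrow> \<exists>N. \<forall>m\<ge>N. \<forall>n\<ge>N. pre_form P \<mu> (\<lambda>x. u m x - u n x) < e"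
  using assms D2_L2 by (auto simp: approximates_def)

lemma Et_tendsto:
  assumes "0 < t" "f \<in> L2fun \<mu>" "\<And>n. u n \<in> L2fun \<mu>" "L2_tendsto \<mu> u f sequentially" "g \<in> L2fun \<mu>"
  shows "(\<lambda>n. Et t (\<lambda>x. u n x - g x) (\<lambda>x. u n x - g x)) \<longlonglongrightarrow> Et t (\<lambda>x. f x - g x) (\<lambda>x. f x - g x)"
proof -
  have t: "0 \<le> t" using assms by simp
  have S: "L2_tendsto \<mu> (\<lambda>n. S t (u n)) (S t f) sequentially"
  proof -
    have l: "(\<lambda>n. sqn \<mu> (\<lambda>x. u n x - f x)) \<longlonglongrightarrow> 0"
      using assms L2_tendsto_iff[of u \<mu> sequentially f] by simp
    have "(\<lambda>n. sqn \<mu> (\<lambda>x. S t (u n) x - S t f x)) \<longlonglongrightarrow> 0"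
    proof (rule tendsto_sandwich[OF _ _ tendsto_const l])
      show "\<forall>\<^sub>F n in sequentially. sqn \<mu> (\<lambda>x. S t (u n) x - S t f x) \<le> sqn \<mu> (\<lambda>x. u n x - f x)"
      proof (rule always_eventually, rule allI)
        fix n
        have "sqn \<mu> (\<lambda>x. S t (u n) x - S t f x) = sqn \<mu> (S t (\<lambda>x. u n x - f x))"
          unfolding sqn_ip
        proof (rule ip_cong_AE)
          have "AE x in \<mu>. S t (\<lambda>x. u n x - f x) x = S t (u n) x - S t f x"
            by (rule S_diff[OF t L2_int[OF assms(3)] L2_int[OF assms(2)]])
          then show "AE x in \<mu>. S t (u n) x - S t f x = S t (\<lambda>x. u n x - f x) x"
            "AE x in \<mu>. S t (u n) x - S t f x = S t (\<lambda>x. u n x - f x) x" by (auto elim!: eventually_mono)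
        qed (use assms t in \<open>auto intro!: L2D L2_diff S_L2\<close>)
        then show "sqn \<mu> (\<lambda>x. S t (u n) x - S t f x) \<le> sqn \<mu> (\<lambda>x. u n x - f x)"
          using S_L2(2)[OF t L2_diff[OF assms(3)[of n] assms(2)]] by simp
      qed
    qed (simp add: sqn_nonneg)
    then show ?thesis
      by (subst L2_tendsto_iff) (use S_L2(1)[OF t] assms in auto)
  qed
  have uu: "(\<lambda>n. Et t (u n) (u n)) \<longlonglongrightarrow> Et t f f"
    unfolding Et_def
    by (intro tendsto_intros tendsto_ip S always_eventually allI S_L2(1)[OF t] assms) (use assms in simp)
  have ug: "(\<lambda>n. Et t (u n) g) \<longlonglongrightarrow> Et t f g"
    unfolding Et_def
    by (intro tendsto_intros tendsto_ip L2_tendsto_const always_eventually allI S_L2(1)[OF t] assms) (use assms in simp)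
  have e: "Et t (\<lambda>x. v x - g x) (\<lambda>x. v x - g x) = Et t v v - 2 * Et t v g + Et t g g" if "v \<in> L2fun \<mu>" for v
    using Et_quad[OF t that assms(5), of 1 "-1"] by simp
  show ?thesis unfolding e[OF assms(3)] e[OF assms(2)]
    by (intro tendsto_intros uu ug)
qed

text \<open>This is closability. \<open>sqrt (Et t f f)\<close> is a seminorm dominated by the root
  of the form, so along a form-Cauchy sequence it converges uniformly in \<open>t\<close>. Hence the
  limits in \<open>n\<close> and in \<open>t\<close> may be exchanged.\<close>

lemma form_approx:
  assumes "approximates P \<mu> u f" "f \<in> L2fun \<mu>"
  shows "\<exists>e. (\<lambda>n. pre_form P \<mu> (u n)) \<longlonglongrightarrow> e \<and> ((\<lambda>t. Et t f f) \<longlongrightarrow> e) (at_right 0)"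
proof -
  note u = approximatesD[OF assms(1)]
  define a where "a n = sqrt (pre_form P \<mu> (u n))" for n
  have close: "\<exists>N. \<forall>n\<ge>N. \<forall>t>0. \<bar>sqrt (Et t f f) - sqrt (Et t (u n) (u n))\<bar> \<le> e" if e: "e > 0" for e
  proof -
    obtain N where N: "\<forall>m\<ge>N. \<forall>n\<ge>N. pre_form P \<mu> (\<lambda>x. u m x - u n x) < e\<^sup>2"
      using u(4)[of "e\<^sup>2"] e by auto
    have "\<bar>sqrt (Et t f f) - sqrt (Et t (u n) (u n))\<bar> \<le> e" if "n \<ge> N" "t > 0" for n t
    proof -
      \<comment> \<open>For fixed \<open>t\<close> the approximating form is continuous in L2, so
        the Cauchy bound for \<open>u m - u n\<close> passes to the limit in
        \<open>m\<close>.\<close>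
      have "Et t (\<lambda>x. f x - u n x) (\<lambda>x. f x - u n x) \<le> e\<^sup>2"
      proof (rule LIMSEQ_le_const2[OF Et_tendsto[OF that(2) assms(2) u(2,3) u(2)]])
        have "Et t (\<lambda>x. u m x - u n x) (\<lambda>x. u m x - u n x) \<le> e\<^sup>2" if "m \<ge> N" for m
          using Et_le_pre_form[OF \<open>t > 0\<close> D2_diff[OF u(1) u(1)], of m n] N \<open>n \<ge> N\<close> that by force
        then show "\<exists>N. \<forall>m\<ge>N. Et t (\<lambda>x. u m x - u n x) (\<lambda>x. u m x - u n x) \<le> e\<^sup>2" by auto
      qed
      then have "sqrt (Et t (\<lambda>x. f x - u n x) (\<lambda>x. f x - u n x)) \<le> e"
        using e by (simp add: real_le_lsqrt sqrt_le_D real_sqrt_le_iff')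
      then show ?thesis using Et_triangle[OF that(2) assms(2) u(2)[of n]] by linarith
    qed
    then show ?thesis by blast
  qed
  have tri: "\<bar>a m - a n\<bar> \<le> sqrt (pre_form P \<mu> (\<lambda>x. u m x - u n x))" for m n
  proof (rule tendsto_le[OF trivial_limit_at_right_real])
    show "((\<lambda>t. \<bar>sqrt (Et t (u m) (u m)) - sqrt (Et t (u n) (u n))\<bar>) \<longlongrightarrow> \<bar>a m - a n\<bar>) (at_right 0)"
      unfolding a_def by (intro tendsto_intros Et_pre_form u)
    show "((\<lambda>t. sqrt (Et t (\<lambda>x. u m x - u n x) (\<lambda>x. u m x - u n x))) \<longlongrightarrow> sqrt (pre_form P \<mu> (\<lambda>x. u m x - u n x))) (at_right 0)"
      by (intro tendsto_intros Et_pre_form D2_diff u)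
    show "\<forall>\<^sub>F t in at_right 0. \<bar>sqrt (Et t (u m) (u m)) - sqrt (Et t (u n) (u n))\<bar>
        \<le> sqrt (Et t (\<lambda>x. u m x - u n x) (\<lambda>x. u m x - u n x))"
      using eventually_at_right_less[of "0::real"]
      by eventually_elim (intro Et_triangle u)
  qed
  have "Cauchy a"
  proof (rule metric_CauchyI)
    fix e :: real assume e: "0 < e"
    obtain N where N: "\<forall>m\<ge>N. \<forall>n\<ge>N. pre_form P \<mu> (\<lambda>x. u m x - u n x) < e\<^sup>2"
      using u(4)[of "e\<^sup>2"] e by auto
    have "dist (a m) (a n) < e" if "m \<ge> N" "n \<ge> N" for m n
    proof -
      have "sqrt (pre_form P \<mu> (\<lambda>x. u m x - u n x)) < sqrt (e\<^sup>2)"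
        using N that by (intro real_sqrt_less_mono) auto
      then show ?thesis using tri[of m n] e by (simp add: dist_real_def)
    qed
    then show "\<exists>N. \<forall>m\<ge>N. \<forall>n\<ge>N. dist (a m) (a n) < e" by blast
  qed
  then obtain l where l: "a \<longlonglongrightarrow> l" using Cauchy_convergent convergent_def by blast
  have "((\<lambda>t. sqrt (Et t f f)) \<longlongrightarrow> l) (at_right 0)"
  proof (rule tendstoI)
    fix e :: real assume e: "0 < e"
    then obtain N where N: "\<forall>n\<ge>N. \<forall>t>0. \<bar>sqrt (Et t f f) - sqrt (Et t (u n) (u n))\<bar> \<le> e / 3"
      using close[of "e / 3"] by auto
    obtain N' where N': "\<forall>n\<ge>N'. \<bar>a n - l\<bar> < e / 3"
      using l e by (auto simp: LIMSEQ_iff dest!: spec[of _ "e / 3"])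
    define n where "n = max N N'"
    have "((\<lambda>t. sqrt (Et t (u n) (u n))) \<longlongrightarrow> a n) (at_right 0)"
      unfolding a_def by (intro tendsto_intros Et_pre_form u)
    then have "eventually (\<lambda>t. dist (sqrt (Et t (u n) (u n))) (a n) < e / 3) (at_right 0)"
      using e by (auto dest: tendstoD[of _ _ _ "e / 3"])
    then show "eventually (\<lambda>t. dist (sqrt (Et t f f)) l < e) (at_right 0)"
      using eventually_at_right_less[of "0::real"]
    proof eventually_elim
      case (elim t)
      have "\<bar>sqrt (Et t f f) - sqrt (Et t (u n) (u n))\<bar> \<le> e / 3" "\<bar>a n - l\<bar> < e / 3"
        using N N' elim by (auto simp: n_def)
      then show ?case using elim(1) unfolding dist_real_def by linarith
    qed
  qed
  then have "((\<lambda>t. (sqrt (Et t f f))\<^sup>2) \<longlongrightarrow> l\<^sup>2) (at_right 0)" by (rule tendsto_power)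
  moreover have "eventually (\<lambda>t. (sqrt (Et t f f))\<^sup>2 = Et t f f) (at_right 0)"
    using eventually_at_right_less[of "0::real"] by eventually_elim (simp add: Et_nonneg assms)
  ultimately have "((\<lambda>t. Et t f f) \<longlongrightarrow> l\<^sup>2) (at_right 0)" by (rule Lim_transform_eventually)
  moreover have "(\<lambda>n. pre_form P \<mu> (u n)) \<longlonglongrightarrow> l\<^sup>2"
    using tendsto_power[OF l, of 2] by (simp add: a_def pre_form_nonneg u)
  ultimately show ?thesis by blast
qed

lemma D_form_L2: "f \<in> D_form P \<mu> \<Longrightarrow> f \<in> L2fun \<mu>"
  by (simp add: D_form_def)

text \<open>Every approximating sequence produces the limit of \<open>Et t f f\<close>, in which the
  sequence does not occur; so the description in \<open>dirichlet_form\<close> determines exactly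
  one value.\<close>

lemma Et_dirichlet:
  assumes "f \<in> D_form P \<mu>"
  shows "((\<lambda>t. Et t f f) \<longlongrightarrow> dirichlet_form P \<mu> f) (at_right 0)"
proof -
  note fL = D_form_L2[OF assms]
  obtain u where u: "approximates P \<mu> u f" using assms by (auto simp: D_form_def)
  obtain e where e: "(\<lambda>n. pre_form P \<mu> (u n)) \<longlonglongrightarrow> e" "((\<lambda>t. Et t f f) \<longlongrightarrow> e) (at_right 0)"
    using form_approx[OF u fL] by blast
  have "dirichlet_form P \<mu> f = e"
    unfolding dirichlet_form_def
  proof (rule the_equality)
    show "\<exists>u. approximates P \<mu> u f \<and> (\<lambda>n. pre_form P \<mu> (u n)) \<longlonglongrightarrow> e" using u e by blast
    fix e' assume "\<exists>u. approximates P \<mu> u f \<and> (\<lambda>n. pre_form P \<mu> (u n)) \<longlonglongrightarrow> e'"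
    then obtain v where v: "approximates P \<mu> v f" "(\<lambda>n. pre_form P \<mu> (v n)) \<longlonglongrightarrow> e'" by blast
    obtain d where d: "(\<lambda>n. pre_form P \<mu> (v n)) \<longlonglongrightarrow> d" "((\<lambda>t. Et t f f) \<longlongrightarrow> d) (at_right 0)"
      using form_approx[OF v(1) fL] by blast
    have "d = e" using tendsto_unique[OF trivial_limit_at_right_real d(2) e(2)] .
    moreover have "d = e'" using LIMSEQ_unique[OF d(1) v(2)] .
    ultimately show "e' = e" by simp
  qed
  then show ?thesis using e by simp
qed

text \<open>The parallelogram identity with one nonnegative term dropped, proved for
  \<open>Et\<close> and passed to the limit.\<close>

lemma pre_form_quad_le:
  assumes "f \<in> D2 P \<mu>" "g \<in> D2 P \<mu>"
  shows "pre_form P \<mu> (\<lambda>x. a * f x + b * g x) \<le> 2 * a\<^sup>2 * pre_form P \<mu> f + 2 * b\<^sup>2 * pre_form P \<mu> g"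
proof (rule tendsto_le[OF trivial_limit_at_right_real])
  show "((\<lambda>t. Et t (\<lambda>x. a * f x + b * g x) (\<lambda>x. a * f x + b * g x)) \<longlongrightarrow> pre_form P \<mu> (\<lambda>x. a * f x + b * g x)) (at_right 0)"
    by (intro Et_pre_form D2_lin assms)
  show "((\<lambda>t. 2 * a\<^sup>2 * Et t f f + 2 * b\<^sup>2 * Et t g g) \<longlongrightarrow> 2 * a\<^sup>2 * pre_form P \<mu> f + 2 * b\<^sup>2 * pre_form P \<mu> g) (at_right 0)"
    by (intro tendsto_intros Et_pre_form assms)
  show "\<forall>\<^sub>F t in at_right 0. Et t (\<lambda>x. a * f x + b * g x) (\<lambda>x. a * f x + b * g x) \<le> 2 * a\<^sup>2 * Et t f f + 2 * b\<^sup>2 * Et t g g"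
    using eventually_at_right_less[of "0::real"]
  proof eventually_elim
    case (elim t)
    then have t: "0 \<le> t" by simp
    note L = D2_L2[OF assms(1)] D2_L2[OF assms(2)]
    have "0 \<le> Et t (\<lambda>x. a * f x + (- b) * g x) (\<lambda>x. a * f x + (- b) * g x)"
      by (rule Et_nonneg[OF elim L2_add[OF L2_scale[OF L(1)] L2_scale[OF L(2)]]])
    then show ?case using Et_quad[OF t L, of a "-b"] Et_quad[OF t L, of a b] by simp
  qed
qed

lemma D_form_lin:
  assumes "f \<in> D_form P \<mu>" "g \<in> D_form P \<mu>"
  shows "(\<lambda>x. a * f x + b * g x) \<in> D_form P \<mu>"
proof -
  obtain u v where uv: "approximates P \<mu> u f" "approximates P \<mu> v g"
    using assms by (auto simp: D_form_def)
  note u = approximatesD[OF uv(1)] and v = approximatesD[OF uv(2)]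
  note L = D_form_L2[OF assms(1)] D_form_L2[OF assms(2)]
  have "approximates P \<mu> (\<lambda>n x. a * u n x + b * v n x) (\<lambda>x. a * f x + b * g x)"
    unfolding approximates_def
  proof (intro conjI allI impI)
    show "(\<lambda>x. a * u n x + b * v n x) \<in> D2 P \<mu>" for n by (intro D2_lin u v)
    show "L2_tendsto \<mu> (\<lambda>n x. a * u n x + b * v n x) (\<lambda>x. a * f x + b * g x) sequentially"
      by (intro L2_tendsto_lin always_eventually allI u v L)
    fix e :: real assume e: "0 < e"
    define d where "d = e / (2 * a\<^sup>2 + 2 * b\<^sup>2 + 1)"
    have p: "0 < 2 * a\<^sup>2 + 2 * b\<^sup>2 + 1" using zero_le_power2[of a] zero_le_power2[of b] by linarith
    have d: "0 < d" using e p by (simp add: d_def)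
    obtain N1 N2 where N: "\<forall>m\<ge>N1. \<forall>n\<ge>N1. pre_form P \<mu> (\<lambda>x. u m x - u n x) < d"
      "\<forall>m\<ge>N2. \<forall>n\<ge>N2. pre_form P \<mu> (\<lambda>x. v m x - v n x) < d"
      using u(4)[OF d] v(4)[OF d] by auto
    have "pre_form P \<mu> (\<lambda>x. a * u m x + b * v m x - (a * u n x + b * v n x)) < e"
      if "m \<ge> max N1 N2" "n \<ge> max N1 N2" for m n
    proof -
      have "pre_form P \<mu> (\<lambda>x. a * u m x + b * v m x - (a * u n x + b * v n x))
        = pre_form P \<mu> (\<lambda>x. a * (u m x - u n x) + b * (v m x - v n x))"
        by (intro arg_cong[where f = "pre_form P \<mu>"]) (auto simp: algebra_simps)
      also have "\<dots> \<le> 2 * a\<^sup>2 * pre_form P \<mu> (\<lambda>x. u m x - u n x) + 2 * b\<^sup>2 * pre_form P \<mu> (\<lambda>x. v m x - v n x)"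
        by (intro pre_form_quad_le D2_diff u v)
      also have "\<dots> \<le> 2 * a\<^sup>2 * d + 2 * b\<^sup>2 * d"
        using N that by (intro add_mono mult_left_mono) (auto simp: less_imp_le)
      also have "\<dots> < (2 * a\<^sup>2 + 2 * b\<^sup>2 + 1) * d" using d by (simp add: algebra_simps)
      also have "\<dots> = e" using p by (simp add: d_def)
      finally show ?thesis .
    qed
    then show "\<exists>N. \<forall>m\<ge>N. \<forall>n\<ge>N. pre_form P \<mu> (\<lambda>x. a * u m x + b * v m x - (a * u n x + b * v n x)) < e"
      by blast
  qed
  then show ?thesis using L by (auto simp: D_form_def intro!: L2_add L2_scale)
qed

lemma D_form_add: "f \<in> D_form P \<mu> \<Longrightarrow> g \<in> D_form P \<mu> \<Longrightarrow> (\<lambda>x. f x + g x) \<in> D_form P \<mu>"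
  using D_form_lin[of f g 1 1] by simp

lemma D2_D_form: assumes "f \<in> D2 P \<mu>" shows "f \<in> D_form P \<mu>"
proof -
  have "pre_form P \<mu> (\<lambda>x. 0) = 0" using pre_form_gg[OF gg_const[of 0]] by (simp add: ip_def)
  then have "approximates P \<mu> (\<lambda>_. f) f"
    using assms by (simp add: approximates_def L2_tendsto_const)
  then show ?thesis using D2_L2[OF assms] by (auto simp: D_form_def)
qed

lemma D_form_const: "(\<lambda>x. c) \<in> D_form P \<mu>"
  by (rule D2_D_form[OF gg_D2[OF gg_const]])

text \<open>On the grid \<open>2r/j\<close> the increments of \<open>\<tau> \<mapsto> \<langle>f, P\<^sub>\<tau> f\<rangle>\<close> decrease in absolute value by
  midpoint convexity.\<close>

lemma Et_S_le:
  assumes "f \<in> L2fun \<mu>" "0 < r"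
  shows "Et (2 * r / real (Suc j)) (S r f) (S r f) \<le> Et (2 * r / real (Suc j)) f f"
proof -
  \<comment> \<open>With this mesh \<open>2 * r\<close> is the grid point of index
    \<open>Suc j\<close>; the increment of \<open>m\<close> that starts there is compared with the
    first one.\<close>
  define s where "s = 2 * r / real (Suc j)"
  have s: "0 < s" "real (Suc j) * s = 2 * r" using assms by (auto simp: s_def)
  define m where "m t = ip \<mu> f (S t f)" for t
  have dec: "m (real i * s) - m (real (Suc i) * s) \<le> m 0 - m s" for i
  proof (induction i)
    case 0 show ?case by simp
  next
    case (Suc i)
    have "2 * m (real i * s + s) \<le> m (real i * s) + m (real i * s + 2 * s)"
      unfolding m_def by (rule ip_S_convex) (use s assms in auto)
    then have "m (real (Suc i) * s) - m (real (Suc (Suc i)) * s) \<le> m (real i * s) - m (real (Suc i) * s)"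
      by (simp add: algebra_simps)
    then show ?case using Suc by linarith
  qed
  have r: "0 \<le> r" "0 \<le> r + s" using assms s by auto
  have L: "S r f \<in> L2fun \<mu>" by (rule S_L2(1)[OF r(1) assms(1)])
  have "ip \<mu> (S r f) (S r f) = m (2 * r)"
    using ip_S_split[OF r(1) r(1) assms(1,1)] by (simp add: m_def)
  moreover have "ip \<mu> (S r f) (S s (S r f)) = m (2 * r + s)"
  proof -
    have "ip \<mu> (S r f) (S s (S r f)) = ip \<mu> (S r f) (S (s + r) f)"
      using S_semigroup[of s r f] s r assms L2_int[OF assms(1)]
      by (intro ip_cong_AE) (auto intro!: L2D S_L2 elim!: eventually_mono)
    also have "\<dots> = m (r + (s + r))"
      unfolding m_def by (rule ip_S_split[symmetric]) (use s r assms in auto)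
    also have "r + (s + r) = 2 * r + s" by simp
    finally show ?thesis .
  qed
  ultimately have "Et s (S r f) (S r f) = (m (2 * r) - m (2 * r + s)) / s"
    by (simp add: Et_def)
  also have "\<dots> \<le> (m 0 - m s) / s"
  proof (rule divide_right_mono)
    have "real (Suc (Suc j)) * s = 2 * r + s" using s(2) by (simp add: algebra_simps)
    then show "m (2 * r) - m (2 * r + s) \<le> m 0 - m s" using dec[of "Suc j"] s(2) by simp
  qed (use s in simp)
  also have "\<dots> = Et s f f"
    using S_0[OF L2_meas[OF assms(1)]] by (simp add: Et_def m_def)
  finally show ?thesis by (simp add: s_def)
qed

text \<open>The meshes of \<open>Et_S_le\<close> tend to 0, and both forms are limits along any such
  sequence.\<close>

lemma pre_form_S_le:
  assumes "f \<in> D2 P \<mu>" "0 < r"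
  shows "pre_form P \<mu> (S r f) \<le> pre_form P \<mu> f"
proof -
  have fl: "filterlim (\<lambda>j. 2 * r / real (Suc j)) (at_right 0) sequentially"
  proof -
    have "(\<lambda>j. 2 * r * inverse (real (Suc j))) \<longlonglongrightarrow> 2 * r * 0"
      by (intro tendsto_mult tendsto_const LIMSEQ_inverse_real_of_nat)
    then show ?thesis using assms(2) by (auto simp: filterlim_at divide_inverse)
  qed
  have d: "S r f \<in> D2 P \<mu>" using gg_S[OF gg_generator[OF assms(1)], of r] assms(2) by (auto intro: gg_D2)
  show ?thesis
    by (rule LIMSEQ_le[OF filterlim_compose[OF Et_pre_form[OF d] fl] filterlim_compose[OF Et_pre_form[OF assms(1)] fl]])
      (use Et_S_le[OF D2_L2[OF assms(1)] assms(2)] in auto)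
qed

lemma pre_form_AE:
  assumes "f \<in> D2 P \<mu>" "g \<in> borel_measurable borel" "AE x in \<mu>. f x = g x"
  shows "pre_form P \<mu> g = pre_form P \<mu> f"
proof -
  note gf = gg_generator[OF assms(1)]
  have gg: "generator_graph P \<mu> g (generator P \<mu> f)"
    by (rule gg_AE[OF gf assms(2) L2_meas[OF ggD(2)[OF gf]] assms(3)]) simp
  show ?thesis unfolding pre_form_gg[OF gf] pre_form_gg[OF gg]
    using ggD[OF gf] ggD[OF gg] assms(3) by (auto intro!: ip_cong_AE L2D)
qed

text \<open>Second order formulas are later tested against \<open>S t \<psi>\<close> at every time
  \<open>t\<close>, so this function has to stay in the domain. Contraction in L2 and in energy
  carries an approximating sequence over; time 0 is apart because the grid argument divides
  \<open>2 * r\<close>.\<close>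

lemma D_form_S:
  assumes "f \<in> D_form P \<mu>" "0 \<le> r"
  shows "S r f \<in> D_form P \<mu>"
proof (cases "r = 0")
  case True
  then show ?thesis using assms S_0[OF L2_meas[OF D_form_L2]] by simp
next
  case False
  then have r: "0 < r" using assms by simp
  obtain u where u0: "approximates P \<mu> u f" using assms by (auto simp: D_form_def)
  note u = approximatesD[OF u0] and fL = D_form_L2[OF assms(1)]
  have ae: "AE x in \<mu>. S r (\<lambda>x. f x - g x) x = S r f x - S r g x" if "f \<in> L2fun \<mu>" "g \<in> L2fun \<mu>" for f g
    by (rule S_diff[OF assms(2)]) (use that L2_int in auto)
  have l: "(\<lambda>n. sqn \<mu> (\<lambda>x. u n x - f x)) \<longlonglongrightarrow> 0"
    using u fL L2_tendsto_iff[of u \<mu> sequentially f] by simp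
  have l2: "(\<lambda>n. sqn \<mu> (\<lambda>x. S r (u n) x - S r f x)) \<longlonglongrightarrow> 0"
  proof (rule tendsto_sandwich[OF _ _ tendsto_const l])
    show "\<forall>\<^sub>F n in sequentially. sqn \<mu> (\<lambda>x. S r (u n) x - S r f x) \<le> sqn \<mu> (\<lambda>x. u n x - f x)"
    proof (rule always_eventually, rule allI)
      fix n
      have "sqn \<mu> (\<lambda>x. S r (u n) x - S r f x) = sqn \<mu> (S r (\<lambda>x. u n x - f x))"
        unfolding sqn_ip using ae[OF u(2) fL, of n] assms(2)
        by (intro ip_cong_AE) (auto intro!: L2D L2_diff S_L2 u fL elim!: eventually_mono)
      then show "sqn \<mu> (\<lambda>x. S r (u n) x - S r f x) \<le> sqn \<mu> (\<lambda>x. u n x - f x)"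
        using S_L2(2)[OF assms(2) L2_diff[OF u(2)[of n] fL]] by simp
    qed
  qed (simp add: sqn_nonneg)
  have "approximates P \<mu> (\<lambda>n. S r (u n)) (S r f)"
    unfolding approximates_def
  proof (intro conjI allI impI)
    show "S r (u n) \<in> D2 P \<mu>" for n
      using gg_S[OF gg_generator[OF u(1)] assms(2)] by (rule gg_D2)
    show "L2_tendsto \<mu> (\<lambda>n. S r (u n)) (S r f) sequentially"
      by (subst L2_tendsto_iff) (use l2 S_L2(1)[OF assms(2)] u fL in auto)
    fix e :: real assume "0 < e"
    then obtain N where N: "\<forall>m\<ge>N. \<forall>n\<ge>N. pre_form P \<mu> (\<lambda>x. u m x - u n x) < e"
      using u(4) by blast
    have "pre_form P \<mu> (\<lambda>x. S r (u m) x - S r (u n) x) < e" if "m \<ge> N" "n \<ge> N" for m n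
    proof -
      have d: "(\<lambda>x. u m x - u n x) \<in> D2 P \<mu>" by (intro D2_diff u)
      have d2: "S r (\<lambda>x. u m x - u n x) \<in> D2 P \<mu>"
        using gg_S[OF gg_generator[OF d] assms(2)] by (rule gg_D2)
      have "pre_form P \<mu> (\<lambda>x. S r (u m) x - S r (u n) x) = pre_form P \<mu> (S r (\<lambda>x. u m x - u n x))"
        by (rule pre_form_AE[OF d2 _ ae[OF u(2) u(2)]])
          (use S_L2(1)[OF assms(2) u(2)] in \<open>auto intro!: borel_measurable_diff dest: L2_meas\<close>)
      also have "\<dots> < e" using pre_form_S_le[OF d r] N that by force
      finally show ?thesis .
    qed
    then show "\<exists>N. \<forall>m\<ge>N. \<forall>n\<ge>N. pre_form P \<mu> (\<lambda>x. S r (u m) x - S r (u n) x) < e" by blast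
  qed
  then show ?thesis using S_L2(1)[OF assms(2) fL] by (auto simp: D_form_def)
qed

end

section \<open>Carre du champ and the chain rule\<close>

text \<open>\<open>R sin (x / R)\<close> is the smooth truncation used wherever the chain rule asks
  for bounded functions: it is bounded by \<open>R\<close>, dominated by the modulus of
  \<open>x\<close>, and its derivative is bounded by 1 and tends to 1.\<close>

lemma scaled_sin_tendsto: "(\<lambda>n. real (Suc n) * sin (x / real (Suc n))) \<longlonglongrightarrow> x"
proof (cases "x = 0")
  case False
  have "(\<lambda>n. x * inverse (real (Suc n))) \<longlonglongrightarrow> x * 0"
    by (intro tendsto_mult tendsto_const LIMSEQ_inverse_real_of_nat)
  then have fl: "filterlim (\<lambda>n. x / real (Suc n)) (at 0) sequentially"
    using False by (auto simp: filterlim_at divide_inverse)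
  have "((\<lambda>h. (sin (0 + h) - sin 0) / h) \<longlongrightarrow> cos (0::real)) (at 0)"
    using DERIV_sin[of "0::real"] unfolding DERIV_def .
  then have "((\<lambda>h. sin h / h) \<longlongrightarrow> (1::real)) (at 0)" by simp
  from tendsto_mult[OF tendsto_const[of x] filterlim_compose[OF this fl]]
  have "(\<lambda>n. x * (sin (x / real (Suc n)) / (x / real (Suc n)))) \<longlonglongrightarrow> x" by simp
  moreover have "(\<lambda>n. x * (sin (x / real (Suc n)) / (x / real (Suc n)))) = (\<lambda>n. real (Suc n) * sin (x / real (Suc n)))"
    using False by (auto simp: field_simps)
  ultimately show ?thesis by simp
qed simp

lemma scaled_sin_le: "0 < R \<Longrightarrow> \<bar>R * sin (x / R)\<bar> \<le> \<bar>x\<bar>" for R x :: real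
  using abs_sin_x_le_abs_x[of "x / R"] by (simp add: abs_mult field_simps)

lemma cos_scaled_tendsto: "(\<lambda>n. cos (x / real (Suc n))) \<longlonglongrightarrow> 1"
proof -
  have "(\<lambda>n. x * inverse (real (Suc n))) \<longlonglongrightarrow> x * 0"
    by (intro tendsto_mult tendsto_const LIMSEQ_inverse_real_of_nat)
  then have "(\<lambda>n. cos (x * inverse (real (Suc n)))) \<longlonglongrightarrow> cos (x * 0)" by (intro tendsto_cos)
  then show ?thesis by (simp add: divide_inverse)
qed

lemma scaled_sin_deriv:
  "0 < R \<Longrightarrow> ((\<lambda>x. R * sin (x / R)) has_real_derivative cos (x / R)) (at x)" for R :: real
  by (auto intro!: derivative_eq_intros)

text \<open>Mean value inequality from right derivatives, the generator being a limit from the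
  right. If the bound with slope \<open>M + e'\<close> failed at \<open>d\<close>, then at the last
  time \<open>s\<close> where it holds the right derivative would carry it further.\<close>

lemma right_derivative_bound:
  fixes f :: "real \<Rightarrow> real"
  assumes "0 \<le> d" "continuous_on {0..d} f"
    and "\<And>t. 0 \<le> t \<Longrightarrow> t < d \<Longrightarrow> \<exists>r\<le>M. ((\<lambda>s. (f (t + s) - f t) / s) \<longlongrightarrow> r) (at_right 0)"
  shows "f d - f 0 \<le> M * d"
proof (rule field_le_epsilon)
  fix e :: real assume e: "0 < e"
  define e' where "e' = e / (d + 1)"
  have e': "0 < e'" "e' * d \<le> e" using e assms(1) by (auto simp: e'_def field_simps)
  define \<phi> where "\<phi> t = f t - f 0 - (M + e') * t" for t
  have "\<phi> d \<le> 0"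
  proof (rule ccontr)
    assume neg: "\<not> \<phi> d \<le> 0"
    define A where "A = {0..d} \<inter> \<phi> -` {..0}"
    have cont: "continuous_on {0..d} \<phi>"
      unfolding \<phi>_def using assms(2) by (intro continuous_intros)
    have "closed A" unfolding A_def by (intro continuous_closed_preimage cont) auto
    moreover have "bounded A" by (rule bounded_subset[of "{0..d}"]) (auto simp: A_def)
    ultimately have "compact A" by (simp add: compact_eq_bounded_closed)
    moreover have "0 \<in> A" using assms(1) by (auto simp: A_def \<phi>_def)
    ultimately obtain s where s: "s \<in> A" "\<And>t. t \<in> A \<Longrightarrow> t \<le> s"
      using compact_attains_sup[of A] by blast
    have sd: "0 \<le> s" "s < d" "\<phi> s \<le> 0"
      using s(1) neg by (auto simp: A_def less_le)
    obtain r where r: "r \<le> M" "((\<lambda>u. (f (s + u) - f s) / u) \<longlongrightarrow> r) (at_right 0)"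
      using assms(3)[OF sd(1,2)] by blast
    have "eventually (\<lambda>u. (f (s + u) - f s) / u < M + e') (at_right 0)"
      using r e' by (intro order_tendstoD(2)[OF r(2)]) simp
    moreover have "eventually (\<lambda>u. u < d - s) (at_right (0::real))"
      using sd by (intro eventually_at_rightI[of 0 "d - s"]) auto
    ultimately have "eventually (\<lambda>u. False) (at_right (0::real))"
      using eventually_at_right_less[of "0::real"]
    proof eventually_elim
      case (elim u)
      then have "f (s + u) - f s < (M + e') * u" by (simp add: divide_less_eq)
      then have "\<phi> (s + u) \<le> 0" using sd by (simp add: \<phi>_def algebra_simps)
      then have "s + u \<in> A" using elim sd by (auto simp: A_def)
      then show False using s(2)[of "s + u"] elim by simp
    qed
    then show False by (simp add: trivial_limit_at_right_real)
  qed
  then show "f d - f 0 \<le> M * d + e" using e'(2) by (simp add: \<phi>_def algebra_simps)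
qed

locale markov_diffusion = symmetric_markov_semigroup +
  fixes \<Gamma> :: "('a \<Rightarrow> real) \<Rightarrow> ('a \<Rightarrow> real) \<Rightarrow> 'a \<Rightarrow> real"
  assumes cdc: "carre_du_champ P \<mu> \<Gamma>"
begin

abbreviation "\<D> \<equiv> D_form P \<mu>"

lemma G_int: "f \<in> \<D> \<Longrightarrow> g \<in> \<D> \<Longrightarrow> integrable \<mu> (\<Gamma> f g)"
  and G_sym: "f \<in> \<D> \<Longrightarrow> g \<in> \<D> \<Longrightarrow> AE x in \<mu>. \<Gamma> f g x = \<Gamma> g f x"
  and G_lin: "f \<in> \<D> \<Longrightarrow> f' \<in> \<D> \<Longrightarrow> g \<in> \<D> \<Longrightarrow>
    AE x in \<mu>. \<Gamma> (\<lambda>y. a * f y + b * f' y) g x = a * \<Gamma> f g x + b * \<Gamma> f' g x"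
  and G_pos: "f \<in> \<D> \<Longrightarrow> AE x in \<mu>. 0 \<le> \<Gamma> f f x"
  and G_dirichlet: "f \<in> \<D> \<Longrightarrow> dirichlet_form P \<mu> f = (\<integral>x. \<Gamma> f f x \<partial>\<mu>)"
  and G_chain: "C1b n F D \<Longrightarrow> g \<in> \<D> \<Longrightarrow> (\<And>i. i < n \<Longrightarrow> k i \<in> \<D>) \<Longrightarrow>
      (\<lambda>y. F (\<lambda>i. k i y)) \<in> \<D> \<and>
      (AE x in \<mu>. \<Gamma> (\<lambda>y. F (\<lambda>i. k i y)) g x = (\<Sum>i<n. D i (\<lambda>j. k j x) * \<Gamma> (k i) g x))"
  using cdc unfolding carre_du_champ_def by blast+

lemma G_quad:
  assumes "f \<in> \<D>" "g \<in> \<D>"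
  shows "AE x in \<mu>. \<Gamma> (\<lambda>x. a * f x + b * g x) (\<lambda>x. a * f x + b * g x) x
    = a\<^sup>2 * \<Gamma> f f x + 2 * a * b * \<Gamma> f g x + b\<^sup>2 * \<Gamma> g g x"
proof -
  note L = D_form_lin[OF assms, of a b]
  show ?thesis
    using G_lin[OF assms L, of a b] G_sym[OF assms(1) L] G_sym[OF assms(2) L]
      G_lin[OF assms assms(1), of a b] G_lin[OF assms assms(2), of a b] G_sym[OF assms]
    by eventually_elim (simp add: power2_eq_square algebra_simps)
qed

text \<open>Polarisation, since the Dirichlet form is given on the diagonal only.\<close>

lemma Et_Gamma:
  assumes "f \<in> \<D>" "g \<in> \<D>"
  shows "((\<lambda>t. Et t f g) \<longlongrightarrow> (\<integral>x. \<Gamma> f g x \<partial>\<mu>)) (at_right 0)"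
proof -
  have D: "(\<lambda>x. 1 * f x + b * g x) \<in> \<D>" for b by (rule D_form_lin[OF assms])
  have lim: "((\<lambda>t. (Et t (\<lambda>x. 1 * f x + 1 * g x) (\<lambda>x. 1 * f x + 1 * g x)
      - Et t (\<lambda>x. 1 * f x + (-1) * g x) (\<lambda>x. 1 * f x + (-1) * g x)) / 4) \<longlongrightarrow>
      ((\<integral>x. \<Gamma> (\<lambda>x. 1 * f x + 1 * g x) (\<lambda>x. 1 * f x + 1 * g x) x \<partial>\<mu>)
      - (\<integral>x. \<Gamma> (\<lambda>x. 1 * f x + (-1) * g x) (\<lambda>x. 1 * f x + (-1) * g x) x \<partial>\<mu>)) / 4) (at_right 0)"
    unfolding G_dirichlet[OF D, symmetric]
    by (intro tendsto_intros Et_dirichlet D) simp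
  have i: "integrable \<mu> (\<Gamma> f f)" "integrable \<mu> (\<Gamma> f g)" "integrable \<mu> (\<Gamma> g g)"
    using G_int assms by auto
  have e: "(\<integral>x. \<Gamma> (\<lambda>x. 1 * f x + b * g x) (\<lambda>x. 1 * f x + b * g x) x \<partial>\<mu>)
    = (\<integral>x. \<Gamma> f f x \<partial>\<mu>) + 2 * b * (\<integral>x. \<Gamma> f g x \<partial>\<mu>) + b\<^sup>2 * (\<integral>x. \<Gamma> g g x \<partial>\<mu>)" for b
  proof -
    have "(\<integral>x. \<Gamma> (\<lambda>x. 1 * f x + b * g x) (\<lambda>x. 1 * f x + b * g x) x \<partial>\<mu>)
      = (\<integral>x. 1\<^sup>2 * \<Gamma> f f x + 2 * 1 * b * \<Gamma> f g x + b\<^sup>2 * \<Gamma> g g x \<partial>\<mu>)"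
      by (rule integral_cong_AE)
        (use i G_int[OF D D] G_quad[OF assms, of 1 b] in \<open>auto dest!: borel_measurable_integrable\<close>)
    then show ?thesis using i by simp
  qed
  have ev: "eventually (\<lambda>t. (Et t (\<lambda>x. 1 * f x + 1 * g x) (\<lambda>x. 1 * f x + 1 * g x)
      - Et t (\<lambda>x. 1 * f x + (-1) * g x) (\<lambda>x. 1 * f x + (-1) * g x)) / 4 = Et t f g) (at_right 0)"
    using eventually_at_right_less[of "0::real"]
  proof eventually_elim
    case (elim t)
    then have t: "0 \<le> t" by simp
    show ?case
      unfolding Et_quad[OF t D_form_L2[OF assms(1)] D_form_L2[OF assms(2)]] by simp
  qed
  show ?thesis using Lim_transform_eventually[OF lim ev] unfolding e by simp
qed

text \<open>Integration by parts: both sides are the limit of \<open>Et t u f\<close>.\<close>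

lemma G_gg:
  assumes "generator_graph P \<mu> f k" "u \<in> \<D>"
  shows "(\<integral>x. \<Gamma> u f x \<partial>\<mu>) = - ip \<mu> u k"
  using tendsto_unique[OF trivial_limit_at_right_real Et_Gamma[OF assms(2) D2_D_form[OF gg_D2[OF assms(1)]]]
    Et_gg[OF assms(1) D_form_L2[OF assms(2)]]] .

lemma G_chain1:
  assumes "\<And>x. (F has_real_derivative F' x) (at x)" "continuous_on UNIV F'"
    and "\<And>x. \<bar>F x\<bar> \<le> B" "\<And>x. \<bar>F' x\<bar> \<le> B'" and f: "f \<in> \<D>"
  shows "(\<lambda>y. F (f y)) \<in> \<D>"
    and "g \<in> \<D> \<Longrightarrow> AE x in \<mu>. \<Gamma> (\<lambda>y. F (f y)) g x = F' (f x) * \<Gamma> f g x"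
proof -
  have c: "C1b 1 (\<lambda>v. F (v 0)) (\<lambda>i v. F' (v 0))"
    unfolding C1b_def
  proof (intro conjI allI impI)
    show "bounded (range (\<lambda>v::nat \<Rightarrow> real. F (v 0)))" by (rule boundedI[of _ B]) (use assms in auto)
    show "bounded (range (\<lambda>v::nat \<Rightarrow> real. F' (v 0)))" by (rule boundedI[of _ B']) (use assms in auto)
    show "continuous_on UNIV (\<lambda>v::nat \<Rightarrow> real. F' (v 0))"
      by (rule continuous_on_compose2[OF assms(2) continuous_on_product_coordinates]) auto
    fix i :: nat and v assume "i < 1"
    then show "((\<lambda>s. F ((v(i := s)) 0)) has_real_derivative F' (v 0)) (at (v i))"
      using assms(1)[of "v 0"] by simp
  qed auto
  show "(\<lambda>y. F (f y)) \<in> \<D>" using G_chain[OF c f, of "\<lambda>_. f"] f by simp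
  show "g \<in> \<D> \<Longrightarrow> AE x in \<mu>. \<Gamma> (\<lambda>y. F (f y)) g x = F' (f x) * \<Gamma> f g x"
    using G_chain[OF c, of g "\<lambda>_. f"] f by simp
qed

text \<open>Leibniz rule for products of bounded functions of \<open>f\<close> and \<open>k\<close>;
  it serves to differentiate the product of a truncated test function and \<open>F'(h)\<close> in
  \<open>G_second_order\<close>.\<close>

lemma G_chain2:
  assumes F: "\<And>x. (F has_real_derivative F' x) (at x)" "continuous_on UNIV F'"
    "\<And>x. \<bar>F x\<bar> \<le> B" "\<And>x. \<bar>F' x\<bar> \<le> B"
    and G: "\<And>x. (G has_real_derivative G' x) (at x)" "continuous_on UNIV G'"
    "\<And>x. \<bar>G x\<bar> \<le> B'" "\<And>x. \<bar>G' x\<bar> \<le> B'"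
    and f: "f \<in> \<D>" and k: "k \<in> \<D>"
  shows "(\<lambda>y. F (f y) * G (k y)) \<in> \<D>"
    and "g \<in> \<D> \<Longrightarrow> AE x in \<mu>. \<Gamma> (\<lambda>y. F (f y) * G (k y)) g x
      = F' (f x) * G (k x) * \<Gamma> f g x + F (f x) * G' (k x) * \<Gamma> k g x"
proof -
  define D where "D i v = (if i = (0::nat) then F' (v 0) * G (v 1) else F (v 0) * G' (v (1::nat)))" for i v
  have cF: "continuous_on UNIV F" and cG: "continuous_on UNIV G"
    using F(1) G(1) by (auto intro: DERIV_continuous_on has_field_derivative_at_within)
  have co: "continuous_on UNIV (\<lambda>v::nat \<Rightarrow> real. H (v i))" if "continuous_on UNIV H" for H :: "real \<Rightarrow> real" and i
    by (rule continuous_on_compose2[OF that continuous_on_product_coordinates]) auto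
  have B: "0 \<le> B" "0 \<le> B'" using F(3)[of 0] G(3)[of 0] by auto
  have c: "C1b 2 (\<lambda>v. F (v 0) * G (v 1)) D"
    unfolding C1b_def
  proof (intro conjI allI impI)
    show "bounded (range (\<lambda>v::nat \<Rightarrow> real. F (v 0) * G (v 1)))"
      by (rule boundedI[of _ "B * B'"]) (use F G B in \<open>auto simp: abs_mult intro!: mult_mono\<close>)
    show "bounded (range (D i))" for i
      by (rule boundedI[of _ "B * B'"]) (use F G B in \<open>auto simp: D_def abs_mult intro!: mult_mono\<close>)
    show "continuous_on UNIV (D i)" for i
      unfolding D_def[abs_def] by (cases "i = 0") (auto intro!: continuous_intros co cF cG F G)
    fix i :: nat and v :: "nat \<Rightarrow> real" assume "i < 2"
    then have "i = 0 \<or> i = 1" by auto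
    then show "((\<lambda>s. F ((v(i := s)) 0) * G ((v(i := s)) 1)) has_real_derivative D i v) (at (v i))"
      using F(1)[of "v 0"] G(1)[of "v 1"] by (auto simp: D_def intro!: derivative_eq_intros)
  qed auto
  have D2: "(if i = 0 then f else k) \<in> \<D>" for i :: nat using f k by simp
  show "(\<lambda>y. F (f y) * G (k y)) \<in> \<D>" using G_chain[OF c f, of "\<lambda>i. if i = 0 then f else k"] D2 by simp
  show "g \<in> \<D> \<Longrightarrow> AE x in \<mu>. \<Gamma> (\<lambda>y. F (f y) * G (k y)) g x
      = F' (f x) * G (k x) * \<Gamma> f g x + F (f x) * G' (k x) * \<Gamma> k g x"
    using G_chain[OF c, of g "\<lambda>i. if i = 0 then f else k"] D2
    by (simp add: numeral_2_eq_2 D_def)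
qed

text \<open>For each real \<open>b\<close> the quadratic polynomial in \<open>b\<close> is
  nonnegative off a null set that depends on \<open>b\<close>. Rational \<open>b\<close> give one
  common null set, and continuity in \<open>b\<close> extends the inequality to all reals before the
  discriminant is taken.\<close>

lemma G_cauchy:
  assumes "f \<in> \<D>" "g \<in> \<D>"
  shows "AE x in \<mu>. (\<Gamma> f g x)\<^sup>2 \<le> \<Gamma> f f x * \<Gamma> g g x"
proof -
  have "AE x in \<mu>. 0 \<le> \<Gamma> f f x + 2 * b * \<Gamma> f g x + b\<^sup>2 * \<Gamma> g g x" for b
  proof -
    have D: "(\<lambda>x. 1 * f x + b * g x) \<in> \<D>" by (rule D_form_lin[OF assms])
    show ?thesis using G_quad[OF assms, of 1 b] G_pos[OF D] by eventually_elim simp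
  qed
  then have "AE x in \<mu>. \<forall>q::rat. 0 \<le> \<Gamma> f f x + 2 * real_of_rat q * \<Gamma> f g x + (real_of_rat q)\<^sup>2 * \<Gamma> g g x"
    by (simp add: AE_all_countable)
  then show ?thesis using G_pos[OF assms(2)]
  proof eventually_elim
    case (elim x)
    define p where "p t = \<Gamma> f f x + 2 * t * \<Gamma> f g x + t\<^sup>2 * \<Gamma> g g x" for t
    have "0 \<le> p t" for t
    proof (rule ccontr)
      assume "\<not> 0 \<le> p t"
      moreover have "isCont p t" unfolding p_def by (intro continuous_intros)
      ultimately have "eventually (\<lambda>s. p s < 0) (at t)"
        by (intro order_tendstoD(2)[of p "p t"]) (auto simp: isCont_def)
      then obtain d where d: "d > 0" "\<And>s. s \<noteq> t \<Longrightarrow> dist s t < d \<Longrightarrow> p s < 0"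
        by (auto simp: eventually_at)
      obtain r where r: "r \<in> \<rat>" "t < r" "r < t + d" using Rats_dense_in_real[of t "t + d"] d by auto
      then obtain q where "r = real_of_rat q" by (auto elim: Rats_cases)
      then have "0 \<le> p r" using elim(1) by (simp add: p_def)
      moreover have "p r < 0" using d(2)[of r] r by (simp add: dist_real_def)
      ultimately show False by simp
    qed
    then show ?case using elim(2) unfolding p_def by (intro discriminant_nonpos) auto
  qed
qed

end

section \<open>A solution of the Poisson equation and the weak second order formula\<close>

locale poisson_solution = markov_diffusion +
  fixes h g :: "'a \<Rightarrow> real" and K B :: real
  assumes hg: "generator_graph P \<mu> h (\<lambda>x. - g x)"
    and g_bdd: "\<And>x. \<bar>g x\<bar> \<le> B"
    and g_meas[measurable]: "g \<in> borel_measurable borel"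
    and G_le: "AE x in \<mu>. \<Gamma> h h x \<le> K"
    and C_Lip_D: "\<And>\<psi>. \<psi> \<in> C_Lip \<Longrightarrow> bounded (range \<psi>) \<Longrightarrow> \<psi> \<in> \<D>"
begin

lemma h_D: "h \<in> \<D>" and h_L2: "h \<in> L2fun \<mu>"
  and h_meas[measurable]: "h \<in> borel_measurable borel"
  using hg by (auto intro: gg_D2 D2_D_form L2_meas ggD(1))

lemma g_L2: "g \<in> L2fun \<mu>"
  by (rule L2_bounded[OF finite_measure_axioms _ g_bdd]) (simp add: meas_mu)

lemma K_nonneg: "0 \<le> K"
proof -
  have "AE x in \<mu>. 0 \<le> K" using G_le G_pos[OF h_D] by eventually_elim simp
  then show ?thesis by simp
qed

lemma G_mult_int:
  assumes "u \<in> \<D>" "v \<in> \<D>" "w \<in> borel_measurable borel" "\<And>x. \<bar>w x\<bar> \<le> b"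
  shows "integrable \<mu> (\<lambda>x. w x * \<Gamma> u v x)"
proof (rule Bochner_Integration.integrable_bound)
  show "integrable \<mu> (\<lambda>x. b * \<Gamma> u v x)" using G_int[OF assms(1,2)] by simp
  have "0 \<le> b" using assms(4)[of undefined] by simp
  then show "AE x in \<mu>. norm (w x * \<Gamma> u v x) \<le> norm (b * \<Gamma> u v x)"
    using assms(4) by (auto simp: abs_mult intro!: AE_I2 mult_right_mono)
qed (use G_int[OF assms(1,2)] assms(3) in \<open>auto intro!: borel_measurable_times simp: meas_mu\<close>)

text \<open>The identity \<open>\<E>(\<Psi>, F h) = \<langle>\<Psi> F' h, g\<rangle> - \<langle>\<Psi>, F'' h \<Gamma>(h, h)\<rangle>\<close> is the weak form of
  \<open>\<L> (F h) = F' h \<L> h + F'' h \<Gamma>(h, h)\<close>; the bounded \<open>\<Psi>\<close> is replaced by \<open>R sin(\<Psi>/R)\<close> since the chain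
  rule is available for bounded functions only.\<close>

lemma G_second_order:
  assumes F: "\<And>x. (F has_real_derivative F' x) (at x)" "\<And>x. (F' has_real_derivative F'' x) (at x)"
    "continuous_on UNIV F''" "\<And>x. \<bar>F x\<bar> \<le> b" "\<And>x. \<bar>F' x\<bar> \<le> b" "\<And>x. \<bar>F'' x\<bar> \<le> b"
    and \<Psi>: "\<Psi> \<in> \<D>" "\<And>x. 0 \<le> \<Psi> x" "\<And>x. \<Psi> x \<le> 1"
  shows "(\<lambda>x. F (h x)) \<in> \<D>"
    "(\<integral>x. \<Gamma> (\<lambda>x. F (h x)) \<Psi> x \<partial>\<mu>)
      = (\<integral>x. \<Psi> x * F' (h x) * g x \<partial>\<mu>) - (\<integral>x. \<Psi> x * F'' (h x) * \<Gamma> h h x \<partial>\<mu>)"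
proof -
  have cF': "continuous_on UNIV F'"
    using F(2) by (auto intro: DERIV_continuous_on has_field_derivative_at_within)
  have b: "0 \<le> b" using F(4)[of 0] by simp
  have m[measurable]: "F' \<in> borel_measurable borel" "F'' \<in> borel_measurable borel" "\<Psi> \<in> borel_measurable borel"
    using cF' F(3) L2_meas[OF D_form_L2[OF \<Psi>(1)]] by (auto intro: borel_measurable_continuous_onI)
  show FD: "(\<lambda>x. F (h x)) \<in> \<D>"
    by (rule G_chain1(1)[OF F(1) cF' F(4,5) h_D])
  define qs where "qs n x = real (Suc n) * sin (x / real (Suc n))" for n x
  define c where "c n x = cos (x / real (Suc n))" for n x
  have [measurable]: "qs n \<in> borel_measurable borel" "c n \<in> borel_measurable borel" for n
    unfolding qs_def[abs_def] c_def[abs_def] by auto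
  have qs1: "\<bar>qs n (\<Psi> x)\<bar> \<le> 1" for n x
    using scaled_sin_le[of "real (Suc n)" "\<Psi> x"] \<Psi>(2,3)[of x] unfolding qs_def by linarith
  have c1: "\<bar>c n y\<bar> \<le> 1" for n y unfolding c_def by simp
  have e1: "(\<integral>x. \<Gamma> (\<lambda>x. F (h x)) \<Psi> x \<partial>\<mu>) = (\<integral>x. F' (h x) * \<Gamma> h \<Psi> x \<partial>\<mu>)"
    by (rule integral_cong_AE)
      (use G_int[OF FD \<Psi>(1)] G_mult_int[OF h_D \<Psi>(1), of "\<lambda>x. F' (h x)" b] F
        G_chain1(2)[OF F(1) cF' F(4,5) h_D \<Psi>(1)] in \<open>auto dest: borel_measurable_integrable\<close>)
  have e2: "(\<integral>x. F' (h x) * \<Gamma> h \<Psi> x \<partial>\<mu>) = (\<integral>x. F' (h x) * \<Gamma> \<Psi> h x \<partial>\<mu>)"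
  proof (rule integral_cong_AE)
    show "AE x in \<mu>. F' (h x) * \<Gamma> h \<Psi> x = F' (h x) * \<Gamma> \<Psi> h x"
      using G_sym[OF h_D \<Psi>(1)] by eventually_elim simp
  qed (use G_mult_int[OF h_D \<Psi>(1), of "\<lambda>x. F' (h x)" b] G_mult_int[OF \<Psi>(1) h_D, of "\<lambda>x. F' (h x)" b] F
        in \<open>auto dest: borel_measurable_integrable\<close>)
  have i1: "integrable \<mu> (\<lambda>x. (c n (\<Psi> x) * F' (h x)) * \<Gamma> \<Psi> h x)" for n
    by (rule G_mult_int[OF \<Psi>(1) h_D, of _ b]) (use mult_mono[OF c1 F(5)] b in \<open>auto simp: abs_mult\<close>)
  have i2: "integrable \<mu> (\<lambda>x. (qs n (\<Psi> x) * F'' (h x)) * \<Gamma> h h x)" for n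
    by (rule G_mult_int[OF h_D h_D, of _ b]) (use mult_mono[OF qs1 F(6)] b in \<open>auto simp: abs_mult\<close>)
  \<comment> \<open>The product \<open>qs n (\<Psi>) F'(h)\<close> is paired with \<open>h\<close>:
    on the one hand by the Leibniz rule, on the other by \<open>G_gg\<close>, which gives its inner
    product with \<open>g\<close>. The limits \<open>l1\<close>, \<open>l2\<close> and
    \<open>l3\<close> then remove the truncation.\<close>
  have n: "(\<integral>x. (c n (\<Psi> x) * F' (h x)) * \<Gamma> \<Psi> h x \<partial>\<mu>)
    = (\<integral>x. qs n (\<Psi> x) * F' (h x) * g x \<partial>\<mu>) - (\<integral>x. (qs n (\<Psi> x) * F'' (h x)) * \<Gamma> h h x \<partial>\<mu>)" for n
  proof -
    have c2: "((qs n) has_real_derivative c n x) (at x)" for x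
      unfolding qs_def c_def by (rule scaled_sin_deriv) simp
    have cc: "continuous_on UNIV (c n)" unfolding c_def[abs_def] by (intro continuous_intros) auto
    have cb: "\<bar>qs n x\<bar> \<le> real (Suc n)" for x by (simp add: qs_def abs_mult del: of_nat_Suc)
    have cb': "\<bar>c n x\<bar> \<le> real (Suc n)" for x using c1[of n x] by simp
    note ch = G_chain2[OF c2 cc cb cb' F(2,3,5,6) \<Psi>(1) h_D]
    have "(\<integral>x. \<Gamma> (\<lambda>y. qs n (\<Psi> y) * F' (h y)) h x \<partial>\<mu>)
      = (\<integral>x. (c n (\<Psi> x) * F' (h x)) * \<Gamma> \<Psi> h x + (qs n (\<Psi> x) * F'' (h x)) * \<Gamma> h h x \<partial>\<mu>)"
      by (rule integral_cong_AE)
        (use G_int[OF ch(1) h_D] i1[of n] i2[of n] ch(2)[OF h_D] in \<open>auto intro!: borel_measurable_add dest: borel_measurable_integrable\<close>)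
    also have "\<dots> = (\<integral>x. (c n (\<Psi> x) * F' (h x)) * \<Gamma> \<Psi> h x \<partial>\<mu>) + (\<integral>x. (qs n (\<Psi> x) * F'' (h x)) * \<Gamma> h h x \<partial>\<mu>)"
      using i1[of n] i2[of n] by simp
    finally show ?thesis using G_gg[OF hg ch(1)] by (simp add: ip_def)
  qed
  have l1: "(\<lambda>n. \<integral>x. (c n (\<Psi> x) * F' (h x)) * \<Gamma> \<Psi> h x \<partial>\<mu>) \<longlonglongrightarrow> (\<integral>x. F' (h x) * \<Gamma> \<Psi> h x \<partial>\<mu>)"
  proof (rule integral_dominated_convergence[where w = "\<lambda>x. b * \<bar>\<Gamma> \<Psi> h x\<bar>"])
    show "AE x in \<mu>. (\<lambda>n. (c n (\<Psi> x) * F' (h x)) * \<Gamma> \<Psi> h x) \<longlonglongrightarrow> F' (h x) * \<Gamma> \<Psi> h x"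
    proof (rule AE_I2)
      fix x
      have "(\<lambda>n. (c n (\<Psi> x) * F' (h x)) * \<Gamma> \<Psi> h x) \<longlonglongrightarrow> (1 * F' (h x)) * \<Gamma> \<Psi> h x"
        unfolding c_def by (intro tendsto_mult tendsto_const cos_scaled_tendsto)
      then show "(\<lambda>n. (c n (\<Psi> x) * F' (h x)) * \<Gamma> \<Psi> h x) \<longlonglongrightarrow> F' (h x) * \<Gamma> \<Psi> h x" by simp
    qed
    show "AE x in \<mu>. norm ((c n (\<Psi> x) * F' (h x)) * \<Gamma> \<Psi> h x) \<le> b * \<bar>\<Gamma> \<Psi> h x\<bar>" for n
      using mult_mono[OF c1 F(5)] by (auto simp: abs_mult intro!: AE_I2 mult_right_mono)
  qed (use i1 G_int[OF \<Psi>(1) h_D] G_mult_int[OF \<Psi>(1) h_D, of "\<lambda>x. F' (h x)" b] F in \<open>auto dest: borel_measurable_integrable\<close>)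
  have l2: "(\<lambda>n. \<integral>x. (qs n (\<Psi> x) * F'' (h x)) * \<Gamma> h h x \<partial>\<mu>) \<longlonglongrightarrow> (\<integral>x. \<Psi> x * F'' (h x) * \<Gamma> h h x \<partial>\<mu>)"
  proof (rule integral_dominated_convergence[where w = "\<lambda>x. b * \<bar>\<Gamma> h h x\<bar>"])
    show "AE x in \<mu>. (\<lambda>n. (qs n (\<Psi> x) * F'' (h x)) * \<Gamma> h h x) \<longlonglongrightarrow> \<Psi> x * F'' (h x) * \<Gamma> h h x"
      unfolding qs_def by (intro AE_I2 tendsto_mult tendsto_const scaled_sin_tendsto)
    show "AE x in \<mu>. norm ((qs n (\<Psi> x) * F'' (h x)) * \<Gamma> h h x) \<le> b * \<bar>\<Gamma> h h x\<bar>" for n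
      using mult_mono[OF qs1 F(6)] by (auto simp: abs_mult intro!: AE_I2 mult_right_mono)
    show "(\<lambda>x. \<Psi> x * F'' (h x) * \<Gamma> h h x) \<in> borel_measurable \<mu>"
      using G_mult_int[OF h_D h_D, of "\<lambda>x. F'' (h x)" b] F(6)
      by (auto simp: mult.assoc meas_mu intro!: borel_measurable_times dest: borel_measurable_integrable)
  qed (use i2 G_int[OF h_D h_D] in \<open>auto dest: borel_measurable_integrable\<close>)
  have l3: "(\<lambda>n. \<integral>x. qs n (\<Psi> x) * F' (h x) * g x \<partial>\<mu>) \<longlonglongrightarrow> (\<integral>x. \<Psi> x * F' (h x) * g x \<partial>\<mu>)"
  proof (rule integral_dominated_convergence[where w = "\<lambda>x. b * \<bar>g x\<bar>"])
    show "AE x in \<mu>. (\<lambda>n. qs n (\<Psi> x) * F' (h x) * g x) \<longlonglongrightarrow> \<Psi> x * F' (h x) * g x"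
      unfolding qs_def by (intro AE_I2 tendsto_mult tendsto_const scaled_sin_tendsto)
    show "AE x in \<mu>. norm (qs n (\<Psi> x) * F' (h x) * g x) \<le> b * \<bar>g x\<bar>" for n
      using mult_mono[OF qs1 F(5)] by (auto simp: abs_mult intro!: AE_I2 mult_right_mono)
  qed (use L2_int[OF g_L2] in auto)
  have "(\<integral>x. F' (h x) * \<Gamma> \<Psi> h x \<partial>\<mu>)
    = (\<integral>x. \<Psi> x * F' (h x) * g x \<partial>\<mu>) - (\<integral>x. \<Psi> x * F'' (h x) * \<Gamma> h h x \<partial>\<mu>)"
    using LIMSEQ_unique[OF l1 tendsto_diff[OF l3 l2, folded n]] .
  then show "(\<integral>x. \<Gamma> (\<lambda>x. F (h x)) \<Psi> x \<partial>\<mu>)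
      = (\<integral>x. \<Psi> x * F' (h x) * g x \<partial>\<mu>) - (\<integral>x. \<Psi> x * F'' (h x) * \<Gamma> h h x \<partial>\<mu>)"
    using e1 e2 by simp
qed

end

text \<open>A bounded smooth substitute for the square, tending to it as \<open>a\<close> decreases
  to 0. Its second derivative obeys the upper bound 2 of the square itself, so that truncation
  leaves the constant \<open>2 K\<close> intact.\<close>

definition sq_trunc :: "real \<Rightarrow> real \<Rightarrow> real" where "sq_trunc a x = x\<^sup>2 / (1 + a * x\<^sup>2)"
definition sq_trunc' :: "real \<Rightarrow> real \<Rightarrow> real" where "sq_trunc' a x = 2 * x / (1 + a * x\<^sup>2)\<^sup>2"
definition sq_trunc'' :: "real \<Rightarrow> real \<Rightarrow> real" where
  "sq_trunc'' a x = (2 - 6 * a * x\<^sup>2) / (1 + a * x\<^sup>2) ^ 3"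

context
  fixes a :: real assumes a: "0 < a"
begin

lemma sq_trunc_den: "1 \<le> 1 + a * x\<^sup>2" "0 < 1 + a * x\<^sup>2" "1 + a * x\<^sup>2 \<noteq> 0"
proof -
  have "0 \<le> a * x\<^sup>2" using a by simp
  then show "1 \<le> 1 + a * x\<^sup>2" "0 < 1 + a * x\<^sup>2" "1 + a * x\<^sup>2 \<noteq> 0" by linarith+
qed

lemma sq_trunc_deriv: "(sq_trunc a has_real_derivative sq_trunc' a x) (at x)"
  unfolding sq_trunc_def[abs_def] sq_trunc'_def using sq_trunc_den(3)[of x]
  by (auto intro!: derivative_eq_intros simp: power2_eq_square field_simps)

lemma sq_trunc'_deriv: "(sq_trunc' a has_real_derivative sq_trunc'' a x) (at x)"
proof -
  define q where "q = 1 + a * x\<^sup>2"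
  have q: "q \<noteq> 0" using sq_trunc_den(3)[of x] by (simp add: q_def)
  have "(sq_trunc' a has_real_derivative (2 * q\<^sup>2 - 2 * x * (2 * q * (2 * a * x))) / (q\<^sup>2 * q\<^sup>2)) (at x)"
    unfolding sq_trunc'_def[abs_def] q_def using sq_trunc_den(3)[of x]
    by (auto intro!: derivative_eq_intros)
  moreover have "(2 * q\<^sup>2 - 2 * x * (2 * q * (2 * a * x))) / (q\<^sup>2 * q\<^sup>2) = (2 * q - 8 * (a * x\<^sup>2)) / q ^ 3"
    using q by (simp add: field_simps power2_eq_square power3_eq_cube)
  moreover have "2 * q - 8 * (a * x\<^sup>2) = 2 - 6 * a * x\<^sup>2" by (simp add: q_def)
  moreover have "sq_trunc'' a x = (2 - 6 * a * x\<^sup>2) / q ^ 3" by (simp only: sq_trunc''_def q_def)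
  ultimately show ?thesis by (simp only:)
qed

lemma sq_trunc''_cont: "continuous_on UNIV (sq_trunc'' a)"
  unfolding sq_trunc''_def[abs_def] using sq_trunc_den(3) by (intro continuous_intros) auto

lemma sq_trunc_le: "0 \<le> sq_trunc a x" "sq_trunc a x \<le> x\<^sup>2" "sq_trunc a x \<le> 1 / a"
proof -
  show "0 \<le> sq_trunc a x" using sq_trunc_den(2)[of x] by (simp add: sq_trunc_def)
  show "sq_trunc a x \<le> x\<^sup>2"
    using sq_trunc_den(1)[of x] mult_left_mono[of 1 "1 + a * x\<^sup>2" "x\<^sup>2"]
    by (simp add: sq_trunc_def divide_le_eq sq_trunc_den(2))
  show "sq_trunc a x \<le> 1 / a"
    using sq_trunc_den(2)[of x] a by (simp add: sq_trunc_def field_simps)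
qed

lemma sq_trunc'_le: "\<bar>sq_trunc' a x\<bar> \<le> 2 * \<bar>x\<bar>" "\<bar>sq_trunc' a x\<bar> \<le> 1 + 1 / a"
proof -
  define q where "q = 1 + a * x\<^sup>2"
  have q: "1 \<le> q" "0 < q" using sq_trunc_den[of x] by (auto simp: q_def)
  have q2: "q \<le> q\<^sup>2" "1 \<le> q\<^sup>2" using q by (auto simp: power2_eq_square intro: mult_left_le_imp_le mult_ge1_I)
  have e: "\<bar>sq_trunc' a x\<bar> = 2 * \<bar>x\<bar> / q\<^sup>2" by (simp add: sq_trunc'_def q_def abs_mult)
  show "\<bar>sq_trunc' a x\<bar> \<le> 2 * \<bar>x\<bar>"
    unfolding e using q2 mult_left_mono[of 1 "q\<^sup>2" "2 * \<bar>x\<bar>"] q by (simp add: divide_le_eq)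
  have "0 \<le> (\<bar>x\<bar> - 1)\<^sup>2" by simp
  then have "2 * \<bar>x\<bar> \<le> 1 + x\<^sup>2" by (simp add: power2_diff)
  also have "\<dots> \<le> (1 + 1 / a) * q"
    using a by (simp add: q_def field_simps)
  also have "\<dots> \<le> (1 + 1 / a) * q\<^sup>2" using q2 a by (intro mult_left_mono) auto
  finally show "\<bar>sq_trunc' a x\<bar> \<le> 1 + 1 / a" unfolding e using q by (simp add: divide_le_eq)
qed

lemma sq_trunc''_le: "sq_trunc'' a x \<le> 2" "\<bar>sq_trunc'' a x\<bar> \<le> 6"
proof -
  define y where "y = a * x\<^sup>2"
  have y: "0 \<le> y" using a by (simp add: y_def)
  have c: "1 + y \<le> (1 + y) ^ 3" "1 \<le> (1 + y) ^ 3"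
    using y one_le_power[of "1 + y" 3] power_increasing[of 1 3 "1 + y"] by auto
  have e: "sq_trunc'' a x = (2 - 6 * y) / (1 + y) ^ 3" by (simp add: sq_trunc''_def y_def mult.assoc)
  have p: "0 < (1 + y) ^ 3" using y by simp
  show "sq_trunc'' a x \<le> 2" unfolding e using p c y by (simp add: divide_le_eq)
  have "\<bar>2 - 6 * y\<bar> \<le> 6 * (1 + y)" using y by (simp add: abs_if)
  also have "\<dots> \<le> 6 * (1 + y) ^ 3" using c by simp
  finally show "\<bar>sq_trunc'' a x\<bar> \<le> 6" unfolding e abs_divide using p by (simp add: divide_le_eq)
qed

end

lemma sq_trunc_tendsto:
  "(\<lambda>n. sq_trunc (inverse (real (Suc n))) x) \<longlonglongrightarrow> x\<^sup>2"
  "(\<lambda>n. sq_trunc' (inverse (real (Suc n))) x) \<longlonglongrightarrow> 2 * x"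
proof -
  have "(\<lambda>n. 1 + inverse (real (Suc n)) * x\<^sup>2) \<longlonglongrightarrow> 1 + 0 * x\<^sup>2"
    by (intro tendsto_intros LIMSEQ_inverse_real_of_nat)
  then have q: "(\<lambda>n. 1 + inverse (real (Suc n)) * x\<^sup>2) \<longlonglongrightarrow> 1" by simp
  show "(\<lambda>n. sq_trunc (inverse (real (Suc n))) x) \<longlonglongrightarrow> x\<^sup>2"
    unfolding sq_trunc_def using tendsto_divide[OF tendsto_const q, of "x\<^sup>2"] by simp
  show "(\<lambda>n. sq_trunc' (inverse (real (Suc n))) x) \<longlonglongrightarrow> 2 * x"
    unfolding sq_trunc'_def using tendsto_divide[OF tendsto_const tendsto_power[OF q, of 2], of "2 * x"] by simp
qed

lemma one_minus_cos_le: "2 * (1 - cos y) \<le> y\<^sup>2" for y :: real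
proof -
  have "1 - cos y = 2 * (sin (y / 2))\<^sup>2"
    using cos_double_sin[of "y / 2"] by simp
  moreover have "(sin (y / 2))\<^sup>2 \<le> (y / 2)\<^sup>2"
    using abs_sin_x_le_abs_x[of "y / 2"] by (rule abs_le_square_iff[THEN iffD1])
  ultimately show ?thesis by (simp add: power_divide)
qed

section \<open>One-step drift of the squared solution\<close>

context poisson_solution
begin

text \<open>Strong continuity at 0 and \<open>sqn_S_diff\<close> give one modulus of continuity for
  all times.\<close>

lemma ip_S_continuous:
  assumes "u \<in> L2fun \<mu>" "v \<in> L2fun \<mu>"
  shows "continuous_on {0..} (\<lambda>t. ip \<mu> u (S t v))"
  unfolding continuous_on_iff
proof (intro ballI allI impI)
  fix s e :: real assume s: "s \<in> {0..}" and e: "0 < e"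
  define \<omega> where "\<omega> d = sqrt (sqn \<mu> u) * sqrt (sqn \<mu> (\<lambda>x. S d v x - v x))" for d
  have "(\<omega> \<longlongrightarrow> sqrt (sqn \<mu> u) * sqrt 0) (at_right 0)"
    unfolding \<omega>_def by (intro tendsto_intros sqn_S_tendsto assms)
  then have "eventually (\<lambda>d. \<omega> d < e) (at_right 0)"
    using e by (intro order_tendstoD(2)) auto
  then obtain d0 where d0: "d0 > 0" "\<And>d. 0 < d \<Longrightarrow> d < d0 \<Longrightarrow> \<omega> d < e"
    by (auto simp: eventually_at_right_field)
  have b: "\<bar>ip \<mu> u (S (a + d) v) - ip \<mu> u (S a v)\<bar> \<le> \<omega> d" if "0 \<le> a" "0 \<le> d" for a d
  proof -
    have L: "S (a + d) v \<in> L2fun \<mu>" "S a v \<in> L2fun \<mu>" using that assms by (auto intro!: S_L2)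
    have "\<bar>ip \<mu> u (S (a + d) v) - ip \<mu> u (S a v)\<bar> = \<bar>ip \<mu> u (\<lambda>x. S (a + d) v x - S a v x)\<bar>"
      by (simp add: ip_lin(4)[OF L assms(1)])
    also have "\<dots> \<le> sqrt (sqn \<mu> u) * sqrt (sqn \<mu> (\<lambda>x. S (a + d) v x - S a v x))"
      by (rule ip_cauchy_sqrt[OF assms(1) L2_diff[OF L]])
    also have "\<dots> \<le> \<omega> d" unfolding \<omega>_def
      using sqn_S_diff[OF that assms(2)] by (intro mult_left_mono real_sqrt_le_mono) (auto simp: sqn_nonneg)
    finally show ?thesis .
  qed
  show "\<exists>d>0. \<forall>x'\<in>{0..}. dist x' s < d \<longrightarrow> dist (ip \<mu> u (S x' v)) (ip \<mu> u (S s v)) < e"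
  proof (intro exI conjI ballI impI)
    fix t assume t: "t \<in> {0..}" "dist t s < d0"
    show "dist (ip \<mu> u (S t v)) (ip \<mu> u (S s v)) < e"
    proof (cases t s rule: linorder_cases)
      case less
      then show ?thesis using b[of t "s - t"] d0(2)[of "s - t"] t by (simp add: dist_real_def abs_minus_commute)
    next
      case greater
      then show ?thesis using b[of s "t - s"] d0(2)[of "t - s"] t s by (simp add: dist_real_def)
    qed (use e in simp)
  qed fact
qed

lemma abs_ip_le_L1:
  assumes "\<psi> \<in> borel_measurable borel" "\<And>x. 0 \<le> \<psi> x" "\<And>x. \<psi> x \<le> 1" "integrable \<mu> w"
  shows "\<bar>ip \<mu> \<psi> w\<bar> \<le> (\<integral>x. \<bar>w x\<bar> \<partial>\<mu>)" "integrable \<mu> (\<lambda>x. \<psi> x * w x)"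
proof -
  show i: "integrable \<mu> (\<lambda>x. \<psi> x * w x)"
    by (rule Bochner_Integration.integrable_bound[OF assms(4)])
      (use assms in \<open>auto simp: abs_mult meas_mu intro!: AE_I2 mult_left_le_one_le\<close>)
  have "\<bar>ip \<mu> \<psi> w\<bar> \<le> (\<integral>x. \<bar>\<psi> x * w x\<bar> \<partial>\<mu>)" unfolding ip_def by (rule integral_abs_bound)
  also have "\<dots> \<le> (\<integral>x. \<bar>w x\<bar> \<partial>\<mu>)"
    by (rule integral_mono[OF integrable_abs[OF i] integrable_abs[OF assms(4)]])
      (use assms(2,3) in \<open>auto simp: abs_mult intro!: mult_left_le_one_le\<close>)
  finally show "\<bar>ip \<mu> \<psi> w\<bar> \<le> (\<integral>x. \<bar>w x\<bar> \<partial>\<mu>)" .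
qed

text \<open>The semigroup is put on \<psi>, which stays in the form domain, and the pairing with
  \<open>F(h)\<close> is differentiated in time. By \<open>G_second_order\<close> the right
  derivative is minus the pairing of \<open>S t \<psi>\<close> with \<open>F'(h) g\<close>, plus a
  term controlled by F'' \<le> 2 and \<Gamma>(h, h) \<le> K. Symmetry moves the semigroup off \<psi>
  again, and \<open>e\<close> measures how far it moves \<open>F'(h) g\<close> up to time
  \<open>d\<close>.\<close>

lemma drift_bound_smooth:
  assumes F: "\<And>x. (F has_real_derivative F' x) (at x)" "\<And>x. (F' has_real_derivative F'' x) (at x)"
    "continuous_on UNIV F''" "\<And>x. \<bar>F x\<bar> \<le> b" "\<And>x. \<bar>F' x\<bar> \<le> b" "\<And>x. \<bar>F'' x\<bar> \<le> b"
    and F2: "\<And>x. F'' x \<le> 2"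
    and \<psi>: "\<psi> \<in> \<D>" "\<And>x. 0 \<le> \<psi> x" "\<And>x. \<psi> x \<le> 1"
    and d: "0 \<le> d"
    and e: "\<And>t. 0 \<le> t \<Longrightarrow> t \<le> d \<Longrightarrow> (\<integral>x. \<bar>S t (\<lambda>x. F' (h x) * g x) x - F' (h x) * g x\<bar> \<partial>\<mu>) \<le> e"
  shows "ip \<mu> \<psi> (S d (\<lambda>x. F (h x))) - ip \<mu> \<psi> (\<lambda>x. F (h x))
    \<le> (- (\<integral>x. \<psi> x * (F' (h x) * g x) \<partial>\<mu>) + e + 2 * K * (\<integral>x. \<psi> x \<partial>\<mu>)) * d"
proof -
  define w where "w x = F' (h x) * g x" for x
  define Fh where "Fh x = F (h x)" for x
  have cF': "continuous_on UNIV F'" and cF: "continuous_on UNIV F"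
    using F(1,2) by (auto intro: DERIV_continuous_on has_field_derivative_at_within)
  have [measurable]: "F \<in> borel_measurable borel" "F' \<in> borel_measurable borel" "F'' \<in> borel_measurable borel"
    using cF cF' F(3) by (auto intro: borel_measurable_continuous_onI)
  have \<psi>L: "\<psi> \<in> L2fun \<mu>" by (rule D_form_L2[OF \<psi>(1)])
  have FhL: "Fh \<in> L2fun \<mu>"
    unfolding Fh_def by (rule L2_bounded[OF finite_measure_axioms _ F(4)]) (simp add: meas_mu)
  have wL: "w \<in> L2fun \<mu>"
    unfolding w_def by (rule L2_bdd_mult[OF g_L2 _ F(5)]) (simp add: meas_mu)
  define f where "f t = ip \<mu> Fh (S t \<psi>)" for t
  define M where "M = - ip \<mu> \<psi> w + e + 2 * K * (\<integral>x. \<psi> x \<partial>\<mu>)"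
  have "f d - f 0 \<le> M * d"
  proof (rule right_derivative_bound[OF d])
    show "continuous_on {0..d} f"
      unfolding f_def by (rule continuous_on_subset[OF ip_S_continuous[OF FhL \<psi>L]]) auto
    fix t assume t: "0 \<le> t" "t < d"
    define \<Psi> where "\<Psi> = S t \<psi>"
    have \<Psi>: "\<Psi> \<in> \<D>" "\<And>x. 0 \<le> \<Psi> x" "\<And>x. \<Psi> x \<le> 1"
      unfolding \<Psi>_def using D_form_S[OF \<psi>(1) t(1)] S_bounds[OF t(1) L2_meas[OF \<psi>L] \<psi>(2,3)] by auto
    have \<Psi>L: "\<Psi> \<in> L2fun \<mu>" by (rule D_form_L2[OF \<Psi>(1)])
    have [measurable]: "\<Psi> \<in> borel_measurable borel" by (rule L2_meas[OF \<Psi>L])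
    note so = G_second_order[OF F \<Psi>, folded Fh_def]
    define r where "r = - (\<integral>x. \<Gamma> Fh \<Psi> x \<partial>\<mu>)"
    have "((\<lambda>s. - Et s Fh \<Psi>) \<longlongrightarrow> r) (at_right 0)"
      unfolding r_def by (intro tendsto_minus Et_Gamma so(1) \<Psi>(1))
    moreover have "eventually (\<lambda>s. - Et s Fh \<Psi> = (f (t + s) - f t) / s) (at_right 0)"
      using eventually_at_right_less[of "0::real"]
    proof eventually_elim
      case (elim s)
      then have s: "0 \<le> s" by simp
      have "f (t + s) = ip \<mu> Fh (S s \<Psi>)"
        unfolding f_def \<Psi>_def using S_semigroup[OF s t(1) L2_int[OF \<psi>L]] s t
        by (intro ip_cong_AE) (auto intro!: L2D S_L2 FhL \<psi>L simp: add.commute)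
      then show ?case by (simp add: Et_def f_def \<Psi>_def minus_divide_left)
    qed
    ultimately have lim: "((\<lambda>s. (f (t + s) - f t) / s) \<longlongrightarrow> r) (at_right 0)"
      by (rule Lim_transform_eventually)
    have i: "integrable \<mu> (\<lambda>x. \<Psi> x * F'' (h x) * \<Gamma> h h x)"
    proof (rule G_mult_int[OF h_D h_D, of _ b])
      fix x
      have "\<bar>\<Psi> x\<bar> * \<bar>F'' (h x)\<bar> \<le> 1 * b" using \<Psi>(2,3)[of x] F(6)[of "h x"] by (intro mult_mono) auto
      then show "\<bar>\<Psi> x * F'' (h x)\<bar> \<le> b" by (simp add: abs_mult)
    qed simp
    have "(\<integral>x. \<Psi> x * F'' (h x) * \<Gamma> h h x \<partial>\<mu>) \<le> (\<integral>x. 2 * K * \<Psi> x \<partial>\<mu>)"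
    proof (rule integral_mono_AE[OF i])
      show "integrable \<mu> (\<lambda>x. 2 * K * \<Psi> x)" using L2_int[OF \<Psi>L] by simp
      show "AE x in \<mu>. \<Psi> x * F'' (h x) * \<Gamma> h h x \<le> 2 * K * \<Psi> x"
        using G_pos[OF h_D] G_le
      proof eventually_elim
        case (elim x)
        have "F'' (h x) * \<Gamma> h h x \<le> 2 * \<Gamma> h h x" using F2 elim by (intro mult_right_mono) auto
        also have "\<dots> \<le> 2 * K" using elim by simp
        finally have "\<Psi> x * (F'' (h x) * \<Gamma> h h x) \<le> \<Psi> x * (2 * K)" using \<Psi>(2) by (intro mult_left_mono) auto
        then show ?case by (simp add: mult_ac)
      qed
    qed
    also have "\<dots> = 2 * K * (\<integral>x. \<psi> x \<partial>\<mu>)"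
      unfolding \<Psi>_def using S_integrable(3)[OF t(1) L2_int[OF \<psi>L]] by simp
    finally have r1: "r \<le> - (\<integral>x. \<Psi> x * F' (h x) * g x \<partial>\<mu>) + 2 * K * (\<integral>x. \<psi> x \<partial>\<mu>)"
      unfolding r_def so(2) by simp
    have "(\<integral>x. \<Psi> x * F' (h x) * g x \<partial>\<mu>) = ip \<mu> \<psi> (S t w)"
      using S_sym[OF t(1) \<psi>L wL] by (simp add: \<Psi>_def ip_def w_def mult.assoc)
    moreover have "ip \<mu> \<psi> (S t w) - ip \<mu> \<psi> w = ip \<mu> \<psi> (\<lambda>x. S t w x - w x)"
      by (rule ip_lin(4)[symmetric, OF S_L2(1)[OF t(1) wL] wL \<psi>L])
    moreover have "\<bar>ip \<mu> \<psi> (\<lambda>x. S t w x - w x)\<bar> \<le> e"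
      using abs_ip_le_L1(1)[OF L2_meas[OF \<psi>L] \<psi>(2,3) L2_int[OF L2_diff[OF S_L2(1)[OF t(1) wL] wL]]]
        e[of t] t unfolding w_def by linarith
    ultimately have "r \<le> M" using r1 unfolding M_def by linarith
    then show "\<exists>r\<le>M. ((\<lambda>s. (f (t + s) - f t) / s) \<longlongrightarrow> r) (at_right 0)" using lim by blast
  qed
  moreover have "f d = ip \<mu> \<psi> (S d Fh)" unfolding f_def using S_sym[OF d FhL \<psi>L] by (simp add: ip_commute)
  moreover have "f 0 = ip \<mu> \<psi> Fh" unfolding f_def S_0[OF L2_meas[OF \<psi>L]] by (rule ip_commute)
  ultimately show ?thesis unfolding M_def ip_def w_def Fh_def by simp
qed

definition "h2 x = (h x)\<^sup>2"
text \<open>Formally the generator maps \<open>h2\<close> to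
  \<open>- w + 2 \<Gamma>(h, h)\<close>.\<close>

definition "w x = 2 * h x * g x"

lemma h2_int: "integrable \<mu> h2" unfolding h2_def[abs_def] by (rule L2D(2)[OF h_L2])

lemma w_L2: "w \<in> L2fun \<mu>"
proof -
  have "(\<lambda>x. g x * (2 * h x)) \<in> L2fun \<mu>"
    by (rule L2_bdd_mult[OF L2_scale[OF h_L2] _ g_bdd]) (simp add: meas_mu)
  then show ?thesis by (simp add: w_def[abs_def] mult_ac)
qed

text \<open>This is \<open>drift_bound_smooth\<close> for truncated squares. Convergence in L1 is
  enough to remove the truncation, because \<psi> is bounded and the semigroup contracts L1.\<close>

lemma drift_bound:
  assumes \<psi>: "\<psi> \<in> \<D>" "\<And>x. 0 \<le> \<psi> x" "\<And>x. \<psi> x \<le> 1" and d: "0 \<le> d"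
    and e: "\<And>t. 0 \<le> t \<Longrightarrow> t \<le> d \<Longrightarrow> (\<integral>x. \<bar>S t w x - w x\<bar> \<partial>\<mu>) \<le> e"
  shows "ip \<mu> \<psi> (S d h2) - ip \<mu> \<psi> h2 \<le> (- ip \<mu> \<psi> w + e + 2 * K * (\<integral>x. \<psi> x \<partial>\<mu>)) * d"
proof -
  define a where "a n = inverse (real (Suc n))" for n
  have a: "0 < a n" for n by (simp add: a_def)
  define wn where "wn n x = sq_trunc' (a n) (h x) * g x" for n x
  define hn where "hn n x = sq_trunc (a n) (h x)" for n x
  have mq[measurable]: "sq_trunc (a n) \<in> borel_measurable borel" "sq_trunc' (a n) \<in> borel_measurable borel" for n
    unfolding sq_trunc_def[abs_def] sq_trunc'_def[abs_def] by auto
  have \<psi>m[measurable]: "\<psi> \<in> borel_measurable borel" by (rule L2_meas[OF D_form_L2[OF \<psi>(1)]])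
  have wnL: "wn n \<in> L2fun \<mu>" for n
    unfolding wn_def using sq_trunc'_le(2)[OF a] by (intro L2_bdd_mult[OF g_L2, of _ "1 + 1 / a n"]) (auto simp: meas_mu)
  have hnL: "hn n \<in> L2fun \<mu>" for n
    unfolding hn_def using sq_trunc_le[OF a] by (intro L2_bounded[OF finite_measure_axioms, of _ "1 / a n"]) (auto simp: meas_mu)
  have rw: "(\<lambda>n. \<integral>x. \<bar>wn n x - w x\<bar> \<partial>\<mu>) \<longlonglongrightarrow> 0"
  proof -
    have "(\<lambda>n. \<integral>x. \<bar>wn n x - w x\<bar> \<partial>\<mu>) \<longlonglongrightarrow> (\<integral>x. 0 \<partial>\<mu>)"
    proof (rule integral_dominated_convergence[where w = "\<lambda>x. 2 * \<bar>w x\<bar>"])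
      show "AE x in \<mu>. (\<lambda>n. \<bar>wn n x - w x\<bar>) \<longlonglongrightarrow> 0"
      proof (rule AE_I2)
        fix x
        have "(\<lambda>n. \<bar>wn n x - w x\<bar>) \<longlonglongrightarrow> \<bar>2 * h x * g x - w x\<bar>"
          unfolding wn_def a_def by (intro tendsto_intros sq_trunc_tendsto)
        then show "(\<lambda>n. \<bar>wn n x - w x\<bar>) \<longlonglongrightarrow> 0" by (simp add: w_def)
      qed
      fix n
      have "\<bar>wn n x\<bar> \<le> \<bar>w x\<bar>" for x
        unfolding wn_def w_def abs_mult using sq_trunc'_le(1)[OF a] by (intro mult_right_mono) auto
      then show "AE x in \<mu>. norm \<bar>wn n x - w x\<bar> \<le> 2 * \<bar>w x\<bar>"
        by (intro AE_I2) (smt (verit) real_norm_def)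
    qed (use L2D(1)[OF wnL] L2D(1)[OF w_L2] L2_int[OF w_L2] in auto)
    then show ?thesis by simp
  qed
  have rh: "(\<lambda>n. \<integral>x. \<bar>hn n x - h2 x\<bar> \<partial>\<mu>) \<longlonglongrightarrow> 0"
  proof -
    have "(\<lambda>n. \<integral>x. \<bar>hn n x - h2 x\<bar> \<partial>\<mu>) \<longlonglongrightarrow> (\<integral>x. 0 \<partial>\<mu>)"
    proof (rule integral_dominated_convergence[where w = h2])
      show "AE x in \<mu>. (\<lambda>n. \<bar>hn n x - h2 x\<bar>) \<longlonglongrightarrow> 0"
      proof (rule AE_I2)
        fix x
        have "(\<lambda>n. \<bar>hn n x - h2 x\<bar>) \<longlonglongrightarrow> \<bar>(h x)\<^sup>2 - h2 x\<bar>"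
          unfolding hn_def a_def by (intro tendsto_intros sq_trunc_tendsto)
        then show "(\<lambda>n. \<bar>hn n x - h2 x\<bar>) \<longlonglongrightarrow> 0" by (simp add: h2_def)
      qed
      show "AE x in \<mu>. norm \<bar>hn n x - h2 x\<bar> \<le> h2 x" for n
      proof (rule AE_I2)
        fix x
        show "norm \<bar>hn n x - h2 x\<bar> \<le> h2 x"
          using sq_trunc_le(1,2)[OF a[of n], of "h x"] unfolding hn_def h2_def real_norm_def by linarith
      qed
    qed (use L2D(1)[OF hnL] h2_int in auto)
    then show ?thesis by simp
  qed
  have wi: "integrable \<mu> w" "integrable \<mu> (wn n)" "integrable \<mu> (hn n)" for n
    using L2_int wnL w_L2 hnL by auto
  have bn: "ip \<mu> \<psi> (S d (hn n)) - ip \<mu> \<psi> (hn n)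
    \<le> (- ip \<mu> \<psi> (wn n) + (e + 2 * (\<integral>x. \<bar>wn n x - w x\<bar> \<partial>\<mu>)) + 2 * K * (\<integral>x. \<psi> x \<partial>\<mu>)) * d" for n
  proof -
    \<comment> \<open>Exchanging \<open>w\<close> for \<open>wn n\<close> changes the modulus by at
      most twice their L1 distance, once behind the semigroup and once without it.\<close>
    have en: "(\<integral>x. \<bar>S t (wn n) x - wn n x\<bar> \<partial>\<mu>) \<le> e + 2 * (\<integral>x. \<bar>wn n x - w x\<bar> \<partial>\<mu>)" if t: "0 \<le> t" "t \<le> d" for t
    proof -
      have i: "integrable \<mu> (S t w)" "integrable \<mu> (S t (wn n))" "integrable \<mu> (\<lambda>x. wn n x - w x)"
        "integrable \<mu> (S t (\<lambda>x. wn n x - w x))"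
        using S_integrable(2)[OF t(1)] wi by auto
      have "(\<integral>x. \<bar>S t (wn n) x - wn n x\<bar> \<partial>\<mu>)
        \<le> (\<integral>x. \<bar>S t (\<lambda>x. wn n x - w x) x\<bar> + \<bar>S t w x - w x\<bar> + \<bar>wn n x - w x\<bar> \<partial>\<mu>)"
      proof (rule integral_mono_AE)
        show "AE x in \<mu>. \<bar>S t (wn n) x - wn n x\<bar> \<le> \<bar>S t (\<lambda>x. wn n x - w x) x\<bar> + \<bar>S t w x - w x\<bar> + \<bar>wn n x - w x\<bar>"
          using S_diff[OF t(1) wi(2)[of n] wi(1)] by eventually_elim linarith
      qed (use i wi in auto)
      also have "\<dots> = (\<integral>x. \<bar>S t (\<lambda>x. wn n x - w x) x\<bar> \<partial>\<mu>) + (\<integral>x. \<bar>S t w x - w x\<bar> \<partial>\<mu>) + (\<integral>x. \<bar>wn n x - w x\<bar> \<partial>\<mu>)"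
        using i wi by simp
      also have "\<dots> \<le> (\<integral>x. \<bar>wn n x - w x\<bar> \<partial>\<mu>) + e + (\<integral>x. \<bar>wn n x - w x\<bar> \<partial>\<mu>)"
        by (intro add_mono S_L1[OF t(1) i(3)] e t) simp
      finally show ?thesis by simp
    qed
    have bnd: "\<bar>sq_trunc (a n) x\<bar> \<le> 1 + 1 / a n + 6" "\<bar>sq_trunc' (a n) x\<bar> \<le> 1 + 1 / a n + 6"
      "\<bar>sq_trunc'' (a n) x\<bar> \<le> 1 + 1 / a n + 6" for x
    proof -
      have "0 < 1 / a n" using a[of n] by simp
      then show "\<bar>sq_trunc (a n) x\<bar> \<le> 1 + 1 / a n + 6" "\<bar>sq_trunc' (a n) x\<bar> \<le> 1 + 1 / a n + 6"
        "\<bar>sq_trunc'' (a n) x\<bar> \<le> 1 + 1 / a n + 6"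
        using sq_trunc_le[OF a[of n], of x] sq_trunc'_le(2)[OF a[of n], of x] sq_trunc''_le(2)[OF a[of n], of x]
        by linarith+
    qed
    show ?thesis
      using drift_bound_smooth[OF sq_trunc_deriv[OF a[of n]] sq_trunc'_deriv[OF a[of n]]
          sq_trunc''_cont[OF a[of n]] bnd sq_trunc''_le(1)[OF a[of n]] \<psi> d, folded wn_def hn_def, OF en]
      by (simp add: ip_def)
  qed
  have close: "(\<lambda>n. ip \<mu> \<psi> (u n)) \<longlonglongrightarrow> ip \<mu> \<psi> v"
    if u: "\<And>n. integrable \<mu> (u n)" "integrable \<mu> v" "(\<lambda>n. \<integral>x. \<bar>u n x - v x\<bar> \<partial>\<mu>) \<longlonglongrightarrow> 0" for u v
  proof -
    have "(\<lambda>n. ip \<mu> \<psi> (u n) - ip \<mu> \<psi> v) \<longlonglongrightarrow> 0"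
    proof (rule Lim_null_comparison[OF _ u(3)], rule always_eventually, rule allI)
      fix n
      have "ip \<mu> \<psi> (u n) - ip \<mu> \<psi> v = ip \<mu> \<psi> (\<lambda>x. u n x - v x)"
        using abs_ip_le_L1(2)[OF \<psi>m \<psi>(2,3)] u by (simp add: ip_def right_diff_distrib)
      then show "norm (ip \<mu> \<psi> (u n) - ip \<mu> \<psi> v) \<le> (\<integral>x. \<bar>u n x - v x\<bar> \<partial>\<mu>)"
        using abs_ip_le_L1(1)[OF \<psi>m \<psi>(2,3), of "\<lambda>x. u n x - v x"] u by simp
    qed
    then show ?thesis by (rule LIM_zero_cancel)
  qed
  have rS: "(\<lambda>n. \<integral>x. \<bar>S d (hn n) x - S d h2 x\<bar> \<partial>\<mu>) \<longlonglongrightarrow> 0"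
  proof (rule Lim_null_comparison[OF _ rh], rule always_eventually, rule allI)
    fix n
    have "(\<integral>x. \<bar>S d (hn n) x - S d h2 x\<bar> \<partial>\<mu>) = (\<integral>x. \<bar>S d (\<lambda>x. hn n x - h2 x) x\<bar> \<partial>\<mu>)"
    proof (rule integral_cong_AE)
      show "AE x in \<mu>. \<bar>S d (hn n) x - S d h2 x\<bar> = \<bar>S d (\<lambda>x. hn n x - h2 x) x\<bar>"
        using S_diff[OF d wi(3)[of n] h2_int] by eventually_elim simp
    qed (use S_integrable(2)[OF d wi(3)] S_integrable(2)[OF d h2_int] S_integrable(2)[OF d, of "\<lambda>x. hn n x - h2 x"] wi h2_int
        in \<open>auto dest!: borel_measurable_integrable\<close>)
    then show "norm (\<integral>x. \<bar>S d (hn n) x - S d h2 x\<bar> \<partial>\<mu>) \<le> (\<integral>x. \<bar>hn n x - h2 x\<bar> \<partial>\<mu>)"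
      using S_L1[OF d, of "\<lambda>x. hn n x - h2 x"] wi h2_int by simp
  qed
  have l1: "(\<lambda>n. ip \<mu> \<psi> (S d (hn n)) - ip \<mu> \<psi> (hn n)) \<longlonglongrightarrow> ip \<mu> \<psi> (S d h2) - ip \<mu> \<psi> h2"
    by (intro tendsto_diff close S_integrable(2)[OF d] wi h2_int rS rh)
  have l2: "(\<lambda>n. (- ip \<mu> \<psi> (wn n) + (e + 2 * (\<integral>x. \<bar>wn n x - w x\<bar> \<partial>\<mu>)) + 2 * K * (\<integral>x. \<psi> x \<partial>\<mu>)) * d)
    \<longlonglongrightarrow> (- ip \<mu> \<psi> w + (e + 2 * 0) + 2 * K * (\<integral>x. \<psi> x \<partial>\<mu>)) * d"
    by (intro tendsto_intros close wi rw)
  show ?thesis using LIMSEQ_le[OF l1 l2] bn by auto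
qed

text \<open>By how much the conditional mean of \<open>h2\<close> after time \<open>d\<close>
  exceeds its expected first order bound \<open>h2 - d w + 2 K d\<close>. The aim is that the
  positive part is o(d) in L1.\<close>

definition "excess d x = S d h2 x - h2 x + d * w x - 2 * K * d"

lemma excess_int: "0 \<le> d \<Longrightarrow> integrable \<mu> (excess d)"
  unfolding excess_def[abs_def] using S_integrable(2)[OF _ h2_int] h2_int L2_int[OF w_L2] by auto

lemma excess_smooth:
  assumes \<psi>: "\<psi> \<in> \<D>" "\<And>x. 0 \<le> \<psi> x" "\<And>x. \<psi> x \<le> 1" and d: "0 \<le> d"
    and e: "\<And>t. 0 \<le> t \<Longrightarrow> t \<le> d \<Longrightarrow> (\<integral>x. \<bar>S t w x - w x\<bar> \<partial>\<mu>) \<le> e"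
  shows "(\<integral>x. \<psi> x * excess d x \<partial>\<mu>) \<le> e * d"
proof -
  note m = L2_meas[OF D_form_L2[OF \<psi>(1)]]
  note i = abs_ip_le_L1(2)[OF m \<psi>(2,3)]
  have "(\<integral>x. \<psi> x * excess d x \<partial>\<mu>)
    = (\<integral>x. \<psi> x * S d h2 x - \<psi> x * h2 x + d * (\<psi> x * w x) - 2 * K * d * \<psi> x \<partial>\<mu>)"
    by (simp add: excess_def algebra_simps)
  also have "\<dots> = ip \<mu> \<psi> (S d h2) - ip \<mu> \<psi> h2 + d * ip \<mu> \<psi> w - 2 * K * d * (\<integral>x. \<psi> x \<partial>\<mu>)"
    using i[OF S_integrable(2)[OF d h2_int]] i[OF h2_int] i[OF L2_int[OF w_L2]] L2_int[OF D_form_L2[OF \<psi>(1)]]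
    by (simp add: ip_def)
  also have "\<dots> \<le> e * d" using drift_bound[OF \<psi> d e] by (simp add: algebra_simps)
  finally show ?thesis .
qed

text \<open>The indicator of a compact set is the limit of the bounded Lipschitz cutoffs
  \<open>p n\<close>, which lie in the form domain by \<open>C_Lip_D\<close> and so are admissible
  in \<open>excess_smooth\<close>.\<close>

lemma excess_compact:
  assumes C: "compact C" and d: "0 \<le> d" 
    and e: "\<And>t. 0 \<le> t \<Longrightarrow> t \<le> d \<Longrightarrow> (\<integral>x. \<bar>S t w x - w x\<bar> \<partial>\<mu>) \<le> e"
  shows "(\<integral>x. indicator C x * excess d x \<partial>\<mu>) \<le> e * d"
proof (cases "C = {}")
  \<comment> \<open>The distance to the empty set is 0 by convention, so the cutoffs below would be
    constantly 1.\<close>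
  case True
  have "0 \<le> e" using order_trans[OF _ e[of 0]] d by simp
  then show ?thesis using True d by simp
next
  case False
  have cl: "closed C" using C by (rule compact_imp_closed)
  then have [measurable]: "C \<in> sets borel" by simp
  define p where "p n x = max 0 (1 - real n * infdist x C)" for n x
  have p01: "0 \<le> p n x" "p n x \<le> 1" for n x
    using mult_nonneg_nonneg[OF of_nat_0_le_iff infdist_nonneg, of n x C] unfolding p_def by linarith+
  have lip: "(real n)-lipschitz_on UNIV (p n)" for n
  proof (rule lipschitz_on_realI)
    fix x y
    have "infdist y C \<le> infdist x C + dist x y" using infdist_triangle[of y C x] by (simp add: dist_commute)
    then have "real n * infdist y C \<le> real n * infdist x C + real n * dist x y"
      by (metis distrib_left mult_left_mono of_nat_0_le_iff)
    then show "p n x - p n y \<le> real n * dist x y"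
      using mult_nonneg_nonneg[OF of_nat_0_le_iff infdist_nonneg, of n x C]
        mult_nonneg_nonneg[OF of_nat_0_le_iff zero_le_dist, of n x y]
      unfolding p_def by linarith
  qed simp
  have pD: "p n \<in> \<D>" for n
  proof (rule C_Lip_D)
    show "p n \<in> C_Lip" using lip by (auto simp: C_Lip_def)
    show "bounded (range (p n))" by (rule boundedI[of _ 1]) (use p01[of n] in auto)
  qed
  have [measurable]: "p n \<in> borel_measurable borel" for n by (rule L2_meas[OF D_form_L2[OF pD]])
  have lim: "(\<lambda>n. \<integral>x. p n x * excess d x \<partial>\<mu>) \<longlonglongrightarrow> (\<integral>x. indicator C x * excess d x \<partial>\<mu>)"
  proof (rule integral_dominated_convergence[where w = "\<lambda>x. \<bar>excess d x\<bar>"])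
    show "AE x in \<mu>. (\<lambda>n. p n x * excess d x) \<longlonglongrightarrow> indicator C x * excess d x"
    proof (rule AE_I2, intro tendsto_mult tendsto_const)
      fix x
      show "(\<lambda>n. p n x) \<longlonglongrightarrow> indicator C x"
      proof (cases "x \<in> C")
        case True
        then show ?thesis by (simp add: p_def)
      next
        case nx: False
        then have pos: "0 < infdist x C"
          using in_closed_iff_infdist_zero[OF cl False, of x] infdist_nonneg[of x C] by (simp add: less_le)
        obtain N where N: "1 / infdist x C \<le> real N" using real_arch_simple by blast
        have "p n x = 0" if "n \<ge> N" for n
        proof -
          have "1 \<le> real N * infdist x C" using N pos by (simp add: divide_le_eq)
          also have "\<dots> \<le> real n * infdist x C" using that pos by (intro mult_right_mono) auto
          finally show ?thesis by (simp add: p_def)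
        qed
        then have "eventually (\<lambda>n. p n x = indicator C x) sequentially"
          using nx by (auto simp: eventually_sequentially)
        then show ?thesis by (rule tendsto_eventually)
      qed
    qed
    show "AE x in \<mu>. norm (p n x * excess d x) \<le> \<bar>excess d x\<bar>" for n
      using p01 by (intro AE_I2) (simp add: abs_mult mult_left_le_one_le)
  qed (use excess_int[OF d] in \<open>auto simp: meas_mu intro!: borel_measurable_times dest: borel_measurable_integrable\<close>)
  show ?thesis
    by (rule LIMSEQ_le_const2[OF lim]) (use excess_smooth[OF pD p01 d e] in auto)
qed

text \<open>The left-hand side is the mass of \<open>Q = {x. 0 < excess d x}\<close> under the
  measure \<open>m\<close> whose density is the positive part. Finite measures on a Polish space are
  inner regular, so compact subsets of \<open>Q\<close>, on which positive part and excess agree,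
  suffice.\<close>

lemma excess_pos_part:
  assumes d: "0 \<le> d" 
    and e: "\<And>t. 0 \<le> t \<Longrightarrow> t \<le> d \<Longrightarrow> (\<integral>x. \<bar>S t w x - w x\<bar> \<partial>\<mu>) \<le> e"
  shows "(\<integral>x. max 0 (excess d x) \<partial>\<mu>) \<le> e * d"
proof -
  have e0: "0 \<le> e" using order_trans[OF _ e[of 0]] d by simp
  have exm[measurable]: "excess d \<in> borel_measurable borel" using excess_int[OF d] by (auto simp: meas_mu dest: borel_measurable_integrable)
  have i: "integrable \<mu> (\<lambda>x. max 0 (excess d x))" using excess_int[OF d] by auto
  define m where "m = density \<mu> (\<lambda>x. ennreal (max 0 (excess d x)))"
  define Q where "Q = {x. 0 < excess d x}"
  have Qm[measurable]: "Q \<in> sets borel" unfolding Q_def by measurable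
  have em: "emeasure m A = (\<integral>\<^sup>+x. ennreal (max 0 (excess d x)) * indicator A x \<partial>\<mu>)" if "A \<in> sets borel" for A
    unfolding m_def by (rule emeasure_density) (use that in auto)
  have tot: "emeasure m Q = ennreal (\<integral>x. max 0 (excess d x) \<partial>\<mu>)"
  proof -
    have "emeasure m Q = (\<integral>\<^sup>+x. ennreal (max 0 (excess d x)) \<partial>\<mu>)"
      unfolding em[OF Qm] by (intro nn_integral_cong) (auto simp: Q_def indicator_def max_def)
    then show ?thesis using nn_integral_eq_integral[OF i] by simp
  qed
  have "emeasure m UNIV = (\<integral>\<^sup>+x. ennreal (max 0 (excess d x)) \<partial>\<mu>)"
    using em[of UNIV] by simp
  then have fin: "emeasure m (space m) \<noteq> \<infinity>"
    using nn_integral_eq_integral[OF i] by (simp add: m_def)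
  have "emeasure m Q = (SUP C \<in> {C. C \<subseteq> Q \<and> compact C}. emeasure m C)"
    by (rule inner_regular) (use fin in \<open>auto simp: m_def\<close>)
  also have "\<dots> \<le> ennreal (e * d)"
  proof (rule SUP_least)
    fix C assume C: "C \<in> {C. C \<subseteq> Q \<and> compact C}"
    then have [measurable]: "C \<in> sets borel" by (auto intro: borel_compact)
    have iC: "integrable \<mu> (\<lambda>x. indicator C x * excess d x)"
      using integrable_mult_indicator[of C \<mu> "excess d"] excess_int[OF d] by simp
    have "emeasure m C = (\<integral>\<^sup>+x. ennreal (indicator C x * excess d x) \<partial>\<mu>)"
      using C by (subst em) (auto intro!: nn_integral_cong simp: Q_def indicator_def max_def)
    also have "\<dots> = ennreal (\<integral>x. indicator C x * excess d x \<partial>\<mu>)"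
      by (rule nn_integral_eq_integral[OF iC]) (use C in \<open>auto simp: Q_def indicator_def intro!: AE_I2\<close>)
    also have "\<dots> \<le> ennreal (e * d)" using excess_compact[of C d e] C d e by (intro ennreal_leI) auto
    finally show "emeasure m C \<le> ennreal (e * d)" .
  qed
  finally show ?thesis using tot e0 d by simp
qed

text \<open>The modulus \<open>e\<close> of \<open>excess_pos_part\<close> is made small by strong
  continuity at \<open>w\<close>.\<close>

lemma excess_small:
  assumes "0 < \<epsilon>"
  shows "\<exists>d0>0. \<forall>d. 0 < d \<and> d < d0 \<longrightarrow> (\<integral>x. max 0 (excess d x) \<partial>\<mu>) \<le> \<epsilon> * d"
proof -
  have "((\<lambda>t. sqrt (sqn \<mu> (\<lambda>x. S t w x - w x))) \<longlongrightarrow> sqrt 0) (at_right 0)"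
    by (intro tendsto_real_sqrt sqn_S_tendsto w_L2)
  then have "eventually (\<lambda>t. sqrt (sqn \<mu> (\<lambda>x. S t w x - w x)) < \<epsilon>) (at_right 0)"
    using assms by (intro order_tendstoD(2)) auto
  then obtain d0 where d0: "d0 > 0" "\<And>t. 0 < t \<Longrightarrow> t < d0 \<Longrightarrow> sqrt (sqn \<mu> (\<lambda>x. S t w x - w x)) < \<epsilon>"
    by (auto simp: eventually_at_right_field)
  show ?thesis
  proof (intro exI[of _ d0] conjI allI impI)
    fix d assume d: "0 < d \<and> d < d0"
    show "(\<integral>x. max 0 (excess d x) \<partial>\<mu>) \<le> \<epsilon> * d"
    proof (rule excess_pos_part)
      fix t assume t: "0 \<le> t" "t \<le> d"
      show "(\<integral>x. \<bar>S t w x - w x\<bar> \<partial>\<mu>) \<le> \<epsilon>"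
      proof (cases "t = 0")
        case True
        then show ?thesis using S_0[OF L2_meas[OF w_L2]] assms by simp
      next
        case False
        have "(\<integral>x. \<bar>S t w x - w x\<bar> \<partial>\<mu>) \<le> sqrt (sqn \<mu> (\<lambda>x. S t w x - w x))"
          by (rule L1_le_sqn[OF prob_mu L2_diff[OF S_L2(1)[OF t(1) w_L2] w_L2]])
        then show ?thesis using d0(2)[of t] False t d by simp
      qed
    qed (use d in simp)
  qed (use d0 in simp)
qed

text \<open>\<open>Et d h h\<close> lies below its limit, the Dirichlet form, so this holds for
  every \<open>d > 0\<close> and not just asymptotically.\<close>

lemma increment_second_moment:
  assumes "0 < d"
  shows "sqn (J d) (\<lambda>z. h (snd z) - h (fst z)) \<le> 2 * K * d"
proof -
  have "Et d h h \<le> dirichlet_form P \<mu> h"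
    by (rule Et_le_limit[OF assms h_L2 Et_dirichlet[OF h_D]])
  also have "\<dots> = (\<integral>x. \<Gamma> h h x \<partial>\<mu>)" by (rule G_dirichlet[OF h_D])
  also have "\<dots> \<le> (\<integral>x. K \<partial>\<mu>)" by (rule integral_mono_AE[OF G_int[OF h_D h_D] _ G_le]) simp
  finally have "Et d h h \<le> K" using prob_space by simp
  then show ?thesis unfolding Et_J[OF assms h_L2, symmetric] using assms by (simp add: mult.commute)
qed

text \<open>Lindeberg condition. By the chain rule \<open>\<Gamma>(sin lh, sin lh) + \<Gamma>(cos lh, cos lh) = l\<^sup>2 \<Gamma>(h, h)\<close>, so that
  \<open>\<eta>\<^sup>2 - 2 (1 - cos (l \<eta>)) / l\<^sup>2\<close>, which dominates \<open>\<eta>\<^sup>2/2\<close> for \<open>\<bar>\<eta>\<bar> > \<delta>\<close>, has expectation \<open>o(d)\<close> for the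
  increment \<open>\<eta>\<close> of \<open>h\<close>.\<close>

lemma lindeberg:
  assumes "0 < \<delta>" "0 < \<epsilon>"
  shows "\<exists>d0>0. \<forall>d. 0 < d \<and> d < d0 \<longrightarrow>
    (\<integral>z. (h (snd z) - h (fst z))\<^sup>2 * indicator {z. \<delta> < \<bar>h (snd z) - h (fst z)\<bar>} z \<partial>J d) \<le> \<epsilon> * d"
proof -
  \<comment> \<open>With this \<open>l\<close>, the bound 1 - cos \<le> 2 makes the subtracted term
    in \<open>pt\<close> at most \<delta>^2, which is below \<eta>^2 on the event in
    question.\<close>
  define l where "l = sqrt 8 / \<delta>"
  have l: "0 < l" "l\<^sup>2 = 8 / \<delta>\<^sup>2" using assms by (auto simp: l_def power_divide)
  define s where "s x = sin (l * h x)" for x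
  define c where "c x = cos (l * h x)" for x
  have ds: "((\<lambda>x. sin (l * x)) has_real_derivative l * cos (l * x)) (at x)" for x
    by (auto intro!: derivative_eq_intros)
  have dc: "((\<lambda>x. cos (l * x)) has_real_derivative - l * sin (l * x)) (at x)" for x
    by (auto intro!: derivative_eq_intros)
  have cs: "continuous_on UNIV (\<lambda>x. l * cos (l * x))" "continuous_on UNIV (\<lambda>x. - l * sin (l * x))"
    by (intro continuous_intros)+
  have bs: "\<bar>sin (l * x)\<bar> \<le> 1" "\<bar>l * cos (l * x)\<bar> \<le> l" "\<bar>cos (l * x)\<bar> \<le> 1" "\<bar>- l * sin (l * x)\<bar> \<le> l" for x
    using l by (auto simp: abs_mult mult_left_le)
  note chs = G_chain1[OF ds cs(1) bs(1,2) h_D, folded s_def]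
  note chc = G_chain1[OF dc cs(2) bs(3,4) h_D, folded c_def]
  have sD: "s \<in> \<D>" "c \<in> \<D>" using chs(1) chc(1) by auto
  have L: "s \<in> L2fun \<mu>" "c \<in> L2fun \<mu>" using sD by (auto intro: D_form_L2)
  have sum: "(\<integral>x. \<Gamma> s s x \<partial>\<mu>) + (\<integral>x. \<Gamma> c c x \<partial>\<mu>) = l\<^sup>2 * (\<integral>x. \<Gamma> h h x \<partial>\<mu>)"
  proof -
    have "AE x in \<mu>. \<Gamma> s s x + \<Gamma> c c x = l\<^sup>2 * \<Gamma> h h x"
      using chs(2)[OF sD(1)] chc(2)[OF sD(2)] G_sym[OF h_D sD(1)] G_sym[OF h_D sD(2)] chs(2)[OF h_D] chc(2)[OF h_D]
    proof eventually_elim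
      case (elim x)
      have "\<Gamma> s s x + \<Gamma> c c x = l\<^sup>2 * \<Gamma> h h x * ((cos (l * h x))\<^sup>2 + (sin (l * h x))\<^sup>2)"
      proof -
        define p where "p = cos (l * h x)"
        define q where "q = sin (l * h x)"
        show ?thesis unfolding elim p_def[symmetric] q_def[symmetric] by (simp add: power2_eq_square algebra_simps)
      qed
      then show ?case by simp
    qed
    then have "(\<integral>x. \<Gamma> s s x + \<Gamma> c c x \<partial>\<mu>) = (\<integral>x. l\<^sup>2 * \<Gamma> h h x \<partial>\<mu>)"
      using G_int[OF sD(1,1)] G_int[OF sD(2,2)] G_int[OF h_D h_D]
      by (intro integral_cong_AE) (auto dest: borel_measurable_integrable)
    then show ?thesis using G_int[OF sD(1,1)] G_int[OF sD(2,2)] by simp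
  qed
  \<comment> \<open>\<open>r d * d\<close> is the mean of the right-hand side of \<open>pt\<close>;
    by \<open>sum\<close> the limits of its two parts cancel.\<close>
  define r where "r d = 4 * Et d h h - 4 * (Et d s s + Et d c c) / l\<^sup>2" for d
  have "(r \<longlongrightarrow> 4 * (\<integral>x. \<Gamma> h h x \<partial>\<mu>) - 4 * ((\<integral>x. \<Gamma> s s x \<partial>\<mu>) + (\<integral>x. \<Gamma> c c x \<partial>\<mu>)) / l\<^sup>2) (at_right 0)"
    unfolding r_def[abs_def] using l by (intro tendsto_intros Et_Gamma h_D sD) auto
  then have "(r \<longlongrightarrow> 0) (at_right 0)" unfolding sum using l(1) by simp
  then have "eventually (\<lambda>d. r d < \<epsilon>) (at_right 0)"
    using assms by (intro order_tendstoD(2)) auto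
  then obtain d0 where d0: "d0 > 0" "\<And>d. 0 < d \<Longrightarrow> d < d0 \<Longrightarrow> r d < \<epsilon>"
    by (auto simp: eventually_at_right_field)
  show ?thesis
  proof (intro exI[of _ d0] conjI allI impI)
    fix d assume d: "0 < d \<and> d < d0"
    then have d': "0 \<le> d" by simp
    define \<eta> where "\<eta> z = h (snd z) - h (fst z)" for z
    have \<eta>m[measurable]: "\<eta> \<in> borel_measurable (borel \<Otimes>\<^sub>M borel)"
      unfolding \<eta>_def by measurable
    have LJ: "\<eta> \<in> L2fun (J d)" "(\<lambda>z. s (snd z) - s (fst z)) \<in> L2fun (J d)" "(\<lambda>z. c (snd z) - c (fst z)) \<in> L2fun (J d)"
      unfolding \<eta>_def using L2_J[OF d'] h_L2 L by (auto intro!: L2_diff)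
    have pt: "(\<eta> z)\<^sup>2 * indicator {z. \<delta> < \<bar>\<eta> z\<bar>} z
      \<le> 2 * (\<eta> z)\<^sup>2 - 2 / l\<^sup>2 * ((s (snd z) - s (fst z))\<^sup>2 + (c (snd z) - c (fst z))\<^sup>2)" for z
    proof -
      \<comment> \<open>The squared chord between two points of the unit circle whose angles differ
        by \<open>l * \<eta> z\<close>.\<close>
      have e: "(s (snd z) - s (fst z))\<^sup>2 + (c (snd z) - c (fst z))\<^sup>2 = 2 * (1 - cos (l * \<eta> z))"
      proof -
        have "(s (snd z) - s (fst z))\<^sup>2 + (c (snd z) - c (fst z))\<^sup>2
          = ((sin (l * h (snd z)))\<^sup>2 + (cos (l * h (snd z)))\<^sup>2) + ((sin (l * h (fst z)))\<^sup>2 + (cos (l * h (fst z)))\<^sup>2)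
            - 2 * cos (l * h (snd z) - l * h (fst z))"
          unfolding s_def c_def cos_diff power2_diff by (simp add: algebra_simps)
        then show ?thesis by (simp add: \<eta>_def right_diff_distrib)
      qed
      show ?thesis
      proof (cases "\<delta> < \<bar>\<eta> z\<bar>")
        case True
        then have "\<delta>\<^sup>2 \<le> (\<eta> z)\<^sup>2" using assms power_mono[of \<delta> "\<bar>\<eta> z\<bar>" 2] by simp
        moreover have "2 * (1 - cos (l * \<eta> z)) \<le> 4"
        proof -
          define y where "y = cos (l * \<eta> z)"
          have "- 1 \<le> y" by (simp add: y_def)
          then have "2 * (1 - y) \<le> 4" by auto
          then show ?thesis by (simp only: y_def)
        qed
        then have "2 / l\<^sup>2 * (2 * (1 - cos (l * \<eta> z))) \<le> 2 / l\<^sup>2 * 4"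
          by (rule mult_left_mono) simp
        moreover have "2 / l\<^sup>2 * 4 = \<delta>\<^sup>2" using l assms by simp
        ultimately show ?thesis unfolding e using True by simp
      next
        case False
        have "2 / l\<^sup>2 * (2 * (1 - cos (l * \<eta> z))) \<le> 2 / l\<^sup>2 * (l * \<eta> z)\<^sup>2"
          by (intro mult_left_mono one_minus_cos_le) auto
        also have "\<dots> = 2 * (\<eta> z)\<^sup>2" using l(1) by (simp add: power_mult_distrib)
        finally show ?thesis unfolding e using False by simp
      qed
    qed
    have i: "integrable (J d) (\<lambda>z. (\<eta> z)\<^sup>2)" "integrable (J d) (\<lambda>z. (s (snd z) - s (fst z))\<^sup>2)"
      "integrable (J d) (\<lambda>z. (c (snd z) - c (fst z))\<^sup>2)"
      using LJ by (auto dest: L2D(2))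
    have "(\<integral>z. (\<eta> z)\<^sup>2 * indicator {z. \<delta> < \<bar>\<eta> z\<bar>} z \<partial>J d)
      \<le> (\<integral>z. 2 * (\<eta> z)\<^sup>2 - 2 / l\<^sup>2 * ((s (snd z) - s (fst z))\<^sup>2 + (c (snd z) - c (fst z))\<^sup>2) \<partial>J d)"
    proof (rule integral_mono)
      show "integrable (J d) (\<lambda>z. (\<eta> z)\<^sup>2 * indicator {z. \<delta> < \<bar>\<eta> z\<bar>} z)"
      proof (rule Bochner_Integration.integrable_bound[OF i(1)])
        have "{z. \<delta> < \<bar>\<eta> z\<bar>} \<in> sets (borel \<Otimes>\<^sub>M borel)"
        proof -
          have "{z \<in> space (borel \<Otimes>\<^sub>M borel). \<delta> < \<bar>\<eta> z\<bar>} \<in> sets (borel \<Otimes>\<^sub>M borel)" by measurable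
          then show ?thesis by (simp add: space_pair_measure)
        qed
        then show "(\<lambda>z. (\<eta> z)\<^sup>2 * indicator {z. \<delta> < \<bar>\<eta> z\<bar>} z) \<in> borel_measurable (J d)"
          by (simp add: J_meas[OF d'])
      qed (auto simp: indicator_def)
    qed (use i pt in auto)
    also have "\<dots> = 2 * sqn (J d) \<eta> - 2 / l\<^sup>2 * (sqn (J d) (\<lambda>z. s (snd z) - s (fst z)) + sqn (J d) (\<lambda>z. c (snd z) - c (fst z)))"
      using i by (simp add: sqn_def)
    also have "\<dots> = r d * d"
      unfolding \<eta>_def using Et_J[of d] h_L2 L d
      by (simp add: r_def algebra_simps flip: Et_J) (simp add: add_divide_distrib)
    also have "\<dots> \<le> \<epsilon> * d" using d0(2)[of d] d by (intro mult_right_mono) auto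
    finally show "(\<integral>z. (h (snd z) - h (fst z))\<^sup>2 * indicator {z. \<delta> < \<bar>h (snd z) - h (fst z)\<bar>} z \<partial>J d) \<le> \<epsilon> * d"
      unfolding \<eta>_def .
  qed (use d0 in simp)
qed

end

section \<open>Gaussian averages and Taylor expansions\<close>

text \<open>The parameter is the variance. At \<open>v = 0\<close> the density vanishes identically
  through division by zero, so degenerate cases are treated apart.\<close>

definition gauss :: "real \<Rightarrow> real measure" where
  "gauss v = density lborel (\<lambda>x. ennreal (normal_density 0 (sqrt v) x))"

definition gavg :: "real \<Rightarrow> (real \<Rightarrow> real) \<Rightarrow> real \<Rightarrow> real" where
  "gavg v u x = (\<integral>z. u (x + z) \<partial>gauss v)"

lemma sets_gauss[simp, measurable_cong]: "sets (gauss v) = sets borel"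
  by (simp add: gauss_def)

lemma space_gauss[simp]: "space (gauss v) = UNIV"
  by (simp add: gauss_def)

lemma gauss_int:
  assumes "f \<in> borel_measurable borel"
  shows "integrable (gauss v) f \<longleftrightarrow> integrable lborel (\<lambda>x. normal_density 0 (sqrt v) x * f x)"
    and "(\<integral>x. f x \<partial>gauss v) = (\<integral>x. normal_density 0 (sqrt v) x * f x \<partial>lborel)"
  unfolding gauss_def using assms by (simp_all add: integrable_real_density integral_real_density)

context
  fixes v :: real assumes v: "0 < v"
begin

lemma prob_gauss: "prob_space (gauss v)"
  unfolding gauss_def using v by (intro prob_space_normal_density) simp

lemma gauss_moments:
  "integrable (gauss v) (\<lambda>z. z)" "(\<integral>z. z \<partial>gauss v) = 0"
  "integrable (gauss v) (\<lambda>z. z\<^sup>2)" "(\<integral>z. z\<^sup>2 \<partial>gauss v) = v"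
  "integrable (gauss v) (\<lambda>z. z ^ 4)" "(\<integral>z. z ^ 4 \<partial>gauss v) = 3 * v\<^sup>2"
proof -
  have s: "0 < sqrt v" using v by simp
  note m = integrable_normal_moment[OF s, of 0]
  show "integrable (gauss v) (\<lambda>z. z)" "integrable (gauss v) (\<lambda>z. z\<^sup>2)" "integrable (gauss v) (\<lambda>z. z ^ 4)"
    using m[of 1] m[of 2] m[of 4] by (simp_all add: gauss_int)
  show "(\<integral>z. z \<partial>gauss v) = 0"
    using integral_normal_moment_odd[OF s, of 0 0] by (simp add: gauss_int)
  show "(\<integral>z. z\<^sup>2 \<partial>gauss v) = v"
    using integral_normal_moment_even[OF s, of 0 1] v by (simp add: gauss_int)
  have "(\<integral>z. z ^ 4 \<partial>gauss v) = fact 4 / ((2 / v)\<^sup>2 * fact 2)"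
    using integral_normal_moment_even[OF s, of 0 2] v by (simp add: gauss_int)
  also have "\<dots> = 3 * v\<^sup>2" using v by (simp add: fact_numeral power_divide)
  finally show "(\<integral>z. z ^ 4 \<partial>gauss v) = 3 * v\<^sup>2" .
qed

end

lemma gauss_convolution:
  assumes "0 < s" "0 < v"
  shows "distr (gauss s \<Otimes>\<^sub>M gauss v) borel (\<lambda>(x, y). x + y) = gauss (s + v)"
proof -
  interpret A: prob_space "gauss s" by (rule prob_gauss[OF assms(1)])
  interpret B: prob_space "gauss v" by (rule prob_gauss[OF assms(2)])
  have "gauss s \<star> gauss v = density lborel (\<lambda>x. \<integral>\<^sup>+y. ennreal (normal_density 0 (sqrt s) (x - y)) * ennreal (normal_density 0 (sqrt v) y) \<partial>lborel)"
    unfolding gauss_def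
    by (rule convolution_density)
      (use A.finite_measure_axioms B.finite_measure_axioms in \<open>auto simp: gauss_def\<close>)
  also have "(\<lambda>x. \<integral>\<^sup>+y. ennreal (normal_density 0 (sqrt s) (x - y)) * ennreal (normal_density 0 (sqrt v) y) \<partial>lborel)
      = (\<lambda>x. ennreal (normal_density 0 (sqrt ((sqrt s)\<^sup>2 + (sqrt v)\<^sup>2)) x))"
    using conv_normal_density_zero_mean[of "sqrt s" "sqrt v"] assms
    by (simp add: ennreal_mult'' normal_density_nonneg)
  also have "(sqrt s)\<^sup>2 + (sqrt v)\<^sup>2 = s + v" using assms by simp
  finally show ?thesis by (simp add: convolution_def gauss_def)
qed

lemma lip_borel:
  fixes u :: "real \<Rightarrow> real"
  assumes "\<And>x y. \<bar>u x - u y\<bar> \<le> c * \<bar>x - y\<bar>"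
  shows "u \<in> borel_measurable borel"
proof -
  have "0 \<le> c" using assms[of 1 0] by simp
  then have "c-lipschitz_on UNIV u"
    by (intro lipschitz_onI) (use assms in \<open>auto simp: dist_real_def\<close>)
  from lipschitz_on_continuous_on[OF this] show ?thesis by (rule borel_measurable_continuous_onI)
qed

lemma lip_gauss_integrable:
  fixes u :: "real \<Rightarrow> real"
  assumes u: "\<And>x y. \<bar>u x - u y\<bar> \<le> c * \<bar>x - y\<bar>" and v: "0 < v"
  shows "integrable (gauss v) (\<lambda>z. u (x + z))"
proof (rule Bochner_Integration.integrable_bound)
  interpret prob_space "gauss v" by (rule prob_gauss[OF v])
  show "integrable (gauss v) (\<lambda>z. \<bar>u x\<bar> + c * \<bar>z\<bar>)"
    using gauss_moments(1)[OF v] by simp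
  have c: "0 \<le> c" using u[of 1 0] by simp
  have "\<bar>u (x + z)\<bar> \<le> \<bar>u x\<bar> + c * \<bar>z\<bar>" for z
    using u[of "x + z" x] by simp
  then show "AE z in gauss v. norm (u (x + z)) \<le> norm (\<bar>u x\<bar> + c * \<bar>z\<bar>)"
    using c by (intro AE_I2) simp
  have [measurable]: "u \<in> borel_measurable borel" by (rule lip_borel[OF u])
  show "(\<lambda>z. u (x + z)) \<in> borel_measurable (gauss v)" by measurable
qed

lemma gavg_lip:
  fixes u :: "real \<Rightarrow> real"
  assumes u: "\<And>x y. \<bar>u x - u y\<bar> \<le> c * \<bar>x - y\<bar>" and v: "0 < v"
  shows "\<bar>gavg v u x - gavg v u y\<bar> \<le> c * \<bar>x - y\<bar>"
proof -
  interpret prob_space "gauss v" by (rule prob_gauss[OF v])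
  have i: "integrable (gauss v) (\<lambda>z. u (x + z))" for x by (rule lip_gauss_integrable[OF u v])
  have "\<bar>gavg v u x - gavg v u y\<bar> = \<bar>\<integral>z. u (x + z) - u (y + z) \<partial>gauss v\<bar>"
    unfolding gavg_def using i by simp
  also have "\<dots> \<le> (\<integral>z. \<bar>u (x + z) - u (y + z)\<bar> \<partial>gauss v)" by (rule integral_abs_bound)
  also have "\<dots> \<le> (\<integral>z. c * \<bar>x - y\<bar> \<partial>gauss v)"
  proof (rule integral_mono)
    show "\<bar>u (x + z) - u (y + z)\<bar> \<le> c * \<bar>x - y\<bar>" for z using u[of "x + z" "y + z"] by simp
  qed (use i in auto)
  also have "\<dots> = c * \<bar>x - y\<bar>" using prob_space by simp
  finally show ?thesis .
qed

text \<open>Variances of independent Gaussians add; this merges the replaced steps of the chain into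
  a single average.\<close>

lemma gavg_gavg:
  fixes u :: "real \<Rightarrow> real"
  assumes u: "\<And>x y. \<bar>u x - u y\<bar> \<le> c * \<bar>x - y\<bar>" and "0 < s" "0 < v"
  shows "gavg s (gavg v u) x = gavg (s + v) u x"
proof -
  interpret A: prob_space "gauss s" by (rule prob_gauss[OF assms(2)])
  interpret B: prob_space "gauss v" by (rule prob_gauss[OF assms(3)])
  interpret AB: pair_prob_space "gauss s" "gauss v" ..
  have [measurable]: "u \<in> borel_measurable borel" by (rule lip_borel[OF u])
  have i0: "integrable (gauss (s + v)) (\<lambda>z. u (x + z))"
    by (rule lip_gauss_integrable[OF u]) (use assms in simp)
  have m: "(\<lambda>(a, b). a + b) \<in> gauss s \<Otimes>\<^sub>M gauss v \<rightarrow>\<^sub>M (borel :: real measure)" by measurable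
  have mu: "(\<lambda>z. u (x + z)) \<in> borel_measurable borel" by measurable
  have i: "integrable (gauss s \<Otimes>\<^sub>M gauss v) (\<lambda>p. u (x + (case p of (a, b) \<Rightarrow> a + b)))"
    using i0 integrable_distr_eq[OF m mu] unfolding gauss_convolution[OF assms(2,3)] by simp
  have "gavg (s + v) u x = (\<integral>p. u (x + (case p of (a, b) \<Rightarrow> a + b)) \<partial>(gauss s \<Otimes>\<^sub>M gauss v))"
    unfolding gavg_def gauss_convolution[OF assms(2,3), symmetric] by (rule integral_distr[OF m mu])
  also have "\<dots> = (\<integral>a. \<integral>b. u (x + (a + b)) \<partial>gauss v \<partial>gauss s)"
    using AB.integral_fst'[OF i] by simp
  finally show ?thesis by (simp add: gavg_def add.assoc)
qed

text \<open>One constant for all bounds, so that it can be carried through an induction. The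
  remainder is cubic for small increments, which makes it o(d) under the Lindeberg condition, and
  quadratic for large ones, which needs second moments only. The sign of \<open>u2\<close> encodes
  convexity and lets upper bounds on variances be used.\<close>

definition taylor2 :: "real \<Rightarrow> (real \<Rightarrow> real) \<Rightarrow> (real \<Rightarrow> real) \<Rightarrow> (real \<Rightarrow> real) \<Rightarrow> bool" where
  "taylor2 c u u1 u2 \<longleftrightarrow> (\<forall>x y. \<bar>u x - u y\<bar> \<le> c * \<bar>x - y\<bar>) \<and>
    u1 \<in> borel_measurable borel \<and> u2 \<in> borel_measurable borel \<and>
    (\<forall>x. \<bar>u1 x\<bar> \<le> c) \<and> (\<forall>x. 0 \<le> u2 x \<and> u2 x \<le> c) \<and>
    (\<forall>x y. \<bar>u (x + y) - u x - u1 x * y - u2 x * y\<^sup>2 / 2\<bar> \<le> c * min (y\<^sup>2) (\<bar>y\<bar> ^ 3))"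

lemma taylor2D:
  assumes "taylor2 c u u1 u2"
  shows "\<And>x y. \<bar>u x - u y\<bar> \<le> c * \<bar>x - y\<bar>"
    "u1 \<in> borel_measurable borel" "u2 \<in> borel_measurable borel"
    "\<And>x. \<bar>u1 x\<bar> \<le> c" "\<And>x. 0 \<le> u2 x" "\<And>x. u2 x \<le> c"
    "\<And>x y. \<bar>u (x + y) - u x - u1 x * y - u2 x * y\<^sup>2 / 2\<bar> \<le> c * min (y\<^sup>2) (\<bar>y\<bar> ^ 3)"
    "u \<in> borel_measurable borel" "0 \<le> c"
proof -
  show l: "\<And>x y. \<bar>u x - u y\<bar> \<le> c * \<bar>x - y\<bar>"
    "u1 \<in> borel_measurable borel" "u2 \<in> borel_measurable borel"
    "\<And>x. \<bar>u1 x\<bar> \<le> c" "\<And>x. 0 \<le> u2 x" "\<And>x. u2 x \<le> c"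
    "\<And>x y. \<bar>u (x + y) - u x - u1 x * y - u2 x * y\<^sup>2 / 2\<bar> \<le> c * min (y\<^sup>2) (\<bar>y\<bar> ^ 3)"
    using assms by (auto simp: taylor2_def)
  show "u \<in> borel_measurable borel" by (rule lip_borel[OF l(1)])
  show "0 \<le> c" using l(5)[of 0] l(6)[of 0] by simp
qed

text \<open>Every condition is invariant under translation and stable under averaging, so the
  constant stays the same; repeated replacement thus accumulates no factor.\<close>

lemma taylor2_gavg:
  assumes t: "taylor2 c u u1 u2" and v: "0 < v"
  shows "taylor2 c (gavg v u) (gavg v u1) (gavg v u2)"
proof -
  note u = taylor2D[OF t]
  note [measurable] = u(2,3,8)
  interpret prob_space "gauss v" by (rule prob_gauss[OF v])
  have i0: "integrable (gauss v) (\<lambda>z. u (x + z))" for x by (rule lip_gauss_integrable[OF u(1) v])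
  have i1: "integrable (gauss v) (\<lambda>z. u1 (x + z))" for x
    by (rule integrable_const_bound[of _ c]) (use u(4) in auto)
  have i2: "integrable (gauss v) (\<lambda>z. u2 (x + z))" for x
    by (rule integrable_const_bound[of _ c]) (use u(5,6) in auto)
  have m: "gavg v f \<in> borel_measurable borel" if [measurable]: "f \<in> borel_measurable borel" for f
    unfolding gavg_def[abs_def] by (rule borel_measurable_lebesgue_integral) measurable
  have bnd: "\<bar>gavg v u1 x\<bar> \<le> c" for x
  proof -
    have "\<bar>gavg v u1 x\<bar> \<le> (\<integral>z. \<bar>u1 (x + z)\<bar> \<partial>gauss v)" unfolding gavg_def by (rule integral_abs_bound)
    also have "\<dots> \<le> c" by (rule integral_le_const) (use i1 u(4) in auto)
    finally show ?thesis .
  qed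
  have bnd2: "0 \<le> gavg v u2 x" "gavg v u2 x \<le> c" for x
    unfolding gavg_def by (rule integral_ge_const integral_le_const; use i2 u(5,6) in auto)+
  have "\<bar>gavg v u (x + y) - gavg v u x - gavg v u1 x * y - gavg v u2 x * y\<^sup>2 / 2\<bar>
      \<le> c * min (y\<^sup>2) (\<bar>y\<bar> ^ 3)" for x y
  proof -
    have e: "gavg v u (x + y) - gavg v u x - gavg v u1 x * y - gavg v u2 x * y\<^sup>2 / 2
      = (\<integral>z. u (x + y + z) - u (x + z) - u1 (x + z) * y - u2 (x + z) * y\<^sup>2 / 2 \<partial>gauss v)"
      unfolding gavg_def using i0 i1 i2 by simp
    have "\<bar>gavg v u (x + y) - gavg v u x - gavg v u1 x * y - gavg v u2 x * y\<^sup>2 / 2\<bar>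
      \<le> (\<integral>z. \<bar>u (x + y + z) - u (x + z) - u1 (x + z) * y - u2 (x + z) * y\<^sup>2 / 2\<bar> \<partial>gauss v)"
      unfolding e by (rule integral_abs_bound)
    also have "\<dots> \<le> c * min (y\<^sup>2) (\<bar>y\<bar> ^ 3)"
    proof (rule integral_le_const)
      show "AE z in gauss v. \<bar>u (x + y + z) - u (x + z) - u1 (x + z) * y - u2 (x + z) * y\<^sup>2 / 2\<bar> \<le> c * min (y\<^sup>2) (\<bar>y\<bar> ^ 3)"
      proof (rule AE_I2)
        fix z
        have "x + y + z = x + z + y" by simp
        then show "\<bar>u (x + y + z) - u (x + z) - u1 (x + z) * y - u2 (x + z) * y\<^sup>2 / 2\<bar> \<le> c * min (y\<^sup>2) (\<bar>y\<bar> ^ 3)"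
          using u(7)[of "x + z" y] by (simp only:)
      qed
    qed (use i0 i1 i2 in auto)
    finally show ?thesis .
  qed
  then show ?thesis
    unfolding taylor2_def using gavg_lip[OF u(1) v] m[OF u(2)] m[OF u(3)] bnd bnd2 by auto
qed

text \<open>The linear term averages to 0 and the quadratic one to \<open>v / 2 * u2 x\<close>; a
  bound from below is wanted because the chain is compared with the Gaussian from below.\<close>

lemma gavg_lower:
  assumes t: "taylor2 c u u1 u2" and v: "0 < v"
  shows "u x + v / 2 * u2 x - c * (\<integral>z. min (z\<^sup>2) (\<bar>z\<bar> ^ 3) \<partial>gauss v) \<le> gavg v u x"
proof -
  note u = taylor2D[OF t]
  interpret prob_space "gauss v" by (rule prob_gauss[OF v])
  have im: "integrable (gauss v) (\<lambda>z. min (z\<^sup>2) (\<bar>z\<bar> ^ 3))"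
    by (rule Bochner_Integration.integrable_bound[OF gauss_moments(3)[OF v]]) auto
  have "(\<integral>z. u x + u1 x * z + u2 x / 2 * z\<^sup>2 - c * min (z\<^sup>2) (\<bar>z\<bar> ^ 3) \<partial>gauss v) \<le> gavg v u x"
    unfolding gavg_def
  proof (rule integral_mono)
    show "integrable (gauss v) (\<lambda>z. u (x + z))" by (rule lip_gauss_integrable[OF u(1) v])
    show "u x + u1 x * z + u2 x / 2 * z\<^sup>2 - c * min (z\<^sup>2) (\<bar>z\<bar> ^ 3) \<le> u (x + z)" for z
      using u(7)[of x z] by (simp add: abs_le_iff)
  qed (use gauss_moments[OF v] im in auto)
  moreover have "(\<integral>z. u x + u1 x * z + u2 x / 2 * z\<^sup>2 - c * min (z\<^sup>2) (\<bar>z\<bar> ^ 3) \<partial>gauss v)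
    = u x + u2 x / 2 * v - c * (\<integral>z. min (z\<^sup>2) (\<bar>z\<bar> ^ 3) \<partial>gauss v)"
    using gauss_moments[OF v] im prob_space by simp
  ultimately show ?thesis by (simp add: mult.commute)
qed

text \<open>One-sided: an upper bound of order o(d) as \<open>d\<close> decreases to 0.\<close>

definition small_o :: "(real \<Rightarrow> real) \<Rightarrow> bool" where
  "small_o q \<longleftrightarrow> (\<forall>\<epsilon>>0. eventually (\<lambda>d. q d \<le> \<epsilon> * d) (at_right 0))"

lemma small_oD: "small_o q \<Longrightarrow> 0 < \<epsilon> \<Longrightarrow> eventually (\<lambda>d. q d \<le> \<epsilon> * d) (at_right 0)"
  by (simp add: small_o_def)

lemma small_o_add: assumes "small_o p" "small_o q" shows "small_o (\<lambda>d. p d + q d)"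
  unfolding small_o_def
proof (intro allI impI)
  fix \<epsilon> :: real assume "0 < \<epsilon>"
  then have "0 < \<epsilon> / 2" by simp
  from small_oD[OF assms(1) this] small_oD[OF assms(2) this]
  show "eventually (\<lambda>d. p d + q d \<le> \<epsilon> * d) (at_right 0)" by eventually_elim (simp add: field_simps)
qed

lemma small_o_cmult: assumes "small_o p" "0 \<le> c" shows "small_o (\<lambda>d. c * p d)"
  unfolding small_o_def
proof (intro allI impI)
  fix \<epsilon> :: real assume e: "0 < \<epsilon>"
  then have "0 < \<epsilon> / (c + 1)" using assms(2) by simp
  from small_oD[OF assms(1) this] eventually_at_right_less[of "0::real"]
  show "eventually (\<lambda>d. c * p d \<le> \<epsilon> * d) (at_right 0)"
  proof eventually_elim
    case (elim d)
    have "c * p d \<le> c * (\<epsilon> / (c + 1) * d)" using elim assms(2) by (intro mult_left_mono) auto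
    also have "\<dots> = c / (c + 1) * (\<epsilon> * d)" by simp
    also have "\<dots> \<le> 1 * (\<epsilon> * d)" using assms(2) e elim by (intro mult_right_mono) auto
    finally show ?case by simp
  qed
qed

lemma small_o_mono:
  assumes "small_o q" "eventually (\<lambda>d. p d \<le> q d) (at_right 0)" shows "small_o p"
  unfolding small_o_def
proof (intro allI impI)
  fix \<epsilon> :: real assume "0 < \<epsilon>"
  from small_oD[OF assms(1) this] assms(2)
  show "eventually (\<lambda>d. p d \<le> \<epsilon> * d) (at_right 0)" by eventually_elim simp
qed

lemma small_o_square: assumes "0 \<le> a" shows "small_o (\<lambda>d. a * d\<^sup>2)"
  unfolding small_o_def
proof (intro allI impI)
  fix \<epsilon> :: real assume e: "0 < \<epsilon>"
  have "eventually (\<lambda>d. d < \<epsilon> / (a + 1)) (at_right (0::real))"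
    using e assms by (intro eventually_at_rightI[of 0 "\<epsilon> / (a + 1)"]) auto
  then show "eventually (\<lambda>d. a * d\<^sup>2 \<le> \<epsilon> * d) (at_right 0)"
    using eventually_at_right_less[of "0::real"]
  proof eventually_elim
    case (elim d)
    have "a * d \<le> (a + 1) * d" using elim by simp
    also have "\<dots> \<le> \<epsilon>" using elim(1) assms by (simp add: field_simps)
    finally show ?case using elim(2) by (simp add: power2_eq_square flip: mult.assoc)
  qed
qed

text \<open>The cutoff \<delta> is fixed first, so small that the linear part is below half of the
  allowance; then \<open>d\<close> is sent to 0.\<close>

lemma small_o_family:
  assumes "\<And>\<delta>. 0 < \<delta> \<Longrightarrow> small_o (q \<delta>)" "0 \<le> c"
    and "\<And>\<delta>. 0 < \<delta> \<Longrightarrow> eventually (\<lambda>d. p d \<le> \<delta> * (c * d) + q \<delta> d) (at_right 0)"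
  shows "small_o p"
  unfolding small_o_def
proof (intro allI impI)
  fix \<epsilon> :: real assume e: "0 < \<epsilon>"
  define \<delta> where "\<delta> = \<epsilon> / (2 * (c + 1))"
  have d: "0 < \<delta>" using e assms(2) by (simp add: \<delta>_def)
  have "0 < \<epsilon> / 2" using e by simp
  from small_oD[OF assms(1)[OF d] this] assms(3)[OF d] eventually_at_right_less[of "0::real"]
  show "eventually (\<lambda>d. p d \<le> \<epsilon> * d) (at_right 0)"
  proof eventually_elim
    case (elim x)
    have "\<delta> * c \<le> \<delta> * (c + 1)" using d by simp
    also have "\<dots> = \<epsilon> / 2" using assms(2) by (simp add: \<delta>_def field_simps)
    finally have "(\<delta> * c) * x \<le> \<epsilon> / 2 * x" using elim by (intro mult_right_mono) auto
    then have "\<delta> * (c * x) \<le> \<epsilon> / 2 * x" by (simp only: mult.assoc)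
    then show ?case using elim(1,2) by linarith
  qed
qed

text \<open>The modulus of \<open>z\<close> is at most
  \<open>\<delta> + z\<^sup>2 / \<delta>\<close>, so the cube is traded for a small multiple of the
  square and a fourth power, whose Gaussian mean is of order \<open>d\<^sup>2\<close>.\<close>

lemma min_square_cube_le:
  fixes z \<delta> :: real
  assumes "0 < \<delta>"
  shows "min (z\<^sup>2) (\<bar>z\<bar> ^ 3) \<le> \<delta> * z\<^sup>2 + z ^ 4 / \<delta>"
proof -
  have "0 \<le> (\<bar>z\<bar> - \<delta> / 2)\<^sup>2" by simp
  then have "\<delta> * \<bar>z\<bar> \<le> z\<^sup>2 + \<delta>\<^sup>2 / 4" by (simp add: power2_diff power_divide mult.commute)
  moreover have "\<delta>\<^sup>2 / 4 \<le> \<delta>\<^sup>2" by simp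
  ultimately have "\<delta> * \<bar>z\<bar> \<le> \<delta>\<^sup>2 + z\<^sup>2" by linarith
  then have "\<bar>z\<bar> \<le> \<delta> + z\<^sup>2 / \<delta>" using assms by (simp add: field_simps power2_eq_square)
  then have "z\<^sup>2 * \<bar>z\<bar> \<le> z\<^sup>2 * (\<delta> + z\<^sup>2 / \<delta>)" by (intro mult_left_mono) auto
  moreover have "z\<^sup>2 * \<bar>z\<bar> = \<bar>z\<bar> ^ 3" by (simp add: power3_eq_cube power2_eq_square abs_mult_self)
  moreover have "z\<^sup>2 * (\<delta> + z\<^sup>2 / \<delta>) = \<delta> * z\<^sup>2 + z ^ 4 / \<delta>"
    by (simp add: algebra_simps power4_eq_xxxx power2_eq_square)
  ultimately show ?thesis by linarith
qed

lemma small_o_gauss: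
  assumes "0 < K"
  shows "small_o (\<lambda>d. \<integral>z. min (z\<^sup>2) (\<bar>z\<bar> ^ 3) \<partial>gauss (2 * K * d))"
proof (rule small_o_family)
  fix \<delta> :: real assume \<delta>: "0 < \<delta>"
  \<comment> \<open>The fourth moment is 3 v^2 with \<open>v = 2 * K * d\<close>, divided by
    \<delta>.\<close>
  show "small_o (\<lambda>d. 12 * K\<^sup>2 / \<delta> * d\<^sup>2)" by (rule small_o_square) (use \<delta> in simp)
  show "eventually (\<lambda>d. (\<integral>z. min (z\<^sup>2) (\<bar>z\<bar> ^ 3) \<partial>gauss (2 * K * d)) \<le> \<delta> * (2 * K * d) + 12 * K\<^sup>2 / \<delta> * d\<^sup>2) (at_right 0)"
    using eventually_at_right_less[of "0::real"]
  proof eventually_elim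
    case (elim d)
    then have v: "0 < 2 * K * d" using assms by simp
    note g = gauss_moments[OF v]
    have "(\<integral>z. min (z\<^sup>2) (\<bar>z\<bar> ^ 3) \<partial>gauss (2 * K * d)) \<le> (\<integral>z. \<delta> * z\<^sup>2 + z ^ 4 / \<delta> \<partial>gauss (2 * K * d))"
    proof (rule integral_mono)
      show "integrable (gauss (2 * K * d)) (\<lambda>z. min (z\<^sup>2) (\<bar>z\<bar> ^ 3))"
        by (rule Bochner_Integration.integrable_bound[OF g(3)]) auto
    qed (use g min_square_cube_le[OF \<delta>] in auto)
    also have "\<dots> = \<delta> * (2 * K * d) + 3 * (2 * K * d)\<^sup>2 / \<delta>" using g by simp
    finally show ?case by (simp add: power_mult_distrib mult_ac)
  qed
qed (use assms in simp)

lemma sqn_scale: "sqn M (\<lambda>x. c * f x) = c\<^sup>2 * sqn M f"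
  by (simp add: sqn_def power_mult_distrib)

section \<open>One step of the sampled chain\<close>

context poisson_solution
begin

text \<open>Step of an approximate martingale along the chain. Its conditional mean is
  \<open>rho\<close>, which is o(d) in L2 because -\<L> h = g, and \<open>hlag\<close> collects what
  depends on the starting point, so that \<open>incr d x y = h y - hlag d x\<close>.\<close>

definition "incr d x y = h y - h x + d * g x"
definition "rho d x = S d h x - h x + d * g x"
definition "hlag d x = h x - d * g x"

text \<open>The errors of one replacement step, in this order: Taylor remainder of the Gaussian,
  conditional mean, excess variance, cross term of the conditional variance, Taylor remainder of the
  increment.\<close>

definition "err d = (\<integral>z. min (z\<^sup>2) (\<bar>z\<bar> ^ 3) \<partial>gauss (2 * K * d)) + (\<integral>x. \<bar>rho d x\<bar> \<partial>\<mu>)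
   + (\<integral>x. max 0 (excess d x) \<partial>\<mu>) + (\<integral>x. \<bar>hlag d x * rho d x\<bar> \<partial>\<mu>)
   + (\<integral>z. min ((incr d (fst z) (snd z))\<^sup>2) (\<bar>incr d (fst z) (snd z)\<bar> ^ 3) \<partial>J d)"

lemma B_nonneg: "0 \<le> B" using g_bdd[of undefined] by simp

lemma incr_meas[measurable]: "(\<lambda>z. incr d (fst z) (snd z)) \<in> borel_measurable (borel \<Otimes>\<^sub>M borel)"
  unfolding incr_def by measurable

lemma rho_L2: "0 \<le> d \<Longrightarrow> rho d \<in> L2fun \<mu>"
  unfolding rho_def[abs_def] by (intro L2_add L2_diff L2_scale S_L2 h_L2 g_L2)

lemma hlag_L2: "hlag d \<in> L2fun \<mu>"
  unfolding hlag_def[abs_def] by (intro L2_diff L2_scale h_L2 g_L2)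

lemma incr_L2: "0 \<le> d \<Longrightarrow> (\<lambda>z. incr d (fst z) (snd z)) \<in> L2fun (J d)"
  unfolding incr_def by (intro L2_add L2_diff L2_scale L2_J h_L2 g_L2)

lemma small_o_rho: "small_o (\<lambda>d. sqrt (sqn \<mu> (rho d)))"
  unfolding small_o_def
proof (intro allI impI)
  fix \<epsilon> :: real assume e: "0 < \<epsilon>"
  note gg = ggD[OF hg]
  have "((\<lambda>d. sqn \<mu> (\<lambda>x. (S d h x - h x) / d - - g x)) \<longlongrightarrow> 0) (at_right 0)"
    using gg L2_tendsto_iff[OF gg(4,2)] by simp
  from tendsto_real_sqrt[OF this]
  have "eventually (\<lambda>d. sqrt (sqn \<mu> (\<lambda>x. (S d h x - h x) / d - - g x)) < \<epsilon>) (at_right 0)"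
    using e by (intro order_tendstoD(2)) auto
  then show "eventually (\<lambda>d. sqrt (sqn \<mu> (rho d)) \<le> \<epsilon> * d) (at_right 0)"
    using eventually_at_right_less[of "0::real"]
  proof eventually_elim
    case (elim d)
    have "rho d = (\<lambda>x. d * ((S d h x - h x) / d - - g x))"
      using elim by (auto simp: rho_def fun_eq_iff field_simps)
    then have "sqn \<mu> (rho d) = d\<^sup>2 * sqn \<mu> (\<lambda>x. (S d h x - h x) / d - - g x)"
      by (simp only: sqn_scale)
    then have "sqrt (sqn \<mu> (rho d)) = d * sqrt (sqn \<mu> (\<lambda>x. (S d h x - h x) / d - - g x))"
      using elim(2) by (simp add: real_sqrt_mult)
    then show ?case using elim mult_left_mono[of "sqrt (sqn \<mu> (\<lambda>x. (S d h x - h x) / d - - g x))" \<epsilon> d]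
      by (simp add: mult.commute)
  qed
qed

lemma small_o_ex: "(\<And>\<epsilon>. 0 < \<epsilon> \<Longrightarrow> \<exists>d0>0. \<forall>d. 0 < d \<and> d < d0 \<longrightarrow> q d \<le> \<epsilon> * d) \<Longrightarrow> small_o q"
  unfolding small_o_def eventually_at_right_field by blast

text \<open>Where \<open>incr\<close> is at most \<delta> in modulus, the cube is at most \<delta>
  times the square, whose mean is O(d). Elsewhere the bounded drift \<open>d * g\<close> is at most
  \<delta>/2, so the increment of \<open>h\<close> itself exceeds \<delta>/2 and
  \<open>lindeberg\<close> applies.\<close>

lemma small_o_incr:
  "small_o (\<lambda>d. \<integral>z. min ((incr d (fst z) (snd z))\<^sup>2) (\<bar>incr d (fst z) (snd z)\<bar> ^ 3) \<partial>J d)"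
proof (rule small_o_family)
  fix \<delta> :: real assume \<delta>: "0 < \<delta>"
  define l where "l d = (\<integral>z. (h (snd z) - h (fst z))\<^sup>2 * indicator {z. \<delta> / 2 < \<bar>h (snd z) - h (fst z)\<bar>} z \<partial>J d)" for d
  have "small_o l" unfolding l_def by (rule small_o_ex, rule lindeberg) (use \<delta> in auto)
  then show "small_o (\<lambda>d. 2 * \<delta> * sqn \<mu> g * d\<^sup>2 + 4 * l d)"
    using \<delta> by (intro small_o_add small_o_square small_o_cmult) (auto simp: sqn_nonneg)
  have "eventually (\<lambda>d. d < \<delta> / (2 * (B + 1))) (at_right (0::real))"
    using \<delta> B_nonneg by (intro eventually_at_rightI[of 0 "\<delta> / (2 * (B + 1))"]) auto
  then show "eventually (\<lambda>d. (\<integral>z. min ((incr d (fst z) (snd z))\<^sup>2) (\<bar>incr d (fst z) (snd z)\<bar> ^ 3) \<partial>J d)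
      \<le> \<delta> * (4 * K * d) + (2 * \<delta> * sqn \<mu> g * d\<^sup>2 + 4 * l d)) (at_right 0)"
    using eventually_at_right_less[of "0::real"]
  proof eventually_elim
    case (elim d)
    then have d: "0 \<le> d" by simp
    have dB: "d * B \<le> \<delta> / 2"
    proof -
      have "d * B \<le> d * (B + 1)" by (intro mult_left_mono) (use d in auto)
      also have "\<dots> \<le> \<delta> / 2" using elim(1) B_nonneg by (simp add: field_simps)
      finally show ?thesis .
    qed
    define \<eta> where "\<eta> z = h (snd z) - h (fst z)" for z
    have [measurable]: "\<eta> \<in> borel_measurable (borel \<Otimes>\<^sub>M borel)" unfolding \<eta>_def by measurable
    have i1: "integrable (J d) (\<lambda>z. (\<eta> z)\<^sup>2)"
      unfolding \<eta>_def using L2_J[OF d h_L2] by (auto intro: L2D(2) L2_diff)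
    have i2: "integrable (J d) (\<lambda>z. (g (fst z))\<^sup>2)"
      using L2_J[OF d g_L2] by (auto intro: L2D(2))
    have i3: "integrable (J d) (\<lambda>z. (\<eta> z)\<^sup>2 * indicator {z. \<delta> / 2 < \<bar>\<eta> z\<bar>} z)"
    proof (rule Bochner_Integration.integrable_bound[OF i1])
      have "{z \<in> space (borel \<Otimes>\<^sub>M borel). \<delta> / 2 < \<bar>\<eta> z\<bar>} \<in> sets (borel \<Otimes>\<^sub>M borel)" by measurable
      then have "{z. \<delta> / 2 < \<bar>\<eta> z\<bar>} \<in> sets (borel \<Otimes>\<^sub>M borel)" by (simp add: space_pair_measure)
      then show "(\<lambda>z. (\<eta> z)\<^sup>2 * indicator {z. \<delta> / 2 < \<bar>\<eta> z\<bar>} z) \<in> borel_measurable (J d)"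
        by (simp add: J_meas[OF d])
    qed (auto simp: indicator_def)
    have pt: "min ((incr d (fst z) (snd z))\<^sup>2) (\<bar>incr d (fst z) (snd z)\<bar> ^ 3)
      \<le> \<delta> * (2 * (\<eta> z)\<^sup>2 + 2 * d\<^sup>2 * (g (fst z))\<^sup>2) + 4 * ((\<eta> z)\<^sup>2 * indicator {z. \<delta> / 2 < \<bar>\<eta> z\<bar>} z)" for z
    proof -
      define x where "x = incr d (fst z) (snd z)"
      define y where "y = d * g (fst z)"
      have x: "x = \<eta> z + y" by (simp add: x_def y_def incr_def \<eta>_def)
      have yB: "\<bar>y\<bar> \<le> d * B" unfolding y_def abs_mult using d g_bdd by (auto intro: mult_left_mono)
      have y2: "y\<^sup>2 = d\<^sup>2 * (g (fst z))\<^sup>2" by (simp add: y_def power_mult_distrib)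
      show ?thesis
      proof (cases "\<bar>x\<bar> \<le> \<delta>")
        case True
        have "\<bar>x\<bar> ^ 3 = \<bar>x\<bar> * x\<^sup>2" by (simp add: power3_eq_cube power2_eq_square abs_mult_self)
        also have "\<dots> \<le> \<delta> * x\<^sup>2" using True by (intro mult_right_mono) auto
        also have "\<dots> \<le> \<delta> * (2 * (\<eta> z)\<^sup>2 + 2 * y\<^sup>2)"
        proof (intro mult_left_mono)
          have "0 \<le> (\<eta> z - y)\<^sup>2" by simp
          then show "x\<^sup>2 \<le> 2 * (\<eta> z)\<^sup>2 + 2 * y\<^sup>2" by (simp add: x power2_sum power2_diff)
        qed (use \<delta> in simp)
        finally have "\<bar>x\<bar> ^ 3 \<le> \<delta> * (2 * (\<eta> z)\<^sup>2 + 2 * y\<^sup>2)" .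
        moreover have "0 \<le> 4 * ((\<eta> z)\<^sup>2 * indicator {z. \<delta> / 2 < \<bar>\<eta> z\<bar>} z)" by simp
        ultimately have "\<bar>x\<bar> ^ 3 \<le> \<delta> * (2 * (\<eta> z)\<^sup>2 + 2 * y\<^sup>2) + 4 * ((\<eta> z)\<^sup>2 * indicator {z. \<delta> / 2 < \<bar>\<eta> z\<bar>} z)"
          by linarith
        then show ?thesis unfolding x_def[symmetric] y2 mult.assoc[symmetric] by (rule min.coboundedI2)
      next
        case False
        then have "\<delta> / 2 < \<bar>\<eta> z\<bar>" "\<bar>x\<bar> \<le> 2 * \<bar>\<eta> z\<bar>" using yB dB x by linarith+
        then have "x\<^sup>2 \<le> 4 * (\<eta> z)\<^sup>2" "indicator {z. \<delta> / 2 < \<bar>\<eta> z\<bar>} z = (1::real)"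
          using power_mono[of "\<bar>x\<bar>" "2 * \<bar>\<eta> z\<bar>" 2] by (auto simp: power_mult_distrib)
        moreover have "0 \<le> \<delta> * (2 * (\<eta> z)\<^sup>2 + 2 * d\<^sup>2 * (g (fst z))\<^sup>2)" using \<delta> by simp
        ultimately show ?thesis unfolding x_def[symmetric] min_le_iff_disj by simp
      qed
    qed
    have "(\<integral>z. min ((incr d (fst z) (snd z))\<^sup>2) (\<bar>incr d (fst z) (snd z)\<bar> ^ 3) \<partial>J d)
      \<le> (\<integral>z. \<delta> * (2 * (\<eta> z)\<^sup>2 + 2 * d\<^sup>2 * (g (fst z))\<^sup>2) + 4 * ((\<eta> z)\<^sup>2 * indicator {z. \<delta> / 2 < \<bar>\<eta> z\<bar>} z) \<partial>J d)"
    proof (rule integral_mono)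
      show "integrable (J d) (\<lambda>z. min ((incr d (fst z) (snd z))\<^sup>2) (\<bar>incr d (fst z) (snd z)\<bar> ^ 3))"
        by (rule Bochner_Integration.integrable_bound[OF L2D(2)[OF incr_L2[OF d]]]) (auto simp: J_meas[OF d])
    qed (use i1 i2 i3 pt in auto)
    also have "\<dots> = \<delta> * (2 * sqn (J d) \<eta> + 2 * d\<^sup>2 * sqn (J d) (\<lambda>z. g (fst z))) + 4 * l d"
      using i1 i2 i3 by (simp add: sqn_def l_def \<eta>_def)
    also have "\<dots> \<le> \<delta> * (2 * (2 * K * d) + 2 * d\<^sup>2 * sqn \<mu> g) + 4 * l d"
      using increment_second_moment[OF elim(2)] L2_J(4)[OF d g_L2] \<delta>
      by (intro add_mono mult_left_mono) (auto simp: \<eta>_def[abs_def])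
    finally show ?case by (simp add: algebra_simps)
  qed
qed (use K_nonneg in simp)

lemma small_o_err: assumes "0 < K" shows "small_o err"
  unfolding err_def[abs_def]
proof (intro small_o_add small_o_gauss small_o_incr assms)
  show "small_o (\<lambda>d. \<integral>x. max 0 (excess d x) \<partial>\<mu>)" by (rule small_o_ex, rule excess_small)
  show "small_o (\<lambda>d. \<integral>x. \<bar>rho d x\<bar> \<partial>\<mu>)"
  proof (rule small_o_mono[OF small_o_rho])
    show "eventually (\<lambda>d. (\<integral>x. \<bar>rho d x\<bar> \<partial>\<mu>) \<le> sqrt (sqn \<mu> (rho d))) (at_right 0)"
      using eventually_at_right_less[of "0::real"]
      by eventually_elim (intro L1_le_sqn prob_mu rho_L2, simp)
  qed
  define c where "c = sqrt (sqn \<mu> h) + sqrt (sqn \<mu> g)"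
  show "small_o (\<lambda>d. \<integral>x. \<bar>hlag d x * rho d x\<bar> \<partial>\<mu>)"
  proof (rule small_o_mono)
    show "small_o (\<lambda>d. c * sqrt (sqn \<mu> (rho d)))"
      by (rule small_o_cmult[OF small_o_rho]) (simp add: c_def sqn_nonneg)
    have "eventually (\<lambda>d. d < 1) (at_right (0::real))"
      by (intro eventually_at_rightI[of 0 1]) auto
    then show "eventually (\<lambda>d. (\<integral>x. \<bar>hlag d x * rho d x\<bar> \<partial>\<mu>) \<le> c * sqrt (sqn \<mu> (rho d))) (at_right 0)"
      using eventually_at_right_less[of "0::real"]
    proof eventually_elim
      case (elim d)
      have "sqrt (sqn \<mu> (hlag d)) \<le> sqrt (sqn \<mu> h) + sqrt (sqn \<mu> (\<lambda>x. - d * g x))"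
        using sqn_triangle[OF h_L2 L2_scale[OF g_L2, of "- d"]] by (simp add: hlag_def[abs_def])
      also have "sqrt (sqn \<mu> (\<lambda>x. - d * g x)) = d * sqrt (sqn \<mu> g)"
        using elim unfolding sqn_scale by (simp add: real_sqrt_mult)
      also have "\<dots> \<le> 1 * sqrt (sqn \<mu> g)" using elim by (intro mult_right_mono) (auto simp: sqn_nonneg)
      finally have "sqrt (sqn \<mu> (hlag d)) \<le> c" by (simp add: c_def)
      then have "sqrt (sqn \<mu> (hlag d)) * sqrt (sqn \<mu> (rho d)) \<le> c * sqrt (sqn \<mu> (rho d))"
        by (intro mult_right_mono) (auto simp: sqn_nonneg)
      moreover have "0 \<le> d" using elim by simp
      ultimately show ?case using abs_ip_le[OF hlag_L2 rho_L2, of d d] by linarith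
    qed
  qed
qed

text \<open>The square of \<open>h y - hlag d x\<close> is expanded and the mean of
  \<open>h y\<close> is written as \<open>hlag d x + rho d x\<close>.\<close>

lemma conditional_moments:
  assumes d: "0 \<le> d"
  shows "AE x in \<mu>. (\<integral>y. incr d x y \<partial>P d x) = rho d x \<and>
    (\<integral>y. (incr d x y)\<^sup>2 \<partial>P d x) \<le> 2 * K * d + max 0 (excess d x) + 2 * \<bar>hlag d x * rho d x\<bar>"
  using S_integrable(1)[OF d L2_int[OF h_L2]] S_integrable(1)[OF d h2_int]
proof eventually_elim
  case (elim x)
  interpret Px: prob_space "P d x" by (rule P_prob[OF d])
  have e: "incr d x y = h y - hlag d x" for y by (simp add: incr_def hlag_def)
  have e2: "(incr d x y)\<^sup>2 = h2 y - 2 * hlag d x * h y + (hlag d x)\<^sup>2" for y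
    by (simp add: e h2_def power2_diff algebra_simps)
  have 1: "(\<integral>y. incr d x y \<partial>P d x) = rho d x"
    using elim unfolding e by (simp add: Px.prob_space rho_def hlag_def semigroup_op_def)
  have "(\<integral>y. (incr d x y)\<^sup>2 \<partial>P d x) = S d h2 x - 2 * hlag d x * S d h x + (hlag d x)\<^sup>2"
    using elim unfolding e2 by (simp add: Px.prob_space semigroup_op_def)
  \<comment> \<open>The terms of first order in \<open>d\<close> cancel by the choice of
    \<open>w\<close>, and the term \<open>- d\<^sup>2 * (g x)\<^sup>2\<close> has a favourable
    sign.\<close>
  also have "\<dots> = excess d x + 2 * K * d - d\<^sup>2 * (g x)\<^sup>2 - 2 * (hlag d x * rho d x)"
    by (simp add: excess_def w_def rho_def hlag_def h2_def power2_eq_square algebra_simps)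
  also have "\<dots> \<le> 2 * K * d + max 0 (excess d x) + 2 * \<bar>hlag d x * rho d x\<bar>"
  proof -
    have "0 \<le> d\<^sup>2 * (g x)\<^sup>2" by simp
    moreover have "- (hlag d x * rho d x) \<le> \<bar>hlag d x * rho d x\<bar>" by (rule abs_ge_minus_self)
    moreover have "excess d x \<le> max 0 (excess d x)" by simp
    ultimately show ?thesis by linarith
  qed
  finally show ?case using 1 by simp
qed

text \<open>One step of Lindeberg's replacement method: a step of the chain is exchanged for an independent
  Gaussian of variance \<open>2 K d\<close>.\<close>

lemma one_step:
  assumes d: "0 < d" and K: "0 < K" and t: "taylor2 c u u1 u2"
    and L: "prob_space L" and setsL: "sets L = sets (borel \<Otimes>\<^sub>M borel)" and Lmu: "distr L borel snd = \<mu>"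
    and Li: "integrable L fst"
  shows "(\<integral>q. u (fst (fst q) + incr d (snd (fst q)) (snd q)) \<partial>semidirect L borel (\<lambda>p. P d (snd p)))
    \<le> (\<integral>p. gavg (2 * K * d) u (fst p) \<partial>L) + c * err d"
proof -
  interpret L: prob_space L by fact
  have d0: "0 \<le> d" using d by simp
  note u = taylor2D[OF t]
  note [measurable] = u(2,3,8)
  note [measurable_cong] = setsL
  have spL: "space L = UNIV" using sets_eq_imp_space_eq[OF setsL] by (simp add: space_pair_measure)
  have \<kappa>: "(\<lambda>p. P d (snd p)) \<in> L \<rightarrow>\<^sub>M prob_algebra borel"
    by (rule measurable_compose[OF _ P_kernel[OF d0]]) measurable
  define R where "R = semidirect L borel (\<lambda>p. P d (snd p))"
  note R_sets = sets_semidirect[OF L \<kappa>, folded R_def]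
  interpret R: prob_space R unfolding R_def by (rule prob_space_semidirect[OF L \<kappa>])
  have setsR[measurable_cong]: "sets R = sets ((borel \<Otimes>\<^sub>M borel) \<Otimes>\<^sub>M borel)"
    unfolding R_sets by (rule sets_pair_measure_cong) (auto simp: setsL)
  \<comment> \<open>The current position has law \<mu> by \<open>Lmu\<close>, so current and next
    position are distributed as in stationarity, whatever the joint law with the past sum.\<close>
  have RJ: "distr R (borel \<Otimes>\<^sub>M borel) (\<lambda>q. (snd (fst q), snd q)) = J d"
  proof (rule measure_eqI)
    show "sets (distr R (borel \<Otimes>\<^sub>M borel) (\<lambda>q. (snd (fst q), snd q))) = sets (J d)"
      by (simp add: sets_J[OF d0])
    fix A assume "A \<in> sets (distr R (borel \<Otimes>\<^sub>M borel) (\<lambda>q. (snd (fst q), snd q)))"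
    then have A[measurable]: "A \<in> sets (borel \<Otimes>\<^sub>M borel)" by simp
    have AJ: "A \<in> sets (J d)" using A by (simp add: sets_J[OF d0])
    have m1: "(\<lambda>x. \<integral>\<^sup>+y. indicator A (x, y) \<partial>P d x) \<in> borel_measurable borel"
      by (rule nn_integral_measurable_subprob_algebra2[OF _ measurable_prob_algebraD[OF P_kernel[OF d0]]]) measurable
    have "emeasure (distr R (borel \<Otimes>\<^sub>M borel) (\<lambda>q. (snd (fst q), snd q))) A
      = (\<integral>\<^sup>+z. indicator A z \<partial>distr R (borel \<Otimes>\<^sub>M borel) (\<lambda>q. (snd (fst q), snd q)))" by simp
    also have "\<dots> = (\<integral>\<^sup>+q. indicator A (snd (fst q), snd q) \<partial>R)" by (rule nn_integral_distr) measurable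
    also have "\<dots> = (\<integral>\<^sup>+p. \<integral>\<^sup>+y. indicator A (snd p, y) \<partial>P d (snd p) \<partial>L)"
      unfolding R_def by (subst nn_integral_semidirect[OF L \<kappa>]) auto
    also have "\<dots> = (\<integral>\<^sup>+x. \<integral>\<^sup>+y. indicator A (x, y) \<partial>P d x \<partial>distr L borel snd)"
      by (rule nn_integral_distr[symmetric]) (use m1 in auto)
    also have "\<dots> = (\<integral>\<^sup>+z. indicator A z \<partial>J d)"
      unfolding Lmu J_def by (subst nn_integral_semidirect[OF prob_mu P_kernel_mu[OF d0]]) (auto cong: measurable_cong_sets sets_pair_measure_cong)
    also have "\<dots> = emeasure (J d) A" using AJ by simp
    finally show "emeasure (distr R (borel \<Otimes>\<^sub>M borel) (\<lambda>q. (snd (fst q), snd q))) A = emeasure (J d) A" .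
  qed
  have RJ_int: "integrable R (\<lambda>q. f (snd (fst q), snd q)) \<longleftrightarrow> integrable (J d) f"
    "(\<integral>q. f (snd (fst q), snd q) \<partial>R) = (\<integral>z. f z \<partial>J d)"
    if f[measurable]: "f \<in> borel_measurable (borel \<Otimes>\<^sub>M borel)" for f :: "'a \<times> 'a \<Rightarrow> real"
  proof -
    have m: "(\<lambda>q. (snd (fst q), snd q)) \<in> R \<rightarrow>\<^sub>M borel \<Otimes>\<^sub>M borel" by measurable
    show "integrable R (\<lambda>q. f (snd (fst q), snd q)) \<longleftrightarrow> integrable (J d) f"
      "(\<integral>q. f (snd (fst q), snd q) \<partial>R) = (\<integral>z. f z \<partial>J d)"
      using integrable_distr_eq[OF m f] integral_distr[OF m f] unfolding RJ by auto
  qed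
  have RL_int: "integrable R (\<lambda>q. f (fst q))" if f: "integrable L f" for f :: "real \<times> 'a \<Rightarrow> real"
  proof -
    have m: "fst \<in> R \<rightarrow>\<^sub>M L" by measurable
    have "distr R L fst = L" unfolding R_def by (rule distr_fst_semidirect[OF L \<kappa>])
    then show ?thesis using integrable_distr_eq[OF m, of f] f by (auto dest: borel_measurable_integrable)
  qed
  have L_int: "integrable L (\<lambda>p. f (snd p)) \<longleftrightarrow> integrable \<mu> f" "(\<integral>p. f (snd p) \<partial>L) = (\<integral>x. f x \<partial>\<mu>)"
    if f: "f \<in> borel_measurable borel" for f :: "'a \<Rightarrow> real"
  proof -
    have m: "snd \<in> L \<rightarrow>\<^sub>M borel" by measurable
    show "integrable L (\<lambda>p. f (snd p)) \<longleftrightarrow> integrable \<mu> f" "(\<integral>p. f (snd p) \<partial>L) = (\<integral>x. f x \<partial>\<mu>)"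
      using integrable_distr_eq[OF m f] integral_distr[OF m f] unfolding Lmu by auto
  qed
  define X where "X q = incr d (snd (fst q)) (snd q)" for q :: "(real \<times> 'a) \<times> 'a"
  define A where "A q = fst (fst q)" for q :: "(real \<times> 'a) \<times> 'a"
  have [measurable]: "X \<in> borel_measurable R" "A \<in> borel_measurable R"
    unfolding X_def A_def incr_def by measurable
  have iL2: "integrable (J d) (\<lambda>z. (incr d (fst z) (snd z))\<^sup>2)" by (rule L2D(2)[OF incr_L2[OF d0]])
  have iX2: "integrable R (\<lambda>q. (X q)\<^sup>2)"
    using RJ_int(1)[of "\<lambda>z. (incr d (fst z) (snd z))\<^sup>2"] iL2 by (simp add: X_def)
  have "integrable (J d) (\<lambda>z. incr d (fst z) (snd z))"
    by (rule L2_integrable[OF prob_space.finite_measure[OF prob_J[OF d0]] incr_L2[OF d0]])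
  then have iX: "integrable R X"
    using RJ_int(1)[of "\<lambda>z. incr d (fst z) (snd z)"] by (simp add: X_def[abs_def])
  have iA: "integrable R A" unfolding A_def by (rule RL_int[OF Li])
  have ibd: "integrable R f" if "f \<in> borel_measurable R" "integrable R k" "\<And>q. \<bar>f q\<bar> \<le> c * \<bar>k q\<bar>" for f k
    by (rule Bochner_Integration.integrable_bound[of _ "\<lambda>q. c * \<bar>k q\<bar>"])
      (use that u(9) in \<open>auto simp: abs_mult\<close>)
  have iu: "integrable R (\<lambda>q. u (a q))" if a[measurable]: "integrable R a" for a
  proof (rule Bochner_Integration.integrable_bound)
    show "integrable R (\<lambda>q. \<bar>u 0\<bar> + c * \<bar>a q\<bar>)" using a by simp
    have "\<bar>u (a q)\<bar> \<le> \<bar>u 0\<bar> + c * \<bar>a q\<bar>" for q using u(1)[of "a q" 0] by simp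
    then show "AE q in R. norm (u (a q)) \<le> norm (\<bar>u 0\<bar> + c * \<bar>a q\<bar>)" using u(9) by simp
  qed measurable
  have i1: "integrable R (\<lambda>q. u1 (A q) * X q)"
    by (rule ibd[OF _ iX]) (use u(4) in \<open>auto simp: abs_mult intro!: mult_right_mono\<close>)
  have i2: "integrable R (\<lambda>q. u2 (A q) * (X q)\<^sup>2)"
    by (rule ibd[OF _ iX2]) (use u(5,6) in \<open>auto simp: abs_mult intro!: mult_right_mono\<close>)
  have i3: "integrable R (\<lambda>q. min ((X q)\<^sup>2) (\<bar>X q\<bar> ^ 3))"
    by (rule Bochner_Integration.integrable_bound[OF iX2]) auto
  have "(\<integral>q. u (A q + X q) \<partial>R) \<le> (\<integral>q. u (A q) + u1 (A q) * X q + u2 (A q) * (X q)\<^sup>2 / 2 + c * min ((X q)\<^sup>2) (\<bar>X q\<bar> ^ 3) \<partial>R)"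
  proof (rule integral_mono)
    show "integrable R (\<lambda>q. u (A q + X q))" using iA iX by (intro iu) auto
    show "u (A q + X q) \<le> u (A q) + u1 (A q) * X q + u2 (A q) * (X q)\<^sup>2 / 2 + c * min ((X q)\<^sup>2) (\<bar>X q\<bar> ^ 3)" for q
      using u(7)[of "A q" "X q"] by (simp add: abs_le_iff)
  qed (use iu[OF iA] i1 i2 i3 in auto)
  also have "\<dots> = (\<integral>q. u (A q) \<partial>R) + (\<integral>q. u1 (A q) * X q \<partial>R) + (\<integral>q. u2 (A q) * (X q)\<^sup>2 \<partial>R) / 2
      + c * (\<integral>q. min ((X q)\<^sup>2) (\<bar>X q\<bar> ^ 3) \<partial>R)"
    using iu[OF iA] i1 i2 i3 by simp
  finally have main: "(\<integral>q. u (A q + X q) \<partial>R) \<le> \<dots>" .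
  note sdi = integral_semidirect[OF L \<kappa>, folded R_def]
  have t0: "(\<integral>q. u (A q) \<partial>R) = (\<integral>p. u (fst p) \<partial>L)"
    using sdi[OF iu[OF iA]] prob_space.prob_space[OF P_prob[OF d0]] by (simp add: A_def)
  have t3: "(\<integral>q. min ((X q)\<^sup>2) (\<bar>X q\<bar> ^ 3) \<partial>R) = (\<integral>z. min ((incr d (fst z) (snd z))\<^sup>2) (\<bar>incr d (fst z) (snd z)\<bar> ^ 3) \<partial>J d)"
    using RJ_int(2)[of "\<lambda>z. min ((incr d (fst z) (snd z))\<^sup>2) (\<bar>incr d (fst z) (snd z)\<bar> ^ 3)"] by (simp add: X_def)
  have cm: "AE p in L. (\<integral>y. incr d (snd p) y \<partial>P d (snd p)) = rho d (snd p) \<and>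
    (\<integral>y. (incr d (snd p) y)\<^sup>2 \<partial>P d (snd p)) \<le> 2 * K * d + max 0 (excess d (snd p)) + 2 * \<bar>hlag d (snd p) * rho d (snd p)\<bar>"
    using conditional_moments[OF d0] unfolding Lmu[symmetric] by (rule AE_distrD[rotated]) measurable
  have ie: "integrable \<mu> (\<lambda>x. \<bar>rho d x\<bar>)" "integrable \<mu> (\<lambda>x. max 0 (excess d x))"
    "integrable \<mu> (\<lambda>x. \<bar>hlag d x * rho d x\<bar>)"
    using L2_int[OF rho_L2[OF d0]] excess_int[OF d0] L2_mult[OF hlag_L2 rho_L2[OF d0]] by auto
  have iem: "(\<lambda>x. \<bar>rho d x\<bar>) \<in> borel_measurable borel" "(\<lambda>x. max 0 (excess d x)) \<in> borel_measurable borel"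
    "(\<lambda>x. \<bar>hlag d x * rho d x\<bar>) \<in> borel_measurable borel"
    using ie[THEN borel_measurable_integrable] by (simp_all add: meas_mu)
  note ieL = L_int(1)[OF iem(1), THEN iffD2, OF ie(1)] L_int(1)[OF iem(2), THEN iffD2, OF ie(2)]
    L_int(1)[OF iem(3), THEN iffD2, OF ie(3)]
  \<comment> \<open>The factor \<open>u1\<close> depends on the past sum only, so the increment may
    be replaced by its conditional mean.\<close>
  have t1: "(\<integral>q. u1 (A q) * X q \<partial>R) \<le> c * (\<integral>x. \<bar>rho d x\<bar> \<partial>\<mu>)"
  proof -
    have "(\<integral>q. u1 (A q) * X q \<partial>R) = (\<integral>p. u1 (fst p) * (\<integral>y. incr d (snd p) y \<partial>P d (snd p)) \<partial>L)"
      using sdi[OF i1] by (simp add: A_def X_def)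
    also have "\<dots> \<le> (\<integral>p. c * \<bar>rho d (snd p)\<bar> \<partial>L)"
    proof (rule integral_mono_AE)
      show "integrable L (\<lambda>p. u1 (fst p) * (\<integral>y. incr d (snd p) y \<partial>P d (snd p)))"
        using integrable_integral_semidirect[OF L \<kappa>, folded R_def, OF i1] by (simp add: A_def X_def)
      show "AE p in L. u1 (fst p) * (\<integral>y. incr d (snd p) y \<partial>P d (snd p)) \<le> c * \<bar>rho d (snd p)\<bar>"
        using cm
      proof eventually_elim
        case (elim p)
        have "u1 (fst p) * rho d (snd p) \<le> \<bar>u1 (fst p)\<bar> * \<bar>rho d (snd p)\<bar>" by (simp flip: abs_mult)
        also have "\<dots> \<le> c * \<bar>rho d (snd p)\<bar>" using u(4) by (intro mult_right_mono) auto
        finally show ?case using elim by simp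
      qed
    qed (use ieL in simp)
    also have "\<dots> = c * (\<integral>x. \<bar>rho d x\<bar> \<partial>\<mu>)" using L_int(2)[OF iem(1)] by simp
    finally show ?thesis .
  qed
  have iu2: "integrable L (\<lambda>p. u2 (fst p))"
    by (rule L.integrable_const_bound[of _ c]) (use u(5,6) in auto)
  \<comment> \<open>Since \<open>u2\<close> is nonnegative, the upper bound on the conditional
    second moment can be inserted under the integral.\<close>
  have t2: "(\<integral>q. u2 (A q) * (X q)\<^sup>2 \<partial>R) \<le> 2 * K * d * (\<integral>p. u2 (fst p) \<partial>L)
      + c * ((\<integral>x. max 0 (excess d x) \<partial>\<mu>) + 2 * (\<integral>x. \<bar>hlag d x * rho d x\<bar> \<partial>\<mu>))"
  proof -
    have "(\<integral>q. u2 (A q) * (X q)\<^sup>2 \<partial>R) = (\<integral>p. u2 (fst p) * (\<integral>y. (incr d (snd p) y)\<^sup>2 \<partial>P d (snd p)) \<partial>L)"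
      using sdi[OF i2] by (simp add: A_def X_def)
    also have "\<dots> \<le> (\<integral>p. 2 * K * d * u2 (fst p) + c * (max 0 (excess d (snd p)) + 2 * \<bar>hlag d (snd p) * rho d (snd p)\<bar>) \<partial>L)"
    proof (rule integral_mono_AE)
      show "integrable L (\<lambda>p. u2 (fst p) * (\<integral>y. (incr d (snd p) y)\<^sup>2 \<partial>P d (snd p)))"
        using integrable_integral_semidirect[OF L \<kappa>, folded R_def, OF i2] by (simp add: A_def X_def)
      show "AE p in L. u2 (fst p) * (\<integral>y. (incr d (snd p) y)\<^sup>2 \<partial>P d (snd p))
        \<le> 2 * K * d * u2 (fst p) + c * (max 0 (excess d (snd p)) + 2 * \<bar>hlag d (snd p) * rho d (snd p)\<bar>)"
        using cm
      proof eventually_elim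
        case (elim p)
        define r where "r = max 0 (excess d (snd p)) + 2 * \<bar>hlag d (snd p) * rho d (snd p)\<bar>"
        have r: "0 \<le> r" by (simp add: r_def)
        have "u2 (fst p) * (\<integral>y. (incr d (snd p) y)\<^sup>2 \<partial>P d (snd p)) \<le> u2 (fst p) * (2 * K * d + r)"
          using elim u(5) by (intro mult_left_mono) (auto simp: r_def)
        also have "\<dots> = 2 * K * d * u2 (fst p) + u2 (fst p) * r" by (simp add: algebra_simps)
        also have "\<dots> \<le> 2 * K * d * u2 (fst p) + c * r" using u(6) r by (intro add_left_mono mult_right_mono) auto
        finally show ?case unfolding r_def .
      qed
    qed (use ieL iu2 in simp)
    also have "\<dots> = 2 * K * d * (\<integral>p. u2 (fst p) \<partial>L)
      + c * ((\<integral>x. max 0 (excess d x) \<partial>\<mu>) + 2 * (\<integral>x. \<bar>hlag d x * rho d x\<bar> \<partial>\<mu>))"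
      using ieL iu2 L_int(2)[OF iem(2)] L_int(2)[OF iem(3)] by simp
    finally show ?thesis .
  qed
  have v: "0 < 2 * K * d" using K d by simp
  define r where "r = (\<integral>z. min (z\<^sup>2) (\<bar>z\<bar> ^ 3) \<partial>gauss (2 * K * d))"
  have iuL: "integrable L (\<lambda>p. f (fst p))" if f: "\<And>x y. \<bar>f x - f y\<bar> \<le> c * \<bar>x - y\<bar>" for f
  proof (rule Bochner_Integration.integrable_bound)
    have [measurable]: "f \<in> borel_measurable borel" by (rule lip_borel[OF f])
    show "integrable L (\<lambda>p. \<bar>f 0\<bar> + c * \<bar>fst p\<bar>)" using Li by simp
    have "\<bar>f a\<bar> \<le> \<bar>f 0\<bar> + c * \<bar>a\<bar>" for a using f[of a 0] by simp
    then show "AE p in L. norm (f (fst p)) \<le> norm (\<bar>f 0\<bar> + c * \<bar>fst p\<bar>)" using u(9) by simp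
    show "(\<lambda>p. f (fst p)) \<in> borel_measurable L" by measurable
  qed
  \<comment> \<open>The Gaussian of variance \<open>2 K d\<close> contributes \<open>K d u2\<close>,
    which matches the half of \<open>2 K d u2\<close> in \<open>t2\<close>; the leading terms cancel
    in the comparison.\<close>
  have "(\<integral>p. u (fst p) + K * d * u2 (fst p) - c * r \<partial>L) \<le> (\<integral>p. gavg (2 * K * d) u (fst p) \<partial>L)"
  proof (rule integral_mono)
    show "integrable L (\<lambda>p. gavg (2 * K * d) u (fst p))" by (rule iuL[OF gavg_lip[OF u(1) v]])
    show "u (fst p) + K * d * u2 (fst p) - c * r \<le> gavg (2 * K * d) u (fst p)" for p
      using gavg_lower[OF t v, of "fst p"] by (simp add: r_def)
  qed (use iuL[OF u(1)] iu2 in simp)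
  moreover have "(\<integral>p. u (fst p) + K * d * u2 (fst p) - c * r \<partial>L) = (\<integral>p. u (fst p) \<partial>L) + K * d * (\<integral>p. u2 (fst p) \<partial>L) - c * r"
    using iuL[OF u(1)] iu2 L.prob_space by simp
  \<comment> \<open>The second moment enters with a factor 1/2, while \<open>err\<close> counts the
    excess in full; the difference is nonnegative.\<close>
  moreover have "0 \<le> c * (\<integral>x. max 0 (excess d x) \<partial>\<mu>)" using u(9) by simp
  ultimately have "(\<integral>q. u (A q + X q) \<partial>R) \<le> (\<integral>p. gavg (2 * K * d) u (fst p) \<partial>L) + c * err d"
    using main t0 t1 t2 t3 unfolding err_def r_def[symmetric] by (simp add: algebra_simps)
  then show ?thesis unfolding A_def X_def R_def .
qed

end

section \<open>Reversibility of the sampled process\<close>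

locale reversible_process = symmetric_markov_semigroup +
  fixes M :: "'w measure" and X :: "real \<Rightarrow> 'w \<Rightarrow> 'a"
  assumes mp: "markov_process M X P \<mu>"
begin

lemma prob_M: "prob_space M"
  and X_meas[measurable]: "0 \<le> t \<Longrightarrow> X t \<in> M \<rightarrow>\<^sub>M borel"
  and X_0: "distr M borel (X 0) = \<mu>"
  and markov: "0 \<le> s \<Longrightarrow> 0 \<le> t \<Longrightarrow> A \<in> sets borel \<Longrightarrow> AE \<omega> in M.
      real_cond_exp M (natural_filtration M X s) (\<lambda>\<omega>. indicator A (X (s + t) \<omega>)) \<omega> =
        measure (P t (X s \<omega>)) A"
  using mp by (auto simp: markov_process_def)

abbreviation "\<F> s \<equiv> natural_filtration M X s"

lemma space_F: "space (\<F> s) = space M"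
  unfolding natural_filtration_def by (rule space_measure_of) auto

lemma sets_F: "sets (\<F> s) = sigma_sets (space M) {X u -` A \<inter> space M | u A. 0 \<le> u \<and> u \<le> s \<and> A \<in> sets borel}"
  unfolding natural_filtration_def by (rule sets_measure_of) auto

lemma subalg_F: "subalgebra M (\<F> s)"
  unfolding subalgebra_def space_F sets_F
  by (auto intro!: sets.sigma_sets_subset measurable_sets[OF X_meas])

lemma X_meas_F: "0 \<le> u \<Longrightarrow> u \<le> s \<Longrightarrow> X u \<in> \<F> s \<rightarrow>\<^sub>M borel"
  by (rule measurableI) (auto simp: space_F sets_F intro!: sigma_sets.Basic)

lemma F_meas_M: "H \<in> \<F> s \<rightarrow>\<^sub>M N \<Longrightarrow> H \<in> M \<rightarrow>\<^sub>M N"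
  using measurable_from_subalg[OF subalg_F] by blast

text \<open>The conditional expectation is integrated over an event of the past; stated for
  measures, this is the value on rectangles that \<open>markov_joint\<close> starts from.\<close>

lemma markov_sets:
  assumes "0 \<le> s" "0 \<le> t" "C \<in> sets (\<F> s)" "A \<in> sets borel"
  shows "emeasure M (C \<inter> (X (s + t) -` A \<inter> space M)) = (\<integral>\<^sup>+\<omega>. indicator C \<omega> * emeasure (P t (X s \<omega>)) A \<partial>M)"
proof -
  interpret M: prob_space M by (rule prob_M)
  interpret F: finite_measure_subalgebra M "\<F> s"
    by unfold_locales (rule subalg_F)
  have CM[measurable]: "C \<in> sets M" using assms(3) subalg_F by (auto simp: subalgebra_def)
  have st: "0 \<le> s + t" using assms by simp
  note [measurable] = X_meas[OF st] X_meas[OF assms(1)] assms(4)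
  have km: "(\<lambda>\<omega>. measure (P t (X s \<omega>)) A) \<in> borel_measurable M"
    by (rule measurable_compose[OF X_meas[OF assms(1)]
          measurable_compose[OF P_kernel[OF assms(2)] measurable_measure_prob_algebra[OF assms(4)]]])
  have le1: "measure (P t x) A \<le> 1" for x
    using prob_space.prob_le_1[OF P_prob[OF assms(2)]] .
  have i: "integrable M (\<lambda>\<omega>. indicator A (X (s + t) \<omega>) :: real)"
    by (rule M.integrable_const_bound[of _ 1]) (auto simp: indicator_def)
  have i2: "integrable M (\<lambda>\<omega>. indicator C \<omega> * measure (P t (X s \<omega>)) A)"
    by (rule M.integrable_const_bound[of _ 1]) (use km le1 in \<open>auto simp: indicator_def\<close>)
  have "(\<integral>\<omega>. indicator (C \<inter> (X (s + t) -` A \<inter> space M)) \<omega> \<partial>M) = (\<integral>\<omega>\<in>C. indicator A (X (s + t) \<omega>) \<partial>M)"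
    unfolding set_lebesgue_integral_def
    by (rule Bochner_Integration.integral_cong) (auto simp: indicator_def)
  also have "\<dots> = (\<integral>\<omega>\<in>C. real_cond_exp M (\<F> s) (\<lambda>\<omega>. indicator A (X (s + t) \<omega>)) \<omega> \<partial>M)"
    by (rule F.real_cond_exp_intA[OF i assms(3)])
  also have "\<dots> = (\<integral>\<omega>\<in>C. measure (P t (X s \<omega>)) A \<partial>M)"
    unfolding set_lebesgue_integral_def
  proof (rule integral_cong_AE)
    show "AE \<omega> in M. indicator C \<omega> *\<^sub>R real_cond_exp M (\<F> s) (\<lambda>\<omega>. indicator A (X (s + t) \<omega>)) \<omega>
       = indicator C \<omega> *\<^sub>R measure (P t (X s \<omega>)) A"
      using markov[OF assms(1,2,4)] by eventually_elim simp
  qed (use km in auto)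
  finally have e: "measure M (C \<inter> (X (s + t) -` A \<inter> space M)) = (\<integral>\<omega>. indicator C \<omega> * measure (P t (X s \<omega>)) A \<partial>M)"
    by (simp add: set_lebesgue_integral_def)
  have "(\<integral>\<^sup>+\<omega>. indicator C \<omega> * emeasure (P t (X s \<omega>)) A \<partial>M)
    = (\<integral>\<^sup>+\<omega>. ennreal (indicator C \<omega> * measure (P t (X s \<omega>)) A) \<partial>M)"
    using finite_measure.emeasure_eq_measure[OF prob_space.finite_measure[OF P_prob[OF assms(2)]]]
    by (intro nn_integral_cong) (auto simp: indicator_def)
  also have "\<dots> = ennreal (\<integral>\<omega>. indicator C \<omega> * measure (P t (X s \<omega>)) A \<partial>M)"
    by (rule nn_integral_eq_integral[OF i2]) auto
  finally show ?thesis using e by (simp add: M.emeasure_eq_measure)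
qed

text \<open>\<open>H\<close> stands for any functional of the past from which \<open>p\<close>
  recovers the current position, such as a partial sum paired with that position. The two laws agree
  on rectangles, which generate the product and are stable under intersection.\<close>

lemma markov_joint:
  assumes s: "0 \<le> s" and t: "0 \<le> t" and H: "H \<in> \<F> s \<rightarrow>\<^sub>M N" and p: "p \<in> N \<rightarrow>\<^sub>M borel"
    and pH: "\<And>\<omega>. \<omega> \<in> space M \<Longrightarrow> p (H \<omega>) = X s \<omega>"
  shows "distr M (N \<Otimes>\<^sub>M borel) (\<lambda>\<omega>. (H \<omega>, X (s + t) \<omega>)) = semidirect (distr M N H) borel (\<lambda>y. P t (p y))"
proof -
  interpret M: prob_space M by (rule prob_M)
  have HM[measurable]: "H \<in> M \<rightarrow>\<^sub>M N" by (rule F_meas_M[OF H])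
  have st: "0 \<le> s + t" using s t by simp
  note [measurable] = X_meas[OF st] p
  interpret HN: prob_space "distr M N H" by (rule M.prob_space_distr[OF HM])
  have k: "(\<lambda>y. P t (p y)) \<in> distr M N H \<rightarrow>\<^sub>M prob_algebra borel"
    by (rule measurable_compose[OF _ P_kernel[OF t]]) simp
  define E where "E = {a \<times> b | a b. a \<in> sets N \<and> b \<in> sets (borel :: 'a measure)}"
  have sp: "sets (N \<Otimes>\<^sub>M (borel :: 'a measure)) = sigma_sets (space N \<times> UNIV) E"
    unfolding E_def sets_pair_measure by simp
  show ?thesis
  proof (rule measure_eqI_generator_eq[where E = E and \<Omega> = "space N \<times> UNIV" and A = "\<lambda>_. space N \<times> UNIV"])
    show "Int_stable E" unfolding E_def by (rule Int_stable_pair_measure_generator)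
    show "E \<subseteq> Pow (space N \<times> UNIV)" unfolding E_def using sets.sets_into_space by fastforce
    show "sets (distr M (N \<Otimes>\<^sub>M borel) (\<lambda>\<omega>. (H \<omega>, X (s + t) \<omega>))) = sigma_sets (space N \<times> UNIV) E"
      by (simp add: sp)
    show "sets (semidirect (distr M N H) borel (\<lambda>y. P t (p y))) = sigma_sets (space N \<times> UNIV) E"
      unfolding sets_semidirect[OF HN.prob_space_axioms k] sp[symmetric]
      by (rule sets_pair_measure_cong) auto
    have "space N \<times> UNIV \<in> E"
      unfolding E_def mem_Collect_eq by (intro exI[of _ "space N"] exI[of _ UNIV]) auto
    then show "range (\<lambda>_. space N \<times> UNIV) \<subseteq> E" by auto
    show "emeasure (distr M (N \<Otimes>\<^sub>M borel) (\<lambda>\<omega>. (H \<omega>, X (s + t) \<omega>))) (space N \<times> UNIV) \<noteq> \<infinity>"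
      using prob_space.finite_measure[OF M.prob_space_distr[of "\<lambda>\<omega>. (H \<omega>, X (s + t) \<omega>)" "N \<Otimes>\<^sub>M borel"]]
      by (simp add: finite_measure.emeasure_eq_measure)
    fix D assume "D \<in> E"
    then obtain a b where D: "D = a \<times> b" and a[measurable]: "a \<in> sets N" and b[measurable]: "b \<in> sets borel"
      by (auto simp: E_def)
    have "emeasure (distr M (N \<Otimes>\<^sub>M borel) (\<lambda>\<omega>. (H \<omega>, X (s + t) \<omega>))) D
      = emeasure M ((H -` a \<inter> space M) \<inter> (X (s + t) -` b \<inter> space M))"
      unfolding D by (subst emeasure_distr) (auto intro!: arg_cong[where f = "emeasure M"])
    also have "\<dots> = (\<integral>\<^sup>+\<omega>. indicator (H -` a \<inter> space M) \<omega> * emeasure (P t (X s \<omega>)) b \<partial>M)"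
      by (rule markov_sets[OF s t _ b]) (use measurable_sets[OF H a] in \<open>simp add: space_F\<close>)
    also have "\<dots> = (\<integral>\<^sup>+\<omega>. indicator a (H \<omega>) * emeasure (P t (p (H \<omega>))) b \<partial>M)"
      by (intro nn_integral_cong) (auto simp: indicator_def pH)
    also have "\<dots> = (\<integral>\<^sup>+y. indicator a y * emeasure (P t (p y)) b \<partial>distr M N H)"
    proof (rule nn_integral_distr[symmetric, OF HM])
      have "(\<lambda>y. emeasure (P t (p y)) b) \<in> borel_measurable N"
        by (rule measurable_compose[OF p measurable_compose[OF measurable_prob_algebraD[OF P_kernel[OF t]] measurable_emeasure_subprob_algebra[OF b]]])
      then show "(\<lambda>y. indicator a y * emeasure (P t (p y)) b) \<in> borel_measurable (distr M N H)" by simp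
    qed
    also have "\<dots> = (\<integral>\<^sup>+y. \<integral>\<^sup>+x. indicator D (y, x) \<partial>P t (p y) \<partial>distr M N H)"
    proof (rule nn_integral_cong)
      fix y
      have "(\<integral>\<^sup>+x. indicator D (y, x) \<partial>P t (p y)) = (\<integral>\<^sup>+x. indicator a y * indicator b x \<partial>P t (p y))"
        unfolding D by (intro nn_integral_cong) (auto simp: indicator_def)
      also have "\<dots> = indicator a y * emeasure (P t (p y)) b"
        using b by (subst nn_integral_cmult) (auto simp: P_meas[OF t] P_sets[OF t])
      finally show "indicator a y * emeasure (P t (p y)) b = (\<integral>\<^sup>+x. indicator D (y, x) \<partial>P t (p y))" by simp
    qed
    also have "\<dots> = (\<integral>\<^sup>+z. indicator D z \<partial>semidirect (distr M N H) borel (\<lambda>y. P t (p y)))"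
      unfolding D by (subst nn_integral_semidirect[OF HN.prob_space_axioms k]) auto
    also have "\<dots> = emeasure (semidirect (distr M N H) borel (\<lambda>y. P t (p y))) D"
      by (rule nn_integral_indicator)
        (simp add: D sets_semidirect[OF HN.prob_space_axioms k] cong: sets_pair_measure_cong)
    finally show "emeasure (distr M (N \<Otimes>\<^sub>M borel) (\<lambda>\<omega>. (H \<omega>, X (s + t) \<omega>))) D
      = emeasure (semidirect (distr M N H) borel (\<lambda>y. P t (p y))) D" .
  qed auto
qed

lemma stationary: assumes t: "0 \<le> t" shows "distr M borel (X t) = \<mu>"
proof -
  interpret M: prob_space M by (rule prob_M)
  have j: "distr M (borel \<Otimes>\<^sub>M borel) (\<lambda>\<omega>. (X 0 \<omega>, X (0 + t) \<omega>)) = semidirect (distr M borel (X 0)) borel (\<lambda>y. P t y)"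
    by (rule markov_joint[OF _ t X_meas_F]) auto
  note [measurable] = X_meas[OF t] X_meas[of 0, simplified]
  have e: "distr M borel (X t) = distr (distr M (borel \<Otimes>\<^sub>M borel) (\<lambda>\<omega>. (X 0 \<omega>, X (0 + t) \<omega>))) borel snd"
    by (subst distr_distr) (auto simp: comp_def)
  show ?thesis
    unfolding e j X_0 J_def[symmetric] by (rule J_snd[OF t])
qed

lemma X_integral:
  assumes "0 \<le> t" "f \<in> borel_measurable borel"
  shows "integrable M (\<lambda>\<omega>. f (X t \<omega>) :: real) \<longleftrightarrow> integrable \<mu> f" "(\<integral>\<omega>. (f (X t \<omega>) :: real) \<partial>M) = (\<integral>x. f x \<partial>\<mu>)"
  using integrable_distr_eq[OF X_meas[OF assms(1)] assms(2)] integral_distr[OF X_meas[OF assms(1)] assms(2)]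
  unfolding stationary[OF assms(1)] by auto

lemma markov_expectation:
  assumes s: "0 \<le> s" and t: "0 \<le> t" and Z: "Z \<in> borel_measurable (\<F> s)" "\<And>\<omega>. \<bar>Z \<omega>\<bar> \<le> 1"
    and f: "f \<in> borel_measurable borel" "\<And>x. \<bar>f x\<bar> \<le> 1"
  shows "(\<integral>\<omega>. Z \<omega> * f (X (s + t) \<omega>) \<partial>M) = (\<integral>\<omega>. Z \<omega> * S t f (X s \<omega>) \<partial>M)"
proof -
  interpret M: prob_space M by (rule prob_M)
  define H where "H \<omega> = (Z \<omega>, X s \<omega>)" for \<omega>
  have H: "H \<in> \<F> s \<rightarrow>\<^sub>M borel \<Otimes>\<^sub>M borel"
    unfolding H_def using Z(1) X_meas_F[OF s order_refl] by measurable
  have HM[measurable]: "H \<in> M \<rightarrow>\<^sub>M borel \<Otimes>\<^sub>M borel" by (rule F_meas_M[OF H])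
  have [measurable]: "Z \<in> borel_measurable M" by (rule F_meas_M[OF Z(1)])
  note [measurable] = f(1) X_meas[OF s] X_meas[OF add_nonneg_nonneg[OF s t]] S_meas[OF t f(1)]
  interpret HN: prob_space "distr M (borel \<Otimes>\<^sub>M borel) H" by (rule M.prob_space_distr[OF HM])
  note j = markov_joint[OF s t H measurable_snd, simplified H_def snd_conv, OF refl, folded H_def]
  have k: "(\<lambda>y. P t (snd y)) \<in> distr M (borel \<Otimes>\<^sub>M borel) H \<rightarrow>\<^sub>M prob_algebra borel"
    by (rule measurable_compose[OF _ P_kernel[OF t]]) measurable
  have i: "integrable M (\<lambda>\<omega>. Z \<omega> * f (X (s + t) \<omega>))"
    by (rule M.integrable_const_bound[of _ 1])
      (use mult_mono[OF Z(2) f(2)] in \<open>auto simp: abs_mult\<close>)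
  have m: "(\<lambda>\<omega>. (H \<omega>, X (s + t) \<omega>)) \<in> M \<rightarrow>\<^sub>M (borel \<Otimes>\<^sub>M borel) \<Otimes>\<^sub>M borel" by measurable
  have fm: "(\<lambda>q. fst (fst q) * f (snd q)) \<in> borel_measurable ((borel \<Otimes>\<^sub>M borel) \<Otimes>\<^sub>M borel)" by measurable
  have i2: "integrable (semidirect (distr M (borel \<Otimes>\<^sub>M borel) H) borel (\<lambda>y. P t (snd y))) (\<lambda>q. fst (fst q) * f (snd q))"
    unfolding j[symmetric] integrable_distr_eq[OF m fm] using i by (simp add: H_def)
  have "(\<integral>\<omega>. Z \<omega> * f (X (s + t) \<omega>) \<partial>M) = (\<integral>q. fst (fst q) * f (snd q) \<partial>distr M ((borel \<Otimes>\<^sub>M borel) \<Otimes>\<^sub>M borel) (\<lambda>\<omega>. (H \<omega>, X (s + t) \<omega>)))"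
    unfolding integral_distr[OF m fm] by (simp add: H_def)
  also have "\<dots> = (\<integral>p. \<integral>y. fst p * f y \<partial>P t (snd p) \<partial>distr M (borel \<Otimes>\<^sub>M borel) H)"
    unfolding j using integral_semidirect[OF HN.prob_space_axioms k i2] by simp
  also have "\<dots> = (\<integral>p. fst p * S t f (snd p) \<partial>distr M (borel \<Otimes>\<^sub>M borel) H)"
    by (simp add: semigroup_op_def)
  also have "\<dots> = (\<integral>\<omega>. fst (H \<omega>) * S t f (snd (H \<omega>)) \<partial>M)"
    by (rule integral_distr[OF HM]) measurable
  finally show ?thesis by (simp add: H_def)
qed

section \<open>Weighted expectations along a sampled path\<close>

context
  fixes d :: real and k :: "nat \<Rightarrow> 'a \<Rightarrow> real"
  assumes d: "0 \<le> d" and k: "\<And>i. k i \<in> borel_measurable borel" "\<And>i x. 0 \<le> k i x" "\<And>i x. k i x \<le> 1"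
begin

text \<open>\<open>bwd n x\<close> is the mean, for the chain started at \<open>x\<close>, of the
  weights \<open>k (n - 1)\<close>, ..., \<open>k 0\<close> evaluated at the steps 1, ...,
  \<open>n\<close> in this order.\<close>

fun bwd :: "nat \<Rightarrow> 'a \<Rightarrow> real" where
  "bwd 0 = (\<lambda>x. 1)"
| "bwd (Suc n) = S d (\<lambda>x. k n x * bwd n x)"

lemma bwd_props: "bwd n \<in> borel_measurable borel" "0 \<le> bwd n x" "bwd n x \<le> 1"
proof -
  have "bwd n \<in> borel_measurable borel \<and> (\<forall>x. 0 \<le> bwd n x \<and> bwd n x \<le> 1)"
  proof (induction n)
    case (Suc n)
    have m: "(\<lambda>x. k n x * bwd n x) \<in> borel_measurable borel" using Suc k by auto
    have b: "0 \<le> k n x * bwd n x" "k n x * bwd n x \<le> 1" for x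
      using Suc k(2,3)[of n x] mult_mono[of "k n x" 1 "bwd n x" 1] by auto
    show ?case using S_meas[OF d m] S_bounds[OF d m b] by simp
  qed simp
  then show "bwd n \<in> borel_measurable borel" "0 \<le> bwd n x" "bwd n x \<le> 1" by auto
qed

lemma prod_meas_F:
  assumes "\<And>i. i \<in> I \<Longrightarrow> 0 \<le> a i \<and> a i \<le> s"
  shows "(\<lambda>\<omega>. \<Prod>i\<in>I. k i (X (a i) \<omega>)) \<in> borel_measurable (\<F> s)"
  using assms by (intro borel_measurable_prod measurable_compose[OF X_meas_F k(1)]) auto

lemma prod_bound: "0 \<le> (\<Prod>i\<in>I. k i (y i))" "(\<Prod>i\<in>I. k i (y i)) \<le> 1"
  using k by (auto intro!: prod_nonneg prod_le_1)

lemma unit_L2: "f \<in> borel_measurable borel \<Longrightarrow> (\<And>x. 0 \<le> f x) \<Longrightarrow> (\<And>x. f x \<le> 1) \<Longrightarrow> f \<in> L2fun \<mu>"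
  by (rule L2_bounded[OF finite_measure_axioms, of _ 1]) (auto simp: meas_mu)

text \<open>Conditioning on the last step turns \<open>f\<close> into \<open>S d f\<close>, and
  symmetry moves the operator onto the weights of the earlier steps. The induction changes
  \<open>f\<close>, which is therefore arbitrary.\<close>

lemma forward_expectation:
  assumes "f \<in> borel_measurable borel" "\<And>x. 0 \<le> f x" "\<And>x. f x \<le> 1"
  shows "(\<integral>\<omega>. (\<Prod>i<n. k i (X (real i * d) \<omega>)) * f (X (real n * d) \<omega>) \<partial>M) = ip \<mu> f (bwd n)"
  using assms
proof (induction n arbitrary: f)
  case 0
  show ?case using X_integral(2)[of 0 f] 0 by (simp add: ip_def)
next
  case (Suc n)
  note fS = S_meas[OF d Suc.prems(1)] S_bounds[OF d Suc.prems]
  define Z where "Z \<omega> = (\<Prod>i<Suc n. k i (X (real i * d) \<omega>))" for \<omega>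
  have nd: "0 \<le> real n * d" using d by simp
  have Zm: "Z \<in> borel_measurable (\<F> (real n * d))"
    unfolding Z_def by (rule prod_meas_F) (use d in \<open>auto intro: mult_right_mono\<close>)
  have Zb: "\<bar>Z \<omega>\<bar> \<le> 1" for \<omega> unfolding Z_def using prod_bound[where I = "{..<Suc n}" and y = "\<lambda>i. X (real i * d) \<omega>"] by simp
  have e: "real (Suc n) * d = real n * d + d" by (simp add: algebra_simps)
  have "(\<integral>\<omega>. Z \<omega> * f (X (real (Suc n) * d) \<omega>) \<partial>M) = (\<integral>\<omega>. Z \<omega> * S d f (X (real n * d) \<omega>) \<partial>M)"
    unfolding e by (rule markov_expectation[OF nd d Zm Zb Suc.prems(1)]) (use Suc.prems in auto)
  also have "\<dots> = (\<integral>\<omega>. (\<Prod>i<n. k i (X (real i * d) \<omega>)) * (\<lambda>x. k n x * S d f x) (X (real n * d) \<omega>) \<partial>M)"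
    by (simp add: Z_def mult.assoc)
  also have "\<dots> = ip \<mu> (\<lambda>x. k n x * S d f x) (bwd n)"
  proof (rule Suc.IH)
    fix x
    show "0 \<le> k n x * S d f x" "k n x * S d f x \<le> 1"
      using fS k(2,3)[of n x] mult_mono[of "k n x" 1 "S d f x" 1] by auto
  qed (use fS k in auto)
  also have "\<dots> = ip \<mu> (S d f) (\<lambda>x. k n x * bwd n x)" by (simp add: ip_def mult_ac)
  also have "\<dots> = ip \<mu> f (bwd (Suc n))"
  proof -
    have "(\<lambda>x. k n x * bwd n x) \<in> L2fun \<mu>"
    proof (rule unit_L2)
      fix x
      show "0 \<le> k n x * bwd n x" "k n x * bwd n x \<le> 1"
        using bwd_props(2,3)[of n x] k(2,3)[of n x] mult_mono[of "k n x" 1 "bwd n x" 1] by auto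
    qed (use bwd_props k in auto)
    then show ?thesis using S_sym[OF d unit_L2[OF Suc.prems]] by simp
  qed
  finally show ?case by (simp add: Z_def)
qed

text \<open>Here the weights occur in the order of \<open>bwd\<close>, so the Markov property alone
  integrates them out from the latest time on.\<close>

lemma backward_expectation:
  assumes f: "f \<in> borel_measurable borel" "\<And>x. 0 \<le> f x" "\<And>x. f x \<le> 1"
  shows "(\<integral>\<omega>. f (X 0 \<omega>) * (\<Prod>i<n. k i (X (real (n - i) * d) \<omega>)) \<partial>M) = ip \<mu> f (bwd n)"
proof -
  \<comment> \<open>In \<open>E j\<close> the weights of index below \<open>j\<close>, which sit at
    the latest times, have already been integrated out into \<open>bwd j\<close>; \<open>E 0\<close>
    is the left-hand side and \<open>E n\<close> involves time 0 only.\<close>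
  define E where "E j = (\<integral>\<omega>. f (X 0 \<omega>) * (\<Prod>i\<in>{j..<n}. k i (X (real (n - i) * d) \<omega>)) * bwd j (X (real (n - j) * d) \<omega>) \<partial>M)" for j
  have step: "E j = E (Suc j)" if j: "j < n" for j
  proof -
    define Z where "Z \<omega> = f (X 0 \<omega>) * (\<Prod>i\<in>{Suc j..<n}. k i (X (real (n - i) * d) \<omega>))" for \<omega>
    define s where "s = real (n - Suc j) * d"
    have s: "0 \<le> s" using d by (simp add: s_def)
    have sd: "real (n - j) * d = s + d"
      using j by (simp add: s_def of_nat_diff algebra_simps)
    have Zm: "Z \<in> borel_measurable (\<F> s)"
      unfolding Z_def
      by (intro borel_measurable_times measurable_compose[OF X_meas_F f(1)] prod_meas_F)
        (use d s in \<open>auto simp: s_def intro!: mult_right_mono\<close>)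
    have Zb: "\<bar>Z \<omega>\<bar> \<le> 1" for \<omega>
      unfolding Z_def abs_mult
      using prod_bound[where I = "{Suc j..<n}" and y = "\<lambda>i. X (real (n - i) * d) \<omega>"] f(2,3)[of "X 0 \<omega>"]
      by (intro mult_le_one) auto
    have b: "0 \<le> k j x * bwd j x" "k j x * bwd j x \<le> 1" for x
      using bwd_props(2,3)[of j x] k(2,3)[of j x] mult_mono[of "k j x" 1 "bwd j x" 1] by auto
    have "E j = (\<integral>\<omega>. Z \<omega> * (\<lambda>x. k j x * bwd j x) (X (s + d) \<omega>) \<partial>M)"
      unfolding E_def Z_def sd[symmetric] using j
      by (simp add: prod.atLeast_Suc_lessThan mult_ac)
    also have "\<dots> = (\<integral>\<omega>. Z \<omega> * S d (\<lambda>x. k j x * bwd j x) (X s \<omega>) \<partial>M)"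
      by (rule markov_expectation[OF s d Zm Zb]) (use b k bwd_props in \<open>auto intro!: borel_measurable_times\<close>)
    also have "\<dots> = E (Suc j)" unfolding E_def Z_def s_def by simp
    finally show ?thesis .
  qed
  have "E 0 = E j" if "j \<le> n" for j using that by (induction j) (auto simp: step)
  then have "E 0 = E n" by simp
  moreover have "E n = ip \<mu> f (bwd n)"
    using X_integral(2)[of 0 "\<lambda>x. f x * bwd n x"] f bwd_props by (simp add: E_def ip_def)
  ultimately show ?thesis by (simp add: E_def atLeast0LessThan)
qed

end

lemma path_reversal:
  assumes d: "0 \<le> d"
  shows "distr M (PiM {..n} (\<lambda>_. borel)) (\<lambda>\<omega>. \<lambda>i\<in>{..n}. X (real i * d) \<omega>)
    = distr M (PiM {..n} (\<lambda>_. borel)) (\<lambda>\<omega>. \<lambda>i\<in>{..n}. X (real (n - i) * d) \<omega>)"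
    (is "distr M ?Pi ?Y = distr M ?Pi ?Z")
proof -
  interpret M: prob_space M by (rule prob_M)
  have nd: "0 \<le> real i * d" for i using d by simp
  have Ym[measurable]: "?Y \<in> M \<rightarrow>\<^sub>M ?Pi" "?Z \<in> M \<rightarrow>\<^sub>M ?Pi"
    by (auto intro!: measurable_restrict X_meas nd)
  show ?thesis
  proof (rule measure_eqI_PiM_finite[where I = "{..n}" and M = "\<lambda>_. borel" and A = "\<lambda>_. Pi\<^sub>E {..n} (\<lambda>_. UNIV)"])
    fix A :: "nat \<Rightarrow> 'a set" assume A: "\<And>i. i \<in> {..n} \<Longrightarrow> A i \<in> sets borel"
    \<comment> \<open>The product of these indicators tests a box; beyond \<open>n\<close> the value
      0 keeps the family measurable and within [0, 1] at every index.\<close>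
    define k where "k i x = (if i \<le> n then indicator (A i) x else 0 :: real)" for i x
    have k: "k i \<in> borel_measurable borel" "0 \<le> k i x" "k i x \<le> 1" for i x
      using A[of i] unfolding k_def[abs_def] by (cases "i \<le> n"; auto simp: indicator_def)+
    have box: "Pi\<^sub>E {..n} A \<in> sets ?Pi" using A by (intro sets_PiM_I_finite) auto
    have em: "emeasure (distr M ?Pi W) (Pi\<^sub>E {..n} A) = ennreal (\<integral>\<omega>. (\<Prod>i\<in>{..n}. k i (w i \<omega>)) \<partial>M)"
      if W: "W \<in> M \<rightarrow>\<^sub>M ?Pi" and w: "W = (\<lambda>\<omega>. \<lambda>i\<in>{..n}. w i \<omega>)" for W w
    proof -
      have ms: "W -` Pi\<^sub>E {..n} A \<inter> space M \<in> sets M" by (rule measurable_sets[OF W box])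
      have "indicator (W -` Pi\<^sub>E {..n} A \<inter> space M) \<omega> = (\<Prod>i\<in>{..n}. k i (w i \<omega>))" if "\<omega> \<in> space M" for \<omega>
      proof (cases "\<forall>i\<in>{..n}. w i \<omega> \<in> A i")
        case True
        then have "(\<Prod>i\<in>{..n}. k i (w i \<omega>)) = 1" by (intro prod.neutral) (auto simp: k_def)
        then show ?thesis using True that by (auto simp: w PiE_iff)
      next
        case False
        then obtain j where "j \<le> n" "w j \<omega> \<notin> A j" by auto
        then have "(\<Prod>i\<in>{..n}. k i (w i \<omega>)) = 0" by (intro prod_zero bexI[of _ j]) (auto simp: k_def)
        then show ?thesis using False by (auto simp: w PiE_iff)
      qed
      then have "(\<integral>\<omega>. (\<Prod>i\<in>{..n}. k i (w i \<omega>)) \<partial>M) = (\<integral>\<omega>. indicator (W -` Pi\<^sub>E {..n} A \<inter> space M) \<omega> \<partial>M)"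
        by (intro Bochner_Integration.integral_cong) auto
      also have "\<dots> = measure M (W -` Pi\<^sub>E {..n} A \<inter> space M)" using ms by simp
      finally show ?thesis using emeasure_distr[OF W box] by (simp add: M.emeasure_eq_measure)
    qed
    have e1: "(\<integral>\<omega>. (\<Prod>i\<in>{..n}. k i (X (real i * d) \<omega>)) \<partial>M) = ip \<mu> (k n) (bwd d k n)"
      using forward_expectation[where k = k and n = n and f = "k n", OF d k k] by (simp add: lessThan_Suc_atMost[symmetric])
    have e2: "(\<integral>\<omega>. (\<Prod>i\<in>{..n}. k i (X (real (n - i) * d) \<omega>)) \<partial>M) = ip \<mu> (k n) (bwd d k n)"
      using backward_expectation[where k = k and n = n and f = "k n", OF d k k] by (simp add: lessThan_Suc_atMost[symmetric] mult.commute)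
    show "emeasure (distr M ?Pi ?Y) (Pi\<^sub>E {..n} A) = emeasure (distr M ?Pi ?Z) (Pi\<^sub>E {..n} A)"
      unfolding em[OF Ym(1) refl] em[OF Ym(2) refl] e1 e2 ..
  next
    show "range (\<lambda>_. Pi\<^sub>E {..n} (\<lambda>_. UNIV)) \<subseteq> prod_algebra {..n} (\<lambda>_. borel :: 'a measure)"
      by (auto intro!: prod_algebraI_finite)
    show "emeasure (distr M ?Pi ?Y) (Pi\<^sub>E {..n} (\<lambda>_. UNIV)) \<noteq> \<infinity>"
      using prob_space.finite_measure[OF M.prob_space_distr[OF Ym(1)]]
      by (simp add: finite_measure.emeasure_eq_measure)
  qed (auto simp: space_PiM)
qed

end

section \<open>Riemann sums and convex functions\<close>

text \<open>Tags are free within their intervals, so that left and right sums, whose mean is the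
  trapezoidal sum, are covered at once.\<close>

lemma riemann_tagged:
  fixes f :: "real \<Rightarrow> real"
  assumes d: "0 \<le> d" and e: "0 \<le> e" and f: "continuous_on {0..real n * d} f"
    and osc: "\<And>x y. x \<in> {0..real n * d} \<Longrightarrow> y \<in> {0..real n * d} \<Longrightarrow> \<bar>x - y\<bar> \<le> d \<Longrightarrow> \<bar>f x - f y\<bar> \<le> e"
    and tag: "\<And>i. i < n \<Longrightarrow> real i * d \<le> \<tau> i \<and> \<tau> i \<le> real (Suc i) * d"
  shows "\<bar>integral {0..real n * d} f - (\<Sum>i<n. d * f (\<tau> i))\<bar> \<le> e * (real n * d)"
  using f osc tag
proof (induction n)
  case (Suc n)
  have n: "0 \<le> real n * d" "real n * d \<le> real (Suc n) * d" using d by (auto intro: mult_right_mono)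
  have sub: "{0..real n * d} \<subseteq> {0..real (Suc n) * d}" "{real n * d..real (Suc n) * d} \<subseteq> {0..real (Suc n) * d}"
    using n by auto
  have i: "f integrable_on {0..real (Suc n) * d}" by (rule integrable_continuous_real[OF Suc.prems(1)])
  have c: "integral {0..real (Suc n) * d} f = integral {0..real n * d} f + integral {real n * d..real (Suc n) * d} f"
    by (rule Henstock_Kurzweil_Integration.integral_combine[OF n i, symmetric])
  have ih: "\<bar>integral {0..real n * d} f - (\<Sum>i<n. d * f (\<tau> i))\<bar> \<le> e * (real n * d)"
  proof (rule Suc.IH)
    show "continuous_on {0..real n * d} f" by (rule continuous_on_subset[OF Suc.prems(1) sub(1)])
    show "\<bar>f x - f y\<bar> \<le> e" if "x \<in> {0..real n * d}" "y \<in> {0..real n * d}" "\<bar>x - y\<bar> \<le> d" for x y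
      by (rule Suc.prems(2)) (use sub(1) that in blast)+
    show "real i * d \<le> \<tau> i \<and> \<tau> i \<le> real (Suc i) * d" if "i < n" for i
      using Suc.prems(3)[of i] that by simp
  qed
  have t: "\<tau> n \<in> {real n * d..real (Suc n) * d}" using Suc.prems(3)[of n] by simp
  have cn: "continuous_on {real n * d..real (Suc n) * d} f" by (rule continuous_on_subset[OF Suc.prems(1) sub(2)])
  have len: "real (Suc n) * d - real n * d = d" by (simp add: algebra_simps)
  have "integral {real n * d..real (Suc n) * d} f - d * f (\<tau> n) = integral {real n * d..real (Suc n) * d} (\<lambda>x. f x - f (\<tau> n))"
    using integrable_continuous_real[OF cn] n len by (subst Henstock_Kurzweil_Integration.integral_diff) auto
  also have "norm \<dots> \<le> e * (real (Suc n) * d - real n * d)"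
  proof (rule integral_bound[OF n(2)])
    show "continuous_on {real n * d..real (Suc n) * d} (\<lambda>x. f x - f (\<tau> n))" by (intro continuous_intros cn)
    fix x assume x: "x \<in> {real n * d..real (Suc n) * d}"
    have "\<bar>x - \<tau> n\<bar> \<le> d" using x t len by auto
    moreover have "x \<in> {0..real (Suc n) * d}" "\<tau> n \<in> {0..real (Suc n) * d}" using x t sub(2) by blast+
    ultimately show "norm (f x - f (\<tau> n)) \<le> e" using Suc.prems(2)[of x "\<tau> n"] by simp
  qed
  finally have "\<bar>integral {real n * d..real (Suc n) * d} f - d * f (\<tau> n)\<bar> \<le> e * d" using len by simp
  then have "\<bar>integral {0..real (Suc n) * d} f - (\<Sum>i<Suc n. d * f (\<tau> i))\<bar> \<le> e * (real n * d) + e * d"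
    using ih unfolding c by simp
  then show ?case by (simp add: algebra_simps)
qed simp

lemma riemann_sums:
  fixes f :: "real \<Rightarrow> real"
  assumes T: "0 < T" and f: "continuous_on {0..T} f"
    and tag: "\<And>n i. i < Suc n \<Longrightarrow> real i * (T / real (Suc n)) \<le> \<tau> n i \<and> \<tau> n i \<le> real (Suc i) * (T / real (Suc n))"
  shows "(\<lambda>n. \<Sum>i<Suc n. T / real (Suc n) * f (\<tau> n i)) \<longlonglongrightarrow> (LINT s:{0..T}|lborel. f s)"
proof -
  have si: "set_integrable lborel {0..T} f"
    by (rule borel_integrable_atLeastAtMost') (use f in simp)
  have I: "(LINT s:{0..T}|lborel. f s) = integral {0..T} f"
    using set_borel_integral_eq_integral(2)[OF si] by simp
  have uc: "uniformly_continuous_on {0..T} f" by (rule compact_uniformly_continuous[OF f]) simp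
  show ?thesis
    unfolding I
  proof (rule LIMSEQ_I)
    fix r :: real assume r: "0 < r"
    define e where "e = r / (2 * T)"
    have e: "0 < e" using r T by (simp add: e_def)
    obtain \<delta> where \<delta>: "0 < \<delta>" "\<And>x y. x \<in> {0..T} \<Longrightarrow> y \<in> {0..T} \<Longrightarrow> \<bar>x - y\<bar> < \<delta> \<Longrightarrow> \<bar>f x - f y\<bar> < e"
      using uc e unfolding uniformly_continuous_on_def dist_real_def by metis
    obtain N where N: "T / \<delta> < real N" using reals_Archimedean2 by blast
    show "\<exists>no. \<forall>n\<ge>no. norm ((\<Sum>i<Suc n. T / real (Suc n) * f (\<tau> n i)) - integral {0..T} f) < r"
    proof (intro exI allI impI)
      fix n assume n: "N \<le> n"
      define d where "d = T / real (Suc n)"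
      have d: "0 < d" "real (Suc n) * d = T" using T by (auto simp: d_def)
      have "T / \<delta> < real (Suc n)" using N n by linarith
      then have d\<delta>: "d < \<delta>" using \<delta>(1) T by (simp add: d_def field_simps)
      have "\<bar>integral {0..real (Suc n) * d} f - (\<Sum>i<Suc n. d * f (\<tau> n i))\<bar> \<le> e * (real (Suc n) * d)"
      proof (rule riemann_tagged)
        show "\<bar>f x - f y\<bar> \<le> e" if "x \<in> {0..real (Suc n) * d}" "y \<in> {0..real (Suc n) * d}" "\<bar>x - y\<bar> \<le> d" for x y
          using \<delta>(2)[of x y] that d\<delta> unfolding d(2) by (auto intro: less_imp_le)
        show "real i * d \<le> \<tau> n i \<and> \<tau> n i \<le> real (Suc i) * d" if "i < Suc n" for i
          using tag[OF that] unfolding d_def .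
        show "continuous_on {0..real (Suc n) * d} f" unfolding d(2) by (rule f)
      qed (use d e in auto)
      also have "e * (real (Suc n) * d) = r / 2" unfolding d(2) using T by (simp add: e_def)
      finally have "\<bar>integral {0..T} f - (\<Sum>i<Suc n. d * f (\<tau> n i))\<bar> \<le> r / 2" unfolding d(2) .
      then show "norm ((\<Sum>i<Suc n. T / real (Suc n) * f (\<tau> n i)) - integral {0..T} f) < r"
        using r unfolding d_def by (simp add: abs_minus_commute del: of_nat_Suc sum.lessThan_Suc)
    qed
  qed
qed

section \<open>Smoothing and Lipschitz minorants of convex functions\<close>

lemma antiderivative_exists:
  fixes f :: "real \<Rightarrow> real"
  assumes "continuous_on UNIV f"
  shows "\<exists>F. \<forall>x. (F has_real_derivative f x) (at x)"
proof -
  have "\<exists>F. \<forall>x. - \<infinity> < ereal x \<longrightarrow> ereal x < \<infinity> \<longrightarrow> (F has_vector_derivative f x) (at x)"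
    by (rule einterval_antiderivative) (use assms in \<open>auto simp: continuous_on_eq_continuous_at\<close>)
  then show ?thesis by (auto simp: has_real_derivative_iff_has_vector_derivative)
qed

lemma convex_second_difference:
  fixes f :: "real \<Rightarrow> real"
  assumes "convex_on UNIV f"
  shows "0 \<le> f (x + 2 * e) - 2 * f (x + e) + f x"
proof -
  have "f ((1 - 1 / 2) *\<^sub>R x + (1 / 2) *\<^sub>R (x + 2 * e)) \<le> (1 - 1 / 2) * f x + 1 / 2 * f (x + 2 * e)"
    by (rule convex_onD[OF assms]) auto
  moreover have "(1 - 1 / 2) *\<^sub>R x + (1 / 2) *\<^sub>R (x + 2 * e) = x + e" by (simp add: field_simps)
  ultimately show ?thesis by simp
qed

text \<open>A convex Lipschitz function is smoothed by averaging it twice over an interval of length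
  \<open>e\<close>, that is by taking a second difference of its second antiderivative.\<close>

lemma convex_lipschitz_smoothing:
  fixes f :: "real \<Rightarrow> real"
  assumes cv: "convex_on UNIV f" and lip: "\<And>x y. \<bar>f x - f y\<bar> \<le> L * \<bar>x - y\<bar>" and e: "0 < e"
  shows "\<exists>c u u1 u2. taylor2 c u u1 u2 \<and> convex_on UNIV u \<and> (\<forall>x. \<bar>u x - f x\<bar> \<le> 2 * L * e)"
proof -
  have L: "0 \<le> L" using lip[of 1 0] by simp
  have cf: "continuous_on UNIV f"
  proof (rule lipschitz_on_continuous_on[of L])
    show "L-lipschitz_on UNIV f" using lip L by (intro lipschitz_onI) (auto simp: dist_real_def)
  qed
  obtain F1 where F1: "\<And>x. (F1 has_real_derivative f x) (at x)" using antiderivative_exists[OF cf] by blast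
  have "continuous_on UNIV F1" using F1 by (auto intro: DERIV_continuous_on has_field_derivative_at_within)
  from antiderivative_exists[OF this] obtain F2 where F2: "\<And>x. (F2 has_real_derivative F1 x) (at x)" by blast
  \<comment> \<open>Second divided differences of the second antiderivative, the first
    antiderivative and \<open>f\<close> itself; each is the derivative of the previous one.\<close>
  define u where "u x = (F2 (x + 2 * e) - 2 * F2 (x + e) + F2 x) / e\<^sup>2" for x
  define u1 where "u1 x = (F1 (x + 2 * e) - 2 * F1 (x + e) + F1 x) / e\<^sup>2" for x
  define u2 where "u2 x = (f (x + 2 * e) - 2 * f (x + e) + f x) / e\<^sup>2" for x
  have sh: "((\<lambda>x. G (x + a)) has_real_derivative g (x + a)) (at x)"
    if "\<And>x. (G has_real_derivative g x) (at x)" for G g :: "real \<Rightarrow> real" and a x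
    using that[of "x + a"] by (simp add: DERIV_shift)
  have D: "(u has_real_derivative u1 x) (at x)" for x
    unfolding u_def[abs_def] u1_def
    by (intro DERIV_cdivide DERIV_add DERIV_diff DERIV_cmult sh F2)
  have D1: "(u1 has_real_derivative u2 x) (at x)" for x
    unfolding u1_def[abs_def] u2_def
    by (intro DERIV_cdivide DERIV_add DERIV_diff DERIV_cmult sh F1)
  have u2: "0 \<le> u2 x" for x
    unfolding u2_def using convex_second_difference[OF cv, of x e] by simp
  have u2le: "u2 x \<le> 2 * L / e" for x
  proof -
    have "f (x + 2 * e) - 2 * f (x + e) + f x \<le> 2 * L * e"
      using lip[of "x + 2 * e" "x + e"] lip[of x "x + e"] e by (simp add: abs_le_iff)
    then have "u2 x \<le> (2 * L * e) / e\<^sup>2" unfolding u2_def by (rule divide_right_mono) simp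
    also have "\<dots> = 2 * L / e" using e by (simp add: power2_eq_square)
    finally show ?thesis .
  qed
  have u2lip: "\<bar>u2 x - u2 y\<bar> \<le> 4 * L / e\<^sup>2 * \<bar>x - y\<bar>" for x y
  proof -
    have "\<bar>(f (x + 2 * e) - 2 * f (x + e) + f x) - (f (y + 2 * e) - 2 * f (y + e) + f y)\<bar> \<le> 4 * (L * \<bar>x - y\<bar>)"
      using lip[of "x + 2 * e" "y + 2 * e"] lip[of "x + e" "y + e"] lip[of x y] by simp
    then have "\<bar>(f (x + 2 * e) - 2 * f (x + e) + f x) - (f (y + 2 * e) - 2 * f (y + e) + f y)\<bar> / e\<^sup>2 \<le> 4 * (L * \<bar>x - y\<bar>) / e\<^sup>2"
      by (rule divide_right_mono) simp
    then show ?thesis unfolding u2_def diff_divide_distrib[symmetric] by simp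
  qed
  have u1b: "\<bar>u1 x\<bar> \<le> L" for x
  proof -
    \<comment> \<open>A second difference is a difference of differences: the mean value theorem for
      the increment of \<open>F1\<close> over length \<open>e\<close> reduces it to a difference of
      \<open>f\<close>, which the Lipschitz bound controls.\<close>
    have "\<exists>z>x. z < x + e \<and> (F1 (x + e + e) - F1 (x + e)) - (F1 (x + e) - F1 x) = (x + e - x) * (f (z + e) - f z)"
      by (rule MVT2[where f = "\<lambda>z. F1 (z + e) - F1 z"]) (use e in \<open>auto intro!: DERIV_diff sh F1\<close>)
    then obtain z where z: "F1 (x + e + e) - F1 (x + e) - (F1 (x + e) - F1 x) = e * (f (z + e) - f z)" by auto
    have "F1 (x + 2 * e) - 2 * F1 (x + e) + F1 x = e * (f (z + e) - f z)" using z by (simp add: add.assoc)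
    then have "\<bar>u1 x\<bar> = \<bar>f (z + e) - f z\<bar> / e"
      unfolding u1_def using e by (simp add: abs_mult power2_eq_square)
    also have "\<dots> \<le> (L * e) / e" using lip[of "z + e" z] e by (intro divide_right_mono) auto
    finally show ?thesis using e by simp
  qed
  have close: "\<bar>u x - f x\<bar> \<le> 2 * L * e" for x
  proof -
    \<comment> \<open>Two applications of the mean value theorem show that \<open>u x\<close> is a
      value of \<open>f\<close> at a point between \<open>x\<close> and
      \<open>x + 2 * e\<close>.\<close>
    have "\<exists>z>x. z < x + e \<and> (F2 (x + e + e) - F2 (x + e)) - (F2 (x + e) - F2 x) = (x + e - x) * (F1 (z + e) - F1 z)"
      by (rule MVT2[where f = "\<lambda>z. F2 (z + e) - F2 z"]) (use e in \<open>auto intro!: DERIV_diff sh F2\<close>)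
    then obtain z where z: "z > x" "z < x + e" "F2 (x + e + e) - F2 (x + e) - (F2 (x + e) - F2 x) = e * (F1 (z + e) - F1 z)" by auto
    have "\<exists>w>z. w < z + e \<and> F1 (z + e) - F1 z = (z + e - z) * f w"
      by (rule MVT2) (use e F1 in auto)
    then obtain w where w: "w > z" "w < z + e" "F1 (z + e) - F1 z = e * f w" by auto
    have "F2 (x + 2 * e) - 2 * F2 (x + e) + F2 x = e * (e * f w)" using z(3) w(3) by (simp add: add.assoc)
    then have "u x = f w" unfolding u_def using e by (simp add: power2_eq_square)
    then have "\<bar>u x - f x\<bar> \<le> L * \<bar>w - x\<bar>" using lip[of w x] by simp
    also have "\<dots> \<le> L * (2 * e)" using z w L by (intro mult_left_mono) auto
    finally show ?thesis by (simp add: mult_ac)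
  qed
  have ulip: "\<bar>u x - u y\<bar> \<le> L * \<bar>x - y\<bar>" for x y
  proof -
    have "norm (u x - u y) \<le> L * norm (x - y)"
      by (rule field_differentiable_bound[of UNIV u u1]) (use D u1b in \<open>auto intro: has_field_derivative_at_within\<close>)
    then show ?thesis by simp
  qed
  define c where "c = L + 2 * L / e + 2 * L / e\<^sup>2"
  have c: "L \<le> c" "2 * L / e \<le> c" "2 * L / e\<^sup>2 \<le> c" using L e by (auto simp: c_def)
  have tay: "\<bar>u (x + y) - u x - u1 x * y - u2 x * y\<^sup>2 / 2\<bar> \<le> c * min (y\<^sup>2) (\<bar>y\<bar> ^ 3)" for x y
  proof -
    define diff where "diff m z = (if m = 0 then u (x + z) else if m = 1 then u1 (x + z) else u2 (x + z))" for m :: nat and z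
    have sh': "((\<lambda>z. G (x + z)) has_real_derivative g (x + z)) (at z)"
      if "\<And>x. (G has_real_derivative g x) (at x)" for G g :: "real \<Rightarrow> real" and z
      using sh[OF that, of x z] by (simp add: add.commute)
    have "\<exists>t. \<bar>t\<bar> \<le> \<bar>y\<bar> \<and> u (x + y) = (\<Sum>m<2. diff m 0 / fact m * y ^ m) + diff 2 t / fact 2 * y ^ 2"
    proof (rule Maclaurin_bi_le[where f = "\<lambda>z. u (x + z)"])
      show "diff 0 = (\<lambda>z. u (x + z))" by (simp add: diff_def fun_eq_iff)
      show "\<forall>(m::nat) t. m < 2 \<and> \<bar>t\<bar> \<le> \<bar>y\<bar> \<longrightarrow> (diff m has_real_derivative diff (Suc m) t) (at t)"
      proof (intro allI impI)
        fix m :: nat and t assume "m < 2 \<and> \<bar>t\<bar> \<le> \<bar>y\<bar>"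
        then have "m = 0 \<or> m = 1" by auto
        then show "(diff m has_real_derivative diff (Suc m) t) (at t)"
          using sh'[OF D] sh'[OF D1] by (auto simp: diff_def[abs_def])
      qed
    qed
    then obtain t where t: "\<bar>t\<bar> \<le> \<bar>y\<bar>" "u (x + y) = (\<Sum>m<2. diff m 0 / fact m * y ^ m) + diff 2 t / fact 2 * y ^ 2" by blast
    have "u (x + y) = u x + u1 x * y + u2 (x + t) * y\<^sup>2 / 2"
      using t(2) by (simp add: diff_def numeral_2_eq_2 lessThan_Suc)
    then have e1: "\<bar>u (x + y) - u x - u1 x * y - u2 x * y\<^sup>2 / 2\<bar> = \<bar>u2 (x + t) - u2 x\<bar> / 2 * y\<^sup>2"
      by (simp add: abs_mult diff_divide_distrib[symmetric] left_diff_distrib[symmetric])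
    \<comment> \<open>Boundedness of \<open>u2\<close> gives the quadratic bound on the Lagrange
      remainder, its Lipschitz continuity the cubic one.\<close>
    have "\<bar>u2 (x + t) - u2 x\<bar> \<le> 2 * L / e"
      using u2[of x] u2[of "x + t"] u2le[of x] u2le[of "x + t"] by simp
    then have "\<bar>u2 (x + t) - u2 x\<bar> / 2 \<le> c" using c L e by simp
    then have b1: "\<bar>u2 (x + t) - u2 x\<bar> / 2 * y\<^sup>2 \<le> c * y\<^sup>2" by (intro mult_right_mono) auto
    have "\<bar>u2 (x + t) - u2 x\<bar> \<le> 4 * L / e\<^sup>2 * \<bar>t\<bar>" using u2lip[of "x + t" x] by simp
    also have "\<dots> \<le> 4 * L / e\<^sup>2 * \<bar>y\<bar>" using t(1) L by (intro mult_left_mono) auto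
    finally have "\<bar>u2 (x + t) - u2 x\<bar> / 2 \<le> 2 * L / e\<^sup>2 * \<bar>y\<bar>" by simp
    also have "\<dots> \<le> c * \<bar>y\<bar>" using c by (intro mult_right_mono) auto
    finally have "\<bar>u2 (x + t) - u2 x\<bar> / 2 * y\<^sup>2 \<le> c * \<bar>y\<bar> * y\<^sup>2" by (intro mult_right_mono) auto
    also have "c * \<bar>y\<bar> * y\<^sup>2 = c * \<bar>y\<bar> ^ 3" by (simp add: power3_eq_cube power2_eq_square abs_mult_self mult.assoc)
    finally show ?thesis using b1 unfolding e1 by (simp add: min_def)
  qed
  have meas: "u1 \<in> borel_measurable borel" "u2 \<in> borel_measurable borel"
    using lip_borel[OF u2lip] D1
    by (auto intro!: borel_measurable_continuous_onI DERIV_continuous_on intro: has_field_derivative_at_within)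
  have "taylor2 c u u1 u2"
    unfolding taylor2_def
  proof (intro conjI allI)
    show "\<bar>u x - u y\<bar> \<le> c * \<bar>x - y\<bar>" for x y
      using ulip[of x y] mult_right_mono[OF c(1), of "\<bar>x - y\<bar>"] by simp
    show "\<bar>u1 x\<bar> \<le> c" for x using u1b[of x] c by simp
    show "u2 x \<le> c" for x using u2le[of x] c by simp
  qed (use meas u2 tay in auto)
  moreover have "convex_on UNIV u"
    by (rule f''_ge0_imp_convex[of _ _ u1 u2]) (use D D1 u2 in auto)
  ultimately show ?thesis using close by blast
qed

lemma convex_subgradient:
  fixes f :: "real \<Rightarrow> real"
  assumes "convex_on UNIV f"
  shows "\<exists>s. \<forall>y z. f y + s y * (z - y) \<le> f z"
proof (intro exI allI)
  fix y z
  show "f y + (\<lambda>x. Inf ((\<lambda>t. (f x - f t) / (x - t)) ` ({x<..} \<inter> UNIV))) y * (z - y) \<le> f z"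
    using convex_le_Inf_differential[OF assms, of y z] by simp
qed

text \<open>The supremum of the tangents at points of [-k, k]. It equals \<open>f\<close> there, is
  Lipschitz because the slopes are bounded, and stays above the tangent at 0, the common minorant of
  all \<open>k\<close>.\<close>

lemma convex_lipschitz_minorant:
  fixes f :: "real \<Rightarrow> real"
  assumes cv: "convex_on UNIV f" and s: "\<And>y z. f y + s y * (z - y) \<le> f z" and k: "0 \<le> k"
  shows "\<exists>m L. convex_on UNIV m \<and> (\<forall>x y. \<bar>m x - m y\<bar> \<le> L * \<bar>x - y\<bar>) \<and> (\<forall>x. m x \<le> f x) \<and>
    (\<forall>x. \<bar>x\<bar> \<le> k \<longrightarrow> m x = f x) \<and> (\<forall>x. f 0 + s 0 * x \<le> m x)"
proof -
  define m where "m x = (SUP y\<in>{-k..k}. f y + s y * (x - y))" for x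
  have ne: "{-k..k} \<noteq> {}" using k by auto
  have bdd: "bdd_above ((\<lambda>y. f y + s y * (x - y)) ` {-k..k})" for x
    by (rule bdd_aboveI2[of _ _ "f x"]) (rule s)
  have up: "f y + s y * (x - y) \<le> m x" if "\<bar>y\<bar> \<le> k" for x y
    unfolding m_def by (rule cSUP_upper[OF _ bdd]) (use that in auto)
  have least: "m x \<le> b" if "\<And>y. \<bar>y\<bar> \<le> k \<Longrightarrow> f y + s y * (x - y) \<le> b" for x b
    unfolding m_def by (rule cSUP_least[OF ne]) (use that in auto)
  \<comment> \<open>The slope at \<open>y\<close> is compared with the values of \<open>f\<close> at
    \<open>k + 1\<close> and \<open>- k - 1\<close>, which are at distance at least 1 from
    \<open>y\<close>; the tangent at 0 bounds \<open>f y\<close> from below.\<close>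
  define L where "L = \<bar>f (k + 1)\<bar> + \<bar>f (- k - 1)\<bar> + \<bar>f 0\<bar> + \<bar>s 0\<bar> * k"
  have sL: "\<bar>s y\<bar> \<le> L" if y: "\<bar>y\<bar> \<le> k" for y
  proof -
    have "\<bar>s 0 * y\<bar> \<le> \<bar>s 0\<bar> * k" using y by (simp add: abs_mult mult_left_mono)
    then have lo: "- \<bar>f 0\<bar> - \<bar>s 0\<bar> * k \<le> f y" using s[of 0 y] by (simp add: abs_le_iff) linarith
    show ?thesis
    proof (cases "0 \<le> s y")
      case True
      have "s y * 1 \<le> s y * (k + 1 - y)" using True y by (intro mult_left_mono) auto
      then show ?thesis using s[of y "k + 1"] lo True unfolding L_def by linarith
    next
      case False
      have "(- s y) * 1 \<le> (- s y) * (k + 1 + y)" using False y by (intro mult_left_mono) auto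
      moreover have "s y * (- k - 1 - y) = (- s y) * (k + 1 + y)" by (simp add: algebra_simps)
      ultimately show ?thesis using s[of y "- k - 1"] lo False unfolding L_def by linarith
    qed
  qed
  have lip1: "m x - m z \<le> L * \<bar>x - z\<bar>" for x z
  proof -
    have "f y + s y * (x - y) \<le> m z + L * \<bar>x - z\<bar>" if y: "\<bar>y\<bar> \<le> k" for y
    proof -
      have "s y * (x - z) \<le> \<bar>s y\<bar> * \<bar>x - z\<bar>" by (simp flip: abs_mult)
      also have "\<dots> \<le> L * \<bar>x - z\<bar>" using sL[OF y] by (intro mult_right_mono) auto
      finally have "s y * (x - z) \<le> L * \<bar>x - z\<bar>" .
      moreover have "f y + s y * (x - y) = f y + s y * (z - y) + s y * (x - z)" by (simp add: algebra_simps)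
      ultimately show ?thesis using up[OF y, of z] by linarith
    qed
    then have "m x \<le> m z + L * \<bar>x - z\<bar>" by (rule least)
    then show ?thesis by simp
  qed
  have "convex_on UNIV m"
  proof (rule convex_onI)
    fix t x z :: real assume t: "0 < t" "t < 1"
    show "m ((1 - t) *\<^sub>R x + t *\<^sub>R z) \<le> (1 - t) * m x + t * m z"
    proof (rule least)
      fix y assume y: "\<bar>y\<bar> \<le> k"
      have "f y + s y * ((1 - t) *\<^sub>R x + t *\<^sub>R z - y) = (1 - t) * (f y + s y * (x - y)) + t * (f y + s y * (z - y))"
        by (simp add: algebra_simps)
      also have "\<dots> \<le> (1 - t) * m x + t * m z"
        using t by (intro add_mono mult_left_mono up y) auto
      finally show "f y + s y * ((1 - t) *\<^sub>R x + t *\<^sub>R z - y) \<le> (1 - t) * m x + t * m z" .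
    qed
  qed auto
  moreover have "\<bar>m x - m y\<bar> \<le> L * \<bar>x - y\<bar>" for x y
    using lip1[of x y] lip1[of y x] by (simp add: abs_le_iff abs_minus_commute)
  moreover have "m x \<le> f x" for x by (rule least) (rule s)
  moreover have "f x \<le> m x" if "\<bar>x\<bar> \<le> k" for x using up[OF that, of x] by simp
  moreover have "f 0 + s 0 * x \<le> m x" for x using up[of 0 x] k by simp
  ultimately show ?thesis by (intro exI[of _ m] exI[of _ L]) (auto intro: antisym)
qed

lemma convex_borel:
  fixes f :: "real \<Rightarrow> real"
  assumes "convex_on UNIV f" shows "f \<in> borel_measurable borel"
  using convex_on_continuous[OF open_UNIV assms] by (rule borel_measurable_continuous_onI)

lemma ext_expectation_integrable:
  assumes "integrable M Y"
  shows "ext_expectation M Y = ereal (\<integral>\<omega>. Y \<omega> \<partial>M)"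
proof -
  have "(\<integral>\<^sup>+\<omega>. ennreal (Y \<omega>) \<partial>M) \<le> (\<integral>\<^sup>+\<omega>. ennreal (norm (Y \<omega>)) \<partial>M)"
    "(\<integral>\<^sup>+\<omega>. ennreal (- Y \<omega>) \<partial>M) \<le> (\<integral>\<^sup>+\<omega>. ennreal (norm (Y \<omega>)) \<partial>M)"
    by (auto intro!: nn_integral_mono ennreal_leI)
  moreover have "(\<integral>\<^sup>+\<omega>. ennreal (norm (Y \<omega>)) \<partial>M) < \<top>" using assms by (simp add: integrable_iff_bounded)
  ultimately have f: "(\<integral>\<^sup>+\<omega>. ennreal (Y \<omega>) \<partial>M) < \<top>" "(\<integral>\<^sup>+\<omega>. ennreal (- Y \<omega>) \<partial>M) < \<top>" by auto
  have c: "enn2ereal x = ereal (enn2real x)" if "x < \<top>" for x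
    using that by (cases x) (auto simp: enn2ereal_ennreal)
  show ?thesis
    unfolding ext_expectation_def c[OF f(1)] c[OF f(2)] real_lebesgue_integral_def[OF assms] by simp
qed

text \<open>The comparison of expectations extends from Lipschitz convex functions to all convex functions by
  Fatou's lemma, applied to the differences with a common affine minorant.\<close>

lemma convex_order_extend:
  fixes Y :: "'w \<Rightarrow> real" and Z :: "'v \<Rightarrow> real"
  assumes M: "prob_space M" and N: "prob_space N" and Y: "integrable M Y" and Z: "integrable N Z"
    and ord: "\<And>f L. convex_on UNIV f \<Longrightarrow> (\<And>x y. \<bar>f x - f y\<bar> \<le> L * \<bar>x - y\<bar>) \<Longrightarrow>
      (\<integral>\<omega>. f (Y \<omega>) \<partial>M) \<le> (\<integral>\<omega>. f (Z \<omega>) \<partial>N)"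
    and cv: "convex_on UNIV \<phi>"
  shows "ext_expectation M (\<lambda>\<omega>. \<phi> (Y \<omega>)) \<le> ext_expectation N (\<lambda>\<omega>. \<phi> (Z \<omega>))"
proof -
  interpret M: prob_space M by fact
  interpret N: prob_space N by fact
  have [measurable]: "Y \<in> borel_measurable M" "Z \<in> borel_measurable N" using Y Z by auto
  have \<phi>m[measurable]: "\<phi> \<in> borel_measurable borel" by (rule convex_borel[OF cv])
  obtain s where s: "\<And>y z. \<phi> y + s y * (z - y) \<le> \<phi> z" using convex_subgradient[OF cv] by blast
  define a where "a x = \<phi> 0 + s 0 * x" for x
  have aY: "integrable M (\<lambda>\<omega>. a (Y \<omega>))" and aZ: "integrable N (\<lambda>\<omega>. a (Z \<omega>))"
    unfolding a_def using Y Z by auto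
  have a\<phi>: "a x \<le> \<phi> x" for x using s[of 0 x] by (simp add: a_def)
  have acv: "convex_on UNIV (\<lambda>x. c * x :: real)" for c
    by (rule convex_onI) (auto simp: algebra_simps)
  have alip: "\<bar>c * x - c * y\<bar> \<le> \<bar>c\<bar> * \<bar>x - y\<bar>" for c x y :: real
    by (simp add: right_diff_distrib[symmetric] abs_mult)
  \<comment> \<open>The identity and its negative are both convex and Lipschitz, so the hypothesis
    forces equal means; hence the affine minorant has the same integral on both sides.\<close>
  have "(\<integral>\<omega>. Y \<omega> \<partial>M) = (\<integral>\<omega>. Z \<omega> \<partial>N)"
    using ord[OF acv[of 1] alip[of 1]] ord[OF acv[of "-1"] alip[of "-1"]] by simp
  then have ea: "(\<integral>\<omega>. a (Y \<omega>) \<partial>M) = (\<integral>\<omega>. a (Z \<omega>) \<partial>N)"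
    unfolding a_def using Y Z M.prob_space N.prob_space by simp
  have "\<exists>m L. convex_on UNIV m \<and> (\<forall>x y. \<bar>m x - m y\<bar> \<le> L * \<bar>x - y\<bar>) \<and> (\<forall>x. m x \<le> \<phi> x) \<and>
    (\<forall>x. \<bar>x\<bar> \<le> real n \<longrightarrow> m x = \<phi> x) \<and> (\<forall>x. a x \<le> m x)" for n
    unfolding a_def by (rule convex_lipschitz_minorant[OF cv s]) simp
  then obtain m L where m: "\<And>n. convex_on UNIV (m n)" "\<And>n x y. \<bar>m n x - m n y\<bar> \<le> L n * \<bar>x - y\<bar>"
    "\<And>n x. m n x \<le> \<phi> x" "\<And>n x. \<bar>x\<bar> \<le> real n \<Longrightarrow> m n x = \<phi> x" "\<And>n x. a x \<le> m n x"
    by metis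
  have mm[measurable]: "m n \<in> borel_measurable borel" for n by (rule convex_borel[OF m(1)])
  have mi: "integrable W (\<lambda>\<omega>. m n (V \<omega>))" if W: "prob_space W" and V[measurable]: "integrable W V" for W V n
  proof (rule Bochner_Integration.integrable_bound)
    interpret prob_space W by fact
    show "integrable W (\<lambda>\<omega>. \<bar>m n 0\<bar> + L n * \<bar>V \<omega>\<bar>)" using V by simp
    have "\<bar>m n x\<bar> \<le> \<bar>m n 0\<bar> + L n * \<bar>x\<bar>" for x using m(2)[of n x 0] by simp
    then show "AE \<omega> in W. norm (m n (V \<omega>)) \<le> norm (\<bar>m n 0\<bar> + L n * \<bar>V \<omega>\<bar>)"
      by (intro AE_I2) (metis abs_ge_self order_trans real_norm_def)
  qed (use V in measurable)
  define A where "A = (\<integral>\<^sup>+\<omega>. ennreal (\<phi> (Y \<omega>) - a (Y \<omega>)) \<partial>M)"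
  define C where "C = (\<integral>\<^sup>+\<omega>. ennreal (\<phi> (Z \<omega>) - a (Z \<omega>)) \<partial>N)"
  have AC: "A \<le> C"
  proof -
    have "A = (\<integral>\<^sup>+\<omega>. liminf (\<lambda>n. ennreal (m n (Y \<omega>) - a (Y \<omega>))) \<partial>M)"
      unfolding A_def
    proof (rule nn_integral_cong)
      fix \<omega>
      obtain n0 where n0: "\<bar>Y \<omega>\<bar> \<le> real n0" using real_arch_simple by blast
      have "m n (Y \<omega>) = \<phi> (Y \<omega>)" if "n0 \<le> n" for n using n0 that by (intro m(4)) linarith
      then have "eventually (\<lambda>n. ennreal (m n (Y \<omega>) - a (Y \<omega>)) = ennreal (\<phi> (Y \<omega>) - a (Y \<omega>))) sequentially"
        unfolding eventually_sequentially by (intro exI[of _ n0]) simp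
      then have "(\<lambda>n. ennreal (m n (Y \<omega>) - a (Y \<omega>))) \<longlonglongrightarrow> ennreal (\<phi> (Y \<omega>) - a (Y \<omega>))" by (rule tendsto_eventually)
      then show "ennreal (\<phi> (Y \<omega>) - a (Y \<omega>)) = liminf (\<lambda>n. ennreal (m n (Y \<omega>) - a (Y \<omega>)))"
        by (rule lim_imp_Liminf[OF sequentially_bot, symmetric])
    qed
    also have "\<dots> \<le> liminf (\<lambda>n. \<integral>\<^sup>+\<omega>. ennreal (m n (Y \<omega>) - a (Y \<omega>)) \<partial>M)"
      by (rule nn_integral_liminf) (simp add: a_def)
    also have "\<dots> \<le> liminf (\<lambda>n. C)"
    proof (rule Liminf_mono, rule always_eventually, rule allI)
      fix n
      have iY: "integrable M (\<lambda>\<omega>. m n (Y \<omega>) - a (Y \<omega>))" and iZ: "integrable N (\<lambda>\<omega>. m n (Z \<omega>) - a (Z \<omega>))"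
        using mi[OF M Y] mi[OF N Z] aY aZ by auto
      have "(\<integral>\<^sup>+\<omega>. ennreal (m n (Y \<omega>) - a (Y \<omega>)) \<partial>M) = ennreal (\<integral>\<omega>. m n (Y \<omega>) - a (Y \<omega>) \<partial>M)"
        by (rule nn_integral_eq_integral[OF iY]) (use m(5) in simp)
      also have "\<dots> \<le> ennreal (\<integral>\<omega>. m n (Z \<omega>) - a (Z \<omega>) \<partial>N)"
        using ord[OF m(1,2)] ea mi[OF M Y] mi[OF N Z] aY aZ by (intro ennreal_leI) simp
      also have "\<dots> = (\<integral>\<^sup>+\<omega>. ennreal (m n (Z \<omega>) - a (Z \<omega>)) \<partial>N)"
        by (rule nn_integral_eq_integral[OF iZ, symmetric]) (use m(5) in simp)
      also have "\<dots> \<le> C" unfolding C_def by (intro nn_integral_mono ennreal_leI) (use m(3) in simp)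
      finally show "(\<integral>\<^sup>+\<omega>. ennreal (m n (Y \<omega>) - a (Y \<omega>)) \<partial>M) \<le> C" .
    qed
    finally show ?thesis by (simp add: Liminf_const)
  qed
  have negZ: "(\<integral>\<^sup>+\<omega>. ennreal (- \<phi> (Z \<omega>)) \<partial>N) < \<top>"
  proof -
    have "(\<integral>\<^sup>+\<omega>. ennreal (- \<phi> (Z \<omega>)) \<partial>N) \<le> (\<integral>\<^sup>+\<omega>. ennreal (norm (a (Z \<omega>))) \<partial>N)"
    proof (intro nn_integral_mono ennreal_leI)
      fix \<omega> show "- \<phi> (Z \<omega>) \<le> norm (a (Z \<omega>))" using a\<phi>[of "Z \<omega>"] by simp
    qed
    then show ?thesis using aZ by (auto simp: integrable_iff_bounded intro: le_less_trans)
  qed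
  show ?thesis
  proof (cases "integrable N (\<lambda>\<omega>. \<phi> (Z \<omega>))")
    case True
    have "C < \<top>"
      unfolding C_def using True aZ a\<phi>
      by (subst nn_integral_eq_integral) auto
    then have "A < \<top>" using AC by simp
    have iA: "integrable M (\<lambda>\<omega>. \<phi> (Y \<omega>) - a (Y \<omega>))"
      by (rule integrableI_nonneg) (use \<open>A < \<top>\<close> a\<phi> in \<open>auto simp: A_def a_def\<close>)
    then have iY: "integrable M (\<lambda>\<omega>. \<phi> (Y \<omega>))"
      using Bochner_Integration.integrable_add[OF iA aY] by simp
    have "ennreal (\<integral>\<omega>. \<phi> (Y \<omega>) - a (Y \<omega>) \<partial>M) \<le> ennreal (\<integral>\<omega>. \<phi> (Z \<omega>) - a (Z \<omega>) \<partial>N)"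
      using AC unfolding A_def C_def using True aZ a\<phi> iA
      by (subst (asm) (1 2) nn_integral_eq_integral) auto
    then have "(\<integral>\<omega>. \<phi> (Y \<omega>) - a (Y \<omega>) \<partial>M) \<le> (\<integral>\<omega>. \<phi> (Z \<omega>) - a (Z \<omega>) \<partial>N)"
      using a\<phi> by (subst (asm) ennreal_le_iff) (auto intro!: integral_nonneg)
    then have "(\<integral>\<omega>. \<phi> (Y \<omega>) \<partial>M) \<le> (\<integral>\<omega>. \<phi> (Z \<omega>) \<partial>N)" using True iY aY aZ ea by simp
    then show ?thesis using True iY by (simp add: ext_expectation_integrable)
  \<comment> \<open>Here the positive part of the right-hand side has infinite integral and the
    negative part a finite one, so the bound is infinite.\<close>
  next
    case False
    have "(\<integral>\<^sup>+\<omega>. ennreal (\<phi> (Z \<omega>)) \<partial>N) = \<top>"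
    proof (rule ccontr)
      assume "\<not> ?thesis"
      then have "(\<integral>\<^sup>+\<omega>. ennreal (\<phi> (Z \<omega>)) \<partial>N) + (\<integral>\<^sup>+\<omega>. ennreal (- \<phi> (Z \<omega>)) \<partial>N) < \<top>"
        using negZ by (simp add: less_top)
      moreover have "(\<integral>\<^sup>+\<omega>. ennreal (\<phi> (Z \<omega>)) \<partial>N) + (\<integral>\<^sup>+\<omega>. ennreal (- \<phi> (Z \<omega>)) \<partial>N)
        = (\<integral>\<^sup>+\<omega>. ennreal (norm (\<phi> (Z \<omega>))) \<partial>N)"
        by (subst nn_integral_add[symmetric])
          (auto intro!: nn_integral_cong simp: abs_if ennreal_neg not_less)
      ultimately have "integrable N (\<lambda>\<omega>. \<phi> (Z \<omega>))" by (simp add: integrable_iff_bounded)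
      then show False using False by simp
    qed
    moreover have "\<bar>enn2ereal (\<integral>\<^sup>+\<omega>. ennreal (- \<phi> (Z \<omega>)) \<partial>N)\<bar> \<noteq> \<infinity>"
      using negZ by (cases "\<integral>\<^sup>+\<omega>. ennreal (- \<phi> (Z \<omega>)) \<partial>N") (auto simp: enn2ereal_ennreal)
    ultimately show ?thesis by (simp add: ext_expectation_def)
  qed
qed

section \<open>Comparison with Brownian motion\<close>

locale continuous_reversible_process = reversible_process \<mu> P M X
  for \<mu> :: "'a::polish_space measure" and P and M :: "'w measure" and X +
  assumes paths: "continuous_paths M X"
begin

lemma path_cont:
  assumes "continuous_on UNIV f" "\<omega> \<in> space M"
  shows "continuous_on {0..T} (\<lambda>s. (f (X s \<omega>) :: real))"
proof -
  have "continuous_on {0..} (\<lambda>s. X s \<omega>)" using paths assms(2) by (simp add: continuous_paths_def)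
  then have "continuous_on {0..T} (\<lambda>s. X s \<omega>)" by (rule continuous_on_subset) auto
  then show ?thesis by (rule continuous_on_compose2[OF assms(1)]) auto
qed

definition tint :: "real \<Rightarrow> ('a \<Rightarrow> real) \<Rightarrow> 'w \<Rightarrow> real" where
  "tint T f \<omega> = (LINT s:{0..T}|lborel. f (X s \<omega>))"

lemma tint_riemann:
  assumes "0 < T" "continuous_on UNIV f" "\<omega> \<in> space M"
  shows "(\<lambda>n. \<Sum>i<Suc n. T / real (Suc n) * f (X (real i * (T / real (Suc n))) \<omega>)) \<longlonglongrightarrow> tint T f \<omega>"
    "(\<lambda>n. \<Sum>i<Suc n. T / real (Suc n) * f (X (real (Suc i) * (T / real (Suc n))) \<omega>)) \<longlonglongrightarrow> tint T f \<omega>"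
  unfolding tint_def
  by (rule riemann_sums[OF assms(1) path_cont[OF assms(2,3)]];
      use assms(1) in \<open>auto intro!: mult_right_mono divide_right_mono simp del: times_divide_eq_right\<close>)+

text \<open>The pathwise integral is a limit of Riemann sums, each of which involves finitely many
  coordinates of the process.\<close>

lemma tint_meas:
  assumes "0 < T" "continuous_on UNIV f"
  shows "tint T f \<in> borel_measurable M"
proof (rule borel_measurable_LIMSEQ_real[OF tint_riemann(1)[OF assms]])
  have [measurable]: "f \<in> borel_measurable borel" by (rule borel_measurable_continuous_onI[OF assms(2)])
  show "(\<lambda>\<omega>. \<Sum>i<Suc n. T / real (Suc n) * f (X (real i * (T / real (Suc n))) \<omega>)) \<in> borel_measurable M" for n
    using assms(1) by (intro borel_measurable_sum borel_measurable_times borel_measurable_const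
        measurable_compose[OF X_meas \<open>f \<in> borel_measurable borel\<close>]) simp
qed

text \<open>By stationarity every Riemann sum obeys the bound, and Fatou's lemma carries it to the
  limit.\<close>

lemma tint_L1:
  assumes T: "0 < T" and f: "continuous_on UNIV f" and fi: "integrable \<mu> f"
  shows "integrable M (tint T f)" "(\<integral>\<omega>. \<bar>tint T f \<omega>\<bar> \<partial>M) \<le> T * (\<integral>x. \<bar>f x\<bar> \<partial>\<mu>)"
proof -
  have fm: "f \<in> borel_measurable borel" by (rule borel_measurable_continuous_onI[OF f])
  define R where "R n \<omega> = (\<Sum>i<Suc n. T / real (Suc n) * f (X (real i * (T / real (Suc n))) \<omega>))" for n \<omega>
  have nn: "0 \<le> real i * (T / real (Suc n))" for i n using T by simp
  have iX: "integrable M (\<lambda>\<omega>. f (X (real i * (T / real (Suc n))) \<omega>))" for i n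
    using X_integral(1)[OF nn fm] fi by simp
  have Ri: "integrable M (R n)" for n
    unfolding R_def by (intro Bochner_Integration.integrable_sum integrable_mult_right iX)
  have Rb: "(\<integral>\<omega>. \<bar>R n \<omega>\<bar> \<partial>M) \<le> T * (\<integral>x. \<bar>f x\<bar> \<partial>\<mu>)" for n
  proof -
    have "(\<integral>\<omega>. \<bar>R n \<omega>\<bar> \<partial>M) \<le> (\<integral>\<omega>. (\<Sum>i<Suc n. T / real (Suc n) * \<bar>f (X (real i * (T / real (Suc n))) \<omega>)\<bar>) \<partial>M)"
    proof (rule integral_mono)
      show "integrable M (\<lambda>\<omega>. \<Sum>i<Suc n. T / real (Suc n) * \<bar>f (X (real i * (T / real (Suc n))) \<omega>)\<bar>)"
        by (intro Bochner_Integration.integrable_sum integrable_mult_right integrable_abs iX)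
      fix \<omega>
      show "\<bar>R n \<omega>\<bar> \<le> (\<Sum>i<Suc n. T / real (Suc n) * \<bar>f (X (real i * (T / real (Suc n))) \<omega>)\<bar>)"
        unfolding R_def using T
        by (intro order_trans[OF sum_abs] sum_mono) (simp add: abs_mult del: of_nat_Suc)
    qed (use Ri in auto)
    also have "\<dots> = (\<Sum>i<Suc n. T / real (Suc n) * (\<integral>\<omega>. \<bar>f (X (real i * (T / real (Suc n))) \<omega>)\<bar> \<partial>M))"
      using iX by (subst Bochner_Integration.integral_sum) (auto simp del: sum.lessThan_Suc of_nat_Suc)
    also have "\<dots> = (\<Sum>i<Suc n. T / real (Suc n) * (\<integral>x. \<bar>f x\<bar> \<partial>\<mu>))"
      using X_integral(2)[OF nn, of "\<lambda>x. \<bar>f x\<bar>"] fm by simp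
    also have "\<dots> = T * (\<integral>x. \<bar>f x\<bar> \<partial>\<mu>)" by (simp del: of_nat_Suc sum.lessThan_Suc)
    finally show ?thesis .
  qed
  have "(\<integral>\<^sup>+\<omega>. ennreal \<bar>tint T f \<omega>\<bar> \<partial>M) = (\<integral>\<^sup>+\<omega>. liminf (\<lambda>n. ennreal \<bar>R n \<omega>\<bar>) \<partial>M)"
  proof (rule nn_integral_cong)
    fix \<omega> assume "\<omega> \<in> space M"
    then have "(\<lambda>n. R n \<omega>) \<longlonglongrightarrow> tint T f \<omega>" unfolding R_def by (rule tint_riemann(1)[OF T f])
    then have "(\<lambda>n. ennreal \<bar>R n \<omega>\<bar>) \<longlonglongrightarrow> ennreal \<bar>tint T f \<omega>\<bar>" by (intro tendsto_ennrealI tendsto_rabs)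
    then show "ennreal \<bar>tint T f \<omega>\<bar> = liminf (\<lambda>n. ennreal \<bar>R n \<omega>\<bar>)"
      by (rule lim_imp_Liminf[OF sequentially_bot, symmetric])
  qed
  also have "\<dots> \<le> liminf (\<lambda>n. \<integral>\<^sup>+\<omega>. ennreal \<bar>R n \<omega>\<bar> \<partial>M)"
    by (rule nn_integral_liminf) (use Ri in auto)
  also have "\<dots> \<le> liminf (\<lambda>n. ennreal (T * (\<integral>x. \<bar>f x\<bar> \<partial>\<mu>)))"
  proof (rule Liminf_mono, rule always_eventually, rule allI)
    fix n
    have "(\<integral>\<^sup>+\<omega>. ennreal \<bar>R n \<omega>\<bar> \<partial>M) = ennreal (\<integral>\<omega>. \<bar>R n \<omega>\<bar> \<partial>M)"
      by (rule nn_integral_eq_integral) (use Ri in auto)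
    also have "\<dots> \<le> ennreal (T * (\<integral>x. \<bar>f x\<bar> \<partial>\<mu>))" by (intro ennreal_leI Rb)
    finally show "(\<integral>\<^sup>+\<omega>. ennreal \<bar>R n \<omega>\<bar> \<partial>M) \<le> ennreal (T * (\<integral>x. \<bar>f x\<bar> \<partial>\<mu>))" .
  qed
  finally have b: "(\<integral>\<^sup>+\<omega>. ennreal \<bar>tint T f \<omega>\<bar> \<partial>M) \<le> ennreal (T * (\<integral>x. \<bar>f x\<bar> \<partial>\<mu>))"
    by (simp add: Liminf_const)
  show i: "integrable M (tint T f)"
    unfolding integrable_iff_bounded using tint_meas[OF T f] b by (auto intro: le_less_trans)
  have "ennreal (\<integral>\<omega>. \<bar>tint T f \<omega>\<bar> \<partial>M) \<le> ennreal (T * (\<integral>x. \<bar>f x\<bar> \<partial>\<mu>))"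
    using b nn_integral_eq_integral[OF integrable_abs[OF i]] by simp
  then show "(\<integral>\<omega>. \<bar>tint T f \<omega>\<bar> \<partial>M) \<le> T * (\<integral>x. \<bar>f x\<bar> \<partial>\<mu>)"
    using T by (subst (asm) ennreal_le_iff) auto
qed

lemma tint_diff:
  assumes "continuous_on UNIV f" "continuous_on UNIV k" "\<omega> \<in> space M"
  shows "tint T (\<lambda>x. f x - k x) \<omega> = tint T f \<omega> - tint T k \<omega>"
  unfolding tint_def
  by (rule set_integral_diff(2)) (use path_cont assms in \<open>auto intro!: borel_integrable_atLeastAtMost'\<close>)

end

section \<open>Replacement along the whole chain for bounded functions\<close>

locale poisson_process =
  poisson_solution \<mu> P \<Gamma> h g K B + continuous_reversible_process \<mu> P M X
  for \<mu> :: "'a::polish_space measure" and P \<Gamma> h g K B and M :: "'w measure" and X +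
  assumes g_cont: "continuous_on UNIV g" and K_pos: "0 < K"
begin

definition "fwd d n \<omega> = (\<Sum>j<n. incr d (X (real j * d) \<omega>) (X (real (Suc j) * d) \<omega>))"
definition "bsum d n \<omega> = (\<Sum>j<n. incr d (X (real (Suc j) * d) \<omega>) (X (real j * d) \<omega>))"

lemma incr_integrable: "0 \<le> s \<Longrightarrow> 0 \<le> t \<Longrightarrow> integrable M (\<lambda>\<omega>. incr d (X s \<omega>) (X t \<omega>))"
  unfolding incr_def
  using X_integral(1)[OF _ h_meas] X_integral(1)[OF _ g_meas] L2_int[OF h_L2] L2_int[OF g_L2] by auto

lemma fwd_integrable: "0 \<le> d \<Longrightarrow> integrable M (fwd d n)" and bsum_integrable: "0 \<le> d \<Longrightarrow> integrable M (bsum d n)"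
  unfolding fwd_def[abs_def] bsum_def[abs_def]
  by (auto intro!: Bochner_Integration.integrable_sum incr_integrable)

text \<open>The last step is replaced first. It turns \<open>u\<close> into its Gaussian average,
  which satisfies \<open>taylor2\<close> with the same \<open>c\<close>, so the induction goes on
  with the shorter sum. \<open>n = 0\<close> is apart because \<open>gauss 0\<close> is not a
  probability measure.\<close>

lemma chain_bound:
  assumes d: "0 < d" and t: "taylor2 c u u1 u2"
  shows "(\<integral>\<omega>. u (fwd d n \<omega>) \<partial>M) \<le> (if n = 0 then u 0 else gavg (2 * K * d * real n) u 0) + real n * (c * err d)"
  using t
proof (induction n arbitrary: u u1 u2)
  case 0
  then show ?case using prob_space.prob_space[OF prob_M] by (simp add: fwd_def)
next
  case (Suc n)
  interpret M: prob_space M by (rule prob_M)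
  have d0: "0 \<le> d" using d by simp
  define s where "s = real n * d"
  have s: "0 \<le> s" using d by (simp add: s_def)
  have v: "0 < 2 * K * d" using d K_pos by simp
  note u = taylor2D[OF Suc.prems] and u' = taylor2D[OF taylor2_gavg[OF Suc.prems v]]
  have [measurable]: "u \<in> borel_measurable borel" "gavg (2 * K * d) u \<in> borel_measurable borel" using u u' by auto
  \<comment> \<open>The sum so far together with the current position: a functional of the past to
    which \<open>markov_joint\<close> and \<open>one_step\<close> apply.\<close>
  define H where "H \<omega> = (fwd d n \<omega>, X s \<omega>)" for \<omega>
  have fF: "fwd d n \<in> borel_measurable (\<F> s)"
    unfolding fwd_def[abs_def] incr_def
  proof (intro borel_measurable_sum borel_measurable_add borel_measurable_diff borel_measurable_times borel_measurable_const)
    fix j assume j: "j \<in> {..<n}"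
    have le: "real j * d \<le> s" "real (Suc j) * d \<le> s" "0 \<le> real j * d" "0 \<le> real (Suc j) * d"
      unfolding s_def using j d0 by (auto intro!: mult_right_mono simp del: of_nat_Suc)
    show "(\<lambda>\<omega>. h (X (real (Suc j) * d) \<omega>)) \<in> borel_measurable (\<F> s)"
      "(\<lambda>\<omega>. h (X (real j * d) \<omega>)) \<in> borel_measurable (\<F> s)"
      "(\<lambda>\<omega>. g (X (real j * d) \<omega>)) \<in> borel_measurable (\<F> s)"
      using le by (auto intro!: measurable_compose[OF X_meas_F] simp del: of_nat_Suc)
  qed
  have HF: "H \<in> \<F> s \<rightarrow>\<^sub>M borel \<Otimes>\<^sub>M borel"
    unfolding H_def using fF X_meas_F[OF s order_refl] by measurable
  have HM[measurable]: "H \<in> M \<rightarrow>\<^sub>M borel \<Otimes>\<^sub>M borel" by (rule F_meas_M[OF HF])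
  define L where "L = distr M (borel \<Otimes>\<^sub>M borel) H"
  have Lp: "prob_space L" unfolding L_def by (rule M.prob_space_distr[OF HM])
  have Lsnd: "distr L borel snd = \<mu>"
    unfolding L_def using stationary[OF s] by (subst distr_distr) (auto simp: comp_def H_def)
  have Li: "integrable L fst"
    unfolding L_def using fwd_integrable[OF d0, of n]
    by (subst integrable_distr_eq) (auto simp: H_def)
  have j: "distr M ((borel \<Otimes>\<^sub>M borel) \<Otimes>\<^sub>M borel) (\<lambda>\<omega>. (H \<omega>, X (s + d) \<omega>)) = semidirect L borel (\<lambda>p. P d (snd p))"
    unfolding L_def by (rule markov_joint[OF s d0 HF measurable_snd]) (simp add: H_def)
  have sd: "s + d = real (Suc n) * d" by (simp add: s_def algebra_simps)
  have sd0: "0 \<le> s + d" using s d by simp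
  note [measurable] = X_meas[OF sd0]
  have "(\<integral>\<omega>. u (fwd d (Suc n) \<omega>) \<partial>M)
    = (\<integral>q. u (fst (fst q) + incr d (snd (fst q)) (snd q)) \<partial>distr M ((borel \<Otimes>\<^sub>M borel) \<Otimes>\<^sub>M borel) (\<lambda>\<omega>. (H \<omega>, X (s + d) \<omega>)))"
  proof -
    have fm: "(\<lambda>q. u (fst (fst q) + incr d (snd (fst q)) (snd q))) \<in> borel_measurable ((borel \<Otimes>\<^sub>M borel) \<Otimes>\<^sub>M borel)"
      unfolding incr_def by measurable
    have m: "(\<lambda>\<omega>. (H \<omega>, X (s + d) \<omega>)) \<in> M \<rightarrow>\<^sub>M (borel \<Otimes>\<^sub>M borel) \<Otimes>\<^sub>M borel" by measurable
    show ?thesis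
      unfolding integral_distr[OF m fm] by (simp add: H_def fwd_def sd s_def[symmetric] del: of_nat_Suc)
  qed
  also have "\<dots> \<le> (\<integral>p. gavg (2 * K * d) u (fst p) \<partial>L) + c * err d"
    unfolding j by (rule one_step[OF d K_pos Suc.prems Lp _ Lsnd Li]) (simp add: L_def)
  also have "(\<integral>p. gavg (2 * K * d) u (fst p) \<partial>L) = (\<integral>\<omega>. gavg (2 * K * d) u (fwd d n \<omega>) \<partial>M)"
    unfolding L_def by (subst integral_distr) (auto simp: H_def)
  also have "\<dots> \<le> (if n = 0 then gavg (2 * K * d) u 0 else gavg (2 * K * d * real n) (gavg (2 * K * d) u) 0) + real n * (c * err d)"
    by (rule Suc.IH[OF taylor2_gavg[OF Suc.prems v]])
  also have "(if n = 0 then gavg (2 * K * d) u 0 else gavg (2 * K * d * real n) (gavg (2 * K * d) u) 0)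
    = gavg (2 * K * d * real (Suc n)) u 0"
  proof (cases "n = 0")
    case False
    then have vn: "0 < 2 * K * d * real n" using v by simp
    show ?thesis using gavg_gavg[OF u(1) vn v, of 0] False by (simp add: algebra_simps)
  qed simp
  finally show ?case by (simp add: algebra_simps)
qed

text \<open>\<open>bsum\<close> is the functional \<open>fwd\<close> evaluated on the reversed path,
  so \<open>path_reversal\<close> applies; in \<open>e2\<close> the summation index is
  reflected.\<close>

lemma bsum_law:
  assumes d: "0 \<le> d" and u: "u \<in> borel_measurable borel"
  shows "(\<integral>\<omega>. (u (bsum d n \<omega>) :: real) \<partial>M) = (\<integral>\<omega>. u (fwd d n \<omega>) \<partial>M)"
proof -
  define F where "F p = u (\<Sum>j<n. incr d (p j) (p (Suc j)))" for p :: "nat \<Rightarrow> 'a"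
  let ?Pi = "PiM {..n} (\<lambda>_. borel :: 'a measure)"
  have [measurable]: "u \<in> borel_measurable borel" by fact
  have Fm: "F \<in> borel_measurable ?Pi"
    unfolding F_def[abs_def] incr_def
    by (intro measurable_compose[OF _ u] borel_measurable_sum borel_measurable_add borel_measurable_diff
        borel_measurable_times borel_measurable_const measurable_compose[OF measurable_component_singleton])
      auto
  have m: "(\<lambda>\<omega>. \<lambda>i\<in>{..n}. X (real i * d) \<omega>) \<in> M \<rightarrow>\<^sub>M ?Pi" "(\<lambda>\<omega>. \<lambda>i\<in>{..n}. X (real (n - i) * d) \<omega>) \<in> M \<rightarrow>\<^sub>M ?Pi"
    using d by (auto intro!: measurable_restrict X_meas)
  have e1: "F (\<lambda>i\<in>{..n}. X (real i * d) \<omega>) = u (fwd d n \<omega>)" for \<omega>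
    unfolding F_def fwd_def by (intro arg_cong[where f = u] sum.cong refl) auto
  have e2: "F (\<lambda>i\<in>{..n}. X (real (n - i) * d) \<omega>) = u (bsum d n \<omega>)" for \<omega>
  proof -
    have "(\<Sum>j<n. incr d ((\<lambda>i\<in>{..n}. X (real (n - i) * d) \<omega>) j) ((\<lambda>i\<in>{..n}. X (real (n - i) * d) \<omega>) (Suc j)))
      = (\<Sum>j<n. (\<lambda>i. incr d (X (real (Suc i) * d) \<omega>) (X (real i * d) \<omega>)) (n - Suc j))"
      by (intro sum.cong refl) (auto simp: Suc_diff_Suc simp del: of_nat_Suc)
    also have "\<dots> = bsum d n \<omega>" unfolding bsum_def by (rule sum.nat_diff_reindex)
    finally show ?thesis unfolding F_def by simp
  qed
  have "(\<integral>\<omega>. u (bsum d n \<omega>) \<partial>M) = (\<integral>p. F p \<partial>distr M ?Pi (\<lambda>\<omega>. \<lambda>i\<in>{..n}. X (real (n - i) * d) \<omega>))"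
    unfolding integral_distr[OF m(2) Fm] e2 ..
  also have "\<dots> = (\<integral>\<omega>. u (fwd d n \<omega>) \<partial>M)"
    unfolding path_reversal[OF d, symmetric] integral_distr[OF m(1) Fm] e1 ..
  finally show ?thesis .
qed

lemma convex_order_smooth:
  assumes T: "0 < T" and t: "taylor2 c u u1 u2" and cv: "convex_on UNIV u"
  shows "(\<integral>\<omega>. u (tint T g \<omega>) \<partial>M) \<le> gavg (2 * K * T) u 0"
proof -
  interpret M: prob_space M by (rule prob_M)
  note u = taylor2D[OF t]
  have um[measurable]: "u \<in> borel_measurable borel" by (rule u(8))
  define d where "d n = T / real (Suc n)" for n
  have d: "0 < d n" "0 \<le> d n" "real (Suc n) * d n = T" for n using T by (auto simp: d_def)
  define A where "A n = fwd (d n) (Suc n)" for n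
  define A' where "A' n = bsum (d n) (Suc n)" for n
  define Y where "Y n \<omega> = (A n \<omega> + A' n \<omega>) / 2" for n \<omega>
  have Ai: "integrable M (A n)" "integrable M (A' n)" for n
    unfolding A_def A'_def by (rule fwd_integrable[OF d(2)] bsum_integrable[OF d(2)])+
  have [measurable]: "A n \<in> borel_measurable M" "A' n \<in> borel_measurable M" for n using Ai by auto
  \<comment> \<open>Term by term the increments of \<open>h\<close> cancel, which leaves the mean of
    the left and the right Riemann sum.\<close>
  have Y: "Y n \<omega> = ((\<Sum>i<Suc n. d n * g (X (real i * d n) \<omega>)) + (\<Sum>i<Suc n. d n * g (X (real (Suc i) * d n) \<omega>))) / 2" for n \<omega>
    unfolding Y_def A_def A'_def fwd_def bsum_def sum.distrib[symmetric]
    by (intro arg_cong[where f = "\<lambda>x. x / 2"] sum.cong refl) (simp add: incr_def del: of_nat_Suc)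
  have Ylim: "(\<lambda>n. Y n \<omega>) \<longlonglongrightarrow> tint T g \<omega>" if "\<omega> \<in> space M" for \<omega>
  proof -
    have "(\<lambda>n. Y n \<omega>) \<longlonglongrightarrow> (tint T g \<omega> + tint T g \<omega>) / 2"
      unfolding Y d_def by (intro tendsto_divide tendsto_add tendsto_const tint_riemann T g_cont that) simp
    then show ?thesis by simp
  qed
  have YB: "\<bar>Y n \<omega>\<bar> \<le> T * B" for n \<omega>
  proof -
    have b: "\<bar>\<Sum>i<Suc n. d n * g (x i)\<bar> \<le> T * B" for x
    proof -
      have "\<bar>\<Sum>i<Suc n. d n * g (x i)\<bar> \<le> (\<Sum>i<Suc n. d n * B)"
        using d(2) g_bdd by (intro order_trans[OF sum_abs] sum_mono) (auto simp: abs_mult intro!: mult_left_mono)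
      also have "\<dots> = (real (Suc n) * d n) * B" by (simp del: of_nat_Suc sum.lessThan_Suc)
      finally show ?thesis unfolding d(3) .
    qed
    show ?thesis unfolding Y using b[of "\<lambda>i. X (real i * d n) \<omega>"] b[of "\<lambda>i. X (real (Suc i) * d n) \<omega>"]
      by (simp del: of_nat_Suc sum.lessThan_Suc)
  qed
  have iu: "integrable M (\<lambda>\<omega>. u (V \<omega>))" if V: "integrable M V" for V
  proof (rule Bochner_Integration.integrable_bound)
    show "integrable M (\<lambda>\<omega>. \<bar>u 0\<bar> + c * \<bar>V \<omega>\<bar>)" using V by simp
    have "\<bar>u x\<bar> \<le> \<bar>u 0\<bar> + c * \<bar>x\<bar>" for x using u(1)[of x 0] by simp
    then show "AE \<omega> in M. norm (u (V \<omega>)) \<le> norm (\<bar>u 0\<bar> + c * \<bar>V \<omega>\<bar>)" using u(9) by simp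
    show "(\<lambda>\<omega>. u (V \<omega>)) \<in> borel_measurable M" using V by measurable
  qed
  have step: "(\<integral>\<omega>. u (Y n \<omega>) \<partial>M) \<le> gavg (2 * K * T) u 0 + real (Suc n) * (c * err (d n))" for n
  proof -
    \<comment> \<open>Convexity at the midpoint of \<open>A n\<close> and \<open>A' n\<close>; their
      joint law does not enter.\<close>
    have "(\<integral>\<omega>. u (Y n \<omega>) \<partial>M) \<le> (\<integral>\<omega>. (u (A n \<omega>) + u (A' n \<omega>)) / 2 \<partial>M)"
    proof (rule integral_mono)
      show "integrable M (\<lambda>\<omega>. u (Y n \<omega>))" unfolding Y_def using Ai by (intro iu) auto
      show "u (Y n \<omega>) \<le> (u (A n \<omega>) + u (A' n \<omega>)) / 2" for \<omega>
        using convex_onD[OF cv, of "1/2" "A n \<omega>" "A' n \<omega>"] by (simp add: Y_def add_divide_distrib)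
    qed (use iu[OF Ai(1)] iu[OF Ai(2)] in auto)
    also have "\<dots> = (\<integral>\<omega>. u (A n \<omega>) \<partial>M)"
      using iu[OF Ai(1)] iu[OF Ai(2)] bsum_law[OF d(2) um, of n "Suc n"] by (simp add: A_def A'_def)
    also have "\<dots> \<le> gavg (2 * K * d n * real (Suc n)) u 0 + real (Suc n) * (c * err (d n))"
      using chain_bound[OF d(1) t, of n "Suc n"] unfolding A_def by (simp del: of_nat_Suc)
    also have "2 * K * d n * real (Suc n) = 2 * K * T" using d(3)[of n] by (simp add: mult_ac del: of_nat_Suc)
    finally show ?thesis .
  qed
  have lim: "(\<lambda>n. \<integral>\<omega>. u (Y n \<omega>) \<partial>M) \<longlonglongrightarrow> (\<integral>\<omega>. u (tint T g \<omega>) \<partial>M)"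
  proof (rule integral_dominated_convergence[where w = "\<lambda>_. \<bar>u 0\<bar> + c * (T * B)"])
    show "(\<lambda>\<omega>. u (tint T g \<omega>)) \<in> borel_measurable M"
      using tint_meas[OF T g_cont] by measurable
    have cu: "isCont u x" for x
      using u(1) u(9) lipschitz_on_continuous_on[of c UNIV u]
      by (auto simp: continuous_on_eq_continuous_at lipschitz_on_def dist_real_def)
    show "AE \<omega> in M. (\<lambda>n. u (Y n \<omega>)) \<longlonglongrightarrow> u (tint T g \<omega>)"
      using Ylim by (intro AE_I2 isCont_tendsto_compose[OF cu])
    show "AE \<omega> in M. norm (u (Y n \<omega>)) \<le> \<bar>u 0\<bar> + c * (T * B)" for n
    proof (rule AE_I2)
      fix \<omega>
      have "\<bar>u (Y n \<omega>)\<bar> \<le> \<bar>u 0\<bar> + c * \<bar>Y n \<omega>\<bar>" using u(1)[of "Y n \<omega>" 0] by simp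
      also have "\<dots> \<le> \<bar>u 0\<bar> + c * (T * B)" using YB u(9) by (intro add_left_mono mult_left_mono) auto
      finally show "norm (u (Y n \<omega>)) \<le> \<bar>u 0\<bar> + c * (T * B)" by simp
    qed
  qed (auto simp: Y_def)
  have fl: "filterlim d (at_right 0) sequentially"
  proof -
    have "(\<lambda>j. T * inverse (real (Suc j))) \<longlonglongrightarrow> T * 0"
      by (intro tendsto_mult tendsto_const LIMSEQ_inverse_real_of_nat)
    then show ?thesis using d(1) by (auto simp: filterlim_at d_def[abs_def] divide_inverse)
  qed
  show ?thesis
  proof (rule field_le_epsilon)
    fix e :: real assume e: "0 < e"
    \<comment> \<open>Each of the \<open>Suc n\<close> steps costs \<open>c * err (d n)\<close>. As
      this is o(d n) and \<open>Suc n * d n = T\<close>, the total cost is eventually at most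
      \<open>e\<close>.\<close>
    have "small_o (\<lambda>x. c * err x)" by (rule small_o_cmult[OF small_o_err[OF K_pos] u(9)])
    moreover have "0 < e / T" using e T by simp
    ultimately have "eventually (\<lambda>x. c * err x \<le> e / T * x) (at_right 0)" by (rule small_oD)
    then have ev: "eventually (\<lambda>n. c * err (d n) \<le> e / T * d n) sequentially"
      using fl by (auto simp: filterlim_iff)
    show "(\<integral>\<omega>. u (tint T g \<omega>) \<partial>M) \<le> gavg (2 * K * T) u 0 + e"
    proof (rule tendsto_upperbound[OF lim _ sequentially_bot], use ev in eventually_elim)
      fix n assume n: "c * err (d n) \<le> e / T * d n"
      have "real (Suc n) * (c * err (d n)) \<le> real (Suc n) * (e / T * d n)"
        by (rule mult_left_mono[OF n]) simp
      also have "\<dots> = e / T * (real (Suc n) * d n)" by (simp add: mult_ac del: of_nat_Suc)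
      also have "\<dots> = e" unfolding d(3) using T by simp
      finally show "(\<integral>\<omega>. u (Y n \<omega>) \<partial>M) \<le> gavg (2 * K * T) u 0 + e" using step[of n] by linarith
    qed
  qed
qed

lemma tint_integrable: "0 < T \<Longrightarrow> integrable M (tint T g)"
  by (rule tint_L1(1)[OF _ g_cont L2_int[OF g_L2]])

lemma convex_order_lipschitz:
  assumes T: "0 < T" and cv: "convex_on UNIV f" and lip: "\<And>x y. \<bar>f x - f y\<bar> \<le> L * \<bar>x - y\<bar>"
  shows "(\<integral>\<omega>. f (tint T g \<omega>) \<partial>M) \<le> (\<integral>z. f z \<partial>gauss (2 * K * T))"
proof (rule field_le_epsilon)
  interpret M: prob_space M by (rule prob_M)
  have v: "0 < 2 * K * T" using K_pos T by simp
  interpret G: prob_space "gauss (2 * K * T)" by (rule prob_gauss[OF v])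
  have L: "0 \<le> L" using lip[of 1 0] by simp
  have fm[measurable]: "f \<in> borel_measurable borel" by (rule lip_borel[OF lip])
  fix e :: real assume e: "0 < e"
  \<comment> \<open>Chosen so that the smoothing error \<open>2 * L * e'\<close> is at most
    \<open>e / 2\<close> on either side; \<open>L + 1\<close> avoids division by zero.\<close>
  define e' where "e' = e / (4 * (L + 1))"
  have e': "0 < e'" using e L by (simp add: e'_def)
  have Le: "2 * L * e' \<le> e / 2"
  proof -
    have "2 * L * e' = e / 2 * (L / (L + 1))" using L by (simp add: e'_def field_simps)
    also have "\<dots> \<le> e / 2 * 1" using L e by (intro mult_left_mono) auto
    finally show ?thesis by simp
  qed
  obtain c u u1 u2 where u: "taylor2 c u u1 u2" "convex_on UNIV u" "\<And>x. \<bar>u x - f x\<bar> \<le> 2 * L * e'"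
    using convex_lipschitz_smoothing[OF cv lip e'] by blast
  note ut = taylor2D[OF u(1)]
  have [measurable]: "u \<in> borel_measurable borel" by (rule ut(8))
  have ti: "integrable M (tint T g)" by (rule tint_integrable[OF T])
  have ilip: "integrable M (\<lambda>\<omega>. w (tint T g \<omega>))" if w: "\<And>x y. \<bar>w x - w y\<bar> \<le> b * \<bar>x - y\<bar>" for w b
  proof (rule Bochner_Integration.integrable_bound)
    have [measurable]: "w \<in> borel_measurable borel" by (rule lip_borel[OF w])
    show "integrable M (\<lambda>\<omega>. \<bar>w 0\<bar> + b * \<bar>tint T g \<omega>\<bar>)" using ti by simp
    have "\<bar>w x\<bar> \<le> \<bar>w 0\<bar> + b * \<bar>x\<bar>" for x using w[of x 0] by simp
    then show "AE \<omega> in M. norm (w (tint T g \<omega>)) \<le> norm (\<bar>w 0\<bar> + b * \<bar>tint T g \<omega>\<bar>)"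
      by (intro AE_I2) (metis abs_ge_self order_trans real_norm_def)
    show "(\<lambda>\<omega>. w (tint T g \<omega>)) \<in> borel_measurable M" using ti by measurable
  qed
  have "(\<integral>\<omega>. f (tint T g \<omega>) \<partial>M) \<le> (\<integral>\<omega>. u (tint T g \<omega>) + e / 2 \<partial>M)"
  proof (rule integral_mono[OF ilip[OF lip]])
    show "f (tint T g \<omega>) \<le> u (tint T g \<omega>) + e / 2" for \<omega>
      using u(3)[of "tint T g \<omega>"] Le by (simp add: abs_le_iff)
  qed (use ilip[OF ut(1)] in simp)
  also have "\<dots> = (\<integral>\<omega>. u (tint T g \<omega>) \<partial>M) + e / 2" using ilip[OF ut(1)] M.prob_space by simp
  also have "(\<integral>\<omega>. u (tint T g \<omega>) \<partial>M) \<le> gavg (2 * K * T) u 0" by (rule convex_order_smooth[OF T u(1,2)])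
  also have "gavg (2 * K * T) u 0 \<le> (\<integral>z. f z + e / 2 \<partial>gauss (2 * K * T))"
    unfolding gavg_def
  proof (rule integral_mono)
    show "integrable (gauss (2 * K * T)) (\<lambda>z. u (0 + z))" by (rule lip_gauss_integrable[OF ut(1) v])
    show "integrable (gauss (2 * K * T)) (\<lambda>z. f z + e / 2)" using lip_gauss_integrable[OF lip v, of 0] by simp
    show "u (0 + z) \<le> f z + e / 2" for z using u(3)[of z] Le by (simp add: abs_le_iff)
  qed
  also have "\<dots> = (\<integral>z. f z \<partial>gauss (2 * K * T)) + e / 2"
    using lip_gauss_integrable[OF lip v, of 0] G.prob_space by simp
  finally show "(\<integral>\<omega>. f (tint T g \<omega>) \<partial>M) \<le> (\<integral>z. f z \<partial>gauss (2 * K * T)) + e" by simp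
qed

end

text \<open>The bound behind \<open>W\<^sub>1I\<close>: with \<open>s\<^sup>2\<close> the density of \<open>\<nu>\<close>,
  \<open>\<nu>(g) = \<E>(s\<^sup>2, h) = \<integral> 2 s \<Gamma>(s, h) d\<mu>\<close>.\<close>

lemma (in poisson_solution) fisher_bound:
  assumes s: "s \<in> \<D>"
  shows "(\<integral>x. (s x)\<^sup>2 * g x \<partial>\<mu>) \<le> 2 * sqrt K * (sqrt (sqn \<mu> s) * sqrt (\<integral>x. \<Gamma> s s x \<partial>\<mu>))"
proof -
  have sL: "s \<in> L2fun \<mu>" by (rule D_form_L2[OF s])
  have [measurable]: "s \<in> borel_measurable borel" by (rule L2_meas[OF sL])
  define q where "q n x = real (Suc n) * sin (x / real (Suc n))" for n x
  define c where "c n x = cos (x / real (Suc n))" for n x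
  have dq: "((q n) has_real_derivative c n x) (at x)" for n x
    unfolding q_def c_def by (rule scaled_sin_deriv) simp
  have cc: "continuous_on UNIV (c n)" "continuous_on UNIV (q n)" for n
    unfolding c_def[abs_def] q_def[abs_def] by (intro continuous_intros; simp)+
  have [measurable]: "q n \<in> borel_measurable borel" "c n \<in> borel_measurable borel" for n
    using cc by (auto intro: borel_measurable_continuous_onI)
  have qb: "\<bar>q n x\<bar> \<le> real (Suc n)" "\<bar>c n x\<bar> \<le> 1" "\<bar>q n x\<bar> \<le> \<bar>x\<bar>" for n x
    using scaled_sin_le[of "real (Suc n)" x] by (auto simp: q_def c_def abs_mult simp del: of_nat_Suc)
  \<comment> \<open>The root of \<Gamma>(s, s), so that the pointwise Cauchy-Schwarz inequality for
    \<Gamma> can be followed by the one in L2.\<close>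
  define z where "z x = sqrt (\<Gamma> s s x)" for x
  have Gm: "\<Gamma> s s \<in> borel_measurable \<mu>" using G_int[OF s s] by auto
  have zL: "z \<in> L2fun \<mu>"
  proof -
    have "integrable \<mu> (\<lambda>x. (z x)\<^sup>2)"
    proof (rule integrable_cong_AE_imp[OF G_int[OF s s]])
      show "AE x in \<mu>. \<Gamma> s s x = (z x)\<^sup>2"
        using G_pos[OF s] by eventually_elim (simp add: z_def)
    qed (use Gm in \<open>simp add: z_def\<close>)
    then show ?thesis using Gm by (simp add: L2fun_def z_def[abs_def])
  qed
  have zsq: "sqn \<mu> z = (\<integral>x. \<Gamma> s s x \<partial>\<mu>)"
    unfolding sqn_def
  proof (rule integral_cong_AE)
    show "AE x in \<mu>. (z x)\<^sup>2 = \<Gamma> s s x"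
      using G_pos[OF s] by eventually_elim (simp add: z_def)
  qed (use Gm in \<open>auto simp: z_def\<close>)
  \<comment> \<open>The truncation \<open>q n\<close> makes the square of \<open>s\<close> a bounded
    smooth function, as the chain rule demands. Its derivative is still at most twice the modulus of
    \<open>s\<close>, so the bound is uniform in \<open>n\<close>.\<close>
  have n: "(\<integral>x. (q n (s x))\<^sup>2 * g x \<partial>\<mu>) \<le> 2 * sqrt K * (sqrt (sqn \<mu> s) * sqrt (\<integral>x. \<Gamma> s s x \<partial>\<mu>))" for n
  proof -
    have dq2: "((\<lambda>x. (q n x)\<^sup>2) has_real_derivative 2 * q n x * c n x) (at x)" for x
      using DERIV_power[OF dq[of n x], of 2] by (simp add: mult_ac)
    have b1: "\<bar>(q n x)\<^sup>2\<bar> \<le> (real (Suc n))\<^sup>2" for x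
      using power_mono[OF qb(1)[of n x] abs_ge_zero, of 2] by simp
    have b2: "\<bar>2 * q n x * c n x\<bar> \<le> 2 * real (Suc n)" for x
      using mult_mono[OF qb(1)[of n x] qb(2)[of n x]] by (simp add: abs_mult del: of_nat_Suc)
    have co: "continuous_on UNIV (\<lambda>x. 2 * q n x * c n x)" using cc by (intro continuous_intros)
    note ch = G_chain1[OF dq2 co b1 b2 s]
    have i: "integrable \<mu> (\<lambda>x. (2 * q n (s x) * c n (s x)) * \<Gamma> s h x)"
      by (rule G_mult_int[OF s h_D _ b2]) measurable
    have "(\<integral>x. (q n (s x))\<^sup>2 * g x \<partial>\<mu>) = (\<integral>x. \<Gamma> (\<lambda>y. (q n (s y))\<^sup>2) h x \<partial>\<mu>)"
      using G_gg[OF hg ch(1)] by (simp add: ip_def)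
    also have "\<dots> = (\<integral>x. (2 * q n (s x) * c n (s x)) * \<Gamma> s h x \<partial>\<mu>)"
      by (rule integral_cong_AE) (use i G_int[OF ch(1) h_D] ch(2)[OF h_D] in auto)
    also have "\<dots> \<le> (\<integral>x. 2 * sqrt K * (\<bar>s x\<bar> * z x) \<partial>\<mu>)"
    proof (rule integral_mono_AE[OF i])
      show "integrable \<mu> (\<lambda>x. 2 * sqrt K * (\<bar>s x\<bar> * z x))"
        using L2_mult[OF L2_abs[OF sL] zL] by simp
      show "AE x in \<mu>. (2 * q n (s x) * c n (s x)) * \<Gamma> s h x \<le> 2 * sqrt K * (\<bar>s x\<bar> * z x)"
        using G_cauchy[OF s h_D] G_pos[OF s] G_pos[OF h_D] G_le
      proof eventually_elim
        case (elim x)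
        have "\<bar>\<Gamma> s h x\<bar> \<le> sqrt (\<Gamma> s s x * \<Gamma> h h x)" using real_sqrt_le_mono[OF elim(1)] by simp
        also have "\<dots> \<le> sqrt (\<Gamma> s s x * K)" using elim by (intro real_sqrt_le_mono mult_left_mono)
        finally have a: "\<bar>\<Gamma> s h x\<bar> \<le> sqrt K * z x" by (simp add: z_def real_sqrt_mult mult.commute)
        have "(2 * q n (s x) * c n (s x)) * \<Gamma> s h x \<le> \<bar>(2 * q n (s x) * c n (s x)) * \<Gamma> s h x\<bar>" by (rule abs_ge_self)
        also have "\<dots> = 2 * (\<bar>q n (s x)\<bar> * \<bar>c n (s x)\<bar>) * \<bar>\<Gamma> s h x\<bar>" by (simp add: abs_mult)
        also have "\<dots> \<le> 2 * (\<bar>s x\<bar> * 1) * (sqrt K * z x)"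
          using a qb(2,3) by (intro mult_mono) auto
        finally show ?case by (simp add: mult_ac)
      qed
    qed
    also have "\<dots> = 2 * sqrt K * ip \<mu> (\<lambda>x. \<bar>s x\<bar>) z" by (simp add: ip_def)
    also have "\<dots> \<le> 2 * sqrt K * (sqrt (sqn \<mu> (\<lambda>x. \<bar>s x\<bar>)) * sqrt (sqn \<mu> z))"
      using ip_cauchy_sqrt[OF L2_abs[OF sL] zL] K_nonneg by (intro mult_left_mono) auto
    finally show ?thesis unfolding zsq by (simp add: sqn_def)
  qed
  have lim: "(\<lambda>n. \<integral>x. (q n (s x))\<^sup>2 * g x \<partial>\<mu>) \<longlonglongrightarrow> (\<integral>x. (s x)\<^sup>2 * g x \<partial>\<mu>)"
  proof (rule integral_dominated_convergence[where w = "\<lambda>x. B * (s x)\<^sup>2"])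
    show "AE x in \<mu>. (\<lambda>n. (q n (s x))\<^sup>2 * g x) \<longlonglongrightarrow> (s x)\<^sup>2 * g x"
      unfolding q_def by (intro AE_I2 tendsto_mult tendsto_power tendsto_const scaled_sin_tendsto)
    show "AE x in \<mu>. norm ((q n (s x))\<^sup>2 * g x) \<le> B * (s x)\<^sup>2" for n
    proof (rule AE_I2)
      fix x
      have "(q n (s x))\<^sup>2 \<le> (s x)\<^sup>2" using qb(3)[of n "s x"] by (rule abs_le_square_iff[THEN iffD1])
      then have "(q n (s x))\<^sup>2 * \<bar>g x\<bar> \<le> (s x)\<^sup>2 * B" using g_bdd by (intro mult_mono) auto
      then show "norm ((q n (s x))\<^sup>2 * g x) \<le> B * (s x)\<^sup>2" by (simp add: abs_mult mult.commute)
    qed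
  qed (use L2D(2)[OF sL] in auto)
  show ?thesis by (rule LIMSEQ_le_const2[OF lim]) (use n in auto)
qed

section \<open>The Lipschitz seminorm and the laws on the Gaussian side\<close>

lemma lip_seminorm_bound:
  assumes "g \<in> C_Lip"
  shows "\<bar>g x - g y\<bar> \<le> lip_seminorm g * dist x y" "0 \<le> lip_seminorm g"
proof -
  obtain L where L: "L-lipschitz_on UNIV g" using assms by (auto simp: C_Lip_def)
  have L0: "0 \<le> L" by (rule lipschitz_on_nonneg[OF L])
  have q: "\<bar>g x - g y\<bar> / dist x y \<le> L" for x y
    using lipschitz_onD[OF L, of x y] L0
    by (cases "x = y") (auto simp: dist_real_def divide_le_eq)
  have bdd: "bdd_above ((\<lambda>(x, y). \<bar>g x - g y\<bar> / dist x y) ` UNIV)"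
    by (rule bdd_aboveI2[of _ _ L]) (use q in \<open>auto simp: case_prod_beta\<close>)
  have up: "\<bar>g x - g y\<bar> / dist x y \<le> lip_seminorm g" for x y
    unfolding lip_seminorm_def using cSUP_upper[OF UNIV_I bdd, of "(x, y)"] by simp
  show "0 \<le> lip_seminorm g" using up[of x x] by simp
  show "\<bar>g x - g y\<bar> \<le> lip_seminorm g * dist x y"
    using up[of x y] by (cases "x = y") (auto simp: divide_le_eq)
qed

lemma lip_seminorm_le:
  assumes "0 \<le> L" "\<And>x y. \<bar>g x - g y\<bar> \<le> L * dist x y"
  shows "g \<in> C_Lip" "lip_seminorm g \<le> L"
proof -
  have "L-lipschitz_on UNIV g"
    using assms by (intro lipschitz_onI) (auto simp: dist_real_def)
  then show "g \<in> C_Lip" by (auto simp: C_Lip_def)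
  show "lip_seminorm g \<le> L"
    unfolding lip_seminorm_def
  proof (rule cSUP_least)
    fix z :: "'a \<times> 'a"
    show "(case z of (x, y) \<Rightarrow> \<bar>g x - g y\<bar> / dist x y) \<le> L"
      using assms(1) assms(2)[of "fst z" "snd z"]
      by (cases "fst z = snd z") (auto simp: case_prod_beta divide_le_eq)
  qed simp
qed

lemma C_Lip_cont: "g \<in> C_Lip \<Longrightarrow> continuous_on UNIV g"
  by (auto simp: C_Lip_def intro: lipschitz_on_continuous_on)

lemma C_Lip_borel: "g \<in> C_Lip \<Longrightarrow> g \<in> borel_measurable borel"
  using C_Lip_cont by (rule borel_measurable_continuous_onI)

text \<open>Completing the square: exponential tilting shifts the mean by
  \<open>\<theta> * v\<close>.\<close>

lemma normal_density_exp:
  assumes "0 < v"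
  shows "normal_density 0 (sqrt v) x * exp (\<theta> * x) = exp (\<theta>\<^sup>2 * v / 2) * normal_density (\<theta> * v) (sqrt v) x"
proof -
  have "- (x\<^sup>2) / (2 * v) + \<theta> * x = \<theta>\<^sup>2 * v / 2 + - ((x - \<theta> * v)\<^sup>2) / (2 * v)"
    using assms by (simp add: field_simps power2_eq_square)
  then have "exp (- (x\<^sup>2) / (2 * v)) * exp (\<theta> * x) = exp (\<theta>\<^sup>2 * v / 2) * exp (- ((x - \<theta> * v)\<^sup>2) / (2 * v))"
    by (simp only: exp_add[symmetric])
  then show ?thesis using assms by (simp add: normal_density_def)
qed

lemma nn_integral_gauss_exp:
  assumes v: "0 < v"
  shows "(\<integral>\<^sup>+x. ennreal (exp (\<theta> * x)) \<partial>gauss v) = ennreal (exp (\<theta>\<^sup>2 * v / 2))"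
proof -
  have p: "prob_space (density lborel (\<lambda>x. ennreal (normal_density (\<theta> * v) (sqrt v) x)))"
    by (rule prob_space_normal_density) (use v in simp)
  have "(\<integral>\<^sup>+x. ennreal (exp (\<theta> * x)) \<partial>gauss v)
    = (\<integral>\<^sup>+x. ennreal (normal_density 0 (sqrt v) x) * ennreal (exp (\<theta> * x)) \<partial>lborel)"
    unfolding gauss_def by (rule nn_integral_density) auto
  also have "\<dots> = (\<integral>\<^sup>+x. ennreal (exp (\<theta>\<^sup>2 * v / 2)) * ennreal (normal_density (\<theta> * v) (sqrt v) x) \<partial>lborel)"
    by (intro nn_integral_cong) (simp add: ennreal_mult'[symmetric] normal_density_exp[OF v])
  also have "\<dots> = ennreal (exp (\<theta>\<^sup>2 * v / 2)) * (\<integral>\<^sup>+x. ennreal (normal_density (\<theta> * v) (sqrt v) x) \<partial>lborel)"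
    by (rule nn_integral_cmult) auto
  also have "(\<integral>\<^sup>+x. ennreal (normal_density (\<theta> * v) (sqrt v) x) \<partial>lborel) = 1"
    using prob_space.emeasure_space_1[OF p] by (simp add: emeasure_density)
  finally show ?thesis by simp
qed

text \<open>The definition prescribes the law of \<open>B v - B 0\<close>, and
  \<open>B 0 = 0\<close> holds almost surely; both facts are combined here.\<close>

lemma brownian_gauss:
  assumes B: "standard_brownian_motion N B" and v: "0 < v"
  shows "prob_space N" "B v \<in> borel_measurable N"
    "f \<in> borel_measurable borel \<Longrightarrow> integrable (gauss v) f \<Longrightarrow>
      integrable N (\<lambda>\<omega>. f (B v \<omega>) :: real) \<and> (\<integral>\<omega>. f (B v \<omega>) \<partial>N) = (\<integral>z. f z \<partial>gauss v)"
proof -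
  show "prob_space N" and Bm: "B v \<in> borel_measurable N"
    using B v by (auto simp: standard_brownian_motion_def)
  have B0m: "B 0 \<in> borel_measurable N" and B0: "AE \<omega> in N. B 0 \<omega> = 0"
    using B by (auto simp: standard_brownian_motion_def)
  have "distributed N lborel (\<lambda>\<omega>. B v \<omega> - B 0 \<omega>) (normal_density 0 (sqrt (v - 0)))"
    using B v unfolding standard_brownian_motion_def by blast
  then have d: "distr N lborel (\<lambda>\<omega>. B v \<omega> - B 0 \<omega>) = gauss v"
    by (simp add: distributed_def gauss_def)
  assume f[measurable]: "f \<in> borel_measurable borel" and i: "integrable (gauss v) f"
  have m: "(\<lambda>\<omega>. B v \<omega> - B 0 \<omega>) \<in> N \<rightarrow>\<^sub>M lborel" using Bm B0m by measurable
  have fl: "f \<in> borel_measurable lborel" using f by simp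
  have i2: "integrable N (\<lambda>\<omega>. f (B v \<omega> - B 0 \<omega>))" using i integrable_distr_eq[OF m fl] unfolding d by simp
  have ae: "AE \<omega> in N. f (B v \<omega> - B 0 \<omega>) = f (B v \<omega>)" using B0 by eventually_elim simp
  have m2: "(\<lambda>\<omega>. f (B v \<omega>)) \<in> borel_measurable N" using Bm by measurable
  show "integrable N (\<lambda>\<omega>. f (B v \<omega>)) \<and> (\<integral>\<omega>. f (B v \<omega>) \<partial>N) = (\<integral>z. f z \<partial>gauss v)"
    using integrable_cong_AE_imp[OF i2 m2 ae] integral_cong_AE[OF borel_measurable_integrable[OF i2] m2 ae]
      integral_distr[OF m fl] unfolding d by simp
qed

section \<open>Bounded Lipschitz functions and the transport-information inequality\<close>

locale lipschitz_diffusion = markov_diffusion +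
  fixes x0 :: 'a and \<sigma> C :: real
  assumes moment: "(\<integral>\<^sup>+ x. ennreal ((dist x x0)\<^sup>2) \<partial>\<mu>) < \<infinity>"
    and pos: "0 < \<sigma>" "0 < C"
    and poisson: "\<And>g. g \<in> C_Lip \<Longrightarrow> bounded (range g) \<Longrightarrow> (\<integral>x. g x \<partial>\<mu>) = 0 \<Longrightarrow>
      g \<in> \<D> \<and>
      (AE x in \<mu>. sqrt (\<Gamma> g g x) \<le> \<sigma> * lip_seminorm g) \<and>
      (\<exists>h\<in>D2 P \<mu>. (AE x in \<mu>. - generator P \<mu> h x = g x) \<and>
        (\<exists>h'. continuous_on UNIV h' \<and> (AE x in \<mu>. h' x = h x) \<and>
          h' \<in> C_Lip \<and> lip_seminorm h' \<le> C * lip_seminorm g))"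
begin

lemma dist_L2: "(\<lambda>x. dist x x0) \<in> L2fun \<mu>"
  using moment by (auto simp: L2fun_def integrable_iff_bounded)

text \<open>Lipschitz functions grow at most linearly in the distance to \<open>x0\<close>, which is
  square integrable.\<close>

lemma C_Lip_L2: assumes "g \<in> C_Lip" shows "g \<in> L2fun \<mu>"
  unfolding L2fun_def
proof (intro CollectI conjI)
  have [measurable]: "g \<in> borel_measurable borel" using assms by (rule C_Lip_borel)
  show "g \<in> borel_measurable \<mu>" by simp
  define b where "b x = \<bar>g x0\<bar> + lip_seminorm g * dist x x0" for x
  have bL: "b \<in> L2fun \<mu>" unfolding b_def[abs_def] by (intro L2_add L2_scale dist_L2 L2_const finite_measure_axioms)
  have gb: "\<bar>g x\<bar> \<le> b x" for x using lip_seminorm_bound(1)[OF assms, of x x0] unfolding b_def by linarith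
  show "integrable \<mu> (\<lambda>x. (g x)\<^sup>2)"
  proof (rule Bochner_Integration.integrable_bound[OF L2D(2)[OF bL]])
    show "AE x in \<mu>. norm ((g x)\<^sup>2) \<le> norm ((b x)\<^sup>2)"
      using power_mono[OF gb abs_ge_zero, where n = 2] by simp
  qed simp
qed

lemma centered:
  assumes "g \<in> C_Lip" "bounded (range g)"
  shows "(\<lambda>x. g x - (\<integral>x. g x \<partial>\<mu>)) \<in> C_Lip" "bounded (range (\<lambda>x. g x - (\<integral>x. g x \<partial>\<mu>)))"
    "(\<integral>x. g x - (\<integral>x. g x \<partial>\<mu>) \<partial>\<mu>) = 0" "lip_seminorm (\<lambda>x. g x - (\<integral>x. g x \<partial>\<mu>)) = lip_seminorm g"
proof -
  show "(\<lambda>x. g x - (\<integral>x. g x \<partial>\<mu>)) \<in> C_Lip" using assms(1) by (auto simp: C_Lip_def lipschitz_on_def dist_real_def)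
  obtain b where b: "\<And>x. norm (g x) \<le> b" using assms(2) by (auto simp: bounded_iff)
  have "norm (g x - (\<integral>x. g x \<partial>\<mu>)) \<le> b + norm (\<integral>x. g x \<partial>\<mu>)" for x
    using norm_triangle_ineq4[of "g x" "\<integral>x. g x \<partial>\<mu>"] b[of x] by linarith
  then show "bounded (range (\<lambda>x. g x - (\<integral>x. g x \<partial>\<mu>)))" unfolding bounded_iff by blast
  have "integrable \<mu> g" by (rule L2_int[OF C_Lip_L2[OF assms(1)]])
  then show "(\<integral>x. g x - (\<integral>x. g x \<partial>\<mu>) \<partial>\<mu>) = 0" using prob_space by simp
  show "lip_seminorm (\<lambda>x. g x - (\<integral>x. g x \<partial>\<mu>)) = lip_seminorm g" by (simp add: lip_seminorm_def)
qed

lemma C_Lip_D_form: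
  assumes "g \<in> C_Lip" "bounded (range g)" shows "g \<in> \<D>"
proof -
  have "(\<lambda>x. g x - (\<integral>x. g x \<partial>\<mu>)) \<in> \<D>" using poisson[OF centered(1-3)[OF assms]] by blast
  from D_form_add[OF this D_form_const[of "\<integral>x. g x \<partial>\<mu>"]] show ?thesis by simp
qed

lemma G_const: "f \<in> \<D> \<Longrightarrow> AE x in \<mu>. \<Gamma> (\<lambda>x. c) f x = 0"
  using G_chain1(2)[where F = "\<lambda>x. c" and F' = "\<lambda>x. 0" and B = "\<bar>c\<bar>" and B' = 0 and f = f and g = f]
  by simp

text \<open>The assumed bound concerns centred functions; subtracting the mean is harmless because
  \<Gamma> annihilates constants.\<close>

lemma G_lip_bounded:
  assumes "g \<in> C_Lip" "bounded (range g)" "lip_seminorm g \<le> l"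
  shows "AE x in \<mu>. \<Gamma> g g x \<le> (\<sigma> * l)\<^sup>2"
proof -
  define m where "m = (\<integral>x. g x \<partial>\<mu>)"
  have gD: "g \<in> \<D>" by (rule C_Lip_D_form[OF assms(1,2)])
  have l: "0 \<le> l" using lip_seminorm_bound(2)[OF assms(1)] assms(3) by simp
  have "AE x in \<mu>. sqrt (\<Gamma> (\<lambda>x. g x - m) (\<lambda>x. g x - m) x) \<le> \<sigma> * lip_seminorm (\<lambda>x. g x - m)"
    using poisson[OF centered(1-3)[OF assms(1,2)]] unfolding m_def by blast
  then have ae: "AE x in \<mu>. sqrt (\<Gamma> (\<lambda>x. 1 * g x + (- m) * 1) (\<lambda>x. 1 * g x + (- m) * 1) x) \<le> \<sigma> * lip_seminorm g"
    unfolding m_def centered(4)[OF assms(1,2)] by simp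
  show ?thesis
    using ae G_quad[OF gD D_form_const[of 1], of 1 "- m"] G_sym[OF gD D_form_const[of 1]]
      G_const[OF gD, of 1] G_const[OF D_form_const[of 1], of 1] G_pos[OF gD]
  proof eventually_elim
    case (elim x)
    have "sqrt (\<Gamma> g g x) \<le> \<sigma> * lip_seminorm g" using elim by simp
    also have "\<dots> \<le> \<sigma> * l" using assms(3) pos by simp
    finally have "(sqrt (\<Gamma> g g x))\<^sup>2 \<le> (\<sigma> * l)\<^sup>2" using elim by (intro power_mono) auto
    then show ?case using elim by simp
  qed
qed

text \<open>The bound on \<Gamma> is assumed for bounded functions, whereas \<open>h\<close> may be
  unbounded. It is applied to \<open>R sin (h / R)\<close>, whose Lipschitz constant is at most that
  of \<open>h\<close>; this bounds \<Gamma>(h, h) times the square of \<open>cos (h / R)\<close>,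
  and \<open>R\<close> tends to infinity. The slack in \<open>l\<close> allows a common constant for
  all truncations of one function.\<close>

lemma solution:
  assumes g: "g \<in> C_Lip" "bounded (range g)" "(\<integral>x. g x \<partial>\<mu>) = 0" and l: "lip_seminorm g \<le> l"
  shows "\<exists>h B. poisson_solution \<mu> P \<Gamma> h g ((\<sigma> * C * l)\<^sup>2) B"
proof -
  obtain h0 h where h0: "h0 \<in> D2 P \<mu>" "AE x in \<mu>. - generator P \<mu> h0 x = g x"
    and h: "continuous_on UNIV h" "AE x in \<mu>. h x = h0 x" "h \<in> C_Lip" "lip_seminorm h \<le> C * lip_seminorm g"
    using poisson[OF g] by blast
  have lh: "lip_seminorm h \<le> C * l" using h(4) l pos by (meson mult_left_mono less_imp_le order_trans)
  have l0: "0 \<le> C * l" using lip_seminorm_bound(2)[OF h(3)] lh by linarith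
  have gm: "g \<in> borel_measurable borel" by (rule C_Lip_borel[OF g(1)])
  have gg: "generator_graph P \<mu> h (\<lambda>x. - g x)"
  proof (rule gg_AE[OF gg_generator[OF h0(1)]])
    show "AE x in \<mu>. h0 x = h x" using h(2) by eventually_elim simp
    show "AE x in \<mu>. generator P \<mu> h0 x = - g x" using h0(2) by eventually_elim simp
  qed (use C_Lip_borel[OF h(3)] gm in auto)
  have hD: "h \<in> \<D>" by (rule D2_D_form[OF gg_D2[OF gg]])
  have n: "AE x in \<mu>. (cos (h x / real (Suc n)))\<^sup>2 * \<Gamma> h h x \<le> (\<sigma> * (C * l))\<^sup>2" for n
  proof -
    define F where "F x = real (Suc n) * sin (x / real (Suc n))" for x
    define F' where "F' x = cos (x / real (Suc n))" for x
    have dF: "(F has_real_derivative F' x) (at x)" for x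
      unfolding F_def F'_def by (rule scaled_sin_deriv) simp
    have cF: "continuous_on UNIV F'" unfolding F'_def[abs_def] by (intro continuous_intros) simp
    have bF: "\<bar>F x\<bar> \<le> real (Suc n)" "\<bar>F' x\<bar> \<le> 1" for x
      by (auto simp: F_def F'_def abs_mult simp del: of_nat_Suc)
    note ch = G_chain1[OF dF cF bF hD]
    have "\<bar>F a - F b\<bar> \<le> 1 * \<bar>a - b\<bar>" for a b
      using field_differentiable_bound[of UNIV F F' 1 a b] dF bF(2)
      by (auto intro: has_field_derivative_at_within)
    then have Fl: "\<bar>F (h x) - F (h y)\<bar> \<le> (C * l) * dist x y" for x y
      using lip_seminorm_bound(1)[OF h(3), of x y] mult_right_mono[OF lh, of "dist x y"]
      by (metis dual_order.trans mult_1 zero_le_dist)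
    have "bounded (range (\<lambda>x. F (h x)))"
      unfolding bounded_iff using bF(1) by (intro exI[of _ "real (Suc n)"]) auto
    from G_lip_bounded[OF lip_seminorm_le(1)[OF l0 Fl] this lip_seminorm_le(2)[OF l0 Fl]]
    show ?thesis
      using ch(2)[OF ch(1)] G_sym[OF hD ch(1)] ch(2)[OF hD]
      by eventually_elim (simp add: F'_def power2_eq_square mult.assoc)
  qed
  have Gle: "AE x in \<mu>. \<Gamma> h h x \<le> (\<sigma> * C * l)\<^sup>2"
  proof -
    have "AE x in \<mu>. \<forall>n. (cos (h x / real (Suc n)))\<^sup>2 * \<Gamma> h h x \<le> (\<sigma> * (C * l))\<^sup>2"
      using n by (simp add: AE_all_countable)
    then show ?thesis
    proof eventually_elim
      case (elim x)
      have "(\<lambda>n. (cos (h x / real (Suc n)))\<^sup>2 * \<Gamma> h h x) \<longlonglongrightarrow> 1\<^sup>2 * \<Gamma> h h x"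
        by (intro tendsto_mult tendsto_power tendsto_const cos_scaled_tendsto)
      then have "1\<^sup>2 * \<Gamma> h h x \<le> (\<sigma> * (C * l))\<^sup>2" by (rule LIMSEQ_le_const2) (use elim in auto)
      then show ?case by (simp add: mult.assoc)
    qed
  qed
  obtain B where B: "\<And>x. norm (g x) \<le> B" using g(2) by (auto simp: bounded_iff)
  have "poisson_solution \<mu> P \<Gamma> h g ((\<sigma> * C * l)\<^sup>2) B"
    by unfold_locales (use gg B gm Gle C_Lip_D_form in auto)
  then show ?thesis by blast
qed

lemma W1_information:
  assumes \<nu>: "\<nu> \<in> space (prob_algebra borel)"
  shows "(W1 \<nu> \<mu>)\<^sup>2 \<le> ennreal (4 * (\<sigma> * C)\<^sup>2) * DV_information P \<nu> \<mu>"
proof -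
  define s where "s x = sqrt (enn2real (RN_deriv \<mu> \<nu> x))" for x
  define I where "I = dirichlet_form P \<mu> s"
  have K: "0 < \<sigma> * C" using pos by simp
  show ?thesis
  proof (cases "absolutely_continuous \<mu> \<nu> \<and> s \<in> \<D>")
    \<comment> \<open>The information is infinite, and the positive factor in front keeps the
      right-hand side infinite.\<close>
    case False
    then have "DV_information P \<nu> \<mu> = \<infinity>" unfolding DV_information_def Let_def s_def[abs_def] by auto
    moreover have "ennreal (4 * (\<sigma> * C)\<^sup>2) \<noteq> 0" using pos by (simp add: ennreal_eq_0_iff not_le)
    ultimately show ?thesis by (simp add: ennreal_mult_top)
  next
    case True
    then have ac: "absolutely_continuous \<mu> \<nu>" and sD: "s \<in> \<D>" by auto
    have sets\<nu>: "sets \<nu> = sets \<mu>" and p\<nu>: "prob_space \<nu>" using \<nu> by (auto simp: space_prob_algebra)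
    interpret N: prob_space \<nu> by fact
    have info: "DV_information P \<nu> \<mu> = ennreal I"
      using True unfolding DV_information_def Let_def s_def[abs_def] I_def by auto
    have IG: "I = (\<integral>x. \<Gamma> s s x \<partial>\<mu>)" unfolding I_def by (rule G_dirichlet[OF sD])
    have I0: "0 \<le> I"
      unfolding IG using G_pos[OF sD] by (intro integral_nonneg_AE) auto
    have rn: "\<nu> = density \<mu> (RN_deriv \<mu> \<nu>)" by (rule density_RN_deriv[OF ac sets\<nu>, symmetric])
    have fin: "AE x in \<mu>. RN_deriv \<mu> \<nu> x \<noteq> \<infinity>"
      by (rule RN_deriv_finite[OF N.sigma_finite_measure_axioms ac sets\<nu>])
    \<comment> \<open>The density is finite almost everywhere, so nothing is lost by
      \<open>enn2real\<close>, and its root \<open>s\<close> lies in the form domain.\<close>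
    have rn2: "\<nu> = density \<mu> (\<lambda>x. ennreal ((s x)\<^sup>2))"
    proof (subst rn, rule density_cong)
      show "AE x in \<mu>. RN_deriv \<mu> \<nu> x = ennreal ((s x)\<^sup>2)"
        using fin by eventually_elim (simp add: s_def less_top)
    qed (auto simp: s_def)
    have sL: "s \<in> L2fun \<mu>" by (rule D_form_L2[OF sD])
    have sm[measurable]: "s \<in> borel_measurable borel" by (rule L2_meas[OF sL])
    have int\<nu>: "(\<integral>x. f x \<partial>\<nu>) = (\<integral>x. (s x)\<^sup>2 * f x \<partial>\<mu>)" if [measurable]: "f \<in> borel_measurable borel" for f :: "'a \<Rightarrow> real"
      unfolding rn2 by (subst integral_real_density) auto
    have s1: "sqn \<mu> s = 1" using int\<nu>[of "\<lambda>_. 1"] N.prob_space by (simp add: sqn_def)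
    \<comment> \<open>By duality, bounded 1-Lipschitz functions suffice. For these
      \<open>solution\<close> with \<open>l = 1\<close> gives the constant (\<sigma> C)^2 in
      \<open>fisher_bound\<close>, where \<open>s\<close> has norm 1 because \<nu> is a probability
      measure.\<close>
    have "W1 \<nu> \<mu> \<le> ennreal (2 * (\<sigma> * C) * sqrt I)"
    proof (rule kantorovich_rubinstein_bound[OF mu \<nu>])
      show "integrable \<mu> (\<lambda>x. dist x x0)" by (rule L2_int[OF dist_L2])
      show "0 \<le> 2 * (\<sigma> * C) * sqrt I" using K I0 by simp
      fix g :: "'a \<Rightarrow> real" assume g1: "1-lipschitz_on UNIV g" and gb: "bounded (range g)"
      have g: "g \<in> C_Lip" "lip_seminorm g \<le> 1"
        using lip_seminorm_le[of 1 g] lipschitz_onD[OF g1] by (auto simp: dist_real_def)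
      define m where "m = (\<integral>x. g x \<partial>\<mu>)"
      note ce = centered[OF g(1) gb, folded m_def]
      have gm[measurable]: "g \<in> borel_measurable borel" by (rule C_Lip_borel[OF g(1)])
      obtain h B where ps: "poisson_solution \<mu> P \<Gamma> h (\<lambda>x. g x - m) ((\<sigma> * C * 1)\<^sup>2) B"
        using solution[OF ce(1-3), of 1] ce(4) g(2) by auto
      have "(\<integral>x. (s x)\<^sup>2 * (g x - m) \<partial>\<mu>) \<le> 2 * sqrt ((\<sigma> * C * 1)\<^sup>2) * (sqrt (sqn \<mu> s) * sqrt (\<integral>x. \<Gamma> s s x \<partial>\<mu>))"
        by (rule poisson_solution.fisher_bound[OF ps sD])
      also have "\<dots> = 2 * (\<sigma> * C) * sqrt I" using K s1 by (simp add: IG)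
      finally have "(\<integral>x. (g x - m) \<partial>\<nu>) \<le> 2 * (\<sigma> * C) * sqrt I" using int\<nu>[of "\<lambda>x. g x - m"] by simp
      moreover have "integrable \<nu> g"
      proof -
        obtain b where b: "\<And>x. norm (g x) \<le> b" using gb by (auto simp: bounded_iff)
        show ?thesis
          by (rule N.integrable_const_bound[of _ b]) (use b sets\<nu> in \<open>auto cong: measurable_cong_sets\<close>)
      qed
      then have "(\<integral>x. (g x - m) \<partial>\<nu>) = (\<integral>x. g x \<partial>\<nu>) - m" using N.prob_space by simp
      ultimately show "(\<integral>x. g x \<partial>\<nu>) - (\<integral>x. g x \<partial>\<mu>) \<le> 2 * (\<sigma> * C) * sqrt I" by (simp add: m_def)
    qed
    then have "(W1 \<nu> \<mu>)\<^sup>2 \<le> (ennreal (2 * (\<sigma> * C) * sqrt I))\<^sup>2" by (intro power_mono) auto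
    also have "\<dots> = ennreal ((2 * (\<sigma> * C) * sqrt I)\<^sup>2)" using K I0 by (simp add: ennreal_power)
    also have "(2 * (\<sigma> * C) * sqrt I)\<^sup>2 = 4 * (\<sigma> * C)\<^sup>2 * I" using I0 by (simp add: power_mult_distrib)
    also have "ennreal (4 * (\<sigma> * C)\<^sup>2 * I) = ennreal (4 * (\<sigma> * C)\<^sup>2) * ennreal I"
      by (rule ennreal_mult) (use I0 in auto)
    finally show ?thesis unfolding info .
  qed
qed

end

section \<open>Unbounded Lipschitz functions along the process\<close>

locale lipschitz_diffusion_process =
  lipschitz_diffusion \<mu> P \<Gamma> x0 \<sigma> C + continuous_reversible_process \<mu> P M X
  for \<mu> :: "'a::polish_space measure" and P \<Gamma> x0 \<sigma> C and M :: "'w measure" and X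
begin

text \<open>\<open>g\<close> is clipped at height \<open>n\<close> and recentred. Clipping does not
  increase the seminorm, so one constant \<open>K\<close> serves all \<open>n\<close>, and the limit
  is controlled in L1.\<close>

lemma convex_order:
  assumes g: "g \<in> C_Lip" "(\<integral>x. g x \<partial>\<mu>) = 0" and l: "0 < lip_seminorm g" and T: "0 < T"
    and cv: "convex_on UNIV f" and lip: "\<And>x y. \<bar>f x - f y\<bar> \<le> L * \<bar>x - y\<bar>"
  shows "(\<integral>\<omega>. f (tint T g \<omega>) \<partial>M) \<le> (\<integral>z. f z \<partial>gauss (2 * (\<sigma> * C * lip_seminorm g)\<^sup>2 * T))"
proof -
  define K where "K = (\<sigma> * C * lip_seminorm g)\<^sup>2"
  have K: "0 < K" using pos l by (simp add: K_def)
  have L: "0 \<le> L" using lip[of 1 0] by simp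
  have gc: "continuous_on UNIV g" by (rule C_Lip_cont[OF g(1)])
  have gm[measurable]: "g \<in> borel_measurable borel" by (rule C_Lip_borel[OF g(1)])
  have gi: "integrable \<mu> g" by (rule L2_int[OF C_Lip_L2[OF g(1)]])
  have fm[measurable]: "f \<in> borel_measurable borel" by (rule lip_borel[OF lip])
  define cl where "cl n x = max (- real n) (min (real n) (g x))" for n x
  define m where "m n = (\<integral>x. cl n x \<partial>\<mu>)" for n
  define gn where "gn n x = cl n x - m n" for n x
  have clip: "\<bar>cl n x - cl n y\<bar> \<le> lip_seminorm g * dist x y" for n x y
    unfolding cl_def by (rule order_trans[OF clip_dist lip_seminorm_bound(1)[OF g(1)]])
  have cl: "cl n \<in> C_Lip" "lip_seminorm (cl n) \<le> lip_seminorm g" for n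
    using lip_seminorm_le[OF lip_seminorm_bound(2)[OF g(1)] clip] by auto
  have clb: "\<bar>cl n x\<bar> \<le> real n" "\<bar>cl n x\<bar> \<le> \<bar>g x\<bar>" for n x by (auto simp: cl_def)
  have clbd: "bounded (range (cl n))" for n
    by (rule boundedI[of _ "real n"]) (use clb in auto)
  have cli: "integrable \<mu> (cl n)" for n by (rule L2_int[OF C_Lip_L2[OF cl(1)]])
  have ce: "gn n \<in> C_Lip" "bounded (range (gn n))" "(\<integral>x. gn n x \<partial>\<mu>) = 0"
    "lip_seminorm (gn n) = lip_seminorm (cl n)" for n
    using centered[OF cl(1)[of n] clbd[of n]] unfolding gn_def[abs_def] m_def by auto
  have cm[measurable]: "cl n \<in> borel_measurable borel" for n by (rule C_Lip_borel[OF cl(1)])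
  have cllim: "(\<lambda>n. cl n x) \<longlonglongrightarrow> g x" for x
  proof -
    obtain n0 where n0: "\<bar>g x\<bar> \<le> real n0" using real_arch_simple by blast
    have "cl n x = g x" if "n0 \<le> n" for n using n0 that by (auto simp: cl_def)
    then show ?thesis by (intro tendsto_eventually) (auto simp: eventually_sequentially)
  qed
  have mlim: "m \<longlonglongrightarrow> 0"
  proof -
    have "(\<lambda>n. \<integral>x. cl n x \<partial>\<mu>) \<longlonglongrightarrow> (\<integral>x. g x \<partial>\<mu>)"
      by (rule integral_dominated_convergence[where w = "\<lambda>x. \<bar>g x\<bar>"]) (use gi cllim clb in auto)
    then show ?thesis by (simp add: m_def[abs_def] g(2))
  qed
  have glim: "(\<lambda>n. \<integral>x. \<bar>gn n x - g x\<bar> \<partial>\<mu>) \<longlonglongrightarrow> 0"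
  proof -
    have "(\<lambda>n. (\<integral>x. \<bar>cl n x - g x\<bar> \<partial>\<mu>) + \<bar>m n\<bar>) \<longlonglongrightarrow> (\<integral>x. 0 \<partial>\<mu>) + \<bar>0\<bar>"
    proof (intro tendsto_add tendsto_rabs mlim integral_dominated_convergence[where w = "\<lambda>x. 2 * \<bar>g x\<bar>"])
      show "AE x in \<mu>. (\<lambda>n. \<bar>cl n x - g x\<bar>) \<longlonglongrightarrow> 0"
        using tendsto_rabs_zero[OF LIM_zero[OF cllim]] by simp
      show "AE x in \<mu>. norm \<bar>cl n x - g x\<bar> \<le> 2 * \<bar>g x\<bar>" for n
      proof (rule AE_I2)
        fix x show "norm \<bar>cl n x - g x\<bar> \<le> 2 * \<bar>g x\<bar>" using clb(2)[of n x] unfolding real_norm_def by linarith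
      qed
    qed (use gi in auto)
    then have lim: "(\<lambda>n. (\<integral>x. \<bar>cl n x - g x\<bar> \<partial>\<mu>) + \<bar>m n\<bar>) \<longlonglongrightarrow> 0" by simp
    show ?thesis
    proof (rule Lim_null_comparison[OF _ lim], rule always_eventually, rule allI)
      fix n
      have "(\<integral>x. \<bar>gn n x - g x\<bar> \<partial>\<mu>) \<le> (\<integral>x. \<bar>cl n x - g x\<bar> + \<bar>m n\<bar> \<partial>\<mu>)"
        by (rule integral_mono) (use cli gi in \<open>auto simp: gn_def\<close>)
      also have "\<dots> = (\<integral>x. \<bar>cl n x - g x\<bar> \<partial>\<mu>) + \<bar>m n\<bar>" using cli gi prob_space by simp
      finally show "norm (\<integral>x. \<bar>gn n x - g x\<bar> \<partial>\<mu>) \<le> (\<integral>x. \<bar>cl n x - g x\<bar> \<partial>\<mu>) + \<bar>m n\<bar>" by simp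
    qed
  qed
  have gnc: "continuous_on UNIV (gn n)" for n by (rule C_Lip_cont[OF ce(1)])
  have gni: "integrable \<mu> (gn n)" for n by (rule L2_int[OF C_Lip_L2[OF ce(1)]])
  have bn: "(\<integral>\<omega>. f (tint T (gn n) \<omega>) \<partial>M) \<le> (\<integral>z. f z \<partial>gauss (2 * K * T))" for n
  proof -
    have "lip_seminorm (gn n) \<le> lip_seminorm g" unfolding ce(4) by (rule cl(2))
    then obtain h B where "poisson_solution \<mu> P \<Gamma> h (gn n) K B"
      using solution[OF ce(1-3)] unfolding K_def by blast
    then interpret ps: poisson_solution \<mu> P \<Gamma> h "gn n" K B .
    interpret pp: poisson_process \<mu> P \<Gamma> h "gn n" K B M X
      by unfold_locales (use gnc K in auto)
    show ?thesis by (rule pp.convex_order_lipschitz[OF T cv lip])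
  qed
  have ti: "integrable M (tint T g)" "integrable M (tint T (gn n))" for n
    using tint_L1(1)[OF T] gc gi gnc gni by auto
  interpret M: prob_space M by (rule prob_M)
  have ilip: "integrable M (\<lambda>\<omega>. f (V \<omega>))" if V: "integrable M V" for V
  proof (rule Bochner_Integration.integrable_bound)
    show "integrable M (\<lambda>\<omega>. \<bar>f 0\<bar> + L * \<bar>V \<omega>\<bar>)" using V by simp
    have "\<bar>f x\<bar> \<le> \<bar>f 0\<bar> + L * \<bar>x\<bar>" for x using lip[of x 0] by simp
    then show "AE \<omega> in M. norm (f (V \<omega>)) \<le> norm (\<bar>f 0\<bar> + L * \<bar>V \<omega>\<bar>)" using L by simp
    show "(\<lambda>\<omega>. f (V \<omega>)) \<in> borel_measurable M" using V by measurable
  qed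
  \<comment> \<open>Time integration is bounded by \<open>T\<close> from L1 of \<mu> to L1 of the
    process, and \<open>f\<close> is \<open>L\<close>-Lipschitz; this converts L1 convergence of
    \<open>gn n\<close> into convergence of the expectations.\<close>
  have up: "(\<integral>\<omega>. f (tint T g \<omega>) \<partial>M) \<le> (\<integral>z. f z \<partial>gauss (2 * K * T)) + L * (T * (\<integral>x. \<bar>gn n x - g x\<bar> \<partial>\<mu>))" for n
  proof -
    have dc: "continuous_on UNIV (\<lambda>x. gn n x - g x)" by (intro continuous_intros gnc gc)
    have di: "integrable \<mu> (\<lambda>x. gn n x - g x)" using gni gi by simp
    note td = tint_L1[OF T dc di]
    have "(\<integral>\<omega>. f (tint T g \<omega>) \<partial>M) \<le> (\<integral>\<omega>. f (tint T (gn n) \<omega>) + L * \<bar>tint T (\<lambda>x. gn n x - g x) \<omega>\<bar> \<partial>M)"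
    proof (rule integral_mono_AE)
      show "AE \<omega> in M. f (tint T g \<omega>) \<le> f (tint T (gn n) \<omega>) + L * \<bar>tint T (\<lambda>x. gn n x - g x) \<omega>\<bar>"
      proof (rule AE_I2)
        fix \<omega> assume "\<omega> \<in> space M"
        then have "tint T (\<lambda>x. gn n x - g x) \<omega> = tint T (gn n) \<omega> - tint T g \<omega>" by (rule tint_diff[OF gnc gc])
        then show "f (tint T g \<omega>) \<le> f (tint T (gn n) \<omega>) + L * \<bar>tint T (\<lambda>x. gn n x - g x) \<omega>\<bar>"
          using lip[of "tint T g \<omega>" "tint T (gn n) \<omega>"] by (simp add: abs_minus_commute abs_le_iff)
      qed
    qed (use ilip ti td in auto)
    also have "\<dots> = (\<integral>\<omega>. f (tint T (gn n) \<omega>) \<partial>M) + L * (\<integral>\<omega>. \<bar>tint T (\<lambda>x. gn n x - g x) \<omega>\<bar> \<partial>M)"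
      using ilip[OF ti(2)] td by simp
    also have "\<dots> \<le> (\<integral>z. f z \<partial>gauss (2 * K * T)) + L * (T * (\<integral>x. \<bar>gn n x - g x\<bar> \<partial>\<mu>))"
      using td(2) L by (intro add_mono bn mult_left_mono) auto
    finally show ?thesis .
  qed
  have "(\<lambda>n. (\<integral>z. f z \<partial>gauss (2 * K * T)) + L * (T * (\<integral>x. \<bar>gn n x - g x\<bar> \<partial>\<mu>))) \<longlonglongrightarrow> (\<integral>z. f z \<partial>gauss (2 * K * T)) + L * (T * 0)"
    by (intro tendsto_intros glim)
  then have "(\<integral>\<omega>. f (tint T g \<omega>) \<partial>M) \<le> (\<integral>z. f z \<partial>gauss (2 * K * T)) + L * (T * 0)"
    by (rule LIMSEQ_le_const) (use up in auto)
  then show ?thesis unfolding K_def by simp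
qed

lemma tint_zero:
  assumes "g \<in> C_Lip" "(\<integral>x. g x \<partial>\<mu>) = 0" "lip_seminorm g = 0"
  shows "tint T g \<omega> = 0"
proof -
  have "g x = g x0" for x using lip_seminorm_bound(1)[OF assms(1), of x x0] assms(3) by simp
  then have e: "g = (\<lambda>x. g x0)" by auto
  have "(\<integral>x. g x \<partial>\<mu>) = g x0" by (subst e) (use prob_space in simp)
  then show ?thesis using e assms(2) by (simp add: tint_def set_lebesgue_integral_def fun_eq_iff)
qed

lemma tint_C_Lip_integrable: "g \<in> C_Lip \<Longrightarrow> 0 < T \<Longrightarrow> integrable M (tint T g)"
  by (rule tint_L1(1)[OF _ C_Lip_cont L2_int[OF C_Lip_L2]])

lemma convex_order_brownian:
  assumes g: "g \<in> C_Lip" "(\<integral>x. g x \<partial>\<mu>) = 0" and cv: "convex_on UNIV \<phi>" and T: "0 < T"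
    and B: "standard_brownian_motion N B"
  shows "ext_expectation M (\<lambda>\<omega>. \<phi> (tint T g \<omega>))
    \<le> ext_expectation N (\<lambda>\<omega>. \<phi> (B (2 * \<sigma>\<^sup>2 * C\<^sup>2 * (lip_seminorm g)\<^sup>2 * T) \<omega>))"
proof (cases "lip_seminorm g = 0")
  \<comment> \<open>A centred function of zero seminorm vanishes identically, and Brownian motion is
    evaluated at time 0, where \<open>gauss\<close> gives no probability law.\<close>
  case True
  interpret M: prob_space M by (rule prob_M)
  have N: "prob_space N" using B by (simp add: standard_brownian_motion_def)
  interpret N: prob_space N by fact
  have B0: "AE \<omega> in N. B 0 \<omega> = 0" using B by (simp add: standard_brownian_motion_def)
  have "ext_expectation N (\<lambda>\<omega>. \<phi> (B 0 \<omega>)) = ext_expectation N (\<lambda>\<omega>. \<phi> 0)"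
  proof -
    have "(\<integral>\<^sup>+\<omega>. ennreal (\<phi> (B 0 \<omega>)) \<partial>N) = (\<integral>\<^sup>+\<omega>. ennreal (\<phi> 0) \<partial>N)"
      by (rule nn_integral_cong_AE, use B0 in eventually_elim) simp
    moreover have "(\<integral>\<^sup>+\<omega>. ennreal (- \<phi> (B 0 \<omega>)) \<partial>N) = (\<integral>\<^sup>+\<omega>. ennreal (- \<phi> 0) \<partial>N)"
      by (rule nn_integral_cong_AE, use B0 in eventually_elim) simp
    ultimately show ?thesis unfolding ext_expectation_def by (simp only:)
  qed
  also have "\<dots> = ereal (\<phi> 0)" using ext_expectation_integrable[of N "\<lambda>_. \<phi> 0"] N.prob_space by simp
  finally have "ext_expectation N (\<lambda>\<omega>. \<phi> (B 0 \<omega>)) = ereal (\<phi> 0)" .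
  moreover have "ext_expectation M (\<lambda>\<omega>. \<phi> (tint T g \<omega>)) = ereal (\<phi> 0)"
    using ext_expectation_integrable[of M "\<lambda>_. \<phi> 0"] M.prob_space by (simp add: tint_zero[OF g True])
  ultimately show ?thesis using True by simp
next
  case False
  then have l: "0 < lip_seminorm g" using lip_seminorm_bound(2)[OF g(1)] by simp
  define v where "v = 2 * (\<sigma> * C * lip_seminorm g)\<^sup>2 * T"
  have v: "0 < v" using l pos T by (simp add: v_def)
  have ve: "2 * \<sigma>\<^sup>2 * C\<^sup>2 * (lip_seminorm g)\<^sup>2 * T = v" by (simp add: v_def power_mult_distrib)
  note bg = brownian_gauss[OF B v]
  show ?thesis
    unfolding ve
  proof (rule convex_order_extend[OF prob_M bg(1) tint_C_Lip_integrable[OF g(1) T] _ _ cv])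
    show "integrable N (B v)"
      using conjunct1[OF bg(3)[where f = "\<lambda>x. x", OF measurable_ident_sets[OF refl] gauss_moments(1)[OF v]]] .
    fix f :: "real \<Rightarrow> real" and L
    assume f: "convex_on UNIV f" "\<And>x y. \<bar>f x - f y\<bar> \<le> L * \<bar>x - y\<bar>"
    have "(\<integral>\<omega>. f (B v \<omega>) \<partial>N) = (\<integral>z. f z \<partial>gauss v)"
      by (rule conjunct2[OF bg(3)[OF lip_borel[OF f(2)]]]) (use lip_gauss_integrable[OF f(2) v, of 0] in simp_all)
    then show "(\<integral>\<omega>. f (tint T g \<omega>) \<partial>M) \<le> (\<integral>\<omega>. f (B v \<omega>) \<partial>N)"
      using convex_order[OF g l T f] unfolding v_def by simp
  qed
qed

lemma exponential_moment:
  assumes g: "g \<in> C_Lip" "(\<integral>x. g x \<partial>\<mu>) = 0" and T: "0 < T"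
  shows "(\<integral>\<^sup>+\<omega>. ennreal (exp (\<theta> * tint T g \<omega>)) \<partial>M) \<le> ennreal (exp (\<theta>\<^sup>2 * (\<sigma> * C)\<^sup>2 * (lip_seminorm g)\<^sup>2 * T))"
proof (cases "lip_seminorm g = 0")
  case True
  then show ?thesis using prob_space.emeasure_space_1[OF prob_M] by (simp add: tint_zero[OF g True])
next
  case False
  then have l: "0 < lip_seminorm g" using lip_seminorm_bound(2)[OF g(1)] by simp
  define v where "v = 2 * (\<sigma> * C * lip_seminorm g)\<^sup>2 * T"
  have v: "0 < v" using l pos T by (simp add: v_def)
  have cv: "convex_on UNIV (\<lambda>x. exp (\<theta> * x))"
    by (rule f''_ge0_imp_convex[of _ _ "\<lambda>x. \<theta> * exp (\<theta> * x)" "\<lambda>x. \<theta>\<^sup>2 * exp (\<theta> * x)"])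
      (auto intro!: derivative_eq_intros simp: power2_eq_square)
  have ext: "ext_expectation Q (\<lambda>\<omega>. exp (V \<omega>)) = enn2ereal (\<integral>\<^sup>+\<omega>. ennreal (exp (V \<omega>)) \<partial>Q)"
    for Q :: "'z measure" and V
    by (simp add: ext_expectation_def ennreal_neg zero_ennreal.rep_eq)
  \<comment> \<open>The identity on \<open>gauss v\<close> takes the role of the Brownian variable,
    so no Brownian motion has to be at hand.\<close>
  have "ext_expectation M (\<lambda>\<omega>. exp (\<theta> * tint T g \<omega>)) \<le> ext_expectation (gauss v) (\<lambda>z. exp (\<theta> * z))"
    by (rule convex_order_extend[OF prob_M prob_gauss[OF v] tint_C_Lip_integrable[OF g(1) T] gauss_moments(1)[OF v] _ cv])
      (rule convex_order[OF g l T, folded v_def])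
  then have "(\<integral>\<^sup>+\<omega>. ennreal (exp (\<theta> * tint T g \<omega>)) \<partial>M) \<le> (\<integral>\<^sup>+z. ennreal (exp (\<theta> * z)) \<partial>gauss v)"
    unfolding ext less_eq_ennreal.rep_eq .
  also have "\<dots> = ennreal (exp (\<theta>\<^sup>2 * v / 2))" by (rule nn_integral_gauss_exp[OF v])
  also have "\<theta>\<^sup>2 * v / 2 = \<theta>\<^sup>2 * (\<sigma> * C)\<^sup>2 * (lip_seminorm g)\<^sup>2 * T"
    by (simp add: v_def power_mult_distrib)
  finally show ?thesis .
qed

end

theorem theorem4p3:
  fixes \<mu> :: "'a::polish_space measure"
    and P :: "real \<Rightarrow> 'a \<Rightarrow> 'a measure"
    and M :: "'w measure"
    and X :: "real \<Rightarrow> 'w \<Rightarrow> 'a"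
    and \<Gamma> :: "('a \<Rightarrow> real) \<Rightarrow> ('a \<Rightarrow> real) \<Rightarrow> 'a \<Rightarrow> real"
    and x0 :: 'a
    and \<sigma> C :: real
  assumes "\<mu> \<in> space (prob_algebra borel)"
    and "markov_process M X P \<mu>"
    and "continuous_paths M X"
    and "invariant_measure P \<mu>"
    and "symmetric_semigroup P \<mu>"
    and "strongly_continuous_semigroup P \<mu>"
    and "ergodic_semigroup P \<mu>"
    and "carre_du_champ P \<mu> \<Gamma>"
    and "(\<integral>\<^sup>+ x. ennreal ((dist x x0)\<^sup>2) \<partial>\<mu>) < \<infinity>"
    and "\<sigma> > 0" and "C > 0"
    and "\<And>g. g \<in> C_Lip \<Longrightarrow> bounded (range g) \<Longrightarrow> (\<integral>x. g x \<partial>\<mu>) = 0 \<Longrightarrow>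
      g \<in> D_form P \<mu> \<and>
      (AE x in \<mu>. sqrt (\<Gamma> g g x) \<le> \<sigma> * lip_seminorm g) \<and>
      (\<exists>h\<in>D2 P \<mu>. (AE x in \<mu>. - generator P \<mu> h x = g x) \<and>
        (\<exists>h'. continuous_on UNIV h' \<and> (AE x in \<mu>. h' x = h x) \<and>
          h' \<in> C_Lip \<and> lip_seminorm h' \<le> C * lip_seminorm g))"
  shows "(\<forall>g\<in>C_Lip. (\<integral>x. g x \<partial>\<mu>) = 0 \<longrightarrow>
      (\<forall>\<phi> t. convex_on UNIV \<phi> \<longrightarrow> t > 0 \<longrightarrow>
        (\<forall>(N :: 'b measure) B. standard_brownian_motion N B \<longrightarrow>
          ext_expectation M (\<lambda>\<omega>. \<phi> (LINT s:{0..t}|lborel. g (X s \<omega>)))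
            \<le> ext_expectation N (\<lambda>\<omega>. \<phi> (B (2 * \<sigma>\<^sup>2 * C\<^sup>2 * (lip_seminorm g)\<^sup>2 * t) \<omega>))))) \<and>
    (\<forall>g\<in>C_Lip. (\<integral>x. g x \<partial>\<mu>) = 0 \<longrightarrow>
      (\<forall>\<theta> t. t > 0 \<longrightarrow>
        (\<integral>\<^sup>+ \<omega>. ennreal (exp (\<theta> * (LINT s:{0..t}|lborel. g (X s \<omega>)))) \<partial>M)
          \<le> ennreal (exp (\<theta>\<^sup>2 * (\<sigma> * C)\<^sup>2 * (lip_seminorm g)\<^sup>2 * t)))) \<and>
    (\<forall>\<nu>\<in>space (prob_algebra borel).
      (W1 \<nu> \<mu>)\<^sup>2 \<le> ennreal (4 * (\<sigma> * C)\<^sup>2) * DV_information P \<nu> \<mu>)"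
proof -
  interpret lipschitz_diffusion_process \<mu> P \<Gamma> x0 \<sigma> C M X
    by unfold_locales (use assms in \<open>simp_all add: markov_process_def\<close>)
  show ?thesis
    using convex_order_brownian exponential_moment W1_information unfolding tint_def by blast
qed

end
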